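(* Assume that $g$ is locally semiconcave, i.e., for every $r>0$ there exists $C(r)$ such that $$g(z+z_0,w+w_0)+g(z-z_0,w-w_0)-2g(z,w)\le C(r)\|w_0\|_{H^1}^2$$ for all $(z,w),(z_0,w_0)\in\mathcal X$ with $w,w_0\in W(r)$. Then the value functional $\rho$ is locally semiconcave with respect to the history variable; that is, for every $r>0$ and $N\in\mathbb N$ there exists $C(r,N)$ such that $$\rho(t,w+w_0)+\rho(t,w-w_0)-2\rho(t,w)\le C(r,N)\|w_0\|_{H^1}^2$$ whenever $t\in I$ and $w,w_0\in W(r,N)$.
   Context: Setting. Let $t_0<T$, $I=[t_0,T]$, $n,m\ge 1$; $A\subset\mathbb R^m$ is nonempty, convex and compact. $\|\cdot\|$ is the Euclidean norm on $\mathbb R^n$; $\|\cdot\|_m$ that on $\mathbb R^m$; $\|\cdot\|_1,\|\cdot\|_2,\|\cdot\|_\infty,\|\cdot\|_{H^1}$ are the usual $L^1,L^2,L^\infty,H^1$ norms for functions on $[-\bar\tau,0]$ (with $\bar\tau$ introduced in (7) below). $\operatorname{Lip}(v)$ is the Lipschitz constant of $v$. $\mathbb G:=I\times\operatorname{Lip}([-\bar\tau,0];\mathbb R^n)$. For $t_0\le t<s\le T$, $\mathcal A_{t,s}$ is the set of measurable functions $\alpha:(t,s)\to A$. For $R>0$: $P(R)=\{w\in\operatorname{Lip}([-\bar\tau,0];\mathbb R^n):\|w\|_\infty\le R\}$, $V(R)=\{w\in P(R):\|\dot w\|_\infty\le R\}$, $B_R=\{x\in\mathbb R^n:\|x\|\le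 R\}$. $\mathcal X=\{(z,w):w\in\operatorname{Lip}([-\bar\tau,0];\mathbb R^n),\ z=w(0)\}$ with norm $\|(z,w)\|_{\mathcal X}=\|z\|+\|w\|_1$. Standing assumptions. (1) $f:I\times\mathbb R^n\times\mathbb R^n\times A\to\mathbb R^n$ and $L:I\times\mathbb R^n\times\mathbb R^n\times A\to\mathbb R$ are continuous. (2) There is $\lambda_f>0$ with $\|f(t,z,y,a)-f(t,z',y',a)\|\le\lambda_f(\|z-z'\|+\|y-y'\|)$ for all arguments, and hence $\|f(t,z,y,a)\|\le C_f(1+\|z\|+\|y\|)$ for some $C_f>0$. (3) For every $(t,z,y)$ the set $\{(f(t,z,y,a),\ell)\in\mathbb R^n\times\mathbb R:a\in A,\ \ell\ge L(t,z,y,a)\}$ is convex. (4) For every $R>0$ there is $\lambda_L(R)>0$ with $|L(t,z,y,a)-L(t,z',y',a)|\le\lambda_L(R)(\|z-z'\|+\|y-y'\|)$ for $t\in I$, $a\in A$, $z,y,z',y'\in B_R$. (5) There is $C_L>0$ with $|L(t,z,y,a)|\le C_L(1+\|z\|+\|y\|)$ for all arguments. (6) $g:\mathcal X\to\mathbb R$ and for every $R>0$ there is $\lambda_g(R)>0$ with $|g(z_1,w_1)-g(z_2,w_2)|\le\lambda_g(R)\|(z_1,w_1)-(z_2,w_2)\|_{\mathcal X}$ for all $(z_i,w_i)\in\mathcal X$ with $w_i\in P(R)$. (7) $\tau:I\times\mathbb R^n\to[0,\infty)$ is $C^1$ with supremum $\bar\tau<\infty$, and there is $\lambda_\tau>0$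 with $|\tau(t,z)-\tau(t,y)|\le\lambda_\tau\|z-y\|$ for all $t\in I$, $z,y\in\mathbb R^n$. State equation. For $(t,w)\in\mathbb G$ and $\alpha\in\mathcal A_{t,T}$, $x(\cdot\,|\,t,w,\alpha)$ denotes the unique Lipschitz $x:[t-\bar\tau,T]\to\mathbb R^n$ with $\dot x(s)=f(s,x(s),x(s-\tau(s,x(s))),\alpha(s))$ for a.e. $s\in(t,T)$ and $x(t+\theta)=w(\theta)$ for $\theta\in[-\bar\tau,0]$ (it exists and is unique under (1)-(7)). Write $x_s(\theta)=x(s+\theta)$, $\theta\in[-\bar\tau,0]$. (8) (Monotone delay) For every $r>0$ there is $d(r)>0$ such that for every such solution with $t\in I$, $w\in P(r)$, $\alpha\in\mathcal A_{t,T}$: $1-\tau_t(s,x(s))-\tau_z(s,x(s))\cdot\dot x(s)\ge d(r)$ for a.e. $s\in[t,T]$. Cost and value. $J(t,w,\alpha)=\int_t^TL(s,x(s),x(s-\tau(s,x(s))),\alpha(s))\,ds+g(x(T),x_T)$ with $x=x(\cdot\,|\,t,w,\alpha)$, and $\rho(t,w)=\inf_{\alpha\in\mathcal A_{t,T}}J(t,w,\alpha)$ (for $t=T$: $\rho(T,w)=g(w(0),w)$). Additional assumptions. With $\mathcal H(t,z,y,p,a)=f(t,z,y,a)\cdot p+L(t,z,y,a)$: (S1) $f,L\in C^1(I\times\mathbb R^n\times\mathbb R^n\times A)$. (S2) There are $\mu,\lambda_{\mathcal H}>0$ with $(\mathcal H_a(t,z,y,p,a_1)-\mathcal H_a(t,z,y,p,a_2))\cdot(a_1-a_2)\ge\mu\|a_1-a_2\|_m^2$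 and $\|\mathcal H_a(t_1,z_1,y_1,p_1,a)-\mathcal H_a(t_2,z_2,y_2,p_2,a)\|\le\lambda_{\mathcal H}(|t_1-t_2|+\|z_1-z_2\|+\|y_1-y_2\|+\|p_1-p_2\|)$ for all $(t,z,y,p),(t_i,z_i,y_i,p_i)\in I\times(\mathbb R^n)^3$, $a,a_1,a_2\in A$. (S3) For every $r>0$ there are $\gamma_f(r),\gamma_L(r)>0$ with $\|f(t,z_1,y_1,a)+f(t,z_2,y_2,a)-2f(t,\frac{z_1+z_2}2,\frac{y_1+y_2}2,a)\|\le\gamma_f(r)(\|z_1-z_2\|^2+\|y_1-y_2\|^2)$ and $|L(t,z_1,y_1,a)+L(t,z_2,y_2,a)-2L(t,\frac{z_1+z_2}2,\frac{y_1+y_2}2,a)|\le\gamma_L(r)(\|z_1-z_2\|^2+\|y_1-y_2\|^2)$ for $t\in I$, $a\in A$, $z_i,y_i\in B_r$. (S4) For every $r>0$ there is $\gamma_\tau(r)>0$ with $|\tau(t,z_1)+\tau(t,z_2)-2\tau(t,\frac{z_1+z_2}2)|\le\gamma_\tau(r)\|z_1-z_2\|^2$ for $t\in I$, $z_1,z_2\in B_r$. (S5) For any $(t,w)\in\mathbb G$, $\alpha\in\mathcal A_{t,T}$ and $x=x(\cdot\,|\,t,w,\alpha)$, $g$ is Fr\'echet differentiable at $(x(T),x_T)$; and for every $r>0$ there is $\gamma_g(r)>0$ with $\|g_w(x(T),x_T)\|_\infty\le\gamma_g(r)$ for all $t\in I$, $w\in V(r)$, $\alpha\in\mathcal A_{t,T}$.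 Here $g$ is Fr\'echet differentiable at $(z,w)\in\mathcal X$ if there are $g_z(z,w)\in\mathbb R^n$, $g_w(z,w)\in L^\infty([-\bar\tau,0];\mathbb R^n)$ with $g(z+\delta z,w+\delta w)-g(z,w)=g_z(z,w)\cdot\delta z+\int_{-\bar\tau}^0g_w(z,w)(\theta)\cdot\delta w(\theta)\,d\theta+o(\|(\delta z,\delta w)\|_{\mathcal X})$ for $(\delta z,\delta w)\in\mathcal X$. Classes of histories. $W(r)$ is the set of all piecewise $C^{1,1}$ functions $w\in V(r)$ (finitely many breakpoints) such that $\operatorname{Lip}(\dot w|_{(\theta_{j-1},\theta_j)})\le r$ on every subinterval $(\theta_{j-1},\theta_j)$ on which $w$ is $C^{1,1}$; $W(r,N)$ is the set of $w\in W(r)$ having at most $N$ nonsmooth points. *)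

theory Defs
  imports "HOL-Analysis.Analysis" "HOL-Probability.Essential_Supremum"
begin

text \<open>A function on \<open>[-\<tau>bar, 0]\<close> is represented by a total function on the reals of which only
  the values on \<open>{-\<tau>bar..0}\<close> matter. A functional that is Lipschitz for \<open>norm_X\<close> on bounded subsets
  of \<open>hist_space\<close> automatically ignores the other values. The norms below are norms only when
  \<open>\<tau>bar > 0\<close>: for \<open>\<tau>bar = 0\<close> the interval is a null set and they all vanish.\<close>

definition lip_hist :: "real \<Rightarrow> (real \<Rightarrow> real^'n) set" where
  "lip_hist \<tau>bar = {w. \<exists>K. K-lipschitz_on {-\<tau>bar..0} w}"

definition L1_norm :: "real \<Rightarrow> (real \<Rightarrow> real^'n) \<Rightarrow> real" where
  "L1_norm \<tau>bar v = (LINT \<theta>|lebesgue_on {-\<tau>bar..0}. norm (v \<theta>))"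

definition Linf_norm :: "real \<Rightarrow> (real \<Rightarrow> real^'n) \<Rightarrow> ereal" where
  "Linf_norm \<tau>bar v = esssup (lebesgue_on {-\<tau>bar..0}) (\<lambda>\<theta>. ereal (norm (v \<theta>)))"

abbreviation dot :: "(real \<Rightarrow> real^'n) \<Rightarrow> real \<Rightarrow> real^'n" where
  "dot w \<equiv> (\<lambda>\<theta>. vector_derivative w (at \<theta>))"

definition H1_norm :: "real \<Rightarrow> (real \<Rightarrow> real^'n) \<Rightarrow> real" where
  "H1_norm \<tau>bar v = sqrt ((LINT \<theta>|lebesgue_on {-\<tau>bar..0}. (norm (v \<theta>))\<^sup>2)
                        + (LINT \<theta>|lebesgue_on {-\<tau>bar..0}. (norm (dot v \<theta>))\<^sup>2))"

definition hist_space :: "real \<Rightarrow> ((real^'n) \<times> (real \<Rightarrow> real^'n)) set" where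
  "hist_space \<tau>bar = {(z, w). w \<in> lip_hist \<tau>bar \<and> z = w 0}"

definition norm_X :: "real \<Rightarrow> (real^'n) \<times> (real \<Rightarrow> real^'n) \<Rightarrow> real" where
  "norm_X \<tau>bar = (\<lambda>(z, w). norm z + L1_norm \<tau>bar w)"

definition hist_P :: "real \<Rightarrow> real \<Rightarrow> (real \<Rightarrow> real^'n) set" where
  "hist_P \<tau>bar R = {w \<in> lip_hist \<tau>bar. Linf_norm \<tau>bar w \<le> ereal R}"

definition hist_V :: "real \<Rightarrow> real \<Rightarrow> (real \<Rightarrow> real^'n) set" where
  "hist_V \<tau>bar R = {w \<in> hist_P \<tau>bar R. Linf_norm \<tau>bar (dot w) \<le> ereal R}"

text \<open>\<open>C11_on U w\<close> is meant for open intervals \<open>U\<close>.\<close>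

definition C11_on :: "real set \<Rightarrow> (real \<Rightarrow> real^'n) \<Rightarrow> bool" where
  "C11_on U w \<longleftrightarrow> (\<forall>\<theta>\<in>U. w differentiable (at \<theta>)) \<and> (\<exists>K. K-lipschitz_on U (dot w))"

definition piecewise_C11 :: "real \<Rightarrow> (real \<Rightarrow> real^'n) \<Rightarrow> bool" where
  "piecewise_C11 \<tau>bar w \<longleftrightarrow>
     (\<exists>S. finite S \<and> (\<forall>c d. {c<..<d} \<subseteq> {-\<tau>bar<..<0} - S \<longrightarrow> C11_on {c<..<d} w))"

definition hist_W :: "real \<Rightarrow> real \<Rightarrow> (real \<Rightarrow> real^'n) set" where
  "hist_W \<tau>bar r = {w \<in> hist_V \<tau>bar r. piecewise_C11 \<tau>bar w \<and>
     (\<forall>c d. {c<..<d} \<subseteq> {-\<tau>bar<..<0} \<and> C11_on {c<..<d} w \<longrightarrow> r-lipschitz_on {c<..<d} (dot w))}"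

text \<open>For a piecewise \<open>C11\<close> function the set of nonsmooth points is finite, so its \<open>card\<close> is
  meaningful in \<open>hist_WN\<close>.\<close>

definition nonsmooth_points :: "real \<Rightarrow> (real \<Rightarrow> real^'n) \<Rightarrow> real set" where
  "nonsmooth_points \<tau>bar w =
     {\<theta> \<in> {-\<tau>bar<..<0}. \<not> (\<exists>\<epsilon>>0. C11_on {\<theta> - \<epsilon><..<\<theta> + \<epsilon>} w)}"

definition hist_WN :: "real \<Rightarrow> real \<Rightarrow> nat \<Rightarrow> (real \<Rightarrow> real^'n) set" where
  "hist_WN \<tau>bar r N = {w \<in> hist_W \<tau>bar r. card (nonsmooth_points \<tau>bar w) \<le> N}"

text \<open>One-sided derivatives at boundary points of \<open>S\<close> are understood through \<open>at x within S\<close>; the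
  derivative is unique when \<open>S\<close> is convex with nonempty interior.\<close>

definition C1_on :: "'a::real_normed_vector set \<Rightarrow> ('a \<Rightarrow> 'b::real_normed_vector) \<Rightarrow> bool" where
  "C1_on S F \<longleftrightarrow> (\<exists>F'. continuous_on S F' \<and>
     (\<forall>x\<in>S. (F has_derivative blinfun_apply (F' x)) (at x within S)))"

definition controls :: "(real^'m) set \<Rightarrow> real \<Rightarrow> real \<Rightarrow> (real \<Rightarrow> real^'m) set" where
  "controls A t s = {\<alpha>. \<alpha> \<in> borel_measurable (lebesgue_on {t<..<s}) \<and> (\<forall>u\<in>{t<..<s}. \<alpha> u \<in> A)}"

definition is_trajectory ::
  "(real \<times> (real^'n) \<times> (real^'n) \<times> (real^'m) \<Rightarrow> real^'n) \<Rightarrow> (real \<times> (real^'n) \<Rightarrow> real) \<Rightarrow> real \<Rightarrow> real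
    \<Rightarrow> real \<Rightarrow> (real \<Rightarrow> real^'n) \<Rightarrow> (real \<Rightarrow> real^'m) \<Rightarrow> (real \<Rightarrow> real^'n) \<Rightarrow> bool" where
  "is_trajectory f \<tau> \<tau>bar T t w \<alpha> x \<longleftrightarrow>
     (\<exists>K. K-lipschitz_on {t - \<tau>bar..T} x) \<and>
     (AE s in lebesgue_on {t<..<T}.
        (x has_vector_derivative f (s, x s, x (s - \<tau> (s, x s)), \<alpha> s)) (at s)) \<and>
     (\<forall>\<theta>\<in>{-\<tau>bar..0}. x (t + \<theta>) = w \<theta>)"

text \<open>Membership in \<open>extensional\<close> fixes the irrelevant values outside \<open>[t - \<tau>bar, T]\<close>, so that the
  total function is unique.\<close>

definition trajectory ::
  "(real \<times> (real^'n) \<times> (real^'n) \<times> (real^'m) \<Rightarrow> real^'n) \<Rightarrow> (real \<times> (real^'n) \<Rightarrow> real) \<Rightarrow> real \<Rightarrow> real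
    \<Rightarrow> real \<Rightarrow> (real \<Rightarrow> real^'n) \<Rightarrow> (real \<Rightarrow> real^'m) \<Rightarrow> real \<Rightarrow> real^'n" where
  "trajectory f \<tau> \<tau>bar T t w \<alpha> =
     (THE x. x \<in> extensional {t - \<tau>bar..T} \<and> is_trajectory f \<tau> \<tau>bar T t w \<alpha> x)"

definition segment_at :: "(real \<Rightarrow> real^'n) \<Rightarrow> real \<Rightarrow> real \<Rightarrow> real^'n" where
  "segment_at x s = (\<lambda>\<theta>. x (s + \<theta>))"

definition cost ::
  "(real \<times> (real^'n) \<times> (real^'n) \<times> (real^'m) \<Rightarrow> real^'n) \<Rightarrow>
   (real \<times> (real^'n) \<times> (real^'n) \<times> (real^'m) \<Rightarrow> real) \<Rightarrow>
   ((real^'n) \<times> (real \<Rightarrow> real^'n) \<Rightarrow> real) \<Rightarrow> (real \<times> (real^'n) \<Rightarrow> real) \<Rightarrow> real \<Rightarrow> real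
    \<Rightarrow> real \<Rightarrow> (real \<Rightarrow> real^'n) \<Rightarrow> (real \<Rightarrow> real^'m) \<Rightarrow> real" where
  "cost f L g \<tau> \<tau>bar T t w \<alpha> = (let x = trajectory f \<tau> \<tau>bar T t w \<alpha> in
     (LINT s|lebesgue_on {t..T}. L (s, x s, x (s - \<tau> (s, x s)), \<alpha> s)) + g (x T, segment_at x T))"

definition value_functional ::
  "(real^'m) set \<Rightarrow> (real \<times> (real^'n) \<times> (real^'n) \<times> (real^'m) \<Rightarrow> real^'n) \<Rightarrow>
   (real \<times> (real^'n) \<times> (real^'n) \<times> (real^'m) \<Rightarrow> real) \<Rightarrow>
   ((real^'n) \<times> (real \<Rightarrow> real^'n) \<Rightarrow> real) \<Rightarrow> (real \<times> (real^'n) \<Rightarrow> real) \<Rightarrow> real \<Rightarrow> real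
    \<Rightarrow> real \<Rightarrow> (real \<Rightarrow> real^'n) \<Rightarrow> real" where
  "value_functional A f L g \<tau> \<tau>bar T t w =
     (if t = T then g (w 0, w) else (INF \<alpha>\<in>controls A t T. cost f L g \<tau> \<tau>bar T t w \<alpha>))"

definition hamiltonian ::
  "(real \<times> (real^'n) \<times> (real^'n) \<times> (real^'m) \<Rightarrow> real^'n) \<Rightarrow>
   (real \<times> (real^'n) \<times> (real^'n) \<times> (real^'m) \<Rightarrow> real) \<Rightarrow>
   real \<times> (real^'n) \<times> (real^'n) \<times> (real^'n) \<times> (real^'m) \<Rightarrow> real" where
  "hamiltonian f L = (\<lambda>(t, z, y, p, a). f (t, z, y, a) \<bullet> p + L (t, z, y, a))"

definition has_hist_derivative ::
  "real \<Rightarrow> ((real^'n) \<times> (real \<Rightarrow> real^'n) \<Rightarrow> real) \<Rightarrow> real^'n \<Rightarrow> (real \<Rightarrow> real^'n)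
    \<Rightarrow> (real^'n) \<times> (real \<Rightarrow> real^'n) \<Rightarrow> bool" where
  "has_hist_derivative \<tau>bar g gz gw = (\<lambda>(z, w).
     gw \<in> borel_measurable (lebesgue_on {-\<tau>bar..0}) \<and> Linf_norm \<tau>bar gw < \<infinity> \<and>
     (\<forall>\<epsilon>>0. \<exists>\<delta>>0. \<forall>(dz, dw)\<in>hist_space \<tau>bar. norm_X \<tau>bar (dz, dw) < \<delta> \<longrightarrow>
        \<bar>g (z + dz, \<lambda>\<theta>. w \<theta> + dw \<theta>) - g (z, w)
          - (gz \<bullet> dz + (LINT \<theta>|lebesgue_on {-\<tau>bar..0}. gw \<theta> \<bullet> dw \<theta>))\<bar>
        \<le> \<epsilon> * norm_X \<tau>bar (dz, dw)))"

end

theory Submission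
  imports Defs
begin

text \<open>Since the constants in (S2) are uniform in \<open>p\<close>, the dynamics are affine in the control with a
  linear part independent of time and state, and \<open>L\<close> is strongly convex in the control. Replacing a
  control by its mean on a cell of length \<open>h\<close> therefore gains a multiple of its variance and loses at
  most \<open>O(h\<^sup>3)\<close>. Hence there are near-optimal step controls whose values satisfy a Lipschitz condition up
  to an error of the order of the cell length, and neither existence of optimal controls nor a maximum
  principle is needed.

  Such a step control \<open>\<beta>\<close> for \<open>w\<close> is used for \<open>w\<close>, \<open>w + w0\<close> and \<open>w - w0\<close>. The delayed argument is
  expanding along trajectories, so it crosses the breakpoints of \<open>w\<close> and the mass of the derivative of
  \<open>w0\<close> only for a short time, and a Gronwall argument bounds the second difference of the three
  trajectories by the square of the \<open>H\<^sup>1\<close> norm of \<open>w0\<close>. Because \<open>\<beta>\<close> is a step function, the terminal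
  segments are piecewise \<open>C\<^sup>1\<^sup>,\<^sup>1\<close> with uniform constants, so the semiconcavity of \<open>g\<close> applies to them.\<close>

subsection \<open>Lipschitz curves and delayed Gronwall estimates\<close>

text \<open>Two demands shape the choice of controls. \<open>g\<close> is semiconcave with a uniform
  constant only along a class \<open>hist_W\<close>, so the terminal segments need derivative bounds
  that are uniform in the control; and the second difference of \<open>x\<close> at the two
  perturbed lags needs \<open>x\<close> to be almost C^1,1 there. Step controls meet the first
  demand for any number of steps, because \<open>hist_W\<close> bounds the Lipschitz constant of the
  derivative on each smooth piece but not the number of pieces. The second is met because the jumps
  are of the order of the cell length h.

  The exponent 3 balances the two uses of averaging. Near-optimality up to h^3 forces the integrated
  squared deviation over two adjacent cells to be O(h^3), hence their means to differ by O(h); and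
  replacing all of the roughly 1/h cells costs O(h^2) in total. No constant depends on the grid, so
  the term \<open>\<delta> * \<epsilon>\<close> in the second differences and the multiple of
  \<open>\<epsilon>\<^sup>2\<close> in the cost disappear as \<open>\<epsilon>\<close> tends to
  0.\<close>

lemma AE_lebesgue_on_iff:
  assumes "S \<in> sets lebesgue"
  shows "(AE x in lebesgue_on S. P x) \<longleftrightarrow> (\<exists>N. negligible N \<and> (\<forall>x\<in>S - N. P x))"
proof -
  have "(AE x in lebesgue_on S. P x) \<longleftrightarrow> (AE x in lebesgue. x \<in> S \<longrightarrow> P x)"
    using assms by (simp add: AE_restrict_space_iff)
  also have "\<dots> \<longleftrightarrow> (\<exists>N. negligible N \<and> (\<forall>x\<in>S - N. P x))"
  proof
    assume "AE x in lebesgue. x \<in> S \<longrightarrow> P x"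
    then obtain N where "N \<in> null_sets lebesgue" "{x \<in> space lebesgue. \<not> (x \<in> S \<longrightarrow> P x)} \<subseteq> N"
      unfolding eventually_ae_filter by blast
    then show "\<exists>N. negligible N \<and> (\<forall>x\<in>S - N. P x)"
      by (auto simp: negligible_iff_null_sets)
  next
    assume "\<exists>N. negligible N \<and> (\<forall>x\<in>S - N. P x)"
    then obtain N where "negligible N" "\<forall>x\<in>S - N. P x" by blast
    then show "AE x in lebesgue. x \<in> S \<longrightarrow> P x"
      by (intro AE_I'[of N]) (auto simp: negligible_iff_null_sets)
  qed
  finally show ?thesis .
qed

text \<open>Controls are measurable and \<open>A\<close>-valued only on the open interval, so
  everything is asked there and the two endpoints are discarded as a null set.\<close>

lemma bounded_measurable_integrable_on_open:
  fixes h :: "real \<Rightarrow> 'b::euclidean_space"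
  assumes "h \<in> borel_measurable (lebesgue_on {a<..<b})"
    and "\<And>s. s \<in> {a<..<b} \<Longrightarrow> norm (h s) \<le> B"
  shows "h absolutely_integrable_on {a..b}"
proof -
  have "h absolutely_integrable_on {a<..<b}"
    by (rule measurable_bounded_by_integrable_imp_absolutely_integrable[where g="\<lambda>_. B"])
       (use assms in \<open>auto simp: integrable_on_open_interval[of _ a b, unfolded box_real]\<close>)
  then show ?thesis
    by (rule absolutely_integrable_spike_set)
       (auto intro: negligible_subset[of "{a,b}"])
qed

lemma integral_lipschitz_bound:
  fixes h :: "real \<Rightarrow> 'b::euclidean_space"
  assumes "h integrable_on {a..b}" "\<And>s. s \<in> {a<..<b} \<Longrightarrow> norm (h s) \<le> B" "a \<le> b"
  shows "norm (integral {a..b} h) \<le> B * (b - a)"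
proof -
  have "norm (integral {a..b} h) = norm (integral {a<..<b} h)"
    using integral_open_interval[of a b h] by simp
  also have "\<dots> \<le> integral {a<..<b} (\<lambda>_. B)"
    using assms by (intro integral_norm_bound_integral)
      (auto simp: integrable_on_open_interval[of _ a b, unfolded box_real])
  also have "\<dots> = integral {a..b} (\<lambda>_. B)"
    using integral_open_interval[of a b "\<lambda>_. B"] by simp
  finally show ?thesis using assms(3) by (simp add: mult.commute)
qed

lemma integral_diff_Icc:
  fixes h :: "real \<Rightarrow> 'b::euclidean_space"
  assumes "h integrable_on {a..T}" "a \<le> s" "s \<le> s'" "s' \<le> T"
  shows "integral {a..s'} h - integral {a..s} h = integral {s..s'} h"
  using Henstock_Kurzweil_Integration.integral_combine[of a s s' h] assms
  by (metis add_diff_cancel_left' integrable_on_subinterval order_refl order_trans atLeastatMost_subset_iff)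

text \<open>Forward difference quotients of a Lipschitz curve are bounded by \<open>K\<close> and
  converge almost everywhere to \<open>g\<close>, so dominated convergence identifies the integral
  of \<open>g\<close>. The integrals of the quotients collapse to averages over short intervals at
  the two ends.\<close>

lemma lipschitz_on_has_integral_AE_derivative:
  fixes x :: "real \<Rightarrow> 'a::euclidean_space"
  assumes lip: "K-lipschitz_on {a..b} x" and ab: "a \<le> b"
    and der: "AE s in lebesgue_on {a<..<b}. (x has_vector_derivative g s) (at s)"
  shows "(g has_integral (x b - x a)) {a..b}"
proof -
  have K: "K \<ge> 0" using lip lipschitz_on_nonneg by blast
  obtain N where N: "negligible N" "\<And>s. s \<in> {a<..<b} - N \<Longrightarrow> (x has_vector_derivative g s) (at s)"
    using der by (subst (asm) AE_lebesgue_on_iff) auto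
  define N' where "N' = N \<union> {a, b}"
  have N': "negligible N'" using N(1) by (simp add: N'_def)
  \<comment> \<open>Freezing \<open>x\<close> beyond the endpoints keeps the constant
    \<open>K\<close> and makes the forward quotient meaningful up to \<open>b\<close>.\<close>
  define c where "c s = min b (max a s)" for s :: real
  have c: "c s \<in> {a..b}" "s \<in> {a..b} \<Longrightarrow> c s = s" "\<bar>c s - c s'\<bar> \<le> \<bar>s - s'\<bar>" for s s'
    using ab by (auto simp: c_def)
  define X where "X s = x (c s)" for s
  have XL: "norm (X s - X s') \<le> K * \<bar>s - s'\<bar>" for s s'
  proof -
    have "norm (X s - X s') \<le> K * \<bar>c s - c s'\<bar>"
      using lipschitz_onD[OF lip c(1) c(1), of s s'] by (simp add: X_def dist_norm)
    also have "\<dots> \<le> K * \<bar>s - s'\<bar>" using K c(3) by (simp add: mult_left_mono)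
    finally show ?thesis .
  qed
  have Xcont: "continuous_on S X" for S
    by (rule lipschitz_on_continuous_on[of K]) (use XL K in \<open>auto simp: lipschitz_on_def dist_norm\<close>)
  define e where "e n = inverse (real (Suc n))" for n
  have e: "e n > 0" "e \<longlonglongrightarrow> 0" for n
    unfolding e_def using LIMSEQ_inverse_real_of_nat by auto
  define q where "q n s = inverse (e n) *\<^sub>R (X (s + e n) - X s)" for n s
  define q' where "q' n s = (if s \<in> N' then 0 else q n s)" for n s
  define g' where "g' s = (if s \<in> N' then 0 else g s)" for s
  have qint: "q n integrable_on {a..b}" for n
    unfolding q_def
    by (intro integrable_continuous_interval continuous_intros continuous_on_compose2[OF Xcont[of UNIV]]) auto
  have q'int: "q' n integrable_on {a..b}" and q'eq: "integral {a..b} (q' n) = integral {a..b} (q n)" for n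
    using integrable_spike[OF qint N', of "q' n" n] integral_spike[OF N', of "{a..b}" "q n" "q' n"]
    by (auto simp: q'_def)
  have bd: "norm (q' n s) \<le> K" for n s
  proof -
    have "norm (q n s) = inverse (e n) * norm (X (s + e n) - X s)"
      using e(1)[of n] by (simp add: q_def)
    also have "\<dots> \<le> inverse (e n) * (K * e n)"
      using XL[of "s + e n" s] e(1)[of n] by (intro mult_left_mono) auto
    also have "\<dots> = K" using e(1)[of n] by simp
    finally show ?thesis using K by (simp add: q'_def)
  qed
  have lim: "(\<lambda>n. q' n s) \<longlonglongrightarrow> g' s" if s: "s \<in> {a..b}" for s
  proof (cases "s \<in> N'")
    case False
    with s have sab: "s \<in> {a<..<b} - N" by (auto simp: N'_def)
    from N(2)[OF this] have d: "((\<lambda>h. norm (x (s + h) - x s - h *\<^sub>R g s) / norm h) \<longlongrightarrow> 0) (at 0)"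
      unfolding has_vector_derivative_def has_derivative_at by blast
    have "((\<lambda>h. norm ((x (s + h) - x s) /\<^sub>R h - g s)) \<longlongrightarrow> 0) (at 0)"
    proof (rule Lim_transform_eventually[OF d])
      have "norm (x (s + h) - x s - h *\<^sub>R g s) / norm h = norm ((x (s + h) - x s) /\<^sub>R h - g s)" if "h \<noteq> 0" for h
      proof -
        have "(x (s + h) - x s) /\<^sub>R h - g s = (x (s + h) - x s - h *\<^sub>R g s) /\<^sub>R h"
          using that by (simp add: scaleR_diff_right)
        then show ?thesis using that by (simp add: divide_inverse mult.commute)
      qed
      then show "\<forall>\<^sub>F h in at 0. norm (x (s + h) - x s - h *\<^sub>R g s) / norm h = norm ((x (s + h) - x s) /\<^sub>R h - g s)"
        by (auto simp: eventually_at_filter)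
    qed
    then have "((\<lambda>h. (x (s + h) - x s) /\<^sub>R h) \<longlongrightarrow> g s) (at 0)"
      using Lim_null tendsto_norm_zero_iff by blast
    moreover have "filterlim e (at 0) sequentially"
      using e by (auto simp: filterlim_at intro!: always_eventually) (metis less_irrefl)
    ultimately have "(\<lambda>n. (x (s + e n) - x s) /\<^sub>R e n) \<longlonglongrightarrow> g s"
      by (rule filterlim_compose)
    moreover have "\<forall>\<^sub>F n in sequentially. (x (s + e n) - x s) /\<^sub>R e n = q' n s"
    proof -
      have "\<forall>\<^sub>F n in sequentially. e n < b - s" using order_tendstoD(2)[OF e(2), of "b - s"] sab by auto
      then show ?thesis
      proof eventually_elim
        case (elim n)
        then have "s + e n \<in> {a..b}" using sab e(1)[of n] by auto
        then show ?case using False c(2) s by (simp add: q'_def q_def X_def)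
      qed
    qed
    ultimately show ?thesis using False by (simp add: g'_def tendsto_cong)
  qed (simp add: g'_def q'_def)
  have G: "g' integrable_on {a..b}" "(\<lambda>n. integral {a..b} (q' n)) \<longlonglongrightarrow> integral {a..b} g'"
    using dominated_convergence[of q' "{a..b}" "\<lambda>_. K" g'] q'int bd lim by auto
  \<comment> \<open>After a shift, the quotient integral is \<open>x b\<close> minus the mean of
    \<open>X\<close> over \<open>[a, a + e n]\<close>, and this mean is within
    \<open>K * e n\<close> of \<open>x a\<close>.\<close>
  have val: "norm (integral {a..b} (q' n) - (x b - x a)) \<le> K * e n" for n
  proof -
    have e0: "e n \<ge> 0" using e(1) by (simp add: less_imp_le)
    have XI: "X integrable_on {u..v}" for u v by (intro integrable_continuous_interval Xcont)
    have "integral {a..b} (\<lambda>s. X (s + e n)) = integral {a + e n..b + e n} X"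
      using integral_shift_Icc_real[of a b X "e n"] by (simp add: o_def add.commute)
    moreover have "integral {a..b + e n} X = integral {a..a + e n} X + integral {a + e n..b + e n} X"
      using Henstock_Kurzweil_Integration.integral_combine[of a "a + e n" "b + e n" X] XI e0 ab by simp
    moreover have "integral {a..b + e n} X = integral {a..b} X + integral {b..b + e n} X"
      using Henstock_Kurzweil_Integration.integral_combine[of a b "b + e n" X] XI e0 ab by simp
    moreover have "integral {b..b + e n} X = integral {b..b + e n} (\<lambda>_. x b)"
      by (rule integral_cong) (use ab in \<open>auto simp: X_def c_def\<close>)
    moreover have "integral {a..b} (q n) = inverse (e n) *\<^sub>R (integral {a..b} (\<lambda>s. X (s + e n)) - integral {a..b} X)"
      unfolding q_def integral_cmul
      by (subst integral_diff) (auto intro!: XI integrable_continuous_interval continuous_on_compose2[OF Xcont[of UNIV]] continuous_intros)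
    moreover from calculation have "integral {a..b} (\<lambda>s. X (s + e n)) - integral {a..b} X = e n *\<^sub>R x b - integral {a..a + e n} X"
      using e0 by (simp add: algebra_simps)
    ultimately have "integral {a..b} (q n) = inverse (e n) *\<^sub>R (e n *\<^sub>R x b - integral {a..a + e n} X)"
      by simp
    then have "integral {a..b} (q' n) - (x b - x a) = inverse (e n) *\<^sub>R (e n *\<^sub>R x a - integral {a..a + e n} X)"
      using e(1)[of n] by (simp add: q'eq algebra_simps)
    also have "e n *\<^sub>R x a - integral {a..a + e n} X = integral {a..a + e n} (\<lambda>s. X a - X s)"
      using e0 ab XI by (subst integral_diff) (auto simp: X_def c_def)
    finally have "norm (integral {a..b} (q' n) - (x b - x a)) = inverse (e n) * norm (integral {a..a + e n} (\<lambda>s. X a - X s))"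
      using e0 by simp
    also have "\<dots> \<le> inverse (e n) * (K * e n * (a + e n - a))"
    proof (intro mult_left_mono integral_lipschitz_bound)
      show "norm (X a - X s) \<le> K * e n" if "s \<in> {a<..<a + e n}" for s
        using XL[of a s] that mult_left_mono[of "s - a" "e n" K] K by auto
    qed (use e0 in \<open>auto intro!: integrable_continuous_interval continuous_intros Xcont\<close>)
    also have "\<dots> = K * e n" using e(1)[of n] by simp
    finally show ?thesis .
  qed
  have "(\<lambda>n. integral {a..b} (q' n) - (x b - x a)) \<longlonglongrightarrow> 0"
    by (rule Lim_null_comparison[where g="\<lambda>n. K * e n"])
       (use val e(2) in \<open>auto intro!: always_eventually tendsto_mult_right_zero\<close>)
  then have "integral {a..b} g' = x b - x a"
    using LIMSEQ_unique[OF G(2)] by (simp add: LIM_zero_iff)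
  then have "(g' has_integral (x b - x a)) {a..b}" using G(1) by (metis has_integral_iff)
  then show ?thesis
    by (rule has_integral_spike[OF N', rotated]) (auto simp: g'_def)
qed

text \<open>Applied to the lag, it converts the monotone-delay condition, which holds almost
  everywhere, into an expansion property of increments that can be used without exceptional
  sets.\<close>

lemma lipschitz_on_AE_derivative_lower_bound:
  fixes x :: "real \<Rightarrow> real"
  assumes lip: "K-lipschitz_on {a..b} x" and ab: "a \<le> b"
    and der: "AE s in lebesgue_on {a<..<b}. \<exists>D\<ge>d. (x has_real_derivative D) (at s)"
  shows "d * (b - a) \<le> x b - x a"
proof -
  \<comment> \<open>The default \<open>d\<close> off the good set keeps the bound
    \<open>d \<le> g s\<close> true everywhere.\<close>
  define g where "g s = (if \<exists>D\<ge>d. (x has_real_derivative D) (at s)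
     then (SOME D. D \<ge> d \<and> (x has_real_derivative D) (at s)) else d)" for s
  have g: "g s \<ge> d \<and> (x has_real_derivative (g s)) (at s)" if "\<exists>D\<ge>d. (x has_real_derivative D) (at s)" for s
    using someI_ex[OF that] that by (simp add: g_def)
  have "AE s in lebesgue_on {a<..<b}. (x has_vector_derivative g s) (at s)"
    using der by (rule eventually_mono) (use g in \<open>auto simp: has_real_derivative_iff_has_vector_derivative\<close>)
  from lipschitz_on_has_integral_AE_derivative[OF lip ab this]
  have "(g has_integral (x b - x a)) {a..b}" .
  moreover have "((\<lambda>_. d) has_integral d * (b - a)) {a..b}"
    using has_integral_const_real[of d a b] ab by (simp add: mult.commute)
  moreover have "d \<le> g s" for s using g by (cases "\<exists>D\<ge>d. (x has_real_derivative D) (at s)") (auto simp: g_def)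
  ultimately show ?thesis by (metis has_integral_le)
qed

text \<open>One-sided Lebesgue differentiation is used twice: on \<open>k\<close> for right
  quotients and on its reflection for left quotients. The exceptional set is the union of the first
  null set and the reflection of the second.\<close>

lemma integral_has_vector_derivative_AE:
  fixes h :: "real \<Rightarrow> 'b::euclidean_space"
  assumes h: "h integrable_on {a..b}"
  shows "AE s in lebesgue_on {a<..<b}. ((\<lambda>u. integral {a..u} h) has_vector_derivative h s) (at s)"
proof -
  define k where "k s = (if s \<in> {a..b} then h s else 0)" for s
  have "k integrable_on UNIV" using h integrable_restrict_UNIV unfolding k_def by blast
  then have kint: "k integrable_on {u..v}" for u v using integrable_on_subinterval by blast
  obtain N1 where N1: "negligible N1" "\<And>x e. \<lbrakk>x \<notin> N1; 0 < e\<rbrakk> \<Longrightarrow>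
      \<exists>d>0. \<forall>h. 0 < h \<and> h < d \<longrightarrow> norm (integral {x..x + h} k /\<^sub>R h - k x) < e"
    by (rule integrable_ccontinuous_explicit[of k]) (use kint in auto)
  have kint': "(\<lambda>s. k (- s)) integrable_on {u..v}" for u v
    using kint[of "-v" "-u"] Henstock_Kurzweil_Integration.integrable_reflect_real[where f=k and a="-v" and b="-u"] by simp
  obtain N2 where N2: "negligible N2" "\<And>x e. \<lbrakk>x \<notin> N2; 0 < e\<rbrakk> \<Longrightarrow>
      \<exists>d>0. \<forall>h. 0 < h \<and> h < d \<longrightarrow> norm (integral {x..x + h} (\<lambda>s. k (- s)) /\<^sub>R h - k (- x)) < e"
    by (rule integrable_ccontinuous_explicit[of "\<lambda>s. k (- s)"]) (use kint' in auto)
  define N where "N = N1 \<union> uminus ` N2"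
  have "negligible N" using N1(1) N2(1)
    by (auto simp: N_def intro!: negligible_Un negligible_differentiable_image_negligible derivative_intros differentiable_on_minus differentiable_on_id)
  moreover have "((\<lambda>u. integral {a..u} h) has_vector_derivative h s) (at s)" if s: "s \<in> {a<..<b} - N" for s
  proof -
    have kh: "integral {u..v} h = integral {u..v} k" if "a \<le> u" "v \<le> b" for u v
      by (rule integral_cong) (use that in \<open>auto simp: k_def\<close>)
    have ks: "k s = h s" using s by (simp add: k_def)
    show ?thesis unfolding has_vector_derivative_def has_derivative_at_alt
    proof (intro conjI allI impI)
      show "bounded_linear (\<lambda>x. x *\<^sub>R h s)" by (rule bounded_linear_scaleR_left)
      fix e :: real assume e: "e > 0"
      obtain d1 where d1: "d1 > 0" "\<And>r. 0 < r \<Longrightarrow> r < d1 \<Longrightarrow> norm (integral {s..s + r} k /\<^sub>R r - k s) < e"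
        using N1(2)[of s e] s e by (auto simp: N_def)
      have "- s \<notin> N2" using s by (force simp: N_def)
      then obtain d2 where d2: "d2 > 0" "\<And>r. 0 < r \<Longrightarrow> r < d2 \<Longrightarrow> norm (integral {-s..-s + r} (\<lambda>s. k (- s)) /\<^sub>R r - k s) < e"
        using N2(2)[of "-s" e] e by auto
      define d where "d = Min {d1, d2, s - a, b - s}"
      have d: "d > 0" "d \<le> d1" "d \<le> d2" "d \<le> s - a" "d \<le> b - s" using d1 d2 s by (auto simp: d_def)
      show "\<exists>d>0. \<forall>y. norm (y - s) < d \<longrightarrow>
          norm (integral {a..y} h - integral {a..s} h - (y - s) *\<^sub>R h s) \<le> e * norm (y - s)"
      proof (intro exI[of _ d] conjI allI impI d(1))
        fix y :: real assume y: "norm (y - s) < d"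
        consider "y = s" | "y > s" | "y < s" by linarith
        then show "norm (integral {a..y} h - integral {a..s} h - (y - s) *\<^sub>R h s) \<le> e * norm (y - s)"
        proof cases
          case 2
          have "integral {a..y} h - integral {a..s} h = integral {s..y} k"
            using integral_diff_Icc[OF h, of s y] 2 y d s kh[of s y] by auto
          moreover have "norm (integral {s..s + (y - s)} k /\<^sub>R (y - s) - k s) < e"
            using d1(2)[of "y - s"] 2 y d by auto
          ultimately have "norm ((integral {a..y} h - integral {a..s} h) /\<^sub>R (y - s) - h s) < e" using ks by simp
          then have "(y - s) * norm ((integral {a..y} h - integral {a..s} h) /\<^sub>R (y - s) - h s) \<le> (y - s) * e"
            using 2 by (intro mult_left_mono) auto
          also have "(y - s) * norm ((integral {a..y} h - integral {a..s} h) /\<^sub>R (y - s) - h s)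
            = norm ((y - s) *\<^sub>R ((integral {a..y} h - integral {a..s} h) /\<^sub>R (y - s) - h s))" using 2 by simp
          also have "(y - s) *\<^sub>R ((integral {a..y} h - integral {a..s} h) /\<^sub>R (y - s) - h s)
            = integral {a..y} h - integral {a..s} h - (y - s) *\<^sub>R h s" using 2 by (simp add: scaleR_diff_right)
          finally show ?thesis using 2 by (simp add: mult.commute)
        next
          case 3
          have "integral {a..s} h - integral {a..y} h = integral {y..s} k"
            using integral_diff_Icc[OF h, of y s] 3 y d s kh[of y s] by auto
          also have "\<dots> = integral {-s..-s + (s - y)} (\<lambda>s. k (- s))"
            using Henstock_Kurzweil_Integration.integral_reflect_real[where f=k and a=y and b=s] by simp
          finally have *: "integral {a..s} h - integral {a..y} h = integral {-s..-s + (s - y)} (\<lambda>s. k (- s))" .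
          have "norm (integral {-s..-s + (s - y)} (\<lambda>s. k (- s)) /\<^sub>R (s - y) - k s) < e"
            using d2(2)[of "s - y"] 3 y d by auto
          then have "norm ((integral {a..s} h - integral {a..y} h) /\<^sub>R (s - y) - h s) < e" using ks * by simp
          then have "(s - y) * norm ((integral {a..s} h - integral {a..y} h) /\<^sub>R (s - y) - h s) \<le> (s - y) * e"
            using 3 by (intro mult_left_mono) auto
          also have "(s - y) * norm ((integral {a..s} h - integral {a..y} h) /\<^sub>R (s - y) - h s)
            = norm ((s - y) *\<^sub>R ((integral {a..s} h - integral {a..y} h) /\<^sub>R (s - y) - h s))" using 3 by simp
          also have "(s - y) *\<^sub>R ((integral {a..s} h - integral {a..y} h) /\<^sub>R (s - y) - h s)
            = integral {a..s} h - integral {a..y} h - (s - y) *\<^sub>R h s" using 3 by (simp add: scaleR_diff_right)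
          also have "\<dots> = - (integral {a..y} h - integral {a..s} h - (y - s) *\<^sub>R h s)" by (simp add: algebra_simps)
          finally show ?thesis using 3 by (simp add: mult.commute norm_minus_commute)
        qed simp
      qed
    qed
  qed
  ultimately show ?thesis by (subst AE_lebesgue_on_iff) auto
qed

section \<open>Gronwall estimates and occupation times for a delayed argument\<close>

text \<open>A weighted maximum argument: let \<open>M\<close> be the larger of \<open>a\<close> and
  the maximum of \<open>E s * exp (- c * (s - t))\<close>. Evaluating \<open>step\<close> where the
  maximum is attained bounds that maximum by \<open>a + M / 2\<close>, hence
  \<open>M \<le> 2 * a\<close>. A bound on the whole interval is what lets \<open>step\<close> use
  \<open>E\<close> at lagged times.\<close>

lemma delay_gronwall:
  fixes E :: "real \<Rightarrow> real"
  assumes cont: "continuous_on {t..T} E" and a: "a \<ge> 0"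
    and step: "\<And>M s. \<lbrakk>M \<ge> a; \<And>r. r \<in> {t..T} \<Longrightarrow> E r \<le> M * exp (c * (r - t)); s \<in> {t..T}\<rbrakk>
      \<Longrightarrow> E s \<le> a + M / 2 * exp (c * (s - t))"
    and c: "c \<ge> 0" and s: "s \<in> {t..T}"
  shows "E s \<le> 2 * a * exp (c * (s - t))"
proof -
  have "continuous_on {t..T} (\<lambda>s. E s * exp (- c * (s - t)))" by (intro continuous_intros cont)
  moreover have "{t..T} \<noteq> {}" using s by blast
  ultimately obtain m where m: "m \<in> {t..T}" "\<And>r. r \<in> {t..T} \<Longrightarrow> E r * exp (- c * (r - t)) \<le> E m * exp (- c * (m - t))"
    by (rule continuous_attains_sup[OF compact_Icc, rotated, THEN bexE]) blast
  define M0 where "M0 = E m * exp (- c * (m - t))"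
  define M where "M = max a M0"
  have bd: "E r \<le> M * exp (c * (r - t))" if "r \<in> {t..T}" for r
  proof -
    have "E r * exp (- c * (r - t)) \<le> M" using m(2)[OF that] by (simp add: M_def M0_def)
    then have "E r * exp (- c * (r - t)) * exp (c * (r - t)) \<le> M * exp (c * (r - t))" by (intro mult_right_mono) auto
    moreover have "exp (- c * (r - t)) * exp (c * (r - t)) = 1" by (simp flip: exp_add)
    ultimately show ?thesis by (metis mult.assoc mult.right_neutral)
  qed
  have "E m \<le> a + M / 2 * exp (c * (m - t))" using step[of M m] bd m by (simp add: M_def)
  then have "M0 \<le> (a + M / 2 * exp (c * (m - t))) * exp (- c * (m - t))"
    unfolding M0_def by (intro mult_right_mono) auto
  also have "\<dots> = a * exp (- c * (m - t)) + M / 2"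
  proof -
    have "exp (c * (m - t)) * exp (- c * (m - t)) = 1" by (simp flip: exp_add)
    then show ?thesis by (simp add: distrib_right mult.assoc)
  qed
  also have "\<dots> \<le> a + M / 2" using a c m(1) mult_left_le[of "exp (- c * (m - t))" a] by auto
  finally have "M \<le> 2 * a" using a unfolding M_def by linarith
  then have "M * exp (c * (s - t)) \<le> 2 * a * exp (c * (s - t))" by (intro mult_right_mono) auto
  with bd[OF s] show ?thesis by linarith
qed

text \<open>The factor \<open>c / 2\<close> is arranged so that integration returns half of the
  exponential majorant, which is the contraction factor in the Gronwall and Picard
  arguments.\<close>

lemma integral_exp_le:
  fixes c M :: real
  assumes "M \<ge> 0" "c > 0" "t \<le> s"
  shows "(\<lambda>r. c / 2 * (M * exp (c * (r - t)))) integrable_on {t..s}"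
    and "integral {t..s} (\<lambda>r. c / 2 * (M * exp (c * (r - t)))) \<le> M / 2 * exp (c * (s - t))"
proof -
  have "((\<lambda>r. c / 2 * (M * exp (c * (r - t)))) has_integral
      (M / 2 * exp (c * (s - t)) - M / 2 * exp (c * (t - t)))) {t..s}"
    by (rule fundamental_theorem_of_calculus[OF assms(3)])
      (auto intro!: derivative_eq_intros simp flip: has_real_derivative_iff_has_vector_derivative)
  then show "(\<lambda>r. c / 2 * (M * exp (c * (r - t)))) integrable_on {t..s}"
    "integral {t..s} (\<lambda>r. c / 2 * (M * exp (c * (r - t)))) \<le> M / 2 * exp (c * (s - t))"
    using assms by (auto simp: has_integral_iff)
qed

text \<open>With \<open>m = 2 * k / d\<close>, expansion gives
  \<open>u s + k \<le> u (s + m) - k\<close>, so the integrand is at most a time shift by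
  \<open>m\<close> of one monotone function minus that function itself. The integral telescopes to
  two strips of length \<open>m\<close>. This quantifies that the lag stays near any given place
  only for a time of order \<open>k / d\<close>.\<close>

lemma integral_increment_along_expanding:
  fixes V u :: "real \<Rightarrow> real"
  assumes V: "mono V" "\<And>x. 0 \<le> V x" "\<And>x. V x \<le> Vm" and d: "d > 0" and k: "k \<ge> 0" and tT: "t \<le> T"
    and u: "\<And>s s'. t \<le> s \<Longrightarrow> s \<le> s' \<Longrightarrow> s' \<le> T \<Longrightarrow> d * (s' - s) \<le> u s' - u s"
  shows "(\<lambda>s. V (u s + k) - V (u s - k)) integrable_on {t..T}"
    and "integral {t..T} (\<lambda>s. V (u s + k) - V (u s - k)) \<le> 2 * k / d * Vm"
proof -
  define m where "m = 2 * k / d"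
  have m: "m \<ge> 0" "d * m = 2 * k" using d k by (auto simp: m_def)
  \<comment> \<open>Extension by \<open>0\<close> before \<open>t\<close> and by \<open>Vm\<close>
    after \<open>T\<close> keeps the function monotone, so it is integrable and may be shifted past
    \<open>T\<close>.\<close>
  define W where "W s = (if s < t then 0 else if s \<le> T then V (u s - k) else Vm)" for s
  have umono: "u s \<le> u s'" if "t \<le> s" "s \<le> s'" "s' \<le> T" for s s'
    using u[OF that] d that by (smt (verit) mult_nonneg_nonneg)
  have W0: "0 \<le> W s" "W s \<le> Vm" for s using V(2,3) order_trans[OF V(2) V(3)] by (auto simp: W_def)
  have Wmono: "mono_on S W" for S
    by (rule mono_onI) (use umono V in \<open>auto simp: W_def monoD intro: order_trans[OF V(2) V(3)]\<close>)
  have WI: "W integrable_on {p..q}" for p q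
    using integrable_on_lebesgue_on[OF integrable_mono_on_nonneg[OF Wmono W0(1)]] by simp
  define U where "U s = (if s < t then 0 else if s \<le> T then V (u s + k) else Vm)" for s
  have U0: "0 \<le> U s" for s using V(2,3) order_trans[OF V(2) V(3)] by (auto simp: U_def)
  have Umono: "mono_on S U" for S
    by (rule mono_onI) (use umono V in \<open>auto simp: U_def monoD intro: order_trans[OF V(2) V(3)]\<close>)
  have UI: "U integrable_on {p..q}" for p q
    using integrable_on_lebesgue_on[OF integrable_mono_on_nonneg[OF Umono U0]] by simp
  have eq: "V (u s + k) - V (u s - k) = U s - W s" if "s \<in> {t..T}" for s using that by (simp add: U_def W_def)
  show "(\<lambda>s. V (u s + k) - V (u s - k)) integrable_on {t..T}"
    by (rule integrable_eq[OF integrable_diff[OF UI WI]]) (use eq in auto)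
  have "integral {t..T} (\<lambda>s. V (u s + k) - V (u s - k)) = integral {t..T} (\<lambda>s. U s - W s)"
    by (rule integral_cong) (use eq in auto)
  also have "\<dots> = integral {t..T} U - integral {t..T} W" by (rule integral_diff[OF UI WI])
  also have "integral {t..T} U \<le> integral {t..T} (\<lambda>s. W (s + m))"
  proof (rule integral_le[OF UI])
    show "(\<lambda>s. W (s + m)) integrable_on {t..T}"
      using integrable_on_shift_Icc_real[of W m t T] WI by (simp add: o_def add.commute)
    show "U s \<le> W (s + m)" if s: "s \<in> {t..T}" for s
    proof (cases "s + m \<le> T")
      case True
      then have "u s + k \<le> u (s + m) - k" using u[of s "s + m"] s m by auto
      then show ?thesis using True s m V(1) by (auto simp: U_def W_def monoD)
    next
      case False
      then show ?thesis using s m V(3) by (auto simp: U_def W_def)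
    qed
  qed
  also have "integral {t..T} (\<lambda>s. W (s + m)) = integral {t + m..T + m} W"
    using integral_shift_Icc_real[of t T W m] by (simp add: o_def add.commute)
  also have "integral {t + m..T + m} W - integral {t..T} W = integral {T..T + m} W - integral {t..t + m} W"
    using Henstock_Kurzweil_Integration.integral_combine[of t "t + m" "T + m" W]
      Henstock_Kurzweil_Integration.integral_combine[of t T "T + m" W] WI m tT by auto
  also have "\<dots> \<le> Vm * m - 0"
  proof (rule diff_mono)
    show "integral {T..T + m} W \<le> Vm * m"
      using integral_lipschitz_bound[OF WI, of T "T + m" Vm] W0 m by auto
    show "0 \<le> integral {t..t + m} W" by (rule integral_nonneg[OF WI]) (use W0 in auto)
  qed
  finally show "integral {t..T} (\<lambda>s. V (u s + k) - V (u s - k)) \<le> 2 * k / d * Vm"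
    by (simp add: m_def mult.commute)
qed

text \<open>On the line the bounds on consecutive pieces add up to the same constant once continuity
  carries them to the breakpoints; the induction is on the number of points of \<open>S\<close>
  strictly between the two arguments.\<close>

lemma piecewise_lipschitz_on:
  fixes f :: "real \<Rightarrow> 'a::metric_space"
  assumes cont: "continuous_on {c<..<d} f" and fin: "finite S" and r: "r \<ge> 0"
    and pw: "\<And>a b. {a<..<b} \<subseteq> {c<..<d} - S \<Longrightarrow> r-lipschitz_on {a<..<b} f"
  shows "r-lipschitz_on {c<..<d} f"
proof -
  have main: "dist (f x) (f y) \<le> r * (y - x)" if "c < x" "x < y" "y < d" for x y
    using that
  proof (induction "card (S \<inter> {x<..<y})" arbitrary: x y rule: less_induct)
    case less
    show ?case
    proof (cases "S \<inter> {x<..<y} = {}")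
      case True
      then have "r-lipschitz_on {x<..<y} f" using less.prems by (intro pw) auto
      moreover have "continuous_on (closure {x<..<y}) f"
        using less.prems by (auto intro!: continuous_on_subset[OF cont])
      ultimately have "r-lipschitz_on {x..y} f"
        using lipschitz_on_closure[of r "{x<..<y}" f] less.prems by simp
      then show ?thesis using lipschitz_onD[of r "{x..y}" f x y] less.prems by (simp add: dist_real_def)
    next
      case False
      then obtain p where p: "p \<in> S" "x < p" "p < y" by auto
      have f: "finite (S \<inter> {x<..<y})" using fin by simp
      have "card (S \<inter> {x<..<p}) < card (S \<inter> {x<..<y})"
        by (rule psubset_card_mono[OF f]) (use p in auto)
      moreover have "card (S \<inter> {p<..<y}) < card (S \<inter> {x<..<y})"
        by (rule psubset_card_mono[OF f]) (use p in auto)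
      ultimately have "dist (f x) (f p) \<le> r * (p - x)" "dist (f p) (f y) \<le> r * (y - p)"
        using less.hyps p less.prems by auto
      then show ?thesis using dist_triangle[of "f x" "f y" "f p"] by (simp add: algebra_simps)
    qed
  qed
  show ?thesis
  proof (rule lipschitz_onI[OF _ r])
    fix x y assume xy: "x \<in> {c<..<d}" "y \<in> {c<..<d}"
    consider "x = y" | "x < y" | "y < x" by linarith
    then show "dist (f x) (f y) \<le> r * dist x y"
      using main[of x y] main[of y x] xy by cases (auto simp: dist_real_def dist_commute)
  qed
qed

text \<open>Supplies the Lipschitz dependence of \<open>f\<close> and \<open>\<tau>\<close> on time
  over bounded sets of states.\<close>

lemma C1_on_imp_lipschitz_on:
  fixes F :: "'a::real_normed_vector \<Rightarrow> 'b::real_normed_vector"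
  assumes "C1_on S F" "C \<subseteq> S" "compact C" "convex C"
  shows "\<exists>B\<ge>0. \<forall>x\<in>C. \<forall>y\<in>C. norm (F x - F y) \<le> B * norm (x - y)"
proof -
  obtain F' where F': "continuous_on S F'" "\<And>x. x \<in> S \<Longrightarrow> (F has_derivative blinfun_apply (F' x)) (at x within S)"
    using assms(1) unfolding C1_on_def by blast
  have "compact (F' ` C)" using F'(1) assms by (meson compact_continuous_image continuous_on_subset)
  then obtain B where B: "\<And>x. x \<in> C \<Longrightarrow> norm (F' x) \<le> B"
    by (meson bounded_iff compact_imp_bounded imageI)
  have "norm (F x - F y) \<le> max B 0 * norm (x - y)" if "x \<in> C" "y \<in> C" for x y
  proof (rule differentiable_bound[OF assms(4) _ _ that])
    show "(F has_derivative blinfun_apply (F' x)) (at x within C)" if "x \<in> C" for x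
      using F'(2)[of x] that assms(2) has_derivative_subset by blast
    show "onorm (blinfun_apply (F' x)) \<le> max B 0" if "x \<in> C" for x
      using B[OF that] by (simp add: norm_blinfun.rep_eq)
  qed
  then show ?thesis by (intro exI[of _ "max B 0"]) auto
qed

text \<open>Values of \<open>E\<close> at lags before \<open>p\<close> do not enter the recursion
  and must be absorbed by \<open>\<phi>\<close>. The rate \<open>4 * c\<close> arises because the
  present and the lagged value each contribute \<open>c\<close> times the majorant, and the sum
  \<open>2 * c\<close> has to be half of the rate.\<close>

lemma gronwall_along_delay:
  fixes E u :: "real \<Rightarrow> real"
  assumes cont: "continuous_on {p..T} E" and u: "\<And>r. r \<in> {p..T} \<Longrightarrow> u r \<le> r"
    and a: "a \<ge> 0" and c: "c > 0"
    and rho: "\<rho> integrable_on {p..T}" and phi: "\<phi> integrable_on {p..T}"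
    and phi0: "\<And>r. r \<in> {p..T} \<Longrightarrow> 0 \<le> \<phi> r" and b: "integral {p..T} \<phi> \<le> b"
    and E: "\<And>s. s \<in> {p..T} \<Longrightarrow> E s \<le> a + integral {p..s} \<rho>"
    and le: "\<And>r. r \<in> {p..T} \<Longrightarrow> \<rho> r \<le> \<phi> r + c * (E r + (if p \<le> u r then E (u r) else 0))"
    and s: "s \<in> {p..T}"
  shows "E s \<le> 2 * (a + b) * exp (4 * c * (s - p))"
proof (rule delay_gronwall[OF cont])
  have "0 \<le> integral {p..T} \<phi>" by (rule integral_nonneg[OF phi phi0])
  then have b0: "0 \<le> b" using b by linarith
  then show "0 \<le> a + b" using a by simp
  show "0 \<le> 4 * c" using c by simp
  show "s \<in> {p..T}" by fact
  fix M s assume M: "a + b \<le> M" and Er: "\<And>r. r \<in> {p..T} \<Longrightarrow> E r \<le> M * exp (4 * c * (r - p))"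
    and s: "s \<in> {p..T}"
  have M0: "M \<ge> 0" using M a b0 by linarith
  note I = integral_exp_le[OF M0, of "4 * c" p s]
  have phis: "\<phi> integrable_on {p..s}" using phi s by (auto intro: integrable_on_subinterval)
  have "integral {p..s} \<rho> \<le> integral {p..s} (\<lambda>r. \<phi> r + 4 * c / 2 * (M * exp (4 * c * (r - p))))"
  proof (rule integral_le)
    show "\<rho> integrable_on {p..s}" using rho s by (auto intro: integrable_on_subinterval)
    show "(\<lambda>r. \<phi> r + 4 * c / 2 * (M * exp (4 * c * (r - p)))) integrable_on {p..s}"
      using I(1) c s phis by (intro integrable_add) auto
    fix r assume r: "r \<in> {p..s}"
    then have r': "r \<in> {p..T}" using s by auto
    have "(if p \<le> u r then E (u r) else 0) \<le> M * exp (4 * c * (r - p))"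
    proof (cases "p \<le> u r")
      case True
      then have "E (u r) \<le> M * exp (4 * c * (u r - p))" using Er[of "u r"] u[OF r'] r' by auto
      also have "\<dots> \<le> M * exp (4 * c * (r - p))"
        using M0 c u[OF r'] by (intro mult_left_mono) auto
      finally show ?thesis using True by simp
    qed (use M0 in auto)
    then have "c * (E r + (if p \<le> u r then E (u r) else 0)) \<le> c * (M * exp (4 * c * (r - p)) + M * exp (4 * c * (r - p)))"
      using Er[OF r'] c by (intro mult_left_mono add_mono) auto
    then show "\<rho> r \<le> \<phi> r + 4 * c / 2 * (M * exp (4 * c * (r - p)))"
      using le[OF r'] by (simp add: algebra_simps)
  qed
  also have "\<dots> = integral {p..s} \<phi> + integral {p..s} (\<lambda>r. 4 * c / 2 * (M * exp (4 * c * (r - p))))"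
    using I(1) c s phis by (intro integral_add) auto
  also have "\<dots> \<le> b + M / 2 * exp (4 * c * (s - p))"
  proof (rule add_mono)
    have "integral {p..s} \<phi> \<le> integral {p..T} \<phi>"
      using phis phi phi0 s by (intro integral_subset_le) auto
    then show "integral {p..s} \<phi> \<le> b" using b by simp
  qed (use I(2) c s in auto)
  finally show "E s \<le> a + b + M / 2 * exp (4 * c * (s - p))" using E[OF s] by simp
qed

text \<open>\<open>G\<close> is continuous only on the set of admissible arguments, so measurability
  is obtained by composing through the compact set that contains the path; the same set supplies the
  bound.\<close>

lemma path_absolutely_integrable:
  fixes G :: "real \<times> (real^'n) \<times> (real^'n) \<times> (real^'m) \<Rightarrow> 'c::euclidean_space"
  assumes G: "continuous_on ({t0..T} \<times> UNIV \<times> UNIV \<times> A) G" and A: "compact A" "A \<noteq> {}"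
    and t: "t0 \<le> t" and x: "continuous_on {t..T} x" and y: "continuous_on {t..T} y"
    and \<alpha>: "\<alpha> \<in> controls A t T"
  shows "(\<lambda>r. G (r, x r, y r, \<alpha> r)) absolutely_integrable_on {t..T}"
proof -
  define S where "S = {t..T} \<times> x ` {t..T} \<times> y ` {t..T} \<times> A"
  have S: "compact S" unfolding S_def
    using A x y by (intro compact_Times compact_continuous_image) auto
  have GS: "continuous_on S G" by (rule continuous_on_subset[OF G]) (use t in \<open>auto simp: S_def\<close>)
  have "compact (G ` S)" using S GS by (rule compact_continuous_image[rotated])
  then obtain B where B: "\<And>q. q \<in> S \<Longrightarrow> norm (G q) \<le> B"
    by (meson bounded_iff compact_imp_bounded imageI)
  let ?M = "lebesgue_on {t<..<T}"
  have \<alpha>m: "\<alpha> \<in> borel_measurable ?M" and \<alpha>A: "\<And>r. r \<in> {t<..<T} \<Longrightarrow> \<alpha> r \<in> A"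
    using \<alpha> by (auto simp: controls_def)
  have xm: "x \<in> borel_measurable ?M" and ym: "y \<in> borel_measurable ?M" and im: "(\<lambda>r. r) \<in> borel_measurable ?M"
    by (intro continuous_imp_measurable_on_sets_lebesgue continuous_on_subset[OF x] continuous_on_subset[OF y] continuous_on_id; force)+
  have "(\<lambda>r. (r, x r, y r, \<alpha> r)) \<in> borel_measurable ?M"
    by (intro borel_measurable_Pair im xm ym \<alpha>m)
  then have "(\<lambda>r. (r, x r, y r, \<alpha> r)) \<in> measurable ?M (restrict_space borel S)"
    by (rule measurable_restrict_space2[rotated]) (use \<alpha>A in \<open>auto simp: S_def\<close>)
  moreover have "G \<in> borel_measurable (restrict_space borel S)"
    by (rule borel_measurable_continuous_on_restrict[OF GS])
  ultimately have "(\<lambda>r. G (r, x r, y r, \<alpha> r)) \<in> borel_measurable ?M"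
    by (rule measurable_compose)
  then show ?thesis
    by (rule bounded_measurable_integrable_on_open[where B=B]) (use \<alpha>A in \<open>auto intro!: B simp: S_def\<close>)
qed

subsection \<open>The state equation\<close>

locale delay_ode =
  fixes t0 T \<tau>bar :: real and A :: "(real^'m) set"
    and f :: "real \<times> (real^'n) \<times> (real^'n) \<times> (real^'m) \<Rightarrow> real^'n"
    and \<tau> :: "real \<times> (real^'n) \<Rightarrow> real" and lf Cf l\<tau> :: real
  assumes time: "t0 < T" and A: "A \<noteq> {}" "compact A" "convex A"
    and f_cont: "continuous_on ({t0..T} \<times> UNIV \<times> UNIV \<times> A) f"
    and lf: "lf > 0" "\<And>t z y z' y' a. t \<in> {t0..T} \<Longrightarrow> a \<in> A \<Longrightarrow>
          norm (f (t, z, y, a) - f (t, z', y', a)) \<le> lf * (norm (z - z') + norm (y - y'))"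
    and Cf: "Cf > 0" "\<And>t z y a. t \<in> {t0..T} \<Longrightarrow> a \<in> A \<Longrightarrow> norm (f (t, z, y, a)) \<le> Cf * (1 + norm z + norm y)"
    and \<tau>_bounds: "\<And>t z. t \<in> {t0..T} \<Longrightarrow> 0 \<le> \<tau> (t, z)" "\<And>t z. t \<in> {t0..T} \<Longrightarrow> \<tau> (t, z) \<le> \<tau>bar"
    and \<tau>_cont: "continuous_on ({t0..T} \<times> UNIV) \<tau>"
    and l\<tau>: "l\<tau> > 0" "\<And>t z y. t \<in> {t0..T} \<Longrightarrow> \<bar>\<tau> (t, z) - \<tau> (t, y)\<bar> \<le> l\<tau> * norm (z - y)"
    and delay_pos: "\<tau>bar > 0"
begin

definition lag :: "(real \<Rightarrow> real^'n) \<Rightarrow> real \<Rightarrow> real" where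
  "lag x r = r - \<tau> (r, x r)"

definition rhs :: "(real \<Rightarrow> real^'n) \<Rightarrow> (real \<Rightarrow> real^'m) \<Rightarrow> real \<Rightarrow> real^'n" where
  "rhs x \<alpha> r = f (r, x r, x (lag x r), \<alpha> r)"

text \<open>The integral form of the state equation: differences and limits can be taken in it
  without tracking null sets. \<open>is_trajectory_iff_sol\<close> connects it with the almost
  everywhere form.\<close>

definition sol :: "real \<Rightarrow> (real \<Rightarrow> real^'n) \<Rightarrow> (real \<Rightarrow> real^'m) \<Rightarrow> (real \<Rightarrow> real^'n) \<Rightarrow> bool" where
  "sol t w \<alpha> x \<longleftrightarrow> (\<exists>K. K-lipschitz_on {t - \<tau>bar..T} x) \<and> (\<forall>\<theta>\<in>{-\<tau>bar..0}. x (t + \<theta>) = w \<theta>) \<and>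
     (\<forall>s\<in>{t..T}. x s = w 0 + integral {t..s} (rhs x \<alpha>))"

lemma lag_bounds:
  assumes "r \<in> {t..T}" "t0 \<le> t"
  shows "lag x r \<le> r" "r - \<tau>bar \<le> lag x r" "t - \<tau>bar \<le> lag x r" "lag x r \<in> {t - \<tau>bar..T}"
  using assms \<tau>_bounds[of r "x r"] by (auto simp: lag_def)

lemma lag_continuous:
  assumes "continuous_on {t..T} x" "t0 \<le> t"
  shows "continuous_on {t..T} (lag x)"
  unfolding lag_def
  by (intro continuous_intros continuous_on_compose2[OF \<tau>_cont, of _ "\<lambda>r. (r, x r)"] assms)
     (use assms in auto)

lemma delayed_continuous:
  assumes "continuous_on {t - \<tau>bar..T} x" "t0 \<le> t"
  shows "continuous_on {t..T} (\<lambda>r. x (lag x r))" "continuous_on {t..T} x"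
proof -
  show c: "continuous_on {t..T} x" by (rule continuous_on_subset[OF assms(1)]) (use delay_pos in auto)
  show "continuous_on {t..T} (\<lambda>r. x (lag x r))"
    by (rule continuous_on_compose2[OF assms(1) lag_continuous[OF c assms(2)]]) (use lag_bounds assms in auto)
qed

lemma path_integrable:
  fixes G :: "real \<times> (real^'n) \<times> (real^'n) \<times> (real^'m) \<Rightarrow> 'c::euclidean_space"
  assumes "continuous_on ({t0..T} \<times> UNIV \<times> UNIV \<times> A) G"
    "continuous_on {t - \<tau>bar..T} x" "t0 \<le> t" "\<alpha> \<in> controls A t T"
  shows "(\<lambda>r. G (r, x r, x (lag x r), \<alpha> r)) absolutely_integrable_on {t..T}"
  using path_absolutely_integrable[OF assms(1) A(2,1) assms(3) _ _ assms(4)] delayed_continuous[OF assms(2,3)] by blast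

lemma rhs_integrable:
  assumes "continuous_on {t - \<tau>bar..T} x" "t0 \<le> t" "\<alpha> \<in> controls A t T"
  shows "rhs x \<alpha> absolutely_integrable_on {t..T}" "rhs x \<alpha> integrable_on {t..T}"
    "\<And>p q. t \<le> p \<Longrightarrow> q \<le> T \<Longrightarrow> rhs x \<alpha> integrable_on {p..q}"
proof -
  show "rhs x \<alpha> absolutely_integrable_on {t..T}" using path_integrable[OF f_cont assms] unfolding rhs_def .
  then show "rhs x \<alpha> integrable_on {t..T}" by (rule absolutely_integrable_on_def[THEN iffD1, THEN conjunct1])
  then show "rhs x \<alpha> integrable_on {p..q}" if "t \<le> p" "q \<le> T" for p q
    using that by (auto intro: integrable_on_subinterval)
qed

lemma sol_cong:
  assumes "t0 \<le> t" "\<And>s. s \<in> {t - \<tau>bar..T} \<Longrightarrow> x s = x' s" "t \<le> T"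
  shows "sol t w \<alpha> x \<longleftrightarrow> sol t w \<alpha> x'"
proof -
  have 1: "K-lipschitz_on {t - \<tau>bar..T} x \<longleftrightarrow> K-lipschitz_on {t - \<tau>bar..T} x'" for K
    using assms(2) by (simp add: lipschitz_on_def)
  have "rhs x \<alpha> r = rhs x' \<alpha> r" if "r \<in> {t..T}" for r
  proof -
    have "x r = x' r" using assms(2)[of r] that delay_pos by auto
    then have "lag x r = lag x' r" by (simp add: lag_def)
    moreover have "lag x r \<in> {t - \<tau>bar..T}" using lag_bounds[OF that assms(1)] by auto
    ultimately show ?thesis using \<open>x r = x' r\<close> assms(2) by (simp add: rhs_def)
  qed
  then have "integral {t..s} (rhs x \<alpha>) = integral {t..s} (rhs x' \<alpha>)" if "s \<in> {t..T}" for s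
    by (intro integral_cong) (use that in auto)
  moreover have "x s = x' s" if "s \<in> {t..T}" for s using assms(2)[of s] that delay_pos by auto
  moreover have "x (t + \<theta>) = x' (t + \<theta>)" if "\<theta> \<in> {-\<tau>bar..0}" for \<theta> using assms(2)[of "t + \<theta>"] that assms(3) by auto
  ultimately show ?thesis unfolding sol_def 1 by auto
qed

text \<open>One direction integrates the almost everywhere derivative of a Lipschitz curve, the
  other is Lebesgue differentiation of the integral.\<close>

lemma is_trajectory_iff_sol:
  assumes t: "t0 \<le> t" "t < T" and \<alpha>: "\<alpha> \<in> controls A t T"
  shows "is_trajectory f \<tau> \<tau>bar T t w \<alpha> x \<longleftrightarrow> sol t w \<alpha> x"
proof -
  have rhs_eq: "f (s, x s, x (s - \<tau> (s, x s)), \<alpha> s) = rhs x \<alpha> s" for s by (simp add: rhs_def lag_def)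
  show ?thesis
  proof
    assume tr: "is_trajectory f \<tau> \<tau>bar T t w \<alpha> x"
    then obtain K where K: "K-lipschitz_on {t - \<tau>bar..T} x" by (auto simp: is_trajectory_def)
    have hist: "\<forall>\<theta>\<in>{-\<tau>bar..0}. x (t + \<theta>) = w \<theta>" using tr by (auto simp: is_trajectory_def)
    have "AE s in lebesgue_on {t<..<T}. (x has_vector_derivative rhs x \<alpha> s) (at s)"
      using tr by (auto simp: is_trajectory_def rhs_eq)
    then obtain N where N: "negligible N" "\<And>s. s \<in> {t<..<T} - N \<Longrightarrow> (x has_vector_derivative rhs x \<alpha> s) (at s)"
      by (subst (asm) AE_lebesgue_on_iff) auto
    have "x s = w 0 + integral {t..s} (rhs x \<alpha>)" if s: "s \<in> {t..T}" for s
    proof -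
      have "(rhs x \<alpha> has_integral (x s - x t)) {t..s}"
      proof (rule lipschitz_on_has_integral_AE_derivative)
        show "K-lipschitz_on {t..s} x" by (rule lipschitz_on_subset[OF K]) (use s delay_pos in auto)
        show "AE r in lebesgue_on {t<..<s}. (x has_vector_derivative rhs x \<alpha> r) (at r)"
          using N s by (subst AE_lebesgue_on_iff) auto
      qed (use s in auto)
      moreover have "x t = w 0" using hist[rule_format, of 0] delay_pos by simp
      ultimately show ?thesis by (metis add.commute diff_add_cancel integral_unique)
    qed
    then show "sol t w \<alpha> x" using K hist by (auto simp: sol_def)
  next
    assume sol: "sol t w \<alpha> x"
    then obtain K where K: "K-lipschitz_on {t - \<tau>bar..T} x" by (auto simp: sol_def)
    have "rhs x \<alpha> integrable_on {t..T}"
      by (rule rhs_integrable(2)[OF lipschitz_on_continuous_on[OF K] t(1) \<alpha>])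
    then have "AE s in lebesgue_on {t<..<T}. ((\<lambda>u. integral {t..u} (rhs x \<alpha>)) has_vector_derivative rhs x \<alpha> s) (at s)"
      by (rule integral_has_vector_derivative_AE)
    then have "AE s in lebesgue_on {t<..<T}. (x has_vector_derivative rhs x \<alpha> s) (at s)"
    proof (rule AE_mp, intro AE_I2 impI)
      fix s assume s: "s \<in> space (lebesgue_on {t<..<T})"
        and d: "((\<lambda>u. integral {t..u} (rhs x \<alpha>)) has_vector_derivative rhs x \<alpha> s) (at s)"
      have "((\<lambda>u. w 0 + integral {t..u} (rhs x \<alpha>)) has_vector_derivative 0 + rhs x \<alpha> s) (at s)"
        by (intro has_vector_derivative_add d has_vector_derivative_const)
      then show "(x has_vector_derivative rhs x \<alpha> s) (at s)"
        using has_vector_derivative_transform_within_open[of "\<lambda>u. w 0 + integral {t..u} (rhs x \<alpha>)" "rhs x \<alpha> s" s "{t<..<T}" x]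
          s sol by (auto simp: sol_def)
    qed
    then show "is_trajectory f \<tau> \<tau>bar T t w \<alpha> x" using K sol by (auto simp: is_trajectory_def sol_def rhs_eq)
  qed
qed

section \<open>Dependence of trajectories on history and control\<close>

text \<open>The term \<open>x2 (lag x1 r)\<close> is inserted. The lags differ by at most
  \<open>l\<tau>\<close> times the state difference, so a state-dependent delay costs the Lipschitz
  constant of just one of the curves, and the remaining difference is taken at a single
  time.\<close>

lemma delayed_diff:
  assumes "K-lipschitz_on {t - \<tau>bar..T} x2" "r \<in> {t..T}" "t0 \<le> t"
  shows "norm (x1 (lag x1 r) - x2 (lag x2 r)) \<le> K * l\<tau> * norm (x1 r - x2 r) + norm (x1 (lag x1 r) - x2 (lag x1 r))"
proof -
  have K: "K \<ge> 0" using assms(1) lipschitz_on_nonneg by blast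
  have "norm (x2 (lag x1 r) - x2 (lag x2 r)) \<le> K * \<bar>lag x1 r - lag x2 r\<bar>"
    using lipschitz_onD[OF assms(1) lag_bounds(4)[OF assms(2,3)] lag_bounds(4)[OF assms(2,3)]]
    by (simp add: dist_norm)
  also have "\<dots> \<le> K * (l\<tau> * norm (x1 r - x2 r))"
    using l\<tau>(2)[of r "x1 r" "x2 r"] assms K by (intro mult_left_mono) (auto simp: lag_def)
  finally show ?thesis using norm_triangle_ineq[of "x1 (lag x1 r) - x2 (lag x1 r)" "x2 (lag x1 r) - x2 (lag x2 r)"]
    by (simp add: mult.assoc)
qed

lemma rhs_diff:
  assumes "K-lipschitz_on {t - \<tau>bar..T} x2" "r \<in> {t..T}" "t0 \<le> t" "\<alpha> r \<in> A"
  shows "norm (rhs x1 \<alpha> r - rhs x2 \<alpha> r)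
    \<le> lf * (1 + K * l\<tau>) * (norm (x1 r - x2 r) + norm (x1 (lag x1 r) - x2 (lag x1 r)))"
proof -
  have K: "K \<ge> 0" using assms(1) lipschitz_on_nonneg by blast
  have "norm (rhs x1 \<alpha> r - rhs x2 \<alpha> r) \<le> lf * (norm (x1 r - x2 r) + norm (x1 (lag x1 r) - x2 (lag x2 r)))"
    unfolding rhs_def using assms by (intro lf(2)) auto
  also have "\<dots> \<le> lf * (norm (x1 r - x2 r) + (K * l\<tau> * norm (x1 r - x2 r) + norm (x1 (lag x1 r) - x2 (lag x1 r))))"
    using delayed_diff[OF assms(1-3), of x1] lf(1) by (intro mult_left_mono add_left_mono) auto
  also have "\<dots> \<le> lf * ((1 + K * l\<tau>) * (norm (x1 r - x2 r) + norm (x1 (lag x1 r) - x2 (lag x1 r))))"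
  proof (rule mult_left_mono)
    have "0 \<le> K * l\<tau> * norm (x1 (lag x1 r) - x2 (lag x1 r))" using K l\<tau>(1) by simp
    then show "norm (x1 r - x2 r) + (K * l\<tau> * norm (x1 r - x2 r) + norm (x1 (lag x1 r) - x2 (lag x1 r)))
      \<le> (1 + K * l\<tau>) * (norm (x1 r - x2 r) + norm (x1 (lag x1 r) - x2 (lag x1 r)))"
      by (simp add: distrib_right distrib_left)
  qed (use lf in auto)
  finally show ?thesis by (simp add: mult.assoc)
qed

text \<open>The change of control is measured along the fixed curve \<open>x2\<close> by the norm of
  an integral rather than the integral of a norm; the cancellation produced by averaging a control
  survives in this form. The horizon \<open>S\<close> may stop before \<open>T\<close>, so that
  agreement of trajectories up to the start of a cell can be read off with both errors zero.\<close>

lemma sol_diff_bound: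
  assumes t: "t0 \<le> t" "t \<le> S" "S \<le> T" and s1: "sol t w1 \<alpha>1 x1" and s2: "sol t w2 \<alpha>2 x2"
    and K: "K-lipschitz_on {t - \<tau>bar..T} x2"
    and \<alpha>: "\<alpha>1 \<in> controls A t T" "\<alpha>2 \<in> controls A t T"
    and w: "\<And>\<theta>. \<theta> \<in> {-\<tau>bar..0} \<Longrightarrow> norm (w1 \<theta> - w2 \<theta>) \<le> \<delta>"
    and eps: "\<And>s. s \<in> {t..S} \<Longrightarrow> norm (integral {t..s} (\<lambda>r. rhs x2 \<alpha>1 r - rhs x2 \<alpha>2 r)) \<le> \<epsilon>"
    and s: "s \<in> {t - \<tau>bar..S}"
  shows "norm (x1 s - x2 s) \<le> 2 * (1 + lf * (1 + K * l\<tau>) * (T - t0)) * exp (4 * (lf * (1 + K * l\<tau>)) * (T - t0)) * (\<delta> + \<epsilon>)"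
proof -
  define c where "c = lf * (1 + K * l\<tau>)"
  have K0: "K \<ge> 0" using K lipschitz_on_nonneg by blast
  have c: "c > 0" using K0 l\<tau>(1) lf(1) unfolding c_def by (intro mult_pos_pos add_pos_nonneg) auto
  obtain K1 where K1: "K1-lipschitz_on {t - \<tau>bar..T} x1" using s1 by (auto simp: sol_def)
  note cont1 = lipschitz_on_continuous_on[OF K1] and cont2 = lipschitz_on_continuous_on[OF K]
  have "norm (w1 0 - w2 0) \<le> \<delta>" by (rule w) (use delay_pos in auto)
  then have d0: "0 \<le> \<delta>" by (rule order_trans[OF norm_ge_zero])
  have e0: "0 \<le> \<epsilon>" using eps[of t] t by simp
  have hist: "norm (x1 r - x2 r) \<le> \<delta>" if "r \<in> {t - \<tau>bar..t}" for r
  proof -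
    have m: "r - t \<in> {-\<tau>bar..0}" using that by auto
    have "x1 (t + (r - t)) = w1 (r - t)" using s1 m unfolding sol_def by blast
    moreover have "x2 (t + (r - t)) = w2 (r - t)" using s2 m unfolding sol_def by blast
    ultimately show ?thesis using w[OF m] by simp
  qed
  \<comment> \<open>The endpoints are set to \<open>0\<close> because
    \<open>\<alpha>1 r \<in> A\<close> is known only inside the interval.\<close>
  let ?\<rho> = "\<lambda>r. if r \<in> {t<..<S} then norm (rhs x1 \<alpha>1 r - rhs x2 \<alpha>1 r) else 0"
  have r12: "(\<lambda>r. rhs x1 \<alpha>1 r - rhs x2 \<alpha>1 r) absolutely_integrable_on {t..T}"
    using rhs_integrable(1)[OF cont1 t(1) \<alpha>(1)] rhs_integrable(1)[OF cont2 t(1) \<alpha>(1)] by (rule set_integral_diff)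
  then have "(\<lambda>r. norm (rhs x1 \<alpha>1 r - rhs x2 \<alpha>1 r)) integrable_on {t..T}"
    by (auto simp: absolutely_integrable_on_def)
  then have n12: "(\<lambda>r. norm (rhs x1 \<alpha>1 r - rhs x2 \<alpha>1 r)) integrable_on {t..S}"
    by (rule integrable_on_subinterval) (use t in auto)
  have rho: "?\<rho> integrable_on {t..S}"
    by (rule integrable_spike[OF n12, of "{t, S}"]) auto
  \<comment> \<open>Lags that fall into the history see a difference of at most
    \<open>\<delta>\<close>; this is the constant \<open>\<phi>\<close>.\<close>
  have "norm (x1 s - x2 s) \<le> 2 * ((\<delta> + \<epsilon>) + c * \<delta> * (S - t)) * exp (4 * c * (s - t))" if s: "s \<in> {t..S}" for s
  proof (rule gronwall_along_delay[where u="lag x1" and \<rho>="?\<rho>" and \<phi>="\<lambda>_. c * \<delta>"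
      and E="\<lambda>s. norm (x1 s - x2 s)", OF _ _ _ c rho _ _ _ _ _ s])
    show "continuous_on {t..S} (\<lambda>s. norm (x1 s - x2 s))"
      using delayed_continuous(2)[OF cont1 t(1)] delayed_continuous(2)[OF cont2 t(1)] t
      by (intro continuous_intros) (auto intro: continuous_on_subset)
    show "0 \<le> \<delta> + \<epsilon>" "0 \<le> c * \<delta>" using d0 e0 c by auto
    show "integral {t..S} (\<lambda>_. c * \<delta>) \<le> c * \<delta> * (S - t)" using t by simp
    show "norm (x1 s - x2 s) \<le> \<delta> + \<epsilon> + integral {t..s} ?\<rho>" if s: "s \<in> {t..S}" for s
    proof -
      have i1: "rhs x1 \<alpha>1 integrable_on {t..s}" "rhs x2 \<alpha>1 integrable_on {t..s}" "rhs x2 \<alpha>2 integrable_on {t..s}"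
        using rhs_integrable(3)[OF cont1 t(1) \<alpha>(1), of t s] rhs_integrable(3)[OF cont2 t(1) \<alpha>(1), of t s]
          rhs_integrable(3)[OF cont2 t(1) \<alpha>(2), of t s] s t by auto
      have "x1 s - x2 s = (w1 0 - w2 0) + (integral {t..s} (rhs x1 \<alpha>1) - integral {t..s} (rhs x2 \<alpha>2))"
        using s1 s2 s t by (simp add: sol_def)
      also have "integral {t..s} (rhs x1 \<alpha>1) - integral {t..s} (rhs x2 \<alpha>2)
        = integral {t..s} (\<lambda>r. rhs x1 \<alpha>1 r - rhs x2 \<alpha>1 r) + integral {t..s} (\<lambda>r. rhs x2 \<alpha>1 r - rhs x2 \<alpha>2 r)"
        using i1 by (simp add: integral_diff)
      finally have "norm (x1 s - x2 s) \<le> norm (w1 0 - w2 0) + (norm (integral {t..s} (\<lambda>r. rhs x1 \<alpha>1 r - rhs x2 \<alpha>1 r))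
         + norm (integral {t..s} (\<lambda>r. rhs x2 \<alpha>1 r - rhs x2 \<alpha>2 r)))"
        by (smt (verit) norm_triangle_ineq)
      moreover have "norm (integral {t..s} (\<lambda>r. rhs x1 \<alpha>1 r - rhs x2 \<alpha>1 r)) \<le> integral {t..s} (\<lambda>r. norm (rhs x1 \<alpha>1 r - rhs x2 \<alpha>1 r))"
        using i1 n12 s by (intro integral_norm_bound_integral integrable_diff) (auto intro: integrable_on_subinterval)
      moreover have "integral {t..s} (\<lambda>r. norm (rhs x1 \<alpha>1 r - rhs x2 \<alpha>1 r)) = integral {t..s} ?\<rho>"
        by (rule integral_spike[of "{t, S}"]) (use s in auto)
      moreover have "norm (w1 0 - w2 0) \<le> \<delta>" using w[of 0] delay_pos by auto
      ultimately show ?thesis using eps[OF s] by linarith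
    qed
    show "lag x1 r \<le> r" if "r \<in> {t..S}" for r using lag_bounds(1)[of r t x1] that t by auto
    show "?\<rho> r \<le> c * \<delta> + c * (norm (x1 r - x2 r) + (if t \<le> lag x1 r then norm (x1 (lag x1 r) - x2 (lag x1 r)) else 0))"
      if rS: "r \<in> {t..S}" for r
    proof (cases "r \<in> {t<..<S}")
      case True
      have r: "r \<in> {t..T}" using rS t by auto
      have "\<alpha>1 r \<in> A" using True t \<alpha>(1) by (auto simp: controls_def)
      from rhs_diff[where \<alpha>=\<alpha>1 and ?x1.0=x1, OF K r t(1) this]
      have "norm (rhs x1 \<alpha>1 r - rhs x2 \<alpha>1 r) \<le> c * (norm (x1 r - x2 r) + norm (x1 (lag x1 r) - x2 (lag x1 r)))"
        by (simp add: c_def)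
      also have "\<dots> \<le> c * (norm (x1 r - x2 r) + (\<delta> + (if t \<le> lag x1 r then norm (x1 (lag x1 r) - x2 (lag x1 r)) else 0)))"
        using c d0 hist[of "lag x1 r"] lag_bounds[OF r t(1), of x1] by (intro mult_left_mono add_left_mono) auto
      finally show ?thesis using True by (simp add: algebra_simps)
    next
      case False
      have "0 \<le> c * (norm (x1 r - x2 r) + (if t \<le> lag x1 r then norm (x1 (lag x1 r) - x2 (lag x1 r)) else 0))"
        using c by (intro mult_nonneg_nonneg add_nonneg_nonneg) auto
      moreover have "0 \<le> c * \<delta>" using c d0 by simp
      ultimately show ?thesis unfolding if_not_P[OF False] by linarith
    qed
  qed auto
  note main = this
  have ex: "1 \<le> exp (4 * c * (T - t0))" using c t by simp
  have "norm (x1 s - x2 s) \<le> 2 * ((\<delta> + \<epsilon>) + c * (T - t0) * (\<delta> + \<epsilon>)) * exp (4 * c * (T - t0))"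
  proof (cases "s \<in> {t..S}")
    case True
    have "c * \<delta> * (S - t) \<le> c * (T - t0) * (\<delta> + \<epsilon>)"
    proof -
      have "c * \<delta> * (S - t) \<le> c * (\<delta> + \<epsilon>) * (T - t0)"
        using c d0 e0 t by (intro mult_mono mult_nonneg_nonneg) auto
      then show ?thesis by (simp add: mult_ac)
    qed
    moreover have "exp (4 * c * (s - t)) \<le> exp (4 * c * (T - t0))" using True t c by (auto intro!: mult_left_mono)
    moreover have "0 \<le> c * \<delta> * (S - t)" using c d0 t by simp
    ultimately have "2 * ((\<delta> + \<epsilon>) + c * \<delta> * (S - t)) * exp (4 * c * (s - t))
       \<le> 2 * ((\<delta> + \<epsilon>) + c * (T - t0) * (\<delta> + \<epsilon>)) * exp (4 * c * (T - t0))"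
      using d0 e0 by (intro mult_mono) auto
    with main[OF True] show ?thesis by linarith
  next
    case False
    then have "norm (x1 s - x2 s) \<le> \<delta>" using hist[of s] s by auto
    also have "\<dots> \<le> 2 * ((\<delta> + \<epsilon>) + c * (T - t0) * (\<delta> + \<epsilon>)) * 1"
      using d0 e0 c t by (auto intro!: mult_nonneg_nonneg add_nonneg_nonneg)
    also have "\<dots> \<le> 2 * ((\<delta> + \<epsilon>) + c * (T - t0) * (\<delta> + \<epsilon>)) * exp (4 * c * (T - t0))"
      using d0 e0 c t ex by (intro mult_left_mono mult_nonneg_nonneg add_nonneg_nonneg) auto
    finally show ?thesis .
  qed
  also have "\<dots> = 2 * (1 + c * (T - t0)) * exp (4 * c * (T - t0)) * (\<delta> + \<epsilon>)" by (simp add: algebra_simps)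
  finally show ?thesis by (simp add: c_def)
qed

lemma sol_unique:
  assumes "t0 \<le> t" "t < T" "sol t w \<alpha> x1" "sol t w \<alpha> x2" "\<alpha> \<in> controls A t T" "s \<in> {t - \<tau>bar..T}"
  shows "x1 s = x2 s"
proof -
  obtain K where "K-lipschitz_on {t - \<tau>bar..T} x2" using assms(4) by (auto simp: sol_def)
  from sol_diff_bound[OF assms(1) _ _ assms(3,4) this assms(5,5), of T 0 0 s] assms(2,6) show ?thesis by simp
qed

section \<open>Existence of trajectories by Picard iteration\<close>

text \<open>The value at the horizon of the majorant \<open>\<psi>\<close> in
  \<open>sol_exists\<close>. Starting from \<open>R + 1\<close> keeps \<open>\<psi>\<close> at least
  1, and then \<open>1 + 2 * \<psi> \<le> 3 * \<psi>\<close> turns the linear growth of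
  \<open>f\<close> into the rate \<open>3 * Cf\<close>.\<close>

definition sol_bound :: "real \<Rightarrow> real" where
  "sol_bound R = (R + 1) * exp (3 * Cf * (T - t0))"

definition sol_lip :: "real \<Rightarrow> real \<Rightarrow> real" where
  "sol_lip R Kw = max Kw (Cf * (1 + 2 * sol_bound R))"

text \<open>Evaluation at a state-dependent lag is Lipschitz in the curve only with a bound on
  Lipschitz constants, so Picard iteration runs in a class of curves with given history, majorant
  \<open>\<psi>\<close> and common constant \<open>K\<close>. In the sup norm weighted by
  \<open>exp (- c * (s - t))\<close> with \<open>c = 4 * c0\<close> it contracts by one
  half.\<close>

lemma sol_exists:
  assumes t: "t0 \<le> t" "t < T" and Kw: "Kw-lipschitz_on {-\<tau>bar..0} w"
    and R: "\<And>\<theta>. \<theta> \<in> {-\<tau>bar..0} \<Longrightarrow> norm (w \<theta>) \<le> R" and \<alpha>: "\<alpha> \<in> controls A t T"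
  shows "\<exists>x. sol t w \<alpha> x \<and> (\<forall>s\<in>{t - \<tau>bar..T}. norm (x s) \<le> sol_bound R) \<and> (sol_lip R Kw)-lipschitz_on {t - \<tau>bar..T} x"
proof -
  define R1 where "R1 = sol_bound R"
  define K where "K = sol_lip R Kw"
  have "norm (w 0) \<le> R" by (rule R) (use delay_pos in auto)
  then have R0: "R \<ge> 0" by (rule order_trans[OF norm_ge_zero])
  define \<psi> where "\<psi> s = (R + 1) * exp (3 * Cf * (s - t))" for s
  have psi_R: "R + 1 \<le> \<psi> s" if "t \<le> s" for s
  proof -
    have "(R + 1) * 1 \<le> (R + 1) * exp (3 * Cf * (s - t))" using that Cf(1) R0 by (intro mult_left_mono) auto
    then show ?thesis by (simp add: \<psi>_def)
  qed
  have psi_mono: "\<psi> s \<le> \<psi> s'" if "s \<le> s'" for s s'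
    using that Cf(1) R0 by (auto simp: \<psi>_def intro!: mult_left_mono)
  have psi_R1: "\<psi> s \<le> R1" if "s \<le> T" for s
    using that Cf(1) R0 t by (auto simp: \<psi>_def R1_def sol_bound_def intro!: mult_left_mono)
  have R1: "R1 \<ge> R" "R1 \<ge> 0" using psi_R[of T] psi_R1[of T] R0 t by auto
  have Kw0: "Kw \<ge> 0" using Kw lipschitz_on_nonneg by blast
  have K: "K \<ge> 0" "K \<ge> Kw" "K \<ge> Cf * (1 + 2 * R1)" using Kw0 by (auto simp: K_def sol_lip_def R1_def)
  define good where "good X \<longleftrightarrow> (\<forall>s\<in>{t - \<tau>bar..t}. X s = w (s - t)) \<and> (\<forall>s\<in>{t..T}. norm (X s) \<le> \<psi> s)
    \<and> K-lipschitz_on {t - \<tau>bar..T} X" for X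
  define \<Phi> where "\<Phi> X s = (if s \<le> t then w (s - t) else w 0 + integral {t..s} (rhs X \<alpha>))" for X s
  have Phi_int: "\<Phi> X s = w 0 + integral {t..s} (rhs X \<alpha>)" if "t \<le> s" for X s
    using that by (auto simp: \<Phi>_def)
  have hist_lip: "K-lipschitz_on {t - \<tau>bar..t} (\<lambda>s. w (s - t))"
  proof (rule lipschitz_onI[OF _ K(1)])
    fix s s' assume ss: "s \<in> {t - \<tau>bar..t}" "s' \<in> {t - \<tau>bar..t}"
    have "dist (w (s - t)) (w (s' - t)) \<le> Kw * dist (s - t) (s' - t)"
      by (rule lipschitz_onD[OF Kw]) (use ss in auto)
    also have "\<dots> \<le> K * dist s s'" using K(2) by (simp add: dist_real_def mult_right_mono)
    finally show "dist (w (s - t)) (w (s' - t)) \<le> K * dist s s'" .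
  qed
  have goodD: "norm (X (lag X r)) \<le> \<psi> r" "norm (rhs X \<alpha> r) \<le> Cf * (1 + \<psi> r + \<psi> r)"
    if X: "good X" and r: "r \<in> {t<..<T}" for X r
  proof -
    have r': "r \<in> {t..T}" using r by auto
    note lb = lag_bounds[OF r' t(1), of X]
    show 1: "norm (X (lag X r)) \<le> \<psi> r"
    proof (cases "lag X r \<le> t")
      case True
      then have "X (lag X r) = w (lag X r - t)" using X lb by (auto simp: good_def)
      then have "norm (X (lag X r)) \<le> R" using R[of "lag X r - t"] lb True by auto
      then show ?thesis using psi_R[of r] r by auto
    next
      case False
      then have "norm (X (lag X r)) \<le> \<psi> (lag X r)" using X lb by (auto simp: good_def)
      then show ?thesis using psi_mono[OF lb(1)] by linarith
    qed
    have "norm (rhs X \<alpha> r) \<le> Cf * (1 + norm (X r) + norm (X (lag X r)))"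
      unfolding rhs_def using Cf(2) r t \<alpha> by (auto simp: controls_def)
    also have "\<dots> \<le> Cf * (1 + \<psi> r + \<psi> r)"
      using X r' 1 Cf(1) by (intro mult_left_mono add_mono) (auto simp: good_def)
    finally show "norm (rhs X \<alpha> r) \<le> Cf * (1 + \<psi> r + \<psi> r)" .
  qed
  have good_cont: "continuous_on {t - \<tau>bar..T} X" if "good X" for X
    using that lipschitz_on_continuous_on by (auto simp: good_def)
  note good_int = rhs_integrable(3)[OF good_cont t(1) \<alpha>]
  \<comment> \<open>Both bounds reproduce themselves: the increment of \<open>\<psi>\<close> is the
    integral of \<open>3 * Cf * \<psi>\<close>, and \<open>\<psi> \<le> R1\<close> bounds the slope
    of the new curve by \<open>K\<close>.\<close>
  have good_Phi: "good (\<Phi> X)" if X: "good X" for X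
    unfolding good_def
  proof (intro conjI ballI)
    show "\<Phi> X s = w (s - t)" if "s \<in> {t - \<tau>bar..t}" for s using that by (auto simp: \<Phi>_def)
    show "norm (\<Phi> X s) \<le> \<psi> s" if s: "s \<in> {t..T}" for s
    proof -
      have I: "((\<lambda>r. 3 * Cf * ((R + 1) * exp (3 * Cf * (r - t)))) has_integral (\<psi> s - \<psi> t)) {t..s}"
        unfolding \<psi>_def
        by (rule fundamental_theorem_of_calculus)
          (use s in \<open>auto intro!: derivative_eq_intros simp flip: has_real_derivative_iff_has_vector_derivative\<close>)
      let ?h = "\<lambda>r. 3 * Cf * ((R + 1) * exp (3 * Cf * (r - t)))"
      have "norm (integral {t..s} (rhs X \<alpha>)) = norm (integral {t<..<s} (rhs X \<alpha>))"
        using integral_open_interval[of t s "rhs X \<alpha>"] by simp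
      also have "\<dots> \<le> integral {t<..<s} ?h"
      proof (rule integral_norm_bound_integral)
        show "rhs X \<alpha> integrable_on {t<..<s}"
          using good_int[OF X, of t s] s integrable_on_open_interval[of "rhs X \<alpha>" t s] by auto
        show "?h integrable_on {t<..<s}"
          using I integrable_on_open_interval[of ?h t s] by (auto simp: has_integral_iff)
        fix r assume r: "r \<in> {t<..<s}"
        then have "norm (rhs X \<alpha> r) \<le> Cf * (1 + \<psi> r + \<psi> r)" using goodD(2)[OF X, of r] s by auto
        also have "\<dots> \<le> Cf * (3 * \<psi> r)" using Cf(1) psi_R[of r] R0 r by (intro mult_left_mono) auto
        finally show "norm (rhs X \<alpha> r) \<le> ?h r" by (simp add: \<psi>_def mult_ac)
      qed
      also have "\<dots> = \<psi> s - \<psi> t"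
        using I integral_open_interval[of t s ?h] by (auto simp: has_integral_iff)
      finally have "norm (integral {t..s} (rhs X \<alpha>)) \<le> \<psi> s - (R + 1)" by (simp add: \<psi>_def)
      moreover have "norm (\<Phi> X s) \<le> norm (w 0) + norm (integral {t..s} (rhs X \<alpha>))"
        using Phi_int[of s X] s norm_triangle_ineq by auto
      ultimately show ?thesis using \<open>norm (w 0) \<le> R\<close> by linarith
    qed
    have "K-lipschitz_on {t - \<tau>bar..t} (\<Phi> X)"
      by (rule lipschitz_on_transform[OF hist_lip]) (auto simp: \<Phi>_def)
    moreover have "K-lipschitz_on {t..T} (\<Phi> X)"
    proof (rule lipschitz_onI[OF _ K(1)])
      have *: "dist (\<Phi> X s) (\<Phi> X s') \<le> K * (s' - s)" if "t \<le> s" "s \<le> s'" "s' \<le> T" for s s'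
      proof -
        have "\<Phi> X s' - \<Phi> X s = integral {s..s'} (rhs X \<alpha>)"
          using integral_diff_Icc[OF good_int[OF X, of t T], of s s'] that by (simp add: Phi_int)
        also have "norm \<dots> \<le> K * (s' - s)"
        proof (rule integral_lipschitz_bound)
          show "rhs X \<alpha> integrable_on {s..s'}" using good_int[OF X] that by auto
          fix r assume r: "r \<in> {s<..<s'}"
          then have "norm (rhs X \<alpha> r) \<le> Cf * (1 + \<psi> r + \<psi> r)" using goodD(2)[OF X, of r] that by auto
          also have "\<dots> \<le> Cf * (1 + 2 * R1)" using Cf(1) psi_R1[of r] r that by (intro mult_left_mono) auto
          finally show "norm (rhs X \<alpha> r) \<le> K" using K(3) by linarith
        qed (use that in auto)
        finally show ?thesis by (simp add: dist_norm norm_minus_commute)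
      qed
      fix s s' assume "s \<in> {t..T}" "s' \<in> {t..T}"
      then show "dist (\<Phi> X s) (\<Phi> X s') \<le> K * dist s s'"
        using *[of s s'] *[of s' s] by (cases "s \<le> s'") (auto simp: dist_commute dist_real_def)
    qed
    ultimately show "K-lipschitz_on {t - \<tau>bar..T} (\<Phi> X)"
      using lipschitz_on_concat[of K "t - \<tau>bar" t "\<Phi> X" T "\<Phi> X"] by simp
  qed
  \<comment> \<open>The iteration starts from the history continued by the constant
    \<open>w 0\<close>.\<close>
  define X where "X k = (\<Phi> ^^ k) (\<lambda>s. w (min 0 (s - t)))" for k
  have XS: "X (Suc k) = \<Phi> (X k)" for k by (simp add: X_def)
  have good0: "good (X 0)"
    unfolding good_def
  proof (intro conjI ballI)
    show "X 0 s = w (s - t)" if "s \<in> {t - \<tau>bar..t}" for s using that by (simp add: X_def)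
    show "norm (X 0 s) \<le> \<psi> s" if "s \<in> {t..T}" for s
      using that \<open>norm (w 0) \<le> R\<close> psi_R[of s] by (simp add: X_def)
    show "K-lipschitz_on {t - \<tau>bar..T} (X 0)"
    proof (rule lipschitz_onI[OF _ K(1)])
      fix s s' assume ss: "s \<in> {t - \<tau>bar..T}" "s' \<in> {t - \<tau>bar..T}"
      have "dist (w (min 0 (s - t))) (w (min 0 (s' - t))) \<le> Kw * dist (min 0 (s - t)) (min 0 (s' - t))"
        by (rule lipschitz_onD[OF Kw]) (use ss delay_pos in auto)
      also have "\<dots> \<le> K * dist s s'" using K Kw0 by (intro mult_mono) (auto simp: dist_real_def)
      finally show "dist (X 0 s) (X 0 s') \<le> K * dist s s'" by (simp add: X_def)
    qed
  qed
  have good: "good (X k)" for k by (induction k) (auto simp: good0 XS good_Phi)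
  have Klip: "K-lipschitz_on {t - \<tau>bar..T} (X k)" for k using good[of k] by (auto simp: good_def)
  define c0 where "c0 = lf * (1 + K * l\<tau>)"
  have c0: "c0 > 0" using K(1) l\<tau>(1) lf(1) unfolding c0_def by (intro mult_pos_pos add_pos_nonneg) auto
  define c where "c = 4 * c0"
  define M where "M k = 2 * R1 * (1/2) ^ k" for k :: nat
  have M0: "M k \<ge> 0" for k using R1 by (simp add: M_def)
  have hist_eq: "X k s = X l s" if "s \<in> {t - \<tau>bar..t}" for k l s
    using good[of k] good[of l] that by (auto simp: good_def)
  have Xb: "norm (X k s) \<le> R1" if s: "s \<in> {t..T}" for k s
  proof -
    have "norm (X k s) \<le> \<psi> s" using good[of k] s by (auto simp: good_def)
    then show ?thesis using psi_R1[of s] s by simp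
  qed
  have step: "norm (X (Suc k) s - X k s) \<le> M k * exp (c * (s - t))" if "s \<in> {t..T}" for k s
    using that
  proof (induction k arbitrary: s)
    case 0
    have "norm (X 1 s - X 0 s) \<le> norm (X 1 s) + norm (X 0 s)" by (rule norm_triangle_ineq4)
    also have "\<dots> \<le> R1 + R1" by (intro add_mono Xb 0)
    also have "\<dots> \<le> (2 * R1) * exp (c * (s - t))"
      using 0 c0 R1 mult_left_mono[of 1 "exp (c * (s - t))" "2 * R1"] by (auto simp: c_def)
    finally show ?case by (simp add: M_def)
  next
    case (Suc k)
    let ?h = "\<lambda>r. c / 2 * (M k * exp (c * (r - t)))"
    note I = integral_exp_le[OF M0[of k], of c t s]
    have "X (Suc (Suc k)) s - X (Suc k) s = integral {t..s} (rhs (X (Suc k)) \<alpha>) - integral {t..s} (rhs (X k) \<alpha>)"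
      using Suc.prems by (simp add: XS[of "Suc k"] XS[of k] Phi_int)
    also have "\<dots> = integral {t..s} (\<lambda>r. rhs (X (Suc k)) \<alpha> r - rhs (X k) \<alpha> r)"
      using good_int[OF good] Suc.prems by (subst integral_diff) auto
    also have "\<dots> = integral {t<..<s} (\<lambda>r. rhs (X (Suc k)) \<alpha> r - rhs (X k) \<alpha> r)"
      using integral_open_interval[of t s "\<lambda>r. rhs (X (Suc k)) \<alpha> r - rhs (X k) \<alpha> r"] by simp
    also have "norm \<dots> \<le> integral {t<..<s} ?h"
    proof (rule integral_norm_bound_integral)
      show "(\<lambda>r. rhs (X (Suc k)) \<alpha> r - rhs (X k) \<alpha> r) integrable_on {t<..<s}"
      proof -
        have "(\<lambda>r. rhs (X (Suc k)) \<alpha> r - rhs (X k) \<alpha> r) integrable_on {t..s}"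
          using Suc.prems by (intro integrable_diff good_int[OF good]) auto
        then show ?thesis using integrable_on_open_interval[of "\<lambda>r. rhs (X (Suc k)) \<alpha> r - rhs (X k) \<alpha> r" t s] by auto
      qed
      show "?h integrable_on {t<..<s}"
        using I(1) Suc.prems c0 integrable_on_open_interval[of ?h t s] by (auto simp: c_def)
      fix r assume r: "r \<in> {t<..<s}"
      then have r': "r \<in> {t..T}" and \<alpha>r: "\<alpha> r \<in> A" using Suc.prems \<alpha> by (auto simp: controls_def)
      let ?u = "lag (X (Suc k)) r"
      have "norm (rhs (X (Suc k)) \<alpha> r - rhs (X k) \<alpha> r) \<le> c0 * (norm (X (Suc k) r - X k r) + norm (X (Suc k) ?u - X k ?u))"
        using rhs_diff[where \<alpha>=\<alpha> and ?x1.0="X (Suc k)", OF Klip[of k] r' t(1) \<alpha>r] by (simp add: c0_def)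
      also have "\<dots> \<le> c0 * (M k * exp (c * (r - t)) + M k * exp (c * (r - t)))"
      proof (intro mult_left_mono add_mono)
        show "norm (X (Suc k) r - X k r) \<le> M k * exp (c * (r - t))" by (rule Suc.IH[OF r'])
        show "norm (X (Suc k) ?u - X k ?u) \<le> M k * exp (c * (r - t))"
        proof (cases "?u \<le> t")
          case True
          then have "X (Suc k) ?u = X k ?u" using lag_bounds[OF r' t(1), of "X (Suc k)"] by (intro hist_eq) auto
          then show ?thesis using M0[of k] by simp
        next
          case False
          then have "norm (X (Suc k) ?u - X k ?u) \<le> M k * exp (c * (?u - t))"
            using lag_bounds[OF r' t(1), of "X (Suc k)"] by (intro Suc.IH) auto
          also have "\<dots> \<le> M k * exp (c * (r - t))"
            using lag_bounds[OF r' t(1), of "X (Suc k)"] c0 M0[of k] by (intro mult_left_mono) (auto simp: c_def)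
          finally show ?thesis .
        qed
      qed (use c0 in auto)
      finally show "norm (rhs (X (Suc k)) \<alpha> r - rhs (X k) \<alpha> r) \<le> ?h r" by (simp add: c_def)
    qed
    also have "\<dots> = integral {t..s} ?h" using integral_open_interval[of t s ?h] by simp
    also have "\<dots> \<le> M k / 2 * exp (c * (s - t))" using I(2) c0 Suc.prems by (auto simp: c_def)
    finally show ?case by (simp add: M_def)
  qed
  define N where "N = 2 * R1 * exp (c * (T - t))"
  have N0: "N \<ge> 0" using R1 by (simp add: N_def)
  have step': "norm (X (Suc k) s - X k s) \<le> N * (1/2) ^ k" if s: "s \<in> {t - \<tau>bar..T}" for k s
  proof (cases "s \<le> t")
    case True
    then have "X (Suc k) s = X k s" using s by (intro hist_eq) auto
    then show ?thesis using N0 by simp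
  next
    case False
    then have "norm (X (Suc k) s - X k s) \<le> M k * exp (c * (s - t))" using s by (intro step) auto
    also have "\<dots> \<le> M k * exp (c * (T - t))" using s c0 M0[of k] by (intro mult_left_mono) (auto simp: c_def)
    also have "\<dots> = N * (1/2) ^ k" by (simp add: M_def N_def)
    finally show ?thesis .
  qed
  have tail: "norm (X (k + m) s - X k s) \<le> 2 * N * ((1/2) ^ k - (1/2) ^ (k + m))" if s: "s \<in> {t - \<tau>bar..T}" for k m s
  proof (induction m)
    case (Suc m)
    have "norm (X (k + Suc m) s - X k s) \<le> norm (X (k + m) s - X k s) + norm (X (Suc (k + m)) s - X (k + m) s)"
      using norm_triangle_ineq[of "X (k + m) s - X k s" "X (Suc (k + m)) s - X (k + m) s"] by simp
    also have "\<dots> \<le> 2 * N * ((1/2) ^ k - (1/2) ^ (k + m)) + N * (1/2) ^ (k + m)"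
      using Suc step'[OF s, of "k + m"] by linarith
    also have "\<dots> = 2 * N * ((1/2) ^ k - (1/2) ^ (k + Suc m))" by (simp add: algebra_simps)
    finally show ?case .
  qed simp
  have tail': "norm (X m s - X k s) \<le> 2 * N * (1/2) ^ k" if s: "s \<in> {t - \<tau>bar..T}" and "k \<le> m" for k m s
  proof -
    have "norm (X (k + (m - k)) s - X k s) \<le> 2 * N * ((1/2) ^ k - (1/2) ^ (k + (m - k)))" by (rule tail[OF s])
    also have "\<dots> \<le> 2 * N * (1/2) ^ k" using N0 by (intro mult_left_mono) auto
    finally show ?thesis using that by simp
  qed
  have geo: "(\<lambda>k. B * (1/2) ^ k) \<longlonglongrightarrow> 0" for B :: real
    by (intro tendsto_mult_right_zero LIMSEQ_power_zero) simp
  have conv: "convergent (\<lambda>k. X k s)" if s: "s \<in> {t - \<tau>bar..T}" for s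
    unfolding Cauchy_convergent_iff[symmetric]
  proof (rule metric_CauchyI)
    fix e :: real assume "e > 0"
    then have "\<forall>\<^sub>F k in sequentially. 4 * N * (1/2) ^ k < e" using order_tendstoD(2)[OF geo] by blast
    then obtain k where k: "4 * N * (1/2) ^ k < e" by (auto simp: eventually_sequentially)
    show "\<exists>k. \<forall>m\<ge>k. \<forall>n\<ge>k. dist (X m s) (X n s) < e"
    proof (intro exI[of _ k] allI impI)
      fix m n assume "k \<le> m" "k \<le> n"
      then have "dist (X m s) (X k s) \<le> 2 * N * (1/2) ^ k" "dist (X n s) (X k s) \<le> 2 * N * (1/2) ^ k"
        using tail'[OF s] by (auto simp: dist_norm)
      then show "dist (X m s) (X n s) < e" using dist_triangle2[of "X m s" "X n s" "X k s"] k by linarith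
    qed
  qed
  define x where "x s = lim (\<lambda>k. X k s)" for s
  have lim: "(\<lambda>k. X k s) \<longlonglongrightarrow> x s" if "s \<in> {t - \<tau>bar..T}" for s
    using conv[OF that] by (simp add: x_def convergent_LIMSEQ_iff)
  have lim_bound: "norm (x s - X k s) \<le> 2 * N * (1/2) ^ k" if s: "s \<in> {t - \<tau>bar..T}" for s k
    by (rule Lim_bounded[OF tendsto_norm[OF tendsto_diff[OF lim[OF s] tendsto_const]], of k]) (use tail'[OF s] in auto)
  have xlip: "K-lipschitz_on {t - \<tau>bar..T} x"
  proof (rule lipschitz_onI[OF _ K(1)])
    fix s s' assume ss: "s \<in> {t - \<tau>bar..T}" "s' \<in> {t - \<tau>bar..T}"
    show "dist (x s) (x s') \<le> K * dist s s'"
      by (rule Lim_bounded[OF tendsto_dist[OF lim[OF ss(1)] lim[OF ss(2)]], of 0]) (use lipschitz_onD[OF Klip ss] in auto)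
  qed
  have Xbound: "norm (X k s) \<le> R1" if s: "s \<in> {t - \<tau>bar..T}" for k s
  proof (cases "s \<le> t")
    case True
    then have "X k s = w (s - t)" using s good[of k] by (auto simp: good_def)
    then show ?thesis using R[of "s - t"] R1 s True by auto
  next
    case False
    then show ?thesis using s by (intro Xb) auto
  qed
  have xbound: "norm (x s) \<le> R1" if s: "s \<in> {t - \<tau>bar..T}" for s
    by (rule Lim_bounded[OF tendsto_norm[OF lim[OF s]], of 0]) (use Xbound[OF s] in auto)
  have xhist: "x s = w (s - t)" if s: "s \<in> {t - \<tau>bar..t}" for s
  proof -
    have "(\<lambda>k. X k s) = (\<lambda>k. w (s - t))" using good s by (auto simp: good_def)
    moreover have "(\<lambda>k. X k s) \<longlonglongrightarrow> x s" by (rule lim) (use s t in auto)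
    ultimately show ?thesis using LIMSEQ_unique tendsto_const by metis
  qed
  have xcont: "continuous_on {t - \<tau>bar..T} x" using xlip by (rule lipschitz_on_continuous_on)
  have xeq: "x s = w 0 + integral {t..s} (rhs x \<alpha>)" if s: "s \<in> {t..T}" for s
  proof -
    have "norm (integral {t..s} (rhs (X k) \<alpha>) - integral {t..s} (rhs x \<alpha>)) \<le> 4 * c0 * N * (T - t0) * (1/2) ^ k" for k
    proof -
      have "integral {t..s} (rhs (X k) \<alpha>) - integral {t..s} (rhs x \<alpha>) = integral {t..s} (\<lambda>r. rhs (X k) \<alpha> r - rhs x \<alpha> r)"
        using good_int[OF good] rhs_integrable(3)[OF xcont t(1) \<alpha>] s by (subst integral_diff) auto
      also have "norm \<dots> \<le> (4 * c0 * N * (1/2) ^ k) * (s - t)"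
      proof (rule integral_lipschitz_bound)
        show "(\<lambda>r. rhs (X k) \<alpha> r - rhs x \<alpha> r) integrable_on {t..s}"
          using good_int[OF good] rhs_integrable(3)[OF xcont t(1) \<alpha>] s by (intro integrable_diff) auto
        fix r assume r: "r \<in> {t<..<s}"
        then have r': "r \<in> {t..T}" and \<alpha>r: "\<alpha> r \<in> A" using s \<alpha> by (auto simp: controls_def)
        have "norm (rhs (X k) \<alpha> r - rhs x \<alpha> r) \<le> c0 * (norm (X k r - x r) + norm (X k (lag (X k) r) - x (lag (X k) r)))"
          using rhs_diff[where \<alpha>=\<alpha> and ?x1.0="X k", OF xlip r' t(1) \<alpha>r] by (simp add: c0_def)
        also have "\<dots> \<le> c0 * (2 * N * (1/2) ^ k + 2 * N * (1/2) ^ k)"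
          using lim_bound[of r k] lim_bound[OF lag_bounds(4)[OF r' t(1), of "X k"], of k] r' delay_pos c0
          by (intro mult_left_mono add_mono) (auto simp: norm_minus_commute)
        finally show "norm (rhs (X k) \<alpha> r - rhs x \<alpha> r) \<le> 4 * c0 * N * (1/2) ^ k" by simp
      qed (use s in auto)
      also have "\<dots> \<le> (4 * c0 * N * (1/2) ^ k) * (T - t0)" using s t c0 N0 by (intro mult_left_mono) auto
      finally show ?thesis by (simp only: mult_ac)
    qed
    then have "(\<lambda>k. integral {t..s} (rhs (X k) \<alpha>) - integral {t..s} (rhs x \<alpha>)) \<longlonglongrightarrow> 0"
      by (intro Lim_null_comparison[OF _ geo]) (auto intro: always_eventually)
    then have "(\<lambda>k. integral {t..s} (rhs (X k) \<alpha>)) \<longlonglongrightarrow> integral {t..s} (rhs x \<alpha>)" by (rule LIM_zero_cancel)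
    then have "(\<lambda>k. w 0 + integral {t..s} (rhs (X k) \<alpha>)) \<longlonglongrightarrow> w 0 + integral {t..s} (rhs x \<alpha>)" by (intro tendsto_intros)
    then have "(\<lambda>k. X (Suc k) s) \<longlonglongrightarrow> w 0 + integral {t..s} (rhs x \<alpha>)" using s by (simp add: XS Phi_int)
    moreover have "(\<lambda>k. X (Suc k) s) \<longlonglongrightarrow> x s" using lim[of s] s delay_pos by (auto intro: LIMSEQ_Suc)
    ultimately show ?thesis using LIMSEQ_unique by blast
  qed
  have "sol t w \<alpha> x"
    unfolding sol_def using xlip xeq xhist by auto
  then show ?thesis using xbound xlip by (auto simp: R1_def K_def)
qed

text \<open>The description operator in \<open>trajectory\<close> asks for a unique total function;
  restricting the solution to its interval supplies the extensional representative, and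
  \<open>sol_unique\<close> its uniqueness.\<close>

lemma trajectory_sol:
  assumes t: "t0 \<le> t" "t < T" and Kw: "Kw-lipschitz_on {-\<tau>bar..0} w"
    and R: "\<And>\<theta>. \<theta> \<in> {-\<tau>bar..0} \<Longrightarrow> norm (w \<theta>) \<le> R" and \<alpha>: "\<alpha> \<in> controls A t T"
  shows "sol t w \<alpha> (trajectory f \<tau> \<tau>bar T t w \<alpha>)"
    "\<And>s. s \<in> {t - \<tau>bar..T} \<Longrightarrow> norm (trajectory f \<tau> \<tau>bar T t w \<alpha> s) \<le> sol_bound R"
    "(sol_lip R Kw)-lipschitz_on {t - \<tau>bar..T} (trajectory f \<tau> \<tau>bar T t w \<alpha>)"
proof -
  obtain x where x: "sol t w \<alpha> x" "\<And>s. s \<in> {t - \<tau>bar..T} \<Longrightarrow> norm (x s) \<le> sol_bound R"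
      "(sol_lip R Kw)-lipschitz_on {t - \<tau>bar..T} x"
    using sol_exists[OF assms] by blast
  define x' where "x' = restrict x {t - \<tau>bar..T}"
  have x': "x' s = x s" if "s \<in> {t - \<tau>bar..T}" for s using that by (simp add: x'_def)
  have s': "sol t w \<alpha> x'" using x(1) sol_cong[of t x x'] x' t by simp
  have "trajectory f \<tau> \<tau>bar T t w \<alpha> = x'"
    unfolding trajectory_def is_trajectory_iff_sol[OF t \<alpha>]
  proof (rule the_equality)
    show "x' \<in> extensional {t - \<tau>bar..T} \<and> sol t w \<alpha> x'" using s' by (simp add: x'_def)
    fix y assume y: "y \<in> extensional {t - \<tau>bar..T} \<and> sol t w \<alpha> y"
    show "y = x'"
    proof (rule extensionalityI[of _ "{t - \<tau>bar..T}"])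
      show "y s = x' s" if "s \<in> {t - \<tau>bar..T}" for s using sol_unique[OF t _ s' \<alpha> that] y by blast
    qed (use y in \<open>auto simp: x'_def\<close>)
  qed
  then show "sol t w \<alpha> (trajectory f \<tau> \<tau>bar T t w \<alpha>)"
    "\<And>s. s \<in> {t - \<tau>bar..T} \<Longrightarrow> norm (trajectory f \<tau> \<tau>bar T t w \<alpha> s) \<le> sol_bound R"
    "(sol_lip R Kw)-lipschitz_on {t - \<tau>bar..T} (trajectory f \<tau> \<tau>bar T t w \<alpha>)"
    using s' x x' by (auto intro: lipschitz_on_transform)
qed

end

subsection \<open>Control dependence of the dynamics\<close>

text \<open>If \<open>X\<close> were nonzero, the choice \<open>k = (- c - 1) / X\<close> would give
  the value -1.\<close>

lemma affine_nonneg_imp_zero: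
  fixes X c :: real
  assumes "\<And>k. k * X + c \<ge> 0"
  shows "X = 0"
proof (rule ccontr)
  assume "X \<noteq> 0"
  with assms[of "(- c - 1) / X"] show False by simp
qed

text \<open>All constants belong to one radius \<open>R0\<close> for histories; trajectories then
  stay below \<open>sol_bound R0\<close>, and the local Lipschitz constants are taken at that
  radius. \<open>lag_expanding\<close> is the monotone-delay condition in integrated form, with one
  \<open>d\<close> for all admissible histories and controls.\<close>

locale delay_control = delay_ode t0 T \<tau>bar A f \<tau> lf Cf l\<tau>
  for t0 T \<tau>bar :: real and A :: "(real^'m) set"
    and f :: "real \<times> (real^'n) \<times> (real^'n) \<times> (real^'m) \<Rightarrow> real^'n"
    and \<tau> :: "real \<times> (real^'n) \<Rightarrow> real" and lf Cf l\<tau> :: real +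
  fixes L :: "real \<times> (real^'n) \<times> (real^'n) \<times> (real^'m) \<Rightarrow> real"
    and g :: "(real^'n) \<times> (real \<Rightarrow> real^'n) \<Rightarrow> real"
    and Ha :: "real \<times> (real^'n) \<times> (real^'n) \<times> (real^'n) \<times> (real^'m) \<Rightarrow> real^'m"
    and R0 d lt lft lL lg \<mu> lH :: real
  assumes L_cont: "continuous_on ({t0..T} \<times> UNIV \<times> UNIV \<times> A) L"
    and R0: "R0 > 0"
    and lL: "lL > 0" "\<And>t z y z' y' a. t \<in> {t0..T} \<Longrightarrow> a \<in> A \<Longrightarrow> norm z \<le> sol_bound R0 \<Longrightarrow> norm y \<le> sol_bound R0
      \<Longrightarrow> norm z' \<le> sol_bound R0 \<Longrightarrow> norm y' \<le> sol_bound R0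
      \<Longrightarrow> \<bar>L (t, z, y, a) - L (t, z', y', a)\<bar> \<le> lL * (norm (z - z') + norm (y - y'))"
    and lg: "lg > 0" "\<And>w1 w2 k1 k2. k1-lipschitz_on {-\<tau>bar..0} w1 \<Longrightarrow> k2-lipschitz_on {-\<tau>bar..0} w2
      \<Longrightarrow> (\<And>\<theta>. \<theta> \<in> {-\<tau>bar..0} \<Longrightarrow> norm (w1 \<theta>) \<le> sol_bound R0)
      \<Longrightarrow> (\<And>\<theta>. \<theta> \<in> {-\<tau>bar..0} \<Longrightarrow> norm (w2 \<theta>) \<le> sol_bound R0)
      \<Longrightarrow> \<bar>g (w1 0, w1) - g (w2 0, w2)\<bar> \<le> lg * (norm (w1 0 - w2 0) + integral {-\<tau>bar..0} (\<lambda>\<theta>. norm (w1 \<theta> - w2 \<theta>)))"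
    and lag_expanding: "d > 0" "\<And>t w \<alpha> s s'. t0 \<le> t \<Longrightarrow> t < T \<Longrightarrow> R0-lipschitz_on {-\<tau>bar..0} w
      \<Longrightarrow> (\<And>\<theta>. \<theta> \<in> {-\<tau>bar..0} \<Longrightarrow> norm (w \<theta>) \<le> R0) \<Longrightarrow> \<alpha> \<in> controls A t T
      \<Longrightarrow> t \<le> s \<Longrightarrow> s \<le> s' \<Longrightarrow> s' \<le> T
      \<Longrightarrow> d * (s' - s) \<le> lag (trajectory f \<tau> \<tau>bar T t w \<alpha>) s' - lag (trajectory f \<tau> \<tau>bar T t w \<alpha>) s"
    and lt: "lt \<ge> 0" "\<And>s s' z. s \<in> {t0..T} \<Longrightarrow> s' \<in> {t0..T} \<Longrightarrow> norm z \<le> sol_bound R0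
      \<Longrightarrow> \<bar>\<tau> (s, z) - \<tau> (s', z)\<bar> \<le> lt * \<bar>s - s'\<bar>"
    and lft: "lft \<ge> 0" "\<And>s s' z y a. s \<in> {t0..T} \<Longrightarrow> s' \<in> {t0..T} \<Longrightarrow> norm z \<le> sol_bound R0 \<Longrightarrow> norm y \<le> sol_bound R0
      \<Longrightarrow> a \<in> A \<Longrightarrow> norm (f (s, z, y, a) - f (s', z, y, a)) \<le> lft * \<bar>s - s'\<bar>"
    and Ha: "\<And>t z y p a. t \<in> {t0..T} \<Longrightarrow> a \<in> A \<Longrightarrow>
      ((\<lambda>b. f (t, z, y, b) \<bullet> p + L (t, z, y, b)) has_derivative (\<lambda>v. Ha (t, z, y, p, a) \<bullet> v)) (at a within A)"
    and \<mu>: "\<mu> > 0" "\<And>t z y p a1 a2. t \<in> {t0..T} \<Longrightarrow> a1 \<in> A \<Longrightarrow> a2 \<in> A \<Longrightarrow>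
      \<mu> * (norm (a1 - a2))\<^sup>2 \<le> (Ha (t, z, y, p, a1) - Ha (t, z, y, p, a2)) \<bullet> (a1 - a2)"
    and lH: "lH > 0" "\<And>t1 t2 z1 z2 y1 y2 p1 p2 a. t1 \<in> {t0..T} \<Longrightarrow> t2 \<in> {t0..T} \<Longrightarrow> a \<in> A \<Longrightarrow>
      norm (Ha (t1, z1, y1, p1, a) - Ha (t2, z2, y2, p2, a))
        \<le> lH * (\<bar>t1 - t2\<bar> + norm (z1 - z2) + norm (y1 - y2) + norm (p1 - p2))"
begin

text \<open>Strong monotonicity of the gradient in the control gives strong convexity. Along the
  segment from \<open>b\<close> to \<open>a\<close>, the tangent at \<open>b\<close> and
  \<open>\<mu> / 2\<close> times the squared distance are subtracted from the Hamiltonian; the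
  derivative of the remainder is nonnegative at intermediate points, and the mean value theorem
  concludes.\<close>

lemma hamiltonian_gradient_inequality:
  assumes t: "t \<in> {t0..T}" and ab: "a \<in> A" "b \<in> A"
  shows "f (t, z, y, b) \<bullet> p + L (t, z, y, b) + Ha (t, z, y, p, b) \<bullet> (a - b) + \<mu> / 2 * (norm (a - b))\<^sup>2
    \<le> f (t, z, y, a) \<bullet> p + L (t, z, y, a)"
    and "((\<lambda>s. f (t, z, y, b + s *\<^sub>R (a - b)) \<bullet> p + L (t, z, y, b + s *\<^sub>R (a - b)))
      has_real_derivative Ha (t, z, y, p, b) \<bullet> (a - b)) (at 0 within {0..1})"
proof -
  define c where "c s = b + s *\<^sub>R (a - b)" for s :: real
  have cA: "c s \<in> A" if "s \<in> {0..1}" for s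
    using A(3)[unfolded convex_alt, rule_format, OF ab(2,1), of s] that by (simp add: c_def algebra_simps)
  define h where "h s = f (t, z, y, c s) \<bullet> p + L (t, z, y, c s)" for s
  have der: "(h has_real_derivative Ha (t, z, y, p, c s) \<bullet> (a - b)) (at s within {0..1})" if s: "s \<in> {0..1}" for s
  proof -
    have "(c has_derivative (\<lambda>k. k *\<^sub>R (a - b))) (at s within {0..1})"
      unfolding c_def by (auto intro!: derivative_eq_intros)
    moreover have "((\<lambda>b. f (t, z, y, b) \<bullet> p + L (t, z, y, b)) has_derivative (\<lambda>v. Ha (t, z, y, p, c s) \<bullet> v)) (at (c s) within c ` {0..1})"
      by (rule has_derivative_subset[OF Ha[OF t cA[OF s]]]) (use cA in auto)
    ultimately have "((\<lambda>s. f (t, z, y, c s) \<bullet> p + L (t, z, y, c s)) has_derivative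
        (\<lambda>k. Ha (t, z, y, p, c s) \<bullet> (k *\<^sub>R (a - b)))) (at s within {0..1})"
      using has_derivative_in_compose[of c _ s "{0..1}"] by fastforce
    then show ?thesis
      unfolding h_def has_field_derivative_def by (simp add: mult.commute[of _ "_ \<bullet> _"])
  qed
  show "((\<lambda>s. f (t, z, y, b + s *\<^sub>R (a - b)) \<bullet> p + L (t, z, y, b + s *\<^sub>R (a - b)))
      has_real_derivative Ha (t, z, y, p, b) \<bullet> (a - b)) (at 0 within {0..1})"
    using der[of 0] unfolding h_def[abs_def] c_def by simp
  define q where "q s = h s - s * (Ha (t, z, y, p, b) \<bullet> (a - b)) - \<mu> / 2 * s\<^sup>2 * (norm (a - b))\<^sup>2" for s
  have qd: "(q has_derivative (\<lambda>k. k * (Ha (t, z, y, p, c s) \<bullet> (a - b) - Ha (t, z, y, p, b) \<bullet> (a - b) - \<mu> * s * (norm (a - b))\<^sup>2)))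
      (at s within {0..1})" if s: "0 \<le> s" "s \<le> 1" for s
  proof -
    have "(q has_real_derivative Ha (t, z, y, p, c s) \<bullet> (a - b) - Ha (t, z, y, p, b) \<bullet> (a - b) - \<mu> * s * (norm (a - b))\<^sup>2) (at s within {0..1})"
      unfolding q_def[abs_def] using s by (auto intro!: derivative_eq_intros der)
    then show ?thesis by (simp add: has_field_derivative_def mult_commute_abs)
  qed
  obtain s :: real where s: "s \<in> {0<..<1}"
    and qs: "q 1 - q 0 = (1 - 0) * (Ha (t, z, y, p, c s) \<bullet> (a - b) - Ha (t, z, y, p, b) \<bullet> (a - b) - \<mu> * s * (norm (a - b))\<^sup>2)"
    using mvt_simple[OF _ qd] by (metis zero_less_one)
  have "0 \<le> Ha (t, z, y, p, c s) \<bullet> (a - b) - Ha (t, z, y, p, b) \<bullet> (a - b) - \<mu> * s * (norm (a - b))\<^sup>2"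
  proof -
    have "\<mu> * (norm (c s - b))\<^sup>2 \<le> (Ha (t, z, y, p, c s) - Ha (t, z, y, p, b)) \<bullet> (c s - b)"
      by (rule \<mu>(2)[OF t cA ab(2)]) (use s in auto)
    then have "s * (\<mu> * s * (norm (a - b))\<^sup>2) \<le> s * ((Ha (t, z, y, p, c s) - Ha (t, z, y, p, b)) \<bullet> (a - b))"
      by (simp add: c_def power_mult_distrib power2_eq_square mult_ac)
    then show ?thesis using s by (simp add: inner_diff_left)
  qed
  then have "q 0 \<le> q 1" using qs by simp
  then show "f (t, z, y, b) \<bullet> p + L (t, z, y, b) + Ha (t, z, y, p, b) \<bullet> (a - b) + \<mu> / 2 * (norm (a - b))\<^sup>2
    \<le> f (t, z, y, a) \<bullet> p + L (t, z, y, a)"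
    by (simp add: q_def h_def c_def)
qed

text \<open>The monotonicity and Lipschitz constants of \<open>Ha\<close> do not depend on \<open>p\<close>. Replacing \<open>p\<close> by
  \<open>k p\<close> and letting \<open>k\<close> tend to both infinities forces \<open>f\<close> to be affine in the control, with a
  linear part independent of time and state.\<close>

lemma Ha_scale:
  assumes t: "t \<in> {t0..T}" and ab: "a \<in> A" "b \<in> A"
  shows "Ha (t, z, y, k *\<^sub>R p, b) \<bullet> (a - b)
    = k * ((Ha (t, z, y, p, b) - Ha (t, z, y, 0, b)) \<bullet> (a - b)) + Ha (t, z, y, 0, b) \<bullet> (a - b)"
proof -
  define h where "h p s = f (t, z, y, b + s *\<^sub>R (a - b)) \<bullet> p + L (t, z, y, b + s *\<^sub>R (a - b))" for p s
  have D: "(h p has_real_derivative Ha (t, z, y, p, b) \<bullet> (a - b)) (at 0 within {0..1})" for p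
    unfolding h_def by (rule hamiltonian_gradient_inequality(2)[OF assms])
  have "((\<lambda>s. k * (h p s - h 0 s) + h 0 s) has_real_derivative
      k * (Ha (t, z, y, p, b) \<bullet> (a - b) - Ha (t, z, y, 0, b) \<bullet> (a - b)) + Ha (t, z, y, 0, b) \<bullet> (a - b)) (at 0 within {0..1})"
    by (intro DERIV_add DERIV_cmult DERIV_diff D)
  \<comment> \<open>The Hamiltonian is affine in \<open>p\<close>, so both formulas are one-sided
    derivatives at 0 of one function and therefore agree.\<close>
  moreover have "(\<lambda>s. k * (h p s - h 0 s) + h 0 s) = h (k *\<^sub>R p)" by (simp add: h_def fun_eq_iff)
  ultimately have "(h (k *\<^sub>R p) has_vector_derivative
      k * (Ha (t, z, y, p, b) \<bullet> (a - b) - Ha (t, z, y, 0, b) \<bullet> (a - b)) + Ha (t, z, y, 0, b) \<bullet> (a - b)) (at 0 within {0..1})"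
    by (simp add: has_real_derivative_iff_has_vector_derivative)
  moreover have "(h (k *\<^sub>R p) has_vector_derivative Ha (t, z, y, k *\<^sub>R p, b) \<bullet> (a - b)) (at 0 within {0..1})"
    using D by (simp add: has_real_derivative_iff_has_vector_derivative)
  moreover have "at (0::real) within {0..1} \<noteq> bot" by (simp add: at_within_Icc_at_right)
  ultimately show ?thesis using vector_derivative_unique_within by (fastforce simp: inner_diff_left)
qed

text \<open>Two applications of \<open>affine_nonneg_imp_zero\<close> in the scale \<open>k\<close>
  of \<open>p\<close>. The gradient inequality gives an affine function of \<open>k\<close> that is
  nonnegative for all \<open>k\<close>, so its slope vanishes; this identifies the difference of
  \<open>f\<close> with a difference of \<open>Ha\<close> at the same state. The Lipschitz bound on
  \<open>Ha\<close>, in which equal momenta cancel, then moves the base point to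
  \<open>(t0, 0, 0)\<close>.\<close>

lemma f_control_difference:
  assumes t: "t \<in> {t0..T}" and ab: "a \<in> A" "b \<in> A"
  shows "(f (t, z, y, a) - f (t, z, y, b)) \<bullet> p = (Ha (t0, 0, 0, p, b) - Ha (t0, 0, 0, 0, b)) \<bullet> (a - b)"
    and "norm (f (t, z, y, a) - f (t, z, y, b)) \<le> lH * norm (a - b)"
proof -
  have t0: "t0 \<in> {t0..T}" using time by simp
  have 1: "(f (t, z, y, a) - f (t, z, y, b)) \<bullet> p = (Ha (t, z, y, p, b) - Ha (t, z, y, 0, b)) \<bullet> (a - b)" for p
  proof -
    have "(f (t, z, y, a) - f (t, z, y, b)) \<bullet> p - (Ha (t, z, y, p, b) - Ha (t, z, y, 0, b)) \<bullet> (a - b) = 0"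
    proof (rule affine_nonneg_imp_zero)
      fix k
      have "f (t, z, y, b) \<bullet> (k *\<^sub>R p) + L (t, z, y, b) + Ha (t, z, y, k *\<^sub>R p, b) \<bullet> (a - b)
        \<le> f (t, z, y, a) \<bullet> (k *\<^sub>R p) + L (t, z, y, a)"
        using hamiltonian_gradient_inequality(1)[OF t ab, of z y "k *\<^sub>R p"] \<mu>(1) by (smt (verit) mult_nonneg_nonneg zero_le_power2 divide_nonneg_pos)
      then show "0 \<le> k * ((f (t, z, y, a) - f (t, z, y, b)) \<bullet> p - (Ha (t, z, y, p, b) - Ha (t, z, y, 0, b)) \<bullet> (a - b))
        + (L (t, z, y, a) - L (t, z, y, b) - Ha (t, z, y, 0, b) \<bullet> (a - b))"
        unfolding Ha_scale[OF t ab] by (simp add: algebra_simps inner_diff_left)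
    qed
    then show ?thesis by simp
  qed
  have "(Ha (t, z, y, p, b) - Ha (t, z, y, 0, b)) \<bullet> (a - b) - (Ha (t0, 0, 0, p, b) - Ha (t0, 0, 0, 0, b)) \<bullet> (a - b) = 0"
  proof (rule affine_nonneg_imp_zero)
    fix k
    \<comment> \<open>Both gradients carry the same momentum, so this bound does not grow with
      \<open>k\<close>.\<close>
    define B where "B = lH * (\<bar>t - t0\<bar> + norm (z - 0) + norm (y - 0) + norm ((k *\<^sub>R p) - (k *\<^sub>R p))) * norm (a - b)"
    have "\<bar>(Ha (t, z, y, k *\<^sub>R p, b) - Ha (t0, 0, 0, k *\<^sub>R p, b)) \<bullet> (a - b)\<bar>
      \<le> norm (Ha (t, z, y, k *\<^sub>R p, b) - Ha (t0, 0, 0, k *\<^sub>R p, b)) * norm (a - b)"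
      by (rule Cauchy_Schwarz_ineq2)
    also have "\<dots> \<le> B" unfolding B_def by (intro mult_right_mono lH(2) t t0 ab) auto
    finally have "- B \<le> Ha (t, z, y, k *\<^sub>R p, b) \<bullet> (a - b) - Ha (t0, 0, 0, k *\<^sub>R p, b) \<bullet> (a - b)"
      by (simp add: inner_diff_left abs_le_iff)
    then have "0 \<le> k * ((Ha (t, z, y, p, b) - Ha (t, z, y, 0, b)) \<bullet> (a - b) - (Ha (t0, 0, 0, p, b) - Ha (t0, 0, 0, 0, b)) \<bullet> (a - b))
      + (B + Ha (t, z, y, 0, b) \<bullet> (a - b) - Ha (t0, 0, 0, 0, b) \<bullet> (a - b))"
      unfolding Ha_scale[OF t ab] Ha_scale[OF t0 ab] by (simp add: algebra_simps)
    then show "0 \<le> k * ((Ha (t, z, y, p, b) - Ha (t, z, y, 0, b)) \<bullet> (a - b) - (Ha (t0, 0, 0, p, b) - Ha (t0, 0, 0, 0, b)) \<bullet> (a - b))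
      + (lH * (\<bar>t - t0\<bar> + norm z + norm y) * norm (a - b) + Ha (t, z, y, 0, b) \<bullet> (a - b) - Ha (t0, 0, 0, 0, b) \<bullet> (a - b))"
      by (simp add: B_def)
  qed
  then show "(f (t, z, y, a) - f (t, z, y, b)) \<bullet> p = (Ha (t0, 0, 0, p, b) - Ha (t0, 0, 0, 0, b)) \<bullet> (a - b)"
    using 1[of p] by simp
  \<comment> \<open>Taking the difference itself as momentum makes the left side a square, and one
    factor cancels.\<close>
  define F where "F = f (t, z, y, a) - f (t, z, y, b)"
  have "(norm F)\<^sup>2 = (Ha (t, z, y, F, b) - Ha (t, z, y, 0, b)) \<bullet> (a - b)"
    using 1[of F] by (simp add: F_def power2_norm_eq_inner)
  also have "\<dots> \<le> norm (Ha (t, z, y, F, b) - Ha (t, z, y, 0, b)) * norm (a - b)" by (rule norm_cauchy_schwarz)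
  also have "\<dots> \<le> lH * (\<bar>t - t\<bar> + norm (z - z) + norm (y - y) + norm (F - 0)) * norm (a - b)"
    by (intro mult_right_mono lH(2) t ab) auto
  finally have "norm F * norm F \<le> norm F * (lH * norm (a - b))" by (simp add: power2_eq_square mult_ac)
  then have "norm F \<le> lH * norm (a - b)" using lH(1) by (cases "F = 0") auto
  then show "norm (f (t, z, y, a) - f (t, z, y, b)) \<le> lH * norm (a - b)" by (simp add: F_def)
qed

section \<open>Trajectories and cost for admissible histories\<close>

definition hist_ok :: "(real \<Rightarrow> real^'n) \<Rightarrow> bool" where
  "hist_ok w \<longleftrightarrow> R0-lipschitz_on {-\<tau>bar..0} w \<and> (\<forall>\<theta>\<in>{-\<tau>bar..0}. norm (w \<theta>) \<le> R0)"

definition K :: real where "K = sol_lip R0 R0"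

abbreviation tr where "tr \<equiv> trajectory f \<tau> \<tau>bar T"

lemma K_nonneg: "K \<ge> 0" using R0 by (auto simp: K_def sol_lip_def)

lemma tr_props:
  assumes "t0 \<le> t" "t < T" "hist_ok w" "\<alpha> \<in> controls A t T"
  shows "sol t w \<alpha> (tr t w \<alpha>)"
    "\<And>s. s \<in> {t - \<tau>bar..T} \<Longrightarrow> norm (tr t w \<alpha> s) \<le> sol_bound R0"
    "K-lipschitz_on {t - \<tau>bar..T} (tr t w \<alpha>)"
    "continuous_on {t - \<tau>bar..T} (tr t w \<alpha>)"
    "\<And>s s'. t \<le> s \<Longrightarrow> s \<le> s' \<Longrightarrow> s' \<le> T \<Longrightarrow> d * (s' - s) \<le> lag (tr t w \<alpha>) s' - lag (tr t w \<alpha>) s"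
proof -
  have w: "R0-lipschitz_on {-\<tau>bar..0} w" "\<And>\<theta>. \<theta> \<in> {-\<tau>bar..0} \<Longrightarrow> norm (w \<theta>) \<le> R0"
    using assms(3) by (auto simp: hist_ok_def)
  note P = trajectory_sol[OF assms(1,2) w assms(4)]
  show "sol t w \<alpha> (tr t w \<alpha>)" "K-lipschitz_on {t - \<tau>bar..T} (tr t w \<alpha>)"
    "\<And>s. s \<in> {t - \<tau>bar..T} \<Longrightarrow> norm (tr t w \<alpha> s) \<le> sol_bound R0"
    using P unfolding K_def by auto
  then show "continuous_on {t - \<tau>bar..T} (tr t w \<alpha>)" using lipschitz_on_continuous_on by blast
  show "\<And>s s'. t \<le> s \<Longrightarrow> s \<le> s' \<Longrightarrow> s' \<le> T \<Longrightarrow> d * (s' - s) \<le> lag (tr t w \<alpha>) s' - lag (tr t w \<alpha>) s"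
    by (rule lag_expanding(2)[OF assms(1,2) w assms(4)])
qed

definition lagK :: real where "lagK = 1 + lt + l\<tau> * K"

lemma lag_lipschitz:
  assumes "t0 \<le> t" "K-lipschitz_on {t - \<tau>bar..T} x" "\<And>s. s \<in> {t - \<tau>bar..T} \<Longrightarrow> norm (x s) \<le> sol_bound R0"
    "s \<in> {t..T}" "s' \<in> {t..T}"
  shows "\<bar>lag x s - lag x s'\<bar> \<le> lagK * \<bar>s - s'\<bar>" "norm (x (lag x s) - x (lag x s')) \<le> K * lagK * \<bar>s - s'\<bar>"
proof -
  have st: "s \<in> {t - \<tau>bar..T}" "s' \<in> {t - \<tau>bar..T}" using assms delay_pos by auto
  have "\<bar>\<tau> (s, x s) - \<tau> (s', x s')\<bar> \<le> \<bar>\<tau> (s, x s) - \<tau> (s, x s')\<bar> + \<bar>\<tau> (s, x s') - \<tau> (s', x s')\<bar>" by simp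
  also have "\<dots> \<le> l\<tau> * norm (x s - x s') + lt * \<bar>s - s'\<bar>"
    using assms st by (intro add_mono l\<tau>(2) lt(2)) auto
  also have "\<dots> \<le> l\<tau> * (K * \<bar>s - s'\<bar>) + lt * \<bar>s - s'\<bar>"
    using lipschitz_onD[OF assms(2) st] l\<tau>(1) by (intro add_right_mono mult_left_mono) (auto simp: dist_norm)
  finally have "\<bar>\<tau> (s, x s) - \<tau> (s', x s')\<bar> \<le> (l\<tau> * K + lt) * \<bar>s - s'\<bar>" by (simp add: algebra_simps)
  then show 1: "\<bar>lag x s - lag x s'\<bar> \<le> lagK * \<bar>s - s'\<bar>"
    by (simp add: lag_def lagK_def distrib_right)
  have "norm (x (lag x s) - x (lag x s')) \<le> K * \<bar>lag x s - lag x s'\<bar>"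
    using lipschitz_onD[OF assms(2) lag_bounds(4)[OF assms(4,1)] lag_bounds(4)[OF assms(5,1)]] by (simp add: dist_norm)
  also have "\<dots> \<le> K * (lagK * \<bar>s - s'\<bar>)" using 1 K_nonneg by (rule mult_left_mono)
  finally show "norm (x (lag x s) - x (lag x s')) \<le> K * lagK * \<bar>s - s'\<bar>" by (simp add: mult.assoc)
qed

lemma lagK_pos: "lagK > 0"
  using lt(1) l\<tau>(1) K_nonneg by (auto simp: lagK_def intro!: add_pos_nonneg)

text \<open>The cost with the gauge integral in place of the Lebesgue integral;
  \<open>cost_eq_J\<close> identifies the two, because the running cost along a trajectory is
  absolutely integrable.\<close>

definition J :: "real \<Rightarrow> (real \<Rightarrow> real^'n) \<Rightarrow> (real \<Rightarrow> real^'m) \<Rightarrow> real" where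
  "J t w \<alpha> = integral {t..T} (\<lambda>s. L (s, tr t w \<alpha> s, tr t w \<alpha> (lag (tr t w \<alpha>) s), \<alpha> s))
     + g (tr t w \<alpha> T, segment_at (tr t w \<alpha>) T)"

lemma cost_eq_J:
  assumes "t0 \<le> t" "t < T" "hist_ok w" "\<alpha> \<in> controls A t T"
  shows "cost f L g \<tau> \<tau>bar T t w \<alpha> = J t w \<alpha>"
proof -
  have "(\<lambda>s. L (s, tr t w \<alpha> s, tr t w \<alpha> (lag (tr t w \<alpha>) s), \<alpha> s)) absolutely_integrable_on {t..T}"
    by (rule path_integrable[OF L_cont tr_props(4)[OF assms] assms(1,4)])
  then have "integrable (lebesgue_on {t..T}) (\<lambda>s. L (s, tr t w \<alpha> s, tr t w \<alpha> (lag (tr t w \<alpha>) s), \<alpha> s))"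
    by (rule absolutely_integrable_imp_integrable) simp
  from lebesgue_integral_eq_integral[OF this] show ?thesis
    by (simp add: cost_def J_def Let_def lag_def)
qed

definition growth :: real where "growth = lf * (1 + K * l\<tau>)"

lemma growth_pos: "growth > 0"
  using K_nonneg l\<tau>(1) lf(1) unfolding growth_def by (intro mult_pos_pos add_pos_nonneg) auto

definition dep :: real where "dep = 2 * (1 + growth * (T - t0)) * exp (4 * growth * (T - t0))"

lemma dep_pos: "dep > 0"
  using growth_pos time unfolding dep_def by (intro mult_pos_pos add_pos_nonneg) auto

lemma tr_diff_bound:
  assumes "t0 \<le> t" "t < T" "t \<le> S" "S \<le> T" "hist_ok w1" "hist_ok w2" "\<alpha>1 \<in> controls A t T" "\<alpha>2 \<in> controls A t T"
    and "\<And>\<theta>. \<theta> \<in> {-\<tau>bar..0} \<Longrightarrow> norm (w1 \<theta> - w2 \<theta>) \<le> \<delta>"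
    and "\<And>s. s \<in> {t..S} \<Longrightarrow> norm (integral {t..s} (\<lambda>r. rhs (tr t w2 \<alpha>2) \<alpha>1 r - rhs (tr t w2 \<alpha>2) \<alpha>2 r)) \<le> \<epsilon>"
    and "s \<in> {t - \<tau>bar..S}"
  shows "norm (tr t w1 \<alpha>1 s - tr t w2 \<alpha>2 s) \<le> dep * (\<delta> + \<epsilon>)"
  using sol_diff_bound[OF assms(1,3,4) tr_props(1)[OF assms(1,2,5,7)] tr_props(1)[OF assms(1,2,6,8)]
      tr_props(3)[OF assms(1,2,6,8)] assms(7,8,9,10,11)]
  by (simp add: dep_def growth_def)

end

subsection \<open>Averaging a control over a cell\<close>

lemma integral_supported:
  fixes h :: "real \<Rightarrow> 'b::euclidean_space"
  assumes "negligible N" "\<And>r. r \<in> {a..b} - {c..e} - N \<Longrightarrow> h r = 0" "{c..e} \<subseteq> {a..b}"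
  shows "integral {a..b} h = integral {c..e} h"
proof -
  have "integral {a..b} h = integral {a..b} (\<lambda>r. if r \<in> {c..e} then h r else 0)"
    by (rule integral_spike[OF assms(1)]) (use assms(2) in auto)
  also have "\<dots> = integral ({c..e} \<inter> {a..b}) h" by (rule integral_restrict_Int)
  also have "{c..e} \<inter> {a..b} = {c..e}" using assms(3) by blast
  finally show ?thesis .
qed

context delay_control
begin

text \<open>Constants for averaging over a cell of length \<open>len\<close> with L^1 deviation
  \<open>Q\<close>: \<open>dev1 * Q\<close> bounds the change of state at all times,
  \<open>dev2 * len * Q\<close> its size after the cell, \<open>dev3 * len * Q\<close> the time
  integral of the present and lagged changes, and \<open>avgc\<close> is the resulting first-order
  change of cost in units of \<open>len * Q\<close>.\<close>

definition "dev1 = dep * lH"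
definition "dev2 = 2 * (2 * growth * dev1 + 2 * growth * dev1 / d) * exp (4 * growth * (T - t0))"
definition "dev3 = dev1 + 2 * dev2 * (T - t0) + 2 * dev1 / d"
definition "avgc = lL * (1 + K * l\<tau>) * dev3 + lH * (1 + K + K * lagK) + lg * (dev1 + dev2 * (1 + \<tau>bar))"

lemma dev_pos: "dev1 > 0" "dev2 > 0"
  using dep_pos lH(1) growth_pos lag_expanding(1) by (auto simp: dev1_def dev2_def intro!: mult_pos_pos add_pos_pos)

end

locale control_averaging = delay_control +
  fixes t :: real and w :: "real \<Rightarrow> real^'b" and \<alpha> \<beta> :: "real \<Rightarrow> real^'a" and \<sigma> len :: real and abar :: "real^'a"
  assumes t: "t0 \<le> t" "t < T" and w: "hist_ok w" and \<alpha>: "\<alpha> \<in> controls A t T" and \<beta>: "\<beta> \<in> controls A t T"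
    and cell: "t \<le> \<sigma>" "len > 0" "\<sigma> + len \<le> T"
    and mean: "len *\<^sub>R abar = integral {\<sigma>..\<sigma> + len} \<alpha>" and abar: "abar \<in> A"
    and \<beta>_cell: "\<And>s. s \<in> {\<sigma><..<\<sigma> + len} \<Longrightarrow> \<beta> s = abar"
    and \<beta>_off: "\<And>s. s \<in> {t<..<\<sigma>} \<union> {\<sigma> + len<..<T} \<Longrightarrow> \<beta> s = \<alpha> s"
begin

abbreviation "x \<equiv> tr t w \<alpha>"
abbreviation "x' \<equiv> tr t w \<beta>"
text \<open>\<open>Q\<close> controls the perturbation of the state; \<open>q\<close>, which is
  \<open>len\<close> times the variance of \<open>\<alpha>\<close> on the cell, is what strong
  convexity gives back.\<close>

definition "Q = integral {\<sigma>..\<sigma> + len} (\<lambda>r. norm (\<alpha> r - abar))"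
definition "q = integral {\<sigma>..\<sigma> + len} (\<lambda>r. (norm (\<alpha> r - abar))\<^sup>2)"

lemmas px = tr_props[OF t w \<alpha>] and px' = tr_props[OF t w \<beta>]

lemma \<alpha>_integrable: "\<alpha> absolutely_integrable_on {t..T}"
proof -
  obtain B where "\<And>a. a \<in> A \<Longrightarrow> norm a \<le> B" using A(2) by (meson bounded_iff compact_imp_bounded)
  then show ?thesis using \<alpha> by (intro bounded_measurable_integrable_on_open[where B=B]) (auto simp: controls_def)
qed

lemma dev_integrable:
  "(\<lambda>r. \<alpha> r - abar) absolutely_integrable_on {t..T}"
  "(\<lambda>r. \<alpha> r - abar) integrable_on {\<sigma>..\<sigma> + len}"
  "(\<lambda>r. norm (\<alpha> r - abar)) integrable_on {\<sigma>..\<sigma> + len}"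
  "(\<lambda>r. (norm (\<alpha> r - abar))\<^sup>2) integrable_on {\<sigma>..\<sigma> + len}"
proof -
  show a: "(\<lambda>r. \<alpha> r - abar) absolutely_integrable_on {t..T}"
    by (intro set_integral_diff \<alpha>_integrable) (auto intro: absolutely_integrable_on_const)
  have sub: "{\<sigma>..\<sigma> + len} \<subseteq> {t..T}" using cell by auto
  show "(\<lambda>r. \<alpha> r - abar) integrable_on {\<sigma>..\<sigma> + len}" "(\<lambda>r. norm (\<alpha> r - abar)) integrable_on {\<sigma>..\<sigma> + len}"
    using a integrable_on_subinterval[OF _ sub] by (auto simp: absolutely_integrable_on_def)
  obtain B where B: "\<And>a. a \<in> A \<Longrightarrow> norm a \<le> B" using A(2) by (meson bounded_iff compact_imp_bounded)
  have "(\<lambda>r. (norm (\<alpha> r - abar))\<^sup>2) absolutely_integrable_on {t..T}"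
  proof (rule bounded_measurable_integrable_on_open)
    show "(\<lambda>r. (norm (\<alpha> r - abar))\<^sup>2) \<in> borel_measurable (lebesgue_on {t<..<T})"
      using \<alpha> by (auto simp: controls_def intro!: borel_measurable_power borel_measurable_norm borel_measurable_diff)
    show "norm ((norm (\<alpha> s - abar))\<^sup>2) \<le> (B + B)\<^sup>2" if s: "s \<in> {t<..<T}" for s
    proof -
      have "norm (\<alpha> s - abar) \<le> B + B"
        using B[OF abar] B[of "\<alpha> s"] s \<alpha> norm_triangle_ineq4[of "\<alpha> s" abar] by (fastforce simp: controls_def)
      then have "(norm (\<alpha> s - abar))\<^sup>2 \<le> (B + B)\<^sup>2" by (rule power_mono) simp
      then show ?thesis by simp
    qed
  qed
  then show "(\<lambda>r. (norm (\<alpha> r - abar))\<^sup>2) integrable_on {\<sigma>..\<sigma> + len}"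
    using integrable_on_subinterval[OF _ sub] by (auto simp: absolutely_integrable_on_def)
qed

lemma Q_nonneg: "Q \<ge> 0" unfolding Q_def by (rule integral_nonneg[OF dev_integrable(3)]) auto

text \<open>Times at which \<open>\<beta>\<close> is not prescribed, or at which the values of the
  controls are not known to lie in \<open>A\<close>.\<close>

definition "N = {t, \<sigma>, \<sigma> + len, T}"

lemma N: "negligible N" by (simp add: N_def)

lemma rhs_dev:
  assumes "r \<in> {t..T} - N"
  shows "r \<in> {\<sigma>..\<sigma> + len} \<Longrightarrow> norm (rhs x \<beta> r - rhs x \<alpha> r) \<le> lH * norm (\<alpha> r - abar)"
    "r \<in> {\<sigma>..\<sigma> + len} \<Longrightarrow> (rhs x \<beta> r - rhs x \<alpha> r) \<bullet> p = (Ha (t0, 0, 0, 0, abar) - Ha (t0, 0, 0, p, abar)) \<bullet> (\<alpha> r - abar)"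
    "r \<notin> {\<sigma>..\<sigma> + len} \<Longrightarrow> \<beta> r = \<alpha> r"
proof -
  have r: "r \<in> {t0..T}" "r \<in> {t<..<T}" using assms t by (auto simp: N_def)
  then have \<alpha>r: "\<alpha> r \<in> A" using \<alpha> by (auto simp: controls_def)
  show "r \<notin> {\<sigma>..\<sigma> + len} \<Longrightarrow> \<beta> r = \<alpha> r" by (rule \<beta>_off) (use assms in \<open>auto simp: N_def\<close>)
  assume c: "r \<in> {\<sigma>..\<sigma> + len}"
  then have b: "\<beta> r = abar" by (intro \<beta>_cell) (use assms in \<open>auto simp: N_def\<close>)
  show "norm (rhs x \<beta> r - rhs x \<alpha> r) \<le> lH * norm (\<alpha> r - abar)"
    using f_control_difference(2)[OF r(1) \<alpha>r abar, of "x r" "x (lag x r)"] b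
    by (simp add: rhs_def norm_minus_commute)
  show "(rhs x \<beta> r - rhs x \<alpha> r) \<bullet> p = (Ha (t0, 0, 0, 0, abar) - Ha (t0, 0, 0, p, abar)) \<bullet> (\<alpha> r - abar)"
    using f_control_difference(1)[OF r(1) \<alpha>r abar, of "x r" "x (lag x r)" p] b
    by (simp add: rhs_def inner_diff_left)
qed

lemma rhs_dev_integrable: "t \<le> s1 \<Longrightarrow> s2 \<le> T \<Longrightarrow> (\<lambda>r. rhs x \<beta> r - rhs x \<alpha> r) integrable_on {s1..s2}"
  by (intro integrable_diff rhs_integrable(3)[OF px(4) t(1) \<beta>] rhs_integrable(3)[OF px(4) t(1) \<alpha>])

text \<open>The second claim is the cancellation behind averaging. Tested against any
  \<open>p\<close>, the integrand on the cell is a fixed vector paired with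
  \<open>\<alpha> r - abar\<close>, whose integral over the cell is zero.\<close>

lemma rhs_dev_integral:
  assumes "s \<in> {t..T}"
  shows "norm (integral {t..s} (\<lambda>r. rhs x \<beta> r - rhs x \<alpha> r)) \<le> lH * Q"
    "s \<le> \<sigma> \<or> \<sigma> + len \<le> s \<Longrightarrow> integral {t..s} (\<lambda>r. rhs x \<beta> r - rhs x \<alpha> r) = 0"
proof -
  let ?D = "\<lambda>r. rhs x \<beta> r - rhs x \<alpha> r"
  define n where "n r = (if r \<in> {\<sigma>..\<sigma> + len} then lH * norm (\<alpha> r - abar) else 0)" for r
  have n0: "0 \<le> n r" for r using lH(1) by (simp add: n_def)
  have n_int: "n integrable_on {t..T}"
    unfolding n_def using dev_integrable(3) cell
    by (subst integrable_restrict_Int) (auto intro!: integrable_on_mult_right simp: Int_absorb1 Int_absorb2)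
  have D0: "?D r = 0" if "r \<in> {t..T} - N" "r \<notin> {\<sigma>..\<sigma> + len}" for r
    using rhs_dev(3)[OF that] by (simp add: rhs_def)
  have "norm (integral {t..s} ?D) = norm (integral {t..s} (\<lambda>r. if r \<in> N then 0 else ?D r))"
    by (intro arg_cong[where f=norm] integral_spike[OF N]) auto
  also have "\<dots> \<le> integral {t..s} n"
  proof (rule integral_norm_bound_integral)
    show "(\<lambda>r. if r \<in> N then 0 else ?D r) integrable_on {t..s}"
      by (rule integrable_spike[OF rhs_dev_integrable[of t s] N]) (use assms in auto)
    show "n integrable_on {t..s}" by (rule integrable_on_subinterval[OF n_int]) (use assms in auto)
    show "norm (if r \<in> N then 0 else ?D r) \<le> n r" if "r \<in> {t..s}" for r
      using rhs_dev(1)[of r] D0[of r] that assms n0[of r] by (auto simp: n_def)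
  qed
  also have "\<dots> \<le> integral {t..T} n"
    using assms n0 n_int by (intro integral_subset_le integrable_on_subinterval[OF n_int]) auto
  also have "\<dots> = integral {\<sigma>..\<sigma> + len} n"
    by (rule integral_supported[of "{}"]) (use cell in \<open>auto simp: n_def\<close>)
  also have "\<dots> = integral {\<sigma>..\<sigma> + len} (\<lambda>r. lH * norm (\<alpha> r - abar))"
    by (rule integral_cong) (auto simp: n_def)
  also have "\<dots> = lH * Q" by (simp add: Q_def)
  finally show "norm (integral {t..s} ?D) \<le> lH * Q" .
  assume "s \<le> \<sigma> \<or> \<sigma> + len \<le> s"
  then show "integral {t..s} ?D = 0"
  proof
    assume "s \<le> \<sigma>"
    then have "integral {t..s} ?D = integral {t..s} (\<lambda>_. 0)"
      by (intro integral_spike[OF N]) (use D0 assms in \<open>auto simp: N_def\<close>)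
    then show ?thesis by simp
  next
    assume s: "\<sigma> + len \<le> s"
    have "integral {t..s} ?D \<bullet> p = 0" for p
    proof -
      let ?c = "Ha (t0, 0, 0, 0, abar) - Ha (t0, 0, 0, p, abar)"
      have "integral {t..s} ?D = integral {\<sigma>..\<sigma> + len} ?D"
        by (rule integral_supported[OF N]) (use D0 assms cell s in auto)
      then have "integral {t..s} ?D \<bullet> p = integral {\<sigma>..\<sigma> + len} (\<lambda>r. ?D r \<bullet> p)"
        using integral_linear[OF rhs_dev_integrable[of \<sigma> "\<sigma> + len"] bounded_linear_inner_left[of p]] cell by (simp add: o_def)
      also have "\<dots> = integral {\<sigma>..\<sigma> + len} (\<lambda>r. ?c \<bullet> (\<alpha> r - abar))"
        by (rule integral_spike[OF N]) (use rhs_dev(2) cell in auto)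
      also have "\<dots> = ?c \<bullet> integral {\<sigma>..\<sigma> + len} (\<lambda>r. \<alpha> r - abar)"
        using integral_linear[OF dev_integrable(2) bounded_linear_inner_right[of ?c]] by (simp add: o_def)
      also have "integral {\<sigma>..\<sigma> + len} (\<lambda>r. \<alpha> r - abar) = 0"
      proof -
        have "\<alpha> integrable_on {\<sigma>..\<sigma> + len}"
          using integrable_add[OF dev_integrable(2) integrable_const_ivl[of abar \<sigma> "\<sigma> + len"]] by simp
        from integral_diff[OF this integrable_const_ivl[of abar \<sigma> "\<sigma> + len"]]
        show ?thesis using cell by (simp add: mean[symmetric])
      qed
      finally show ?thesis by simp
    qed
    \<comment> \<open>Testing the integral against itself shows that its norm is zero.\<close>
    from this[of "integral {t..s} ?D"] show ?thesis by simp
  qed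
qed

section \<open>State deviation caused by averaging\<close>

lemma dev_hist: "s \<in> {t - \<tau>bar..\<sigma>} \<Longrightarrow> x' s = x s"
  using tr_diff_bound[OF t cell(1) _ w w \<beta> \<alpha>, of 0 0 s] rhs_dev_integral(2) cell by auto

lemma dev_le: "s \<in> {t - \<tau>bar..T} \<Longrightarrow> norm (x' s - x s) \<le> dev1 * Q"
  using tr_diff_bound[OF t less_imp_le[OF t(2)] _ w w \<beta> \<alpha>, of 0 "lH * Q" s] rhs_dev_integral(1)
  by (simp add: dev1_def mult.assoc)

text \<open>A majorant of the indicator of the times whose lag lies in the cell, written as an increment of a
  monotone function along the expanding lag, so that its integral is at most \<open>2 * len / d\<close>.\<close>

definition "spread r = (if \<sigma> + len / 2 \<le> lag x' r + len then 1 else 0 :: real) - (if \<sigma> + len / 2 \<le> lag x' r - len then 1 else 0)"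

lemma spread: "spread integrable_on {t..T}" "integral {t..T} spread \<le> 2 * len / d" "0 \<le> spread r"
  "lag x' r \<in> {\<sigma>..\<sigma> + len} \<Longrightarrow> spread r = 1"
proof -
  let ?V = "\<lambda>v. if \<sigma> + len / 2 \<le> v then 1 else 0 :: real"
  have mV: "mono ?V" by (auto simp: mono_def)
  note I = integral_increment_along_expanding[OF mV, of 1 d len t T "lag x'"]
  have "(\<lambda>r. ?V (lag x' r + len) - ?V (lag x' r - len)) integrable_on {t..T}"
    by (rule I) (use lag_expanding(1) cell t px'(5) in auto)
  then show "spread integrable_on {t..T}" unfolding spread_def .
  have "integral {t..T} (\<lambda>r. ?V (lag x' r + len) - ?V (lag x' r - len)) \<le> 2 * len / d * 1"
    by (rule I) (use lag_expanding(1) cell t px'(5) in auto)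
  then show "integral {t..T} spread \<le> 2 * len / d" unfolding spread_def by simp
  show "0 \<le> spread r" "lag x' r \<in> {\<sigma>..\<sigma> + len} \<Longrightarrow> spread r = 1" using cell by (auto simp: spread_def)
qed

text \<open>A lag before the cell sees no change, one inside the cell is charged to
  \<open>spread\<close>, and one after the cell is left for the Gronwall recursion of
  \<open>dev_after\<close>.\<close>

lemma lagged_dev:
  assumes "r \<in> {t..T}"
  shows "norm (x' (lag x' r) - x (lag x' r))
    \<le> dev1 * Q * spread r + (if \<sigma> + len \<le> lag x' r then norm (x' (lag x' r) - x (lag x' r)) else 0)"
proof -
  note lb = lag_bounds[OF assms t(1), of x']
  have nn: "0 \<le> dev1 * Q * spread r" using dev_pos Q_nonneg spread(3) by simp
  consider "lag x' r \<le> \<sigma>" | "lag x' r \<in> {\<sigma>..\<sigma> + len}" | "\<sigma> + len \<le> lag x' r" by fastforce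
  then show ?thesis
  proof cases
    case 1
    then have "x' (lag x' r) = x (lag x' r)" using lb by (intro dev_hist) auto
    then show ?thesis using nn by simp
  next
    case 2
    then show ?thesis using dev_le[OF lb(4)] spread(4)[OF 2] dev_pos(1) Q_nonneg by auto
  qed (use nn in auto)
qed

lemma dev_rhs_le:
  assumes "r \<in> {t<..<T}"
  shows "norm (rhs x' \<beta> r - rhs x \<beta> r) \<le> growth * (norm (x' r - x r) + norm (x' (lag x' r) - x (lag x' r)))"
  unfolding growth_def
  by (rule rhs_diff[OF px(3) _ t(1)]) (use assms \<beta> in \<open>auto simp: controls_def\<close>)

text \<open>After the cell the direct contribution of \<open>\<beta> - \<alpha>\<close> has integral zero, because \<open>abar\<close> is the mean
  of \<open>\<alpha>\<close> and the dynamics are affine in the control; what remains is of order \<open>dev1 * Q\<close> on a set of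
  times of measure \<open>O(len)\<close>.\<close>

lemma dev_after:
  assumes s: "s \<in> {\<sigma> + len..T}"
  shows "norm (x' s - x s) \<le> dev2 * len * Q"
proof -
  define p where "p = \<sigma> + len"
  define \<rho> where "\<rho> r = (if r \<in> {t<..<T} then norm (rhs x' \<beta> r - rhs x \<beta> r) else 0)" for r
  have "(\<lambda>r. rhs x' \<beta> r - rhs x \<beta> r) absolutely_integrable_on {t..T}"
    using rhs_integrable(1)[OF px'(4) t(1) \<beta>] rhs_integrable(1)[OF px(4) t(1) \<beta>] by (rule set_integral_diff)
  then have nI: "(\<lambda>r. norm (rhs x' \<beta> r - rhs x \<beta> r)) integrable_on {t..T}"
    and dI: "(\<lambda>r. rhs x' \<beta> r - rhs x \<beta> r) integrable_on {t..T}"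
    by (auto simp: absolutely_integrable_on_def)
  have rhoI: "\<rho> integrable_on {t..T}" by (rule integrable_spike[OF nI, of "{t, T}"]) (auto simp: \<rho>_def)
  have rhoI': "\<rho> integrable_on {a..b}" if "t \<le> a" "b \<le> T" for a b
    by (rule integrable_on_subinterval[OF rhoI]) (use that in auto)
  \<comment> \<open>\<open>a\<close> is the drift accumulated up to the end of the cell,
    \<open>b\<close> the contribution of later times whose lag falls back into the cell.\<close>
  define a where "a = 2 * growth * dev1 * len * Q"
  define b where "b = 2 * growth * dev1 / d * len * Q"
  have gdQ: "growth * dev1 * Q \<ge> 0" using growth_pos dev_pos(1) Q_nonneg by simp
  \<comment> \<open>Up to \<open>\<sigma>\<close> nothing has changed, so only the time
    \<open>len\<close> spent in the cell contributes.\<close>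
  have first: "integral {t..p} \<rho> \<le> a"
  proof -
    have rho_le: "\<rho> r \<le> 2 * (growth * dev1 * Q)" if "r \<in> {t..T}" for r
    proof (cases "r \<in> {t<..<T}")
      case True
      have "\<rho> r \<le> growth * (norm (x' r - x r) + norm (x' (lag x' r) - x (lag x' r)))"
        using dev_rhs_le[OF True] True by (simp add: \<rho>_def)
      also have "\<dots> \<le> growth * (dev1 * Q + dev1 * Q)"
        using dev_le[of r] dev_le[of "lag x' r"] lag_bounds[OF that t(1), of x'] that delay_pos growth_pos
        by (intro mult_left_mono add_mono) auto
      finally show ?thesis by (simp add: mult_ac)
    qed (use gdQ in \<open>auto simp: \<rho>_def\<close>)
    have "\<rho> r = 0" if "r \<in> {t..\<sigma>}" for r
    proof (cases "r \<in> {t<..<T}")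
      case True
      then have "norm (rhs x' \<beta> r - rhs x \<beta> r) \<le> growth * (norm (x' r - x r) + norm (x' (lag x' r) - x (lag x' r)))"
        by (rule dev_rhs_le)
      moreover have "x' r = x r" using that delay_pos by (intro dev_hist) auto
      moreover have "x' (lag x' r) = x (lag x' r)"
        using that lag_bounds[of r t x'] t cell by (intro dev_hist) auto
      ultimately show ?thesis by (simp add: \<rho>_def)
    qed (auto simp: \<rho>_def)
    then have "integral {t..p} \<rho> = integral {\<sigma>..p} \<rho>"
      by (intro integral_supported[of "{}"]) (use cell in \<open>auto simp: p_def\<close>)
    also have "\<dots> \<le> norm (integral {\<sigma>..p} \<rho>)" by simp
    also have "\<dots> \<le> 2 * (growth * dev1 * Q) * (p - \<sigma>)"
    proof (rule integral_lipschitz_bound)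
      show "norm (\<rho> r) \<le> 2 * (growth * dev1 * Q)" if "r \<in> {\<sigma><..<p}" for r
      proof -
        have "norm (\<rho> r) = \<rho> r" by (simp add: \<rho>_def)
        then show ?thesis using rho_le[of r] that cell by (simp add: p_def)
      qed
    qed (use rhoI' cell in \<open>auto simp: p_def\<close>)
    finally show ?thesis by (simp add: a_def p_def mult_ac)
  qed
  have "norm (x' s - x s) \<le> 2 * (a + b) * exp (4 * growth * (s - p))"
  proof (rule gronwall_along_delay[where \<rho>=\<rho> and \<phi>="\<lambda>r. growth * dev1 * Q * spread r" and u="lag x'"
      and E="\<lambda>s. norm (x' s - x s)" and T=T])
    show "continuous_on {p..T} (\<lambda>s. norm (x' s - x s))"
      using delayed_continuous(2)[OF px(4) t(1)] delayed_continuous(2)[OF px'(4) t(1)] cell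
      by (intro continuous_intros) (auto intro: continuous_on_subset simp: p_def)
    show "lag x' r \<le> r" if "r \<in> {p..T}" for r using lag_bounds(1)[of r t x'] that t cell by (auto simp: p_def)
    show "0 \<le> a" using gdQ cell by (simp add: a_def mult_ac)
    show "growth > 0" by (rule growth_pos)
    show "\<rho> integrable_on {p..T}" by (rule rhoI') (use cell in \<open>auto simp: p_def\<close>)
    have sI: "spread integrable_on {p..T}" by (rule integrable_on_subinterval[OF spread(1)]) (use cell in \<open>auto simp: p_def\<close>)
    then show "(\<lambda>r. growth * dev1 * Q * spread r) integrable_on {p..T}" by (rule integrable_on_mult_right)
    show "0 \<le> growth * dev1 * Q * spread r" for r using gdQ spread(3) by simp
    have "integral {p..T} spread \<le> integral {t..T} spread"
      by (rule integral_subset_le) (use sI spread cell in \<open>auto simp: p_def\<close>)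
    then have "growth * dev1 * Q * integral {p..T} spread \<le> growth * dev1 * Q * (2 * len / d)"
      using spread(2) gdQ by (intro mult_left_mono) auto
    then show "integral {p..T} (\<lambda>r. growth * dev1 * Q * spread r) \<le> b" by (simp add: b_def mult_ac)
    show "norm (x' s - x s) \<le> a + integral {p..s} \<rho>" if s: "s \<in> {p..T}" for s
    proof -
      have st: "s \<in> {t..T}" using s cell by (auto simp: p_def)
      have "x' s - x s = integral {t..s} (rhs x' \<beta>) - integral {t..s} (rhs x \<alpha>)"
        using px(1) px'(1) st by (simp add: sol_def)
      also have "\<dots> = integral {t..s} (\<lambda>r. rhs x' \<beta> r - rhs x \<beta> r) + integral {t..s} (\<lambda>r. rhs x \<beta> r - rhs x \<alpha> r)"
        using rhs_integrable(3)[OF px'(4) t(1) \<beta>, of t s] rhs_integrable(3)[OF px(4) t(1) \<beta>, of t s]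
          rhs_integrable(3)[OF px(4) t(1) \<alpha>, of t s] st by (simp add: integral_diff)
      also have "integral {t..s} (\<lambda>r. rhs x \<beta> r - rhs x \<alpha> r) = 0"
        by (rule rhs_dev_integral(2)) (use s st in \<open>auto simp: p_def\<close>)
      finally have "norm (x' s - x s) = norm (integral {t..s} (\<lambda>r. rhs x' \<beta> r - rhs x \<beta> r))" by simp
      also have "\<dots> \<le> integral {t..s} (\<lambda>r. norm (rhs x' \<beta> r - rhs x \<beta> r))"
        using st by (intro integral_norm_bound_integral integrable_on_subinterval[OF nI] integrable_on_subinterval[OF dI]) auto
      also have "\<dots> = integral {t..s} \<rho>" by (rule integral_spike[of "{t, T}"]) (use st in \<open>auto simp: \<rho>_def\<close>)
      also have "\<dots> = integral {t..p} \<rho> + integral {p..s} \<rho>"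
        using Henstock_Kurzweil_Integration.integral_combine[of t p s \<rho>] rhoI'[of t s] st s cell by (simp add: p_def)
      finally show ?thesis using first by linarith
    qed
    show "\<rho> r \<le> growth * dev1 * Q * spread r + growth * (norm (x' r - x r)
        + (if p \<le> lag x' r then norm (x' (lag x' r) - x (lag x' r)) else 0))" if r: "r \<in> {p..T}" for r
    proof (cases "r \<in> {t<..<T}")
      case True
      then have rt: "r \<in> {t..T}" by auto
      have "\<rho> r \<le> growth * (norm (x' r - x r) + norm (x' (lag x' r) - x (lag x' r)))"
        using dev_rhs_le[OF True] True by (simp add: \<rho>_def)
      also have "\<dots> \<le> growth * (norm (x' r - x r) + (dev1 * Q * spread r
          + (if p \<le> lag x' r then norm (x' (lag x' r) - x (lag x' r)) else 0)))"
        unfolding p_def using lagged_dev[OF rt] growth_pos by (intro mult_left_mono add_left_mono) auto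
      finally show ?thesis by (simp add: algebra_simps)
    next
      case False
      have "0 \<le> growth * dev1 * Q * spread r" using gdQ spread(3) by simp
      moreover have "0 \<le> growth * (norm (x' r - x r)
        + (if p \<le> lag x' r then norm (x' (lag x' r) - x (lag x' r)) else 0))"
        using growth_pos by (intro mult_nonneg_nonneg add_nonneg_nonneg) auto
      ultimately show ?thesis using False by (simp only: \<rho>_def if_False)
    qed
    show "s \<in> {p..T}" using s by (simp add: p_def)
  qed
  also have "\<dots> \<le> 2 * (a + b) * exp (4 * growth * (T - t0))"
  proof (rule mult_left_mono)
    show "exp (4 * growth * (s - p)) \<le> exp (4 * growth * (T - t0))"
      using growth_pos s t cell by (auto simp: p_def)
    have "0 \<le> a" "0 \<le> b" using gdQ cell lag_expanding(1) by (auto simp: a_def b_def mult_ac)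
    then show "0 \<le> 2 * (a + b)" by simp
  qed
  also have "\<dots> = dev2 * len * Q" by (simp add: a_def b_def dev2_def algebra_simps)
  finally show ?thesis .
qed

end

section \<open>Cost change caused by averaging\<close>

lemma integral_indicator_Icc_le:
  fixes k :: real
  assumes "k \<ge> 0" "c \<le> e"
  shows "(\<lambda>s. if s \<in> {c..e} then k else 0) integrable_on {a..b}"
    "integral {a..b} (\<lambda>s. if s \<in> {c..e} then k else 0) \<le> k * (e - c)"
proof -
  have "{c..e} \<inter> {a..b} = {max c a..min e b}" by auto
  then show 1: "(\<lambda>s. if s \<in> {c..e} then k else 0) integrable_on {a..b}"
    using integrable_const_ivl[of k "max c a" "min e b"] by (subst integrable_restrict_Int) simp
  have "integral {a..b} (\<lambda>s. if s \<in> {c..e} then k else 0) = integral {max c a..min e b} (\<lambda>_. k)"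
    using \<open>{c..e} \<inter> {a..b} = {max c a..min e b}\<close> by (subst integral_restrict_Int) simp
  also have "\<dots> \<le> k * (e - c)" using assms by (cases "max c a \<le> min e b") (auto simp: mult.commute mult_left_mono)
  finally show "integral {a..b} (\<lambda>s. if s \<in> {c..e} then k else 0) \<le> k * (e - c)" .
qed

context control_averaging
begin

definition "m1 s = (if s \<in> {\<sigma>..\<sigma> + len} then dev1 * Q else 0) + dev2 * len * Q"

lemma nonneg: "0 \<le> dev1 * Q" "0 \<le> dev2 * len * Q"
  using dev_pos Q_nonneg cell by auto

lemma dev_le_m1: "s \<in> {t - \<tau>bar..T} \<Longrightarrow> norm (x' s - x s) \<le> m1 s"
proof -
  assume s: "s \<in> {t - \<tau>bar..T}"
  consider "s < \<sigma>" | "s \<in> {\<sigma>..\<sigma> + len}" | "\<sigma> + len < s" by fastforce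
  then show ?thesis
  proof cases
    case 1
    then have "x' s = x s" using s by (intro dev_hist) auto
    then show ?thesis using nonneg by (simp add: m1_def)
  next
    case 2 then show ?thesis using dev_le[OF s] nonneg by (simp add: m1_def)
  next
    case 3 then show ?thesis using dev_after[of s] s nonneg by (simp add: m1_def)
  qed
qed

lemma m1_integral: "m1 integrable_on {a..b}" "a \<le> b \<Longrightarrow> integral {a..b} m1 \<le> (dev1 + dev2 * (b - a)) * (len * Q)"
proof -
  have I: "(\<lambda>s. if s \<in> {\<sigma>..\<sigma> + len} then dev1 * Q else 0) integrable_on {a..b}"
    "integral {a..b} (\<lambda>s. if s \<in> {\<sigma>..\<sigma> + len} then dev1 * Q else 0) \<le> dev1 * Q * (\<sigma> + len - \<sigma>)"
    using integral_indicator_Icc_le[OF nonneg(1), of \<sigma> "\<sigma> + len"] cell by auto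
  show "m1 integrable_on {a..b}" unfolding m1_def by (intro integrable_add I integrable_const_ivl)
  assume ab: "a \<le> b"
  have "integral {a..b} m1 = integral {a..b} (\<lambda>s. if s \<in> {\<sigma>..\<sigma> + len} then dev1 * Q else 0) + integral {a..b} (\<lambda>_. dev2 * len * Q)"
    unfolding m1_def by (intro integral_add I integrable_const_ivl)
  also have "\<dots> \<le> dev1 * Q * (\<sigma> + len - \<sigma>) + dev2 * len * Q * (b - a)"
    using I(2) ab by simp
  finally show "integral {a..b} m1 \<le> (dev1 + dev2 * (b - a)) * (len * Q)" by (simp add: algebra_simps)
qed

text \<open>\<open>m1\<close> majorizes the change at the present time and also a small remainder
  after the cell; the other two summands account for a lag inside the cell and a lag after
  it.\<close>

definition "m r = m1 r + dev1 * Q * spread r + dev2 * len * Q"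

lemma dev_le_m:
  assumes r: "r \<in> {t..T}"
  shows "norm (x' r - x r) + norm (x' (lag x' r) - x (lag x' r)) \<le> m r"
proof -
  have "(if \<sigma> + len \<le> lag x' r then norm (x' (lag x' r) - x (lag x' r)) else 0) \<le> dev2 * len * Q"
    using dev_after[of "lag x' r"] lag_bounds(4)[OF r t(1), of x'] nonneg by auto
  then show ?thesis using dev_le_m1[of r] lagged_dev[OF r] r delay_pos by (simp add: m_def)
qed

lemma m_integral: "m integrable_on {t..T}" "integral {t..T} m \<le> dev3 * (len * Q)"
proof -
  have I: "(\<lambda>r. dev1 * Q * spread r) integrable_on {t..T}" by (rule integrable_on_mult_right[OF spread(1)])
  show "m integrable_on {t..T}" unfolding m_def by (intro integrable_add I m1_integral integrable_const_ivl)
  have "integral {t..T} m = integral {t..T} m1 + integral {t..T} (\<lambda>r. dev1 * Q * spread r) + integral {t..T} (\<lambda>_. dev2 * len * Q)"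
    unfolding m_def
    using integral_add[OF integrable_add[OF m1_integral(1) I] integrable_const_ivl, of "dev2 * len * Q"] integral_add[OF m1_integral(1) I]
    by simp
  also have "\<dots> \<le> (dev1 + dev2 * (T - t)) * (len * Q) + dev1 * Q * (2 * len / d) + dev2 * len * Q * (T - t)"
  proof (intro add_mono)
    show "integral {t..T} m1 \<le> (dev1 + dev2 * (T - t)) * (len * Q)" by (rule m1_integral(2)) (use t in auto)
    show "integral {t..T} (\<lambda>r. dev1 * Q * spread r) \<le> dev1 * Q * (2 * len / d)"
      using mult_left_mono[OF spread(2) nonneg(1)] by simp
  qed (use t in auto)
  also have "\<dots> = (dev1 + 2 * dev2 * (T - t) + 2 * dev1 / d) * (len * Q)" by (simp add: algebra_simps)
  also have "\<dots> \<le> dev3 * (len * Q)"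
    unfolding dev3_def using dev_pos t cell Q_nonneg by (intro mult_right_mono add_mono mult_left_mono) auto
  finally show "integral {t..T} m \<le> dev3 * (len * Q)" .
qed

text \<open>The large deviation \<open>dev1 * Q\<close> lasts for one cell only, and
  \<open>g\<close> measures the segment in the L^1 norm, so even a cell inside the last delay
  interval contributes no more than the order \<open>len * Q\<close>. At \<open>T\<close> itself the
  bound valid after the cell applies.\<close>

lemma terminal_dev:
  "g (x' T, segment_at x' T) - g (x T, segment_at x T) \<le> lg * (dev1 + dev2 * (1 + \<tau>bar)) * (len * Q)"
proof -
  have seg: "K-lipschitz_on {-\<tau>bar..0} (segment_at y T)" if "K-lipschitz_on {t - \<tau>bar..T} y" for y
  proof (rule lipschitz_onI[OF _ K_nonneg])
    fix a b assume "a \<in> {-\<tau>bar..0}" "b \<in> {-\<tau>bar..0}"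
    then show "dist (segment_at y T a) (segment_at y T b) \<le> K * dist a b"
      using lipschitz_onD[OF that, of "T + a" "T + b"] t by (simp add: segment_at_def)
  qed
  have "\<bar>g (segment_at x' T 0, segment_at x' T) - g (segment_at x T 0, segment_at x T)\<bar>
    \<le> lg * (norm (segment_at x' T 0 - segment_at x T 0) + integral {-\<tau>bar..0} (\<lambda>\<theta>. norm (segment_at x' T \<theta> - segment_at x T \<theta>)))"
    by (rule lg(2)[OF seg[OF px'(3)] seg[OF px(3)]]) (use px'(2) px(2) t in \<open>auto simp: segment_at_def\<close>)
  also have "\<dots> \<le> lg * (dev2 * len * Q + (dev1 + dev2 * \<tau>bar) * (len * Q))"
  proof (intro mult_left_mono add_mono)
    show "norm (segment_at x' T 0 - segment_at x T 0) \<le> dev2 * len * Q"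
      using dev_after[of T] cell by (simp add: segment_at_def)
    have "integral {-\<tau>bar..0} (\<lambda>\<theta>. norm (segment_at x' T \<theta> - segment_at x T \<theta>))
      = integral {-\<tau>bar..0} ((\<lambda>s. norm (x' s - x s)) \<circ> (+) T)"
      by (simp add: segment_at_def o_def)
    also have "\<dots> = integral {T - \<tau>bar..T} (\<lambda>s. norm (x' s - x s))"
      by (subst integral_shift_Icc_real) (simp add: add.commute)
    also have "\<dots> \<le> integral {T - \<tau>bar..T} m1"
    proof (rule integral_le[OF _ m1_integral(1)])
      show "(\<lambda>s. norm (x' s - x s)) integrable_on {T - \<tau>bar..T}"
        by (intro integrable_continuous_interval continuous_intros continuous_on_subset[OF px(4)] continuous_on_subset[OF px'(4)])
          (use t in auto)
      show "norm (x' s - x s) \<le> m1 s" if "s \<in> {T - \<tau>bar..T}" for s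
        by (rule dev_le_m1) (use that t in auto)
    qed
    also have "\<dots> \<le> (dev1 + dev2 * (T - (T - \<tau>bar))) * (len * Q)" by (rule m1_integral(2)) (use delay_pos in auto)
    finally show "integral {-\<tau>bar..0} (\<lambda>\<theta>. norm (segment_at x' T \<theta> - segment_at x T \<theta>)) \<le> (dev1 + dev2 * \<tau>bar) * (len * Q)"
      by simp
  qed (use lg in auto)
  also have "\<dots> = lg * (dev1 + dev2 * (1 + \<tau>bar)) * (len * Q)" by (simp add: algebra_simps)
  finally show ?thesis by (simp add: segment_at_def)
qed

lemma running_integrable:
  assumes "\<gamma> \<in> controls A t T"
  shows "(\<lambda>r. L (r, x r, x (lag x r), \<gamma> r)) integrable_on {t..T}" "(\<lambda>r. L (r, x' r, x' (lag x' r), \<gamma> r)) integrable_on {t..T}"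
  using path_integrable[OF L_cont px(4) t(1) assms] path_integrable[OF L_cont px'(4) t(1) assms]
  by (auto simp: absolutely_integrable_on_def)

lemma running_state_dev:
  "integral {t..T} (\<lambda>r. L (r, x' r, x' (lag x' r), \<beta> r)) - integral {t..T} (\<lambda>r. L (r, x r, x (lag x r), \<beta> r))
    \<le> lL * (1 + K * l\<tau>) * dev3 * (len * Q)"
proof -
  let ?D = "\<lambda>r. L (r, x' r, x' (lag x' r), \<beta> r) - L (r, x r, x (lag x r), \<beta> r)"
  have c: "0 \<le> lL * (1 + K * l\<tau>)" using lL(1) K_nonneg l\<tau>(1) by auto
  have DI: "?D integrable_on {t..T}" by (intro integrable_diff running_integrable \<beta>)
  have "integral {t..T} (\<lambda>r. L (r, x' r, x' (lag x' r), \<beta> r)) - integral {t..T} (\<lambda>r. L (r, x r, x (lag x r), \<beta> r)) = integral {t..T} ?D"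
    by (rule integral_diff[symmetric]) (rule running_integrable[OF \<beta>])+
  also have "\<dots> = integral {t..T} (\<lambda>r. if r \<in> N then 0 else ?D r)"
    by (rule integral_spike[OF N]) auto
  also have "\<dots> \<le> integral {t..T} (\<lambda>r. if r \<in> N then 0 else lL * (1 + K * l\<tau>) * m r)"
  proof (rule integral_le)
    show "(\<lambda>r. if r \<in> N then 0 else ?D r) integrable_on {t..T}" by (rule integrable_spike[OF DI N]) auto
    show "(\<lambda>r. if r \<in> N then 0 else lL * (1 + K * l\<tau>) * m r) integrable_on {t..T}"
      by (rule integrable_spike[OF integrable_on_mult_right[OF m_integral(1)] N]) auto
    fix r assume r: "r \<in> {t..T}"
    show "(if r \<in> N then 0 else ?D r) \<le> (if r \<in> N then 0 else lL * (1 + K * l\<tau>) * m r)"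
    proof (cases "r \<in> N")
      case False
      then have "\<beta> r \<in> A" using r \<beta> by (auto simp: controls_def N_def)
      note lb = lag_bounds(4)[OF r t(1)]
      have rr: "r \<in> {t - \<tau>bar..T}" using r delay_pos by auto
      have "?D r \<le> lL * (norm (x' r - x r) + norm (x' (lag x' r) - x (lag x r)))"
        using lL(2)[of r "\<beta> r" "x' r" "x' (lag x' r)" "x r" "x (lag x r)"] r t \<open>\<beta> r \<in> A\<close>
          px(2)[OF rr] px'(2)[OF rr] px(2)[OF lb] px'(2)[OF lb] by auto
      also have "\<dots> \<le> lL * (norm (x' r - x r) + (K * l\<tau> * norm (x' r - x r) + norm (x' (lag x' r) - x (lag x' r))))"
        using delayed_diff[OF px(3) r t(1), of x'] lL(1) by (intro mult_left_mono add_left_mono) auto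
      also have "\<dots> \<le> lL * ((1 + K * l\<tau>) * (norm (x' r - x r) + norm (x' (lag x' r) - x (lag x' r))))"
      proof (rule mult_left_mono)
        have "0 \<le> K * l\<tau> * norm (x' (lag x' r) - x (lag x' r))" using K_nonneg l\<tau>(1) by simp
        then show "norm (x' r - x r) + (K * l\<tau> * norm (x' r - x r) + norm (x' (lag x' r) - x (lag x' r)))
            \<le> (1 + K * l\<tau>) * (norm (x' r - x r) + norm (x' (lag x' r) - x (lag x' r)))"
          by (simp add: distrib_right distrib_left)
      qed (use lL in auto)
      also have "\<dots> \<le> lL * ((1 + K * l\<tau>) * m r)"
        using dev_le_m[OF r] K_nonneg l\<tau>(1) lL(1) by (intro mult_left_mono) auto
      finally show ?thesis using False by (simp add: mult.assoc)
    qed auto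
  qed
  also have "\<dots> = integral {t..T} (\<lambda>r. lL * (1 + K * l\<tau>) * m r)" by (rule integral_spike[OF N]) auto
  also have "\<dots> \<le> lL * (1 + K * l\<tau>) * (dev3 * (len * Q))"
    using mult_left_mono[OF m_integral(2) c] by simp
  finally show ?thesis by (simp add: mult_ac)
qed

text \<open>The gradient inequality at \<open>abar\<close> with zero momentum yields the gain
  \<open>\<mu> / 2 * q\<close> and a term linear in \<open>\<alpha> r - abar\<close>. With the
  gradient frozen at \<open>\<sigma>\<close> the linear term integrates to zero; freezing costs an
  error of order \<open>len\<close>, because the trajectory and its lagged value are Lipschitz in
  time.\<close>

lemma running_control_dev:
  "integral {t..T} (\<lambda>r. L (r, x r, x (lag x r), \<beta> r)) - integral {t..T} (\<lambda>r. L (r, x r, x (lag x r), \<alpha> r))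
    \<le> lH * (1 + K + K * lagK) * (len * Q) - \<mu> / 2 * q"
proof -
  let ?D = "\<lambda>r. L (r, x r, x (lag x r), \<beta> r) - L (r, x r, x (lag x r), \<alpha> r)"
  let ?v = "\<lambda>r. \<alpha> r - abar"
  define G where "G = Ha (\<sigma>, x \<sigma>, x (lag x \<sigma>), 0, abar)"
  define c where "c = lH * (1 + K + K * lagK)"
  have DI: "?D integrable_on {t..T}" by (intro integrable_diff running_integrable \<beta> \<alpha>)
  have sub: "{\<sigma>..\<sigma> + len} \<subseteq> {t..T}" using cell by auto
  have "integral {t..T} (\<lambda>r. L (r, x r, x (lag x r), \<beta> r)) - integral {t..T} (\<lambda>r. L (r, x r, x (lag x r), \<alpha> r)) = integral {t..T} ?D"
    by (rule integral_diff[symmetric]) (rule running_integrable[OF \<beta>] running_integrable[OF \<alpha>])+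
  also have "\<dots> = integral {\<sigma>..\<sigma> + len} ?D"
    by (rule integral_supported[OF N]) (use rhs_dev(3) sub in auto)
  also have "\<dots> = integral {\<sigma>..\<sigma> + len} (\<lambda>r. if r \<in> N then 0 else ?D r)"
    by (rule integral_spike[OF N]) auto
  also have "\<dots> \<le> integral {\<sigma>..\<sigma> + len} (\<lambda>r. if r \<in> N then 0 else c * len * norm (?v r) - \<mu> / 2 * (norm (?v r))\<^sup>2 - G \<bullet> ?v r)"
  proof (rule integral_le)
    show "(\<lambda>r. if r \<in> N then 0 else ?D r) integrable_on {\<sigma>..\<sigma> + len}"
      by (rule integrable_spike[OF integrable_on_subinterval[OF DI sub] N]) auto
    have "(\<lambda>r. c * len * norm (?v r) - \<mu> / 2 * (norm (?v r))\<^sup>2 - G \<bullet> ?v r) integrable_on {\<sigma>..\<sigma> + len}"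
      using integrable_linear[OF dev_integrable(2) bounded_linear_inner_right[of G]]
      by (intro integrable_diff integrable_on_mult_right dev_integrable) (simp add: o_def)
    then show "(\<lambda>r. if r \<in> N then 0 else c * len * norm (?v r) - \<mu> / 2 * (norm (?v r))\<^sup>2 - G \<bullet> ?v r) integrable_on {\<sigma>..\<sigma> + len}"
      by (rule integrable_spike[OF _ N]) auto
    fix r assume r: "r \<in> {\<sigma>..\<sigma> + len}"
    show "(if r \<in> N then 0 else ?D r) \<le> (if r \<in> N then 0 else c * len * norm (?v r) - \<mu> / 2 * (norm (?v r))\<^sup>2 - G \<bullet> ?v r)"
    proof (cases "r \<in> N")
      case False
      have rt: "r \<in> {t..T}" "r \<in> {t0..T}" "\<sigma> \<in> {t..T}" "\<sigma> \<in> {t0..T}" using r cell t by auto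
      have \<alpha>r: "\<alpha> r \<in> A" using rt False \<alpha> by (auto simp: controls_def N_def)
      have \<beta>r: "\<beta> r = abar" by (rule \<beta>_cell) (use r False in \<open>auto simp: N_def\<close>)
      let ?G = "Ha (r, x r, x (lag x r), 0, abar)"
      have "\<bar>r - \<sigma>\<bar> \<le> len" using r by auto
      have "norm (x r - x \<sigma>) \<le> K * \<bar>r - \<sigma>\<bar>"
        using lipschitz_onD[OF px(3), of r \<sigma>] rt delay_pos by (simp add: dist_norm)
      also have "\<dots> \<le> K * len" using \<open>\<bar>r - \<sigma>\<bar> \<le> len\<close> K_nonneg by (rule mult_left_mono)
      finally have d1: "norm (x r - x \<sigma>) \<le> K * len" .
      have "norm (x (lag x r) - x (lag x \<sigma>)) \<le> K * lagK * \<bar>r - \<sigma>\<bar>"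
        by (rule lag_lipschitz(2)[OF t(1) px(3) px(2) rt(1,3)])
      also have "\<dots> \<le> K * lagK * len" using \<open>\<bar>r - \<sigma>\<bar> \<le> len\<close> K_nonneg lagK_pos by (intro mult_left_mono) auto
      finally have d2: "norm (x (lag x r) - x (lag x \<sigma>)) \<le> K * lagK * len" .
      have "norm (?G - G) \<le> lH * (\<bar>r - \<sigma>\<bar> + norm (x r - x \<sigma>) + norm (x (lag x r) - x (lag x \<sigma>)) + norm (0 - 0 :: real^'b))"
        unfolding G_def by (rule lH(2)[OF rt(2,4) abar])
      also have "\<dots> \<le> lH * (len + K * len + K * lagK * len + 0)"
        using \<open>\<bar>r - \<sigma>\<bar> \<le> len\<close> d1 d2 lH(1) by (intro mult_left_mono add_mono) auto
      also have "\<dots> = c * len" by (simp add: c_def algebra_simps)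
      finally have "norm (?G - G) \<le> c * len" .
      then have "norm (?G - G) * norm (?v r) \<le> c * len * norm (?v r)" by (rule mult_right_mono) simp
      then have "- (c * len * norm (?v r)) \<le> (?G - G) \<bullet> ?v r"
        using Cauchy_Schwarz_ineq2[of "?G - G" "?v r"] by linarith
      moreover have "L (r, x r, x (lag x r), abar) + ?G \<bullet> ?v r + \<mu> / 2 * (norm (?v r))\<^sup>2 \<le> L (r, x r, x (lag x r), \<alpha> r)"
        using hamiltonian_gradient_inequality(1)[OF rt(2) \<alpha>r abar, of "x r" "x (lag x r)" 0] by simp
      ultimately show ?thesis using False \<beta>r by (simp add: inner_diff_left)
    qed auto
  qed
  also have "\<dots> = integral {\<sigma>..\<sigma> + len} (\<lambda>r. c * len * norm (?v r) - \<mu> / 2 * (norm (?v r))\<^sup>2 - G \<bullet> ?v r)"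
    by (rule integral_spike[OF N]) auto
  also have "\<dots> = integral {\<sigma>..\<sigma> + len} (\<lambda>r. c * len * norm (?v r)) - integral {\<sigma>..\<sigma> + len} (\<lambda>r. \<mu> / 2 * (norm (?v r))\<^sup>2)
     - integral {\<sigma>..\<sigma> + len} (\<lambda>r. G \<bullet> ?v r)"
  proof -
    have i: "(\<lambda>r. G \<bullet> ?v r) integrable_on {\<sigma>..\<sigma> + len}"
      using integrable_linear[OF dev_integrable(2) bounded_linear_inner_right[of G]] by (simp add: o_def)
    have j: "(\<lambda>r. c * len * norm (?v r)) integrable_on {\<sigma>..\<sigma> + len}" "(\<lambda>r. \<mu> / 2 * (norm (?v r))\<^sup>2) integrable_on {\<sigma>..\<sigma> + len}"
      by (intro integrable_on_mult_right dev_integrable)+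
    show ?thesis using integral_diff[OF integrable_diff[OF j] i] integral_diff[OF j] by simp
  qed
  also have "integral {\<sigma>..\<sigma> + len} (\<lambda>r. G \<bullet> ?v r) = G \<bullet> integral {\<sigma>..\<sigma> + len} ?v"
    using integral_linear[OF dev_integrable(2) bounded_linear_inner_right[of G]] by (simp add: o_def)
  also have "integral {\<sigma>..\<sigma> + len} ?v = 0"
  proof -
    have "\<alpha> integrable_on {\<sigma>..\<sigma> + len}"
      using integrable_add[OF dev_integrable(2) integrable_const_ivl[of abar \<sigma> "\<sigma> + len"]] by simp
    from integral_diff[OF this integrable_const_ivl[of abar \<sigma> "\<sigma> + len"]]
    show ?thesis using cell by (simp add: mean[symmetric])
  qed
  finally show ?thesis by (simp add: c_def Q_def q_def mult.assoc)
qed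

text \<open>The first-order loss \<open>avgc * len * Q\<close> is absorbed pointwise by Young's
  inequality into half of the gain \<open>\<mu> / 2 * q\<close>; the remainder, of size
  \<open>len\<^sup>2\<close> per unit time, adds up to \<open>len ^ 3\<close> on the cell.\<close>

lemma averaging_cost: "J t w \<beta> \<le> J t w \<alpha> - \<mu> / 4 * q + avgc\<^sup>2 / \<mu> * len ^ 3"
proof -
  have "J t w \<beta> - J t w \<alpha> \<le> avgc * (len * Q) - \<mu> / 2 * q"
    using running_state_dev running_control_dev terminal_dev by (simp add: J_def avgc_def algebra_simps)
  moreover have "avgc * (len * Q) \<le> \<mu> / 4 * q + avgc\<^sup>2 / \<mu> * len ^ 3"
  proof -
    have pt: "avgc * len * n \<le> \<mu> / 4 * n\<^sup>2 + avgc\<^sup>2 / \<mu> * len\<^sup>2" for n :: real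
    proof -
      have "0 \<le> (\<mu> * n / 2 - avgc * len)\<^sup>2 / \<mu>" using \<mu>(1) by simp
      also have "\<dots> = \<mu> / 4 * n\<^sup>2 + avgc\<^sup>2 / \<mu> * len\<^sup>2 - avgc * len * n"
        using \<mu>(1) by (simp add: field_simps power2_eq_square)
      finally show ?thesis by simp
    qed
    have "avgc * (len * Q) = integral {\<sigma>..\<sigma> + len} (\<lambda>r. avgc * len * norm (\<alpha> r - abar))" by (simp add: Q_def)
    also have "\<dots> \<le> integral {\<sigma>..\<sigma> + len} (\<lambda>r. \<mu> / 4 * (norm (\<alpha> r - abar))\<^sup>2 + avgc\<^sup>2 / \<mu> * len\<^sup>2)"
      by (intro integral_le integrable_add integrable_on_mult_right dev_integrable integrable_const_ivl pt)
    also have "\<dots> = \<mu> / 4 * q + avgc\<^sup>2 / \<mu> * len\<^sup>2 * len"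
      using cell integral_add[OF integrable_on_mult_right[OF dev_integrable(4)] integrable_const_ivl, of "\<mu> / 4" "avgc\<^sup>2 / \<mu> * len\<^sup>2"]
      by (simp add: q_def)
    finally show ?thesis by (simp add: power3_eq_cube power2_eq_square mult_ac)
  qed
  ultimately show ?thesis by linarith
qed

end

subsection \<open>Near-optimal step controls\<close>

lemma less_sets_lebesgue_on_Ioo:
  "{s \<in> space (lebesgue_on {a<..<b}). s < (c::real)} \<in> sets (lebesgue_on {a<..<b})"
  "{s \<in> space (lebesgue_on {a<..<b}). s \<le> (c::real)} \<in> sets (lebesgue_on {a<..<b})"
proof -
  have "{s \<in> space (lebesgue_on {a<..<b}). s < c} = {a<..<b} \<inter> {..<c}"
    "{s \<in> space (lebesgue_on {a<..<b}). s \<le> c} = {a<..<b} \<inter> {..c}" by auto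
  then show "{s \<in> space (lebesgue_on {a<..<b}). s < c} \<in> sets (lebesgue_on {a<..<b})"
    "{s \<in> space (lebesgue_on {a<..<b}). s \<le> c} \<in> sets (lebesgue_on {a<..<b})"
    by (auto simp: sets_restrict_space_iff)
qed

context delay_control
begin

lemma averaging_decreases_cost:
  assumes "t0 \<le> t" "t < T" "hist_ok w" "\<alpha> \<in> controls A t T" "\<beta> \<in> controls A t T"
    "t \<le> \<sigma>" "len > 0" "\<sigma> + len \<le> T" "len *\<^sub>R abar = integral {\<sigma>..\<sigma> + len} \<alpha>" "abar \<in> A"
    "\<And>s. s \<in> {\<sigma><..<\<sigma> + len} \<Longrightarrow> \<beta> s = abar"
    "\<And>s. s \<in> {t<..<\<sigma>} \<union> {\<sigma> + len<..<T} \<Longrightarrow> \<beta> s = \<alpha> s"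
  shows "J t w \<beta> \<le> J t w \<alpha> - \<mu> / 4 * integral {\<sigma>..\<sigma> + len} (\<lambda>r. (norm (\<alpha> r - abar))\<^sup>2) + avgc\<^sup>2 / \<mu> * len ^ 3"
proof -
  interpret control_averaging t0 T \<tau>bar A f \<tau> lf Cf l\<tau> L g Ha R0 d lt lft lL lg \<mu> lH t w \<alpha> \<beta> \<sigma> len abar
    by unfold_locales (use assms in auto)
  show ?thesis using averaging_cost unfolding q_def .
qed

lemma controls_integrable:
  assumes "\<alpha> \<in> controls A t T"
  shows "\<alpha> absolutely_integrable_on {t..T}" "t \<le> a \<Longrightarrow> b \<le> T \<Longrightarrow> \<alpha> integrable_on {a..b}"
    "t \<le> a \<Longrightarrow> b \<le> T \<Longrightarrow> (\<lambda>r. norm (\<alpha> r - c)) integrable_on {a..b}"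
    "t \<le> a \<Longrightarrow> b \<le> T \<Longrightarrow> (\<lambda>r. (norm (\<alpha> r - c))\<^sup>2) integrable_on {a..b}"
proof -
  obtain B where B: "\<And>a. a \<in> A \<Longrightarrow> norm a \<le> B" using A(2) by (meson bounded_iff compact_imp_bounded)
  show 1: "\<alpha> absolutely_integrable_on {t..T}"
    using B assms by (intro bounded_measurable_integrable_on_open[where B=B]) (auto simp: controls_def)
  show "\<alpha> integrable_on {a..b}" if "t \<le> a" "b \<le> T"
    using 1 that unfolding absolutely_integrable_on_def by (auto intro: integrable_on_subinterval)
  have "(\<lambda>r. norm (\<alpha> r - c)) absolutely_integrable_on {t..T}"
    by (intro absolutely_integrable_norm[unfolded o_def] set_integral_diff 1) (auto intro: absolutely_integrable_on_const)
  then show "(\<lambda>r. norm (\<alpha> r - c)) integrable_on {a..b}" if "t \<le> a" "b \<le> T"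
    using that unfolding absolutely_integrable_on_def by (auto intro: integrable_on_subinterval)
  have "(\<lambda>r. (norm (\<alpha> r - c))\<^sup>2) absolutely_integrable_on {t..T}"
  proof (rule bounded_measurable_integrable_on_open)
    show "(\<lambda>r. (norm (\<alpha> r - c))\<^sup>2) \<in> borel_measurable (lebesgue_on {t<..<T})"
      using assms by (auto simp: controls_def intro!: borel_measurable_power borel_measurable_norm borel_measurable_diff)
    show "norm ((norm (\<alpha> s - c))\<^sup>2) \<le> (B + norm c)\<^sup>2" if s: "s \<in> {t<..<T}" for s
    proof -
      have "norm (\<alpha> s - c) \<le> B + norm c"
        using B[of "\<alpha> s"] s assms norm_triangle_ineq4[of "\<alpha> s" c] by (fastforce simp: controls_def)
      then have "(norm (\<alpha> s - c))\<^sup>2 \<le> (B + norm c)\<^sup>2" by (rule power_mono) simp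
      then show ?thesis by simp
    qed
  qed
  then show "(\<lambda>r. (norm (\<alpha> r - c))\<^sup>2) integrable_on {a..b}" if "t \<le> a" "b \<le> T"
    using that unfolding absolutely_integrable_on_def by (auto intro: integrable_on_subinterval)
qed

text \<open>A mean outside the closed convex set \<open>A\<close> could be strictly separated from
  it, and integrating the separating inequality along \<open>\<alpha>\<close> contradicts this. Cell
  means are therefore admissible control values.\<close>

lemma mean_in_control_set:
  assumes \<alpha>: "\<alpha> \<in> controls A t T" and c: "t \<le> \<sigma>" "len > 0" "\<sigma> + len \<le> T"
  shows "(1 / len) *\<^sub>R integral {\<sigma>..\<sigma> + len} \<alpha> \<in> A"
proof (rule ccontr)
  let ?m = "(1 / len) *\<^sub>R integral {\<sigma>..\<sigma> + len} \<alpha>"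
  assume "?m \<notin> A"
  then obtain p b where pb: "p \<bullet> ?m < b" "\<And>a. a \<in> A \<Longrightarrow> p \<bullet> a > b"
    using separating_hyperplane_closed_point[of A ?m] A compact_imp_closed by blast
  have I: "\<alpha> integrable_on {\<sigma>..\<sigma> + len}" using controls_integrable(2)[OF \<alpha>] c by auto
  have pI: "(\<lambda>r. p \<bullet> \<alpha> r) integrable_on {\<sigma>..\<sigma> + len}" "integral {\<sigma>..\<sigma> + len} (\<lambda>r. p \<bullet> \<alpha> r) = p \<bullet> integral {\<sigma>..\<sigma> + len} \<alpha>"
    using integrable_linear[OF I bounded_linear_inner_right[of p]] integral_linear[OF I bounded_linear_inner_right[of p]]
    by (simp_all add: o_def)
  have "b * len = integral {\<sigma><..<\<sigma> + len} (\<lambda>_. b)"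
    using integral_open_interval[of \<sigma> "\<sigma> + len" "\<lambda>_. b"] c by simp
  also have "\<dots> \<le> integral {\<sigma><..<\<sigma> + len} (\<lambda>r. p \<bullet> \<alpha> r)"
  proof (rule integral_le)
    show "(\<lambda>_. b) integrable_on {\<sigma><..<\<sigma> + len}" "(\<lambda>r. p \<bullet> \<alpha> r) integrable_on {\<sigma><..<\<sigma> + len}"
      using integrable_on_open_interval[of _ \<sigma> "\<sigma> + len", unfolded box_real] pI by auto
    show "b \<le> p \<bullet> \<alpha> r" if "r \<in> {\<sigma><..<\<sigma> + len}" for r
      using pb(2)[of "\<alpha> r"] \<alpha> that c by (auto simp: controls_def intro!: less_imp_le)
  qed
  also have "\<dots> = p \<bullet> integral {\<sigma>..\<sigma> + len} \<alpha>"
    using integral_open_interval[of \<sigma> "\<sigma> + len" "\<lambda>r. p \<bullet> \<alpha> r"] pI by simp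
  finally have "b \<le> p \<bullet> ?m" using c by (simp add: field_simps)
  then show False using pb(1) by simp
qed

text \<open>Only with a lower bound does the real-valued \<open>Inf\<close> lie below each of the
  costs. The running cost is bounded on the compact range of its arguments, and the terminal cost is
  compared with that of the zero history.\<close>

lemma J_bdd_below:
  assumes "t0 \<le> t" "t < T" "hist_ok w"
  shows "bdd_below (J t w ` controls A t T)"
proof -
  define R1 where "R1 = sol_bound R0"
  define S where "S = {t0..T} \<times> cball (0::real^'n) R1 \<times> cball (0::real^'n) R1 \<times> A"
  have "compact S" unfolding S_def using A by (intro compact_Times compact_cball) auto
  moreover have "continuous_on S L" by (rule continuous_on_subset[OF L_cont]) (auto simp: S_def)
  ultimately have "compact (L ` S)" by (rule compact_continuous_image[rotated])
  then obtain B where B: "\<And>q. q \<in> S \<Longrightarrow> norm (L q) \<le> B" by (meson bounded_iff compact_imp_bounded imageI)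
  have R1: "R1 \<ge> 0" using R0 by (auto simp: R1_def sol_bound_def)
  show ?thesis
  proof (rule bdd_belowI2[where m="- (\<bar>B\<bar> * (T - t)) - (\<bar>g (0, \<lambda>_. 0)\<bar> + lg * (R1 + R1 * \<tau>bar))"])
    fix \<alpha> assume \<alpha>: "\<alpha> \<in> controls A t T"
    note P = tr_props[OF assms \<alpha>]
    let ?x = "tr t w \<alpha>"
    let ?L = "\<lambda>r. L (r, ?x r, ?x (lag ?x r), \<alpha> r)"
    have LI: "?L integrable_on {t..T}"
      using path_integrable[OF L_cont P(4) assms(1) \<alpha>] by (auto simp: absolutely_integrable_on_def)
    have "norm (integral {t..T} ?L) \<le> \<bar>B\<bar> * (T - t)"
    proof (rule integral_lipschitz_bound[OF LI])
      fix r assume r: "r \<in> {t<..<T}"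
      then have "(r, ?x r, ?x (lag ?x r), \<alpha> r) \<in> S"
        using P(2)[of r] P(2)[OF lag_bounds(4)[of r t, OF _ assms(1)], of ?x] assms \<alpha> delay_pos
        by (auto simp: S_def R1_def controls_def)
      then show "norm (?L r) \<le> \<bar>B\<bar>" using B by fastforce
    qed (use assms in auto)
    moreover have "\<bar>g (segment_at ?x T 0, segment_at ?x T) - g ((\<lambda>_. 0) (0::real), (\<lambda>_. 0))\<bar>
      \<le> lg * (norm (segment_at ?x T 0 - (\<lambda>_. 0) (0::real)) + integral {-\<tau>bar..0} (\<lambda>\<theta>. norm (segment_at ?x T \<theta> - (\<lambda>_. 0) \<theta>)))"
    proof (rule lg(2))
      show "K-lipschitz_on {-\<tau>bar..0} (segment_at ?x T)"
      proof (rule lipschitz_onI[OF _ K_nonneg])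
        fix a b assume "a \<in> {-\<tau>bar..0}" "b \<in> {-\<tau>bar..0}"
        then show "dist (segment_at ?x T a) (segment_at ?x T b) \<le> K * dist a b"
          using lipschitz_onD[OF P(3), of "T + a" "T + b"] assms by (simp add: segment_at_def)
      qed
      show "0-lipschitz_on {-\<tau>bar..0} (\<lambda>_. 0::real^'n)" by (rule lipschitz_on_constant)
      show "norm (segment_at ?x T \<theta>) \<le> sol_bound R0" if "\<theta> \<in> {-\<tau>bar..0}" for \<theta>
        unfolding segment_at_def by (rule P(2)) (use that assms in auto)
      show "norm (0::real^'n) \<le> sol_bound R0" using R1 by (simp add: R1_def)
    qed
    moreover have "lg * (norm (segment_at ?x T 0 - (\<lambda>_. 0) (0::real)) + integral {-\<tau>bar..0} (\<lambda>\<theta>. norm (segment_at ?x T \<theta> - (\<lambda>_. 0) \<theta>)))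
      \<le> lg * (R1 + R1 * \<tau>bar)"
    proof (intro mult_left_mono add_mono)
      show "norm (segment_at ?x T 0 - (\<lambda>_. 0) (0::real)) \<le> R1"
        using P(2)[of T] assms delay_pos by (simp add: segment_at_def R1_def)
      have "continuous_on {-\<tau>bar..0} (\<lambda>\<theta>. ?x (T + \<theta>))"
        by (intro continuous_on_compose2[OF P(4)] continuous_intros) (use assms in auto)
      then have "(\<lambda>\<theta>. norm (segment_at ?x T \<theta> - (\<lambda>_. 0) \<theta>)) integrable_on {-\<tau>bar..0}"
        unfolding segment_at_def by (intro integrable_continuous_interval) (auto intro!: continuous_intros)
      then have "integral {-\<tau>bar..0} (\<lambda>\<theta>. norm (segment_at ?x T \<theta> - (\<lambda>_. 0) \<theta>)) \<le> integral {-\<tau>bar..0} (\<lambda>_. R1)"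
        by (rule integral_le) (use P(2) assms in \<open>auto simp: segment_at_def R1_def\<close>)
      then show "integral {-\<tau>bar..0} (\<lambda>\<theta>. norm (segment_at ?x T \<theta> - (\<lambda>_. 0) \<theta>)) \<le> R1 * \<tau>bar"
        using delay_pos by (simp add: mult.commute)
    qed (use lg in auto)
    ultimately show "- (\<bar>B\<bar> * (T - t)) - (\<bar>g (0, \<lambda>_. 0)\<bar> + lg * (R1 + R1 * \<tau>bar)) \<le> J t w \<alpha>"
      by (simp add: J_def segment_at_def abs_le_iff) linarith
  qed
qed

lemma controls_nonempty: "controls A t T \<noteq> {}"
proof -
  obtain a where "a \<in> A" using A(1) by blast
  then have "(\<lambda>_. a) \<in> controls A t T" by (simp add: controls_def)
  then show ?thesis by blast
qed

text \<open>One constant for the two bounds of \<open>near_optimal_step_control\<close>: the first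
  two summands cover the excess cost, and the last is twice the constant \<open>c\<close> that
  bounds, in units of the cell length, how far a cell mean lies from the mean over a pair of
  adjacent cells.\<close>

definition "gridc = 1 + avgc\<^sup>2 / \<mu> * (T - t0) + 2 * (2 / \<mu> * (8 * (avgc\<^sup>2 / \<mu>) + 1) + 1)"

lemma gridc_nonneg: "gridc \<ge> 1"
  using \<mu>(1) time unfolding gridc_def by (auto intro!: add_nonneg_nonneg mult_nonneg_nonneg divide_nonneg_pos)

text \<open>The step control consists of the cell means of a control that is optimal up to \<open>h\<^sup>3\<close>. Adjacent
  means differ by \<open>O(h)\<close>, since averaging over the union of the two cells could otherwise lower the cost
  by more than \<open>h\<^sup>3\<close>.\<close>

lemma near_optimal_step_control:
  assumes t: "t0 \<le> t" "t < T" and w: "hist_ok w" and eps: "0 < \<epsilon>" "\<epsilon> \<le> 1"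
  obtains \<beta> S where "\<beta> \<in> controls A t T" "J t w \<beta> \<le> Inf (J t w ` controls A t T) + gridc * \<epsilon>\<^sup>2"
    "\<And>s s'. s \<in> {t<..<T} \<Longrightarrow> s' \<in> {t<..<T} \<Longrightarrow> norm (\<beta> s - \<beta> s') \<le> gridc * (\<bar>s - s'\<bar> + \<epsilon>)"
    "finite S" "\<And>a b s s'. {a<..<b} \<subseteq> {t<..<T} - S \<Longrightarrow> s \<in> {a<..<b} \<Longrightarrow> s' \<in> {a<..<b} \<Longrightarrow> \<beta> s = \<beta> s'"
proof -
  define V where "V = Inf (J t w ` controls A t T)"
  define C where "C = avgc\<^sup>2 / \<mu>"
  have C: "C \<ge> 0" using \<mu>(1) by (simp add: C_def)
  have Vle: "V \<le> J t w \<gamma>" if "\<gamma> \<in> controls A t T" for \<gamma>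
    unfolding V_def using J_bdd_below[OF t w] that by (intro cINF_lower)
  obtain n0 :: nat where n0: "(T - t) / \<epsilon> < real n0" using reals_Archimedean2 by blast
  define n where "n = Suc n0"
  define h where "h = (T - t) / real n"
  have n: "real n > 0" by (simp add: n_def)
  have h: "h > 0" using t n by (simp add: h_def)
  have hn: "real n * h = T - t" using n by (simp add: h_def)
  have heps: "h \<le> \<epsilon>"
  proof -
    have "T - t < real n0 * \<epsilon>" using n0 eps(1) by (simp add: field_simps)
    also have "\<dots> \<le> real n * \<epsilon>" using eps(1) by (simp add: n_def)
    finally show ?thesis using n by (simp add: h_def field_simps)
  qed
  \<comment> \<open>The tolerance \<open>h ^ 3\<close> has the same order as the loss incurred by
    averaging over one cell.\<close>
  obtain \<alpha> where \<alpha>: "\<alpha> \<in> controls A t T" and J\<alpha>: "J t w \<alpha> < V + h ^ 3"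
  proof -
    have "Inf (J t w ` controls A t T) < V + h ^ 3" using h by (simp add: V_def)
    then show thesis
      using cInf_lessD[of "J t w ` controls A t T" "V + h ^ 3"] controls_nonempty that by blast
  qed
  define \<sigma> where "\<sigma> i = t + real i * h" for i
  have \<sigma>S: "\<sigma> (Suc i) = \<sigma> i + h" for i by (simp add: \<sigma>_def algebra_simps)
  have \<sigma>t: "t \<le> \<sigma> i" for i using h by (simp add: \<sigma>_def)
  have \<sigma>T: "\<sigma> i \<le> T" if "i \<le> n" for i
  proof -
    have "real i * h \<le> real n * h" using that h by (intro mult_right_mono) auto
    then show ?thesis using hn by (simp add: \<sigma>_def)
  qed
  define a where "a i = (1 / h) *\<^sub>R integral {\<sigma> i..\<sigma> i + h} \<alpha>" for i
  have aA: "a i \<in> A" if "i < n" for i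
    unfolding a_def by (rule mean_in_control_set[OF \<alpha> \<sigma>t h]) (use \<sigma>T[of "Suc i"] that in \<open>simp add: \<sigma>S\<close>)
  define idx where "idx s = nat \<lfloor>(s - t) / h\<rfloor>" for s
  have idx: "\<sigma> (idx s) \<le> s" "s < \<sigma> (idx s) + h" if "t \<le> s" for s
  proof -
    have "0 \<le> (s - t) / h" using that h by simp
    then have "real (idx s) = of_int \<lfloor>(s - t) / h\<rfloor>" by (simp add: idx_def)
    then have "real (idx s) \<le> (s - t) / h" "(s - t) / h < real (idx s) + 1" by linarith+
    then show "\<sigma> (idx s) \<le> s" "s < \<sigma> (idx s) + h" using h by (auto simp: \<sigma>_def field_simps)
  qed
  have idx_eq: "idx s = i" if "\<sigma> i \<le> s" "s < \<sigma> i + h" for s i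
  proof -
    have "real i \<le> (s - t) / h" "(s - t) / h < real i + 1" using that h by (auto simp: \<sigma>_def field_simps)
    then have "\<lfloor>(s - t) / h\<rfloor> = int i" by linarith
    then show ?thesis by (simp add: idx_def)
  qed
  have idxn: "idx s < n" if "t \<le> s" "s < T" for s
  proof -
    have "(s - t) / h < real n" using that hn h by (simp add: field_simps)
    moreover have "real (idx s) \<le> (s - t) / h" using idx(1)[OF that(1)] h by (simp add: \<sigma>_def field_simps)
    ultimately show ?thesis by linarith
  qed
  have idx_meas: "(\<lambda>s. a (idx s)) \<in> borel_measurable (lebesgue_on {t<..<T})"
  proof -
    have "(\<lambda>s. a (idx s)) \<in> borel_measurable borel" unfolding idx_def by measurable
    then have "(\<lambda>s. a (idx s)) \<in> borel_measurable lebesgue" using borel_measurable_lebesgue_preimage_borel by (simp add: measurable_completion)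
    then show ?thesis by (rule measurable_restrict_space1)
  qed
  \<comment> \<open>An interpolation between \<open>\<alpha>\<close> and the step control: means on
    the first \<open>j\<close> cells, \<open>\<alpha>\<close> afterwards. Passing from
    \<open>j\<close> to \<open>Suc j\<close> is one averaging step, and the \<open>n\<close> losses
    \<open>C * h ^ 3\<close> add up to \<open>C * (T - t) * h\<^sup>2\<close>.\<close>
  define \<gamma> where "\<gamma> j s = (if s < \<sigma> j then a (idx s) else \<alpha> s)" for j s
  have \<gamma>c: "\<gamma> j \<in> controls A t T" for j
  proof -
    have "\<gamma> j \<in> borel_measurable (lebesgue_on {t<..<T})"
      unfolding \<gamma>_def
      by (rule measurable_If[OF idx_meas _ less_sets_lebesgue_on_Ioo(1)]) (use \<alpha> in \<open>auto simp: controls_def\<close>)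
    moreover have "\<gamma> j s \<in> A" if "s \<in> {t<..<T}" for s
      using that aA[OF idxn] \<alpha> by (auto simp: \<gamma>_def controls_def)
    ultimately show ?thesis by (simp add: controls_def)
  qed
  have step: "J t w (\<gamma> (Suc j)) \<le> J t w (\<gamma> j) + C * h ^ 3" if j: "j < n" for j
  proof -
    have jT: "\<sigma> j + h \<le> T" using \<sigma>T[of "Suc j"] j by (simp add: \<sigma>S)
    have "J t w (\<gamma> (Suc j)) \<le> J t w (\<gamma> j) - \<mu> / 4 * integral {\<sigma> j..\<sigma> j + h} (\<lambda>r. (norm (\<gamma> j r - a j))\<^sup>2) + avgc\<^sup>2 / \<mu> * h ^ 3"
    proof (rule averaging_decreases_cost[OF t w \<gamma>c \<gamma>c \<sigma>t h jT _ aA[OF j]])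
      have "integral {\<sigma> j..\<sigma> j + h} (\<gamma> j) = integral {\<sigma> j..\<sigma> j + h} \<alpha>"
        by (rule integral_cong) (auto simp: \<gamma>_def)
      then show "h *\<^sub>R a j = integral {\<sigma> j..\<sigma> j + h} (\<gamma> j)" using h by (simp add: a_def)
      show "\<gamma> (Suc j) s = a j" if "s \<in> {\<sigma> j<..<\<sigma> j + h}" for s
        using that idx_eq[of j s] by (simp add: \<gamma>_def \<sigma>S)
      show "\<gamma> (Suc j) s = \<gamma> j s" if "s \<in> {t<..<\<sigma> j} \<union> {\<sigma> j + h<..<T}" for s
        using that h by (auto simp: \<gamma>_def \<sigma>S)
    qed
    moreover have "0 \<le> integral {\<sigma> j..\<sigma> j + h} (\<lambda>r. (norm (\<gamma> j r - a j))\<^sup>2)"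
      by (rule integral_nonneg[OF controls_integrable(4)[OF \<gamma>c \<sigma>t jT]]) auto
    then have "0 \<le> \<mu> / 4 * integral {\<sigma> j..\<sigma> j + h} (\<lambda>r. (norm (\<gamma> j r - a j))\<^sup>2)" using \<mu>(1) by simp
    ultimately show ?thesis by (simp add: C_def)
  qed
  have steps: "j \<le> n \<Longrightarrow> J t w (\<gamma> j) \<le> J t w (\<gamma> 0) + real j * (C * h ^ 3)" for j
  proof (induction j)
    case (Suc j)
    then show ?case using step[of j] by (simp add: algebra_simps)
  qed simp
  \<comment> \<open>The two controls agree on the open interval but may differ elsewhere, so
    equality of the costs is derived from equality of the trajectories.\<close>
  have J0: "J t w (\<gamma> 0) = J t w \<alpha>"
  proof -
    have 1: "\<sigma> 0 + h \<le> T" using \<sigma>T[of 1] n by (simp add: \<sigma>_def n_def)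
    have "\<gamma> 0 s = \<alpha> s" if "s \<in> {t<..<T}" for s using that by (simp add: \<gamma>_def \<sigma>_def)
    note eq = this
    have P: "tr t w (\<gamma> 0) s = tr t w \<alpha> s" if "s \<in> {t - \<tau>bar..T}" for s
    proof -
      have "integral {t..s} (\<lambda>r. rhs (tr t w \<alpha>) (\<gamma> 0) r - rhs (tr t w \<alpha>) \<alpha> r) = integral {t..s} (\<lambda>_. 0)" if "s \<in> {t..T}" for s
        by (rule integral_spike[of "{t, T}"]) (use that eq in \<open>auto simp: rhs_def\<close>)
      then show ?thesis
        using tr_diff_bound[OF t less_imp_le[OF t(2)] order_refl w w \<gamma>c[of 0] \<alpha>, of 0 0 s] that by simp
    qed
    have "J t w (\<gamma> 0) = J t w \<alpha>"
    proof -
      have "integral {t..T} (\<lambda>s. L (s, tr t w (\<gamma> 0) s, tr t w (\<gamma> 0) (lag (tr t w (\<gamma> 0)) s), \<gamma> 0 s))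
        = integral {t..T} (\<lambda>s. L (s, tr t w \<alpha> s, tr t w \<alpha> (lag (tr t w \<alpha>) s), \<alpha> s))"
      proof (rule integral_spike[of "{t, T}"])
        fix s assume s: "s \<in> {t..T} - {t, T}"
        then have "tr t w (\<gamma> 0) s = tr t w \<alpha> s" using delay_pos by (intro P) auto
        moreover have "lag (tr t w (\<gamma> 0)) s = lag (tr t w \<alpha>) s" using calculation by (simp add: lag_def)
        moreover have "tr t w (\<gamma> 0) (lag (tr t w \<alpha>) s) = tr t w \<alpha> (lag (tr t w \<alpha>) s)"
          using lag_bounds(4)[of s t] s t by (intro P) auto
        ultimately show "L (s, tr t w \<alpha> s, tr t w \<alpha> (lag (tr t w \<alpha>) s), \<alpha> s)
          = L (s, tr t w (\<gamma> 0) s, tr t w (\<gamma> 0) (lag (tr t w (\<gamma> 0)) s), \<gamma> 0 s)" using eq[of s] s by auto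
      qed auto
      moreover have "\<bar>g (segment_at (tr t w (\<gamma> 0)) T 0, segment_at (tr t w (\<gamma> 0)) T) - g (segment_at (tr t w \<alpha>) T 0, segment_at (tr t w \<alpha>) T)\<bar>
        \<le> lg * (norm (segment_at (tr t w (\<gamma> 0)) T 0 - segment_at (tr t w \<alpha>) T 0)
          + integral {-\<tau>bar..0} (\<lambda>\<theta>. norm (segment_at (tr t w (\<gamma> 0)) T \<theta> - segment_at (tr t w \<alpha>) T \<theta>)))"
      proof (rule lg(2))
        have seg: "K-lipschitz_on {-\<tau>bar..0} (segment_at y T)" if "K-lipschitz_on {t - \<tau>bar..T} y" for y
        proof (rule lipschitz_onI[OF _ K_nonneg])
          fix a b assume "a \<in> {-\<tau>bar..0}" "b \<in> {-\<tau>bar..0}"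
          then show "dist (segment_at y T a) (segment_at y T b) \<le> K * dist a b"
            using lipschitz_onD[OF that, of "T + a" "T + b"] t by (simp add: segment_at_def)
        qed
        show "K-lipschitz_on {-\<tau>bar..0} (segment_at (tr t w (\<gamma> 0)) T)" "K-lipschitz_on {-\<tau>bar..0} (segment_at (tr t w \<alpha>) T)"
          by (rule seg[OF tr_props(3)[OF t w \<gamma>c]] seg[OF tr_props(3)[OF t w \<alpha>]])+
      qed (use tr_props(2)[OF t w \<gamma>c] tr_props(2)[OF t w \<alpha>] t in \<open>auto simp: segment_at_def\<close>)
      moreover have "integral {-\<tau>bar..0} (\<lambda>\<theta>. norm (segment_at (tr t w (\<gamma> 0)) T \<theta> - segment_at (tr t w \<alpha>) T \<theta>)) = integral {-\<tau>bar..0} (\<lambda>_. 0)"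
        by (rule integral_cong) (use P t in \<open>auto simp: segment_at_def\<close>)
      moreover have "segment_at (tr t w (\<gamma> 0)) T 0 = segment_at (tr t w \<alpha>) T 0" using P[of T] t delay_pos by (simp add: segment_at_def)
      ultimately show ?thesis by (simp add: J_def segment_at_def)
    qed
    then show ?thesis .
  qed
  \<comment> \<open>The first summand stems from the variance bound, the final 1 from the remainder
    of Young's inequality in \<open>mean_dev\<close>.\<close>
  define c where "c = 2 / \<mu> * (8 * C + 1) + 1"
  have c: "c \<ge> 0" using C \<mu>(1) by (simp add: c_def)
  have gridc_eq: "gridc = 1 + C * (T - t0) + 2 * c" by (simp add: gridc_def c_def C_def)
  have "0 \<le> C * (T - t0)" using C time by simp
  then have c_gridc: "2 * c \<le> gridc" unfolding gridc_eq by linarith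
  \<comment> \<open>Averaging \<open>\<alpha>\<close> over the union of two adjacent cells cannot
    lower the cost by \<open>h ^ 3\<close> or more, since \<open>\<alpha>\<close> is optimal up to
    that amount. The cell now has length \<open>2 * h\<close>, whence the factor 8 in the cubic
    loss.\<close>
  have pair: "norm (a i - a (Suc i)) \<le> 2 * c * h" if i: "Suc i < n" for i
  proof -
    have iT: "\<sigma> i + 2 * h \<le> T" using \<sigma>T[of "Suc (Suc i)"] i by (simp add: \<sigma>S)
    have h2: "2 * h > 0" using h by simp
    define m where "m = (1 / (2 * h)) *\<^sub>R integral {\<sigma> i..\<sigma> i + 2 * h} \<alpha>"
    have mA: "m \<in> A" unfolding m_def by (rule mean_in_control_set[OF \<alpha> \<sigma>t h2 iT])
    define \<beta> where "\<beta> s = (if s < \<sigma> i then \<alpha> s else if s \<le> \<sigma> i + 2 * h then m else \<alpha> s)" for s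
    have \<beta>c: "\<beta> \<in> controls A t T"
    proof -
      have "\<beta> \<in> borel_measurable (lebesgue_on {t<..<T})"
        unfolding \<beta>_def using \<alpha>
        by (intro measurable_If less_sets_lebesgue_on_Ioo) (auto simp: controls_def)
      then show ?thesis using mA \<alpha> by (auto simp: \<beta>_def controls_def)
    qed
    define q where "q = integral {\<sigma> i..\<sigma> i + 2 * h} (\<lambda>r. (norm (\<alpha> r - m))\<^sup>2)"
    have "J t w \<beta> \<le> J t w \<alpha> - \<mu> / 4 * q + avgc\<^sup>2 / \<mu> * (2 * h) ^ 3"
      unfolding q_def
      by (rule averaging_decreases_cost[OF t w \<alpha> \<beta>c \<sigma>t h2 iT _ mA]) (use h in \<open>auto simp: m_def \<beta>_def\<close>)
    then have "\<mu> / 4 * q \<le> h ^ 3 + C * (2 * h) ^ 3" using Vle[OF \<beta>c] J\<alpha> by (simp add: C_def)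
    then have q: "q \<le> 4 / \<mu> * (8 * C + 1) * h ^ 3" using \<mu>(1) by (simp add: field_simps power_mult_distrib)
    have mean_dev: "norm (a j - m) \<le> c * h" if j: "j = i \<or> j = Suc i" for j
    proof -
      have sub: "{\<sigma> j..\<sigma> j + h} \<subseteq> {\<sigma> i..\<sigma> i + 2 * h}" using j h by (auto simp: \<sigma>S)
      have jT: "\<sigma> j + h \<le> T" using sub iT h by auto
      have \<alpha>I: "\<alpha> integrable_on {\<sigma> j..\<sigma> j + h}" by (rule controls_integrable(2)[OF \<alpha> \<sigma>t jT])
      have nI: "(\<lambda>r. norm (\<alpha> r - m)) integrable_on {\<sigma> j..\<sigma> j + h}" "(\<lambda>r. norm (\<alpha> r - m)) integrable_on {\<sigma> i..\<sigma> i + 2 * h}"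
        by (rule controls_integrable(3)[OF \<alpha> \<sigma>t jT] controls_integrable(3)[OF \<alpha> \<sigma>t iT])+
      have qI: "(\<lambda>r. (norm (\<alpha> r - m))\<^sup>2) integrable_on {\<sigma> i..\<sigma> i + 2 * h}" by (rule controls_integrable(4)[OF \<alpha> \<sigma>t iT])
      have "h *\<^sub>R (a j - m) = integral {\<sigma> j..\<sigma> j + h} \<alpha> - integral {\<sigma> j..\<sigma> j + h} (\<lambda>_. m)"
        using h by (simp add: a_def scaleR_diff_right)
      also have "\<dots> = integral {\<sigma> j..\<sigma> j + h} (\<lambda>r. \<alpha> r - m)" by (rule integral_diff[OF \<alpha>I integrable_const_ivl, symmetric])
      finally have "h * norm (a j - m) = norm (integral {\<sigma> j..\<sigma> j + h} (\<lambda>r. \<alpha> r - m))" using h by (metis abs_of_pos norm_scaleR)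
      also have "\<dots> \<le> integral {\<sigma> j..\<sigma> j + h} (\<lambda>r. norm (\<alpha> r - m))"
        by (rule integral_norm_bound_integral[OF integrable_diff[OF \<alpha>I integrable_const_ivl] nI(1)]) simp
      also have "\<dots> \<le> integral {\<sigma> i..\<sigma> i + 2 * h} (\<lambda>r. norm (\<alpha> r - m))"
        by (rule integral_subset_le[OF sub nI]) auto
      \<comment> \<open>Young's inequality with weight \<open>h\<close>: the total squared deviation
        of order \<open>h ^ 3\<close> and the length \<open>2 * h\<close> then both contribute terms
        of order \<open>h\<^sup>2\<close>.\<close>
      also have "\<dots> \<le> integral {\<sigma> i..\<sigma> i + 2 * h} (\<lambda>r. 1 / (2 * h) * (norm (\<alpha> r - m))\<^sup>2 + h / 2)"
      proof (rule integral_le[OF nI(2)])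
        show "(\<lambda>r. 1 / (2 * h) * (norm (\<alpha> r - m))\<^sup>2 + h / 2) integrable_on {\<sigma> i..\<sigma> i + 2 * h}"
          by (intro integrable_add integrable_on_mult_right qI integrable_const_ivl)
        show "norm (\<alpha> r - m) \<le> 1 / (2 * h) * (norm (\<alpha> r - m))\<^sup>2 + h / 2" for r
        proof -
          have "0 \<le> (norm (\<alpha> r - m) - h)\<^sup>2 / (2 * h)" using h by simp
          also have "\<dots> = 1 / (2 * h) * (norm (\<alpha> r - m))\<^sup>2 + h / 2 - norm (\<alpha> r - m)"
            using h by (simp add: field_simps power2_eq_square)
          finally show ?thesis by simp
        qed
      qed
      also have "\<dots> = 1 / (2 * h) * q + h / 2 * (2 * h)"
        using h integral_add[OF integrable_on_mult_right[OF qI] integrable_const_ivl, of "1 / (2 * h)" "h / 2"] by (simp add: q_def)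
      also have "\<dots> \<le> 1 / (2 * h) * (4 / \<mu> * (8 * C + 1) * h ^ 3) + h / 2 * (2 * h)"
        using q h by (intro add_right_mono mult_left_mono) auto
      also have "\<dots> = h * (c * h)"
        using h \<mu>(1) by (simp add: c_def field_simps power3_eq_cube)
      finally show ?thesis using h by simp
    qed
    have "norm (a i - a (Suc i)) \<le> norm (a i - m) + norm (a (Suc i) - m)"
      using norm_triangle_ineq4[of "a i - m" "a (Suc i) - m"] by simp
    then show ?thesis using mean_dev[of i] mean_dev[of "Suc i"] by simp
  qed
  have chain: "norm (a i - a (i + k)) \<le> 2 * c * h * real k" if "i + k < n" for i k
    using that
  proof (induction k)
    case (Suc k)
    have "norm (a i - a (i + Suc k)) \<le> norm (a i - a (i + k)) + norm (a (i + k) - a (Suc (i + k)))"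
      using norm_triangle_ineq[of "a i - a (i + k)" "a (i + k) - a (Suc (i + k))"] by simp
    also have "\<dots> \<le> 2 * c * h * real k + 2 * c * h" using Suc pair[of "i + k"] by (intro add_mono) auto
    finally show ?case by (simp add: algebra_simps)
  qed simp
  have \<gamma>n: "\<gamma> n s = a (idx s)" if "s < T" for s using that hn by (simp add: \<gamma>_def \<sigma>_def)
  \<comment> \<open>The index difference times \<open>h\<close> exceeds \<open>s' - s\<close> by at
    most one cell length, which is the origin of the additive error.\<close>
  have lip: "norm (\<gamma> n s - \<gamma> n s') \<le> 2 * c * (s' - s + h)" if s: "s \<in> {t<..<T}" "s' \<in> {t<..<T}" "s \<le> s'" for s s'
  proof -
    have le: "idx s \<le> idx s'"
      unfolding idx_def using s h by (intro nat_mono floor_mono divide_right_mono) auto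
    define k where "k = idx s' - idx s"
    have k: "idx s' = idx s + k" using le by (simp add: k_def)
    have "\<sigma> (idx s') \<le> s'" "s < \<sigma> (idx s) + h" using idx s by auto
    then have "h * real k \<le> s' - s + h" by (simp add: \<sigma>_def k algebra_simps)
    moreover have "norm (\<gamma> n s - \<gamma> n s') \<le> 2 * c * h * real k"
      using chain[of "idx s" k] idxn[of s'] s k by (simp add: \<gamma>n)
    moreover have "2 * c * (h * real k) \<le> 2 * c * (s' - s + h)" using calculation(1) c by (intro mult_left_mono) auto
    ultimately show ?thesis by (simp add: mult.assoc)
  qed
  show thesis
  proof (rule that[of "\<gamma> n" "\<sigma> ` {..n}"])
    show "\<gamma> n \<in> controls A t T" by (rule \<gamma>c)
    have "J t w (\<gamma> n) \<le> V + h ^ 3 + real n * (C * h ^ 3)"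
      using steps[of n] J0 J\<alpha> by simp
    also have "\<dots> = V + (h + C * (T - t)) * h\<^sup>2"
      unfolding hn[symmetric] by (simp add: power3_eq_cube power2_eq_square algebra_simps)
    also have "\<dots> \<le> V + gridc * \<epsilon>\<^sup>2"
    proof (intro add_left_mono mult_mono)
      have "C * (T - t) \<le> C * (T - t0)" using C t by (intro mult_left_mono) auto
      then show "h + C * (T - t) \<le> gridc" using heps eps c unfolding gridc_eq by linarith
      show "h\<^sup>2 \<le> \<epsilon>\<^sup>2" using heps h by (intro power_mono) auto
    qed (use gridc_nonneg in auto)
    finally show "J t w (\<gamma> n) \<le> Inf (J t w ` controls A t T) + gridc * \<epsilon>\<^sup>2" by (simp add: V_def)
    show "norm (\<gamma> n s - \<gamma> n s') \<le> gridc * (\<bar>s - s'\<bar> + \<epsilon>)" if s: "s \<in> {t<..<T}" "s' \<in> {t<..<T}" for s s'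
    proof -
      have "norm (\<gamma> n s - \<gamma> n s') \<le> 2 * c * (\<bar>s - s'\<bar> + h)"
        using lip[of s s'] lip[of s' s] s by (cases "s \<le> s'") (auto simp: norm_minus_commute)
      also have "\<dots> \<le> gridc * (\<bar>s - s'\<bar> + \<epsilon>)"
        using heps h c c_gridc by (intro mult_mono) auto
      finally show ?thesis .
    qed
    show "finite (\<sigma> ` {..n})" by simp
    show "\<gamma> n s = \<gamma> n s'" if sub: "{p<..<q} \<subseteq> {t<..<T} - \<sigma> ` {..n}" and s: "s \<in> {p<..<q}" "s' \<in> {p<..<q}" for p q s s'
    proof -
      have *: "idx s = idx s'" if s: "s \<in> {p<..<q}" "s' \<in> {p<..<q}" "s \<le> s'" for s s'
      proof -
        have st: "s \<in> {t<..<T}" "s' \<in> {t<..<T}" using sub s by blast+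
        have "\<sigma> (idx s') < s"
        proof (rule ccontr)
          assume "\<not> \<sigma> (idx s') < s"
          then have "\<sigma> (idx s') \<in> {p<..<q}" using idx(1)[of s'] s st by auto
          moreover have "idx s' \<le> n" using idxn[of s'] st by auto
          ultimately show False using sub by blast
        qed
        then show ?thesis using idx(2)[of s'] s st by (intro idx_eq) auto
      qed
      have "s \<in> {t<..<T}" "s' \<in> {t<..<T}" using sub s by blast+
      then have "\<gamma> n s = a (idx s)" "\<gamma> n s' = a (idx s')" using \<gamma>n[of s] \<gamma>n[of s'] by simp_all
      moreover have "idx s = idx s'"
        using *[OF s] *[OF s(2,1)] by (metis linear)
      ultimately show ?thesis by simp
    qed
  qed
qed

end

subsection \<open>Second differences of trajectories\<close>

lemma linearization_error:
  fixes \<phi> :: "real \<Rightarrow> 'a::real_normed_vector"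
  assumes "convex S" "\<And>s. s \<in> S \<Longrightarrow> (\<phi> has_vector_derivative \<phi>' s) (at s within S)"
    "\<And>s. s \<in> S \<Longrightarrow> norm (\<phi>' s - p) \<le> M" "u \<in> S" "v \<in> S"
  shows "norm (\<phi> v - \<phi> u - (v - u) *\<^sub>R p) \<le> M * \<bar>v - u\<bar>"
proof -
  have "norm ((\<phi> v - v *\<^sub>R p) - (\<phi> u - u *\<^sub>R p)) \<le> M * norm (v - u)"
  proof (rule differentiable_bound[OF assms(1)])
    show "((\<lambda>s. \<phi> s - s *\<^sub>R p) has_derivative (\<lambda>k. k *\<^sub>R \<phi>' s - k *\<^sub>R p)) (at s within S)" if "s \<in> S" for s
      using assms(2)[OF that] unfolding has_vector_derivative_def by (auto intro!: derivative_eq_intros)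
    show "onorm (\<lambda>k. k *\<^sub>R \<phi>' s - k *\<^sub>R p) \<le> M" if "s \<in> S" for s
    proof (rule onorm_le)
      show "norm (k *\<^sub>R \<phi>' s - k *\<^sub>R p) \<le> M * norm k" for k
        using assms(3)[OF that] mult_right_mono[of "norm (\<phi>' s - p)" M "\<bar>k\<bar>"]
        by (simp add: scaleR_diff_right[symmetric] mult.commute)
    qed
  qed (use assms in auto)
  then show ?thesis by (simp add: algebra_simps)
qed

lemma norm_diff_triangle3:
  fixes a b c d :: "'a::real_normed_vector"
  shows "norm (a - d) \<le> norm (a - b) + norm (b - c) + norm (c - d)"
  using norm_triangle_ineq[of "a - b" "b - c"] norm_triangle_ineq[of "a - c" "c - d"] by simp

lemma norm_add3_le:
  fixes a b c :: "'a::real_normed_vector"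
  shows "norm (a + b + c) \<le> norm a + norm b + norm c"
  by (rule order_trans[OF norm_triangle_ineq add_right_mono[OF norm_triangle_ineq]])

locale delay_semiconcave = delay_control t0 T \<tau>bar A f \<tau> lf Cf l\<tau> L g Ha R0 d lt lft lL lg \<mu> lH
  for t0 T \<tau>bar :: real and A :: "(real^'m) set"
    and f :: "real \<times> (real^'n) \<times> (real^'n) \<times> (real^'m) \<Rightarrow> real^'n"
    and \<tau> :: "real \<times> (real^'n) \<Rightarrow> real" and lf Cf l\<tau> :: real
    and L :: "real \<times> (real^'n) \<times> (real^'n) \<times> (real^'m) \<Rightarrow> real"
    and g :: "(real^'n) \<times> (real \<Rightarrow> real^'n) \<Rightarrow> real"
    and Ha :: "real \<times> (real^'n) \<times> (real^'n) \<times> (real^'n) \<times> (real^'m) \<Rightarrow> real^'m"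
    and R0 d lt lft lL lg \<mu> lH :: real +
  fixes \<gamma>f \<gamma>L \<gamma>\<tau> :: real
  assumes \<gamma>f: "\<gamma>f \<ge> 0" "\<And>t a z1 z2 y1 y2. t \<in> {t0..T} \<Longrightarrow> a \<in> A \<Longrightarrow> norm z1 \<le> sol_bound R0 \<Longrightarrow> norm z2 \<le> sol_bound R0
      \<Longrightarrow> norm y1 \<le> sol_bound R0 \<Longrightarrow> norm y2 \<le> sol_bound R0 \<Longrightarrow>
      norm (f (t, z1, y1, a) + f (t, z2, y2, a) - 2 *\<^sub>R f (t, (1/2) *\<^sub>R (z1 + z2), (1/2) *\<^sub>R (y1 + y2), a))
        \<le> \<gamma>f * ((norm (z1 - z2))\<^sup>2 + (norm (y1 - y2))\<^sup>2)"
    and \<gamma>L: "\<gamma>L \<ge> 0" "\<And>t a z1 z2 y1 y2. t \<in> {t0..T} \<Longrightarrow> a \<in> A \<Longrightarrow> norm z1 \<le> sol_bound R0 \<Longrightarrow> norm z2 \<le> sol_bound R0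
      \<Longrightarrow> norm y1 \<le> sol_bound R0 \<Longrightarrow> norm y2 \<le> sol_bound R0 \<Longrightarrow>
      \<bar>L (t, z1, y1, a) + L (t, z2, y2, a) - 2 * L (t, (1/2) *\<^sub>R (z1 + z2), (1/2) *\<^sub>R (y1 + y2), a)\<bar>
        \<le> \<gamma>L * ((norm (z1 - z2))\<^sup>2 + (norm (y1 - y2))\<^sup>2)"
    and \<gamma>\<tau>: "\<gamma>\<tau> \<ge> 0" "\<And>t z1 z2. t \<in> {t0..T} \<Longrightarrow> norm z1 \<le> sol_bound R0 \<Longrightarrow> norm z2 \<le> sol_bound R0 \<Longrightarrow>
      \<bar>\<tau> (t, z1) + \<tau> (t, z2) - 2 * \<tau> (t, (1/2) *\<^sub>R (z1 + z2))\<bar> \<le> \<gamma>\<tau> * (norm (z1 - z2))\<^sup>2"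
begin

text \<open>Sizes in the comparison of three trajectories: \<open>shift * \<delta>\<close> covers
  the changes of state and of lag, \<open>rhs_lip\<close> is the Lipschitz constant in time of the
  velocity up to control jumps, and \<open>quasi\<close> measures the linearization error of
  \<open>x\<close> away from breakpoints. In units of \<open>\<Sigma>\<close>, the constants
  \<open>lag_gap N\<close>, \<open>traj_gap N\<close> and \<open>running_gap N\<close> bound the
  integral of \<open>\<Phi>\<close>, the second difference \<open>D\<close> and that of the running
  cost.\<close>

definition "shift = (1 + l\<tau>) * dep"
definition "rhs_lip = lft + lf * (K + K * lagK) + lH * gridc"
definition "quasi = 2 * rhs_lip + R0"
definition "lag_gap N = 4 * shift / d + 8 * K * shift\<^sup>2 / d * (real N + 2)
   + (T - t0) * (4 * growth * dep * shift + 2 * quasi * shift * (shift + 1) + 4 * K * \<gamma>\<tau> * dep\<^sup>2)"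
definition "pair_gap = 8 * (1 + K * l\<tau>)\<^sup>2 * dep\<^sup>2"
definition "traj_gap N = 2 * (lf * lag_gap N + \<gamma>f * pair_gap * (T - t0)) * exp (4 * growth * (T - t0))"
definition "running_gap N = \<gamma>L * pair_gap * (T - t0) + lL * (2 + K * l\<tau>) * traj_gap N * (T - t0) + lL * lag_gap N"

lemma consts_nonneg: "shift > 0" "rhs_lip \<ge> 0" "quasi > 0" "lag_gap N \<ge> 0" "pair_gap \<ge> 0" "traj_gap N \<ge> 0"
proof -
  show s: "shift > 0" using l\<tau>(1) dep_pos by (simp add: shift_def)
  show r: "rhs_lip \<ge> 0" using lft(1) lf(1) K_nonneg lagK_pos lH(1) gridc_nonneg unfolding rhs_lip_def
    by (intro add_nonneg_nonneg mult_nonneg_nonneg) auto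
  then show q: "quasi > 0" using R0 by (simp add: quasi_def)
  show l: "lag_gap N \<ge> 0" unfolding lag_gap_def
    using s q growth_pos dep_pos time K_nonneg \<gamma>\<tau>(1) lag_expanding(1)
    by (intro add_nonneg_nonneg mult_nonneg_nonneg divide_nonneg_nonneg) auto
  show p: "pair_gap \<ge> 0" by (simp add: pair_gap_def)
  show "traj_gap N \<ge> 0" unfolding traj_gap_def using l p lf(1) \<gamma>f(1) time
    by (intro add_nonneg_nonneg mult_nonneg_nonneg) auto
qed

end

text \<open>The direction \<open>w0\<close> is represented by a sup bound \<open>\<delta>\<close>
  and a density \<open>\<omega>\<close> of its increments, the base history by its breakpoints
  \<open>B\<close> and its derivative \<open>dw\<close> between them. \<open>\<beta>_quasi\<close>
  is the Lipschitz condition up to jumps that \<open>near_optimal_step_control\<close>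
  provides.\<close>

locale second_difference = delay_semiconcave +
  fixes t :: real and w w0 :: "real \<Rightarrow> real^'b" and \<beta> :: "real \<Rightarrow> real^'a"
    and B :: "real set" and N :: nat and dw :: "real \<Rightarrow> real^'b" and \<omega> :: "real \<Rightarrow> real" and \<delta> \<epsilon> :: real
  assumes t: "t0 \<le> t" "t < T"
    and hw: "hist_ok w" and hp: "hist_ok (\<lambda>\<theta>. w \<theta> + w0 \<theta>)" and hm: "hist_ok (\<lambda>\<theta>. w \<theta> - w0 \<theta>)"
    and \<beta>: "\<beta> \<in> controls A t T" and eps: "\<epsilon> > 0"
    and \<beta>_quasi: "\<And>s s'. s \<in> {t<..<T} \<Longrightarrow> s' \<in> {t<..<T} \<Longrightarrow> norm (\<beta> s - \<beta> s') \<le> gridc * (\<bar>s - s'\<bar> + \<epsilon>)"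
    and B: "finite B" "card B \<le> N"
    and w_smooth: "\<And>c e \<theta>. {c<..<e} \<subseteq> {-\<tau>bar<..<0} - B \<Longrightarrow> \<theta> \<in> {c<..<e} \<Longrightarrow> (w has_vector_derivative dw \<theta>) (at \<theta>)"
      "\<And>c e. {c<..<e} \<subseteq> {-\<tau>bar<..<0} - B \<Longrightarrow> R0-lipschitz_on {c<..<e} dw"
      "\<And>c e \<theta>. {c<..<e} \<subseteq> {-\<tau>bar<..<0} - B \<Longrightarrow> \<theta> \<in> {c<..<e} \<Longrightarrow> norm (dw \<theta>) \<le> R0"
    and \<omega>: "\<omega> integrable_on {-\<tau>bar..0}" "\<And>\<theta>. 0 \<le> \<omega> \<theta>"
      "\<And>a b. -\<tau>bar \<le> a \<Longrightarrow> a \<le> b \<Longrightarrow> b \<le> 0 \<Longrightarrow> norm (w0 b - w0 a) \<le> integral {a..b} \<omega>"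
    and \<delta>: "\<delta> > 0" "\<And>\<theta>. \<theta> \<in> {-\<tau>bar..0} \<Longrightarrow> norm (w0 \<theta>) \<le> \<delta>"
begin

abbreviation "x \<equiv> tr t w \<beta>"
abbreviation "xp \<equiv> tr t (\<lambda>\<theta>. w \<theta> + w0 \<theta>) \<beta>"
abbreviation "xm \<equiv> tr t (\<lambda>\<theta>. w \<theta> - w0 \<theta>) \<beta>"

lemmas px = tr_props[OF t hw \<beta>] and pp = tr_props[OF t hp \<beta>] and pm = tr_props[OF t hm \<beta>]

text \<open>\<open>\<Sigma>\<close> is the order of magnitude of all second differences. Up to the term with \<open>\<epsilon>\<close> it is bounded by
  the squared \<open>H\<^sup>1\<close> norm of \<open>w0\<close> when \<open>\<delta>\<close> is the sup norm of \<open>w0\<close> and \<open>\<omega>\<close> the norm of its derivative.\<close>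

definition "\<eta> = dep * \<delta>"
definition "\<kappa> = shift * \<delta>"
definition "I1 = integral {-\<tau>bar..0} \<omega>"
definition "\<Sigma> = \<delta>\<^sup>2 + \<delta> * I1 + \<delta> * \<epsilon>"
definition "D s = xp s + xm s - 2 *\<^sub>R x s"

lemma eta_kappa: "\<eta> > 0" "\<kappa> > 0" "\<eta> \<le> \<kappa>" "l\<tau> * \<eta> \<le> \<kappa>" "I1 \<ge> 0" "\<Sigma> \<ge> 0"
proof -
  show "\<eta> > 0" "\<kappa> > 0" using dep_pos \<delta> consts_nonneg(1) by (auto simp: \<eta>_def \<kappa>_def)
  have "\<kappa> = \<eta> + l\<tau> * \<eta>" by (simp add: \<eta>_def \<kappa>_def shift_def algebra_simps)
  moreover have "0 \<le> l\<tau> * \<eta>" using \<open>\<eta> > 0\<close> l\<tau>(1) by simp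
  ultimately show "\<eta> \<le> \<kappa>" "l\<tau> * \<eta> \<le> \<kappa>" using \<open>\<eta> > 0\<close> by linarith+
  show "I1 \<ge> 0" unfolding I1_def using \<omega> by (intro integral_nonneg) auto
  then show "\<Sigma> \<ge> 0" using \<delta> eps by (simp add: \<Sigma>_def)
qed

lemma hist_values:
  assumes "s \<in> {t - \<tau>bar..t}"
  shows "x s = w (s - t)" "xp s = w (s - t) + w0 (s - t)" "xm s = w (s - t) - w0 (s - t)"
proof -
  have m: "s - t \<in> {-\<tau>bar..0}" using assms by auto
  have "x (t + (s - t)) = w (s - t)" using px(1) m unfolding sol_def by blast
  moreover have "xp (t + (s - t)) = w (s - t) + w0 (s - t)" using pp(1) m unfolding sol_def by blast
  moreover have "xm (t + (s - t)) = w (s - t) - w0 (s - t)" using pm(1) m unfolding sol_def by blast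
  ultimately show "x s = w (s - t)" "xp s = w (s - t) + w0 (s - t)" "xm s = w (s - t) - w0 (s - t)" by auto
qed

lemma D_hist: "s \<in> {t - \<tau>bar..t} \<Longrightarrow> D s = 0"
  by (simp add: D_def hist_values scaleR_2)

lemma first_order:
  assumes "s \<in> {t - \<tau>bar..T}"
  shows "norm (xp s - x s) \<le> \<eta>" "norm (xm s - x s) \<le> \<eta>" "norm (xp s - xm s) \<le> 2 * \<eta>"
proof -
  show 1: "norm (xp s - x s) \<le> \<eta>"
    using tr_diff_bound[OF t less_imp_le[OF t(2)] order_refl hp hw \<beta> \<beta>, of \<delta> 0 s] \<delta>(2) assms by (simp add: \<eta>_def)
  show 2: "norm (xm s - x s) \<le> \<eta>"
    using tr_diff_bound[OF t less_imp_le[OF t(2)] order_refl hm hw \<beta> \<beta>, of \<delta> 0 s] \<delta>(2) assms by (simp add: \<eta>_def)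
  show "norm (xp s - xm s) \<le> 2 * \<eta>" using 1 2 norm_triangle_ineq4[of "xp s - x s" "xm s - x s"] by simp
qed

lemma mem: "r \<in> {t..T} \<Longrightarrow> r \<in> {t - \<tau>bar..T}" using delay_pos by auto

lemmas lag_in = lag_bounds(4)[OF _ t(1)]

lemma lag_first_order:
  assumes r: "r \<in> {t..T}"
  shows "\<bar>lag xp r - lag x r\<bar> \<le> \<kappa>" "\<bar>lag xm r - lag x r\<bar> \<le> \<kappa>"
proof -
  have "\<bar>lag xp r - lag x r\<bar> \<le> l\<tau> * norm (xp r - x r)" "\<bar>lag xm r - lag x r\<bar> \<le> l\<tau> * norm (xm r - x r)"
    using l\<tau>(2)[of r "xp r" "x r"] l\<tau>(2)[of r "xm r" "x r"] r t by (auto simp: lag_def)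
  moreover have "l\<tau> * norm (xp r - x r) \<le> l\<tau> * \<eta>" "l\<tau> * norm (xm r - x r) \<le> l\<tau> * \<eta>"
    using first_order[OF mem[OF r]] l\<tau>(1) by (auto intro!: mult_left_mono)
  ultimately show "\<bar>lag xp r - lag x r\<bar> \<le> \<kappa>" "\<bar>lag xm r - lag x r\<bar> \<le> \<kappa>" using eta_kappa by linarith+
qed

text \<open>The midpoint of \<open>xp r\<close> and \<open>xm r\<close> is inserted: up to it the
  second-order condition on \<open>\<tau>\<close> applies, and its distance to \<open>x r\<close> is
  half the norm of \<open>D r\<close>.\<close>

lemma lag_second_order:
  assumes r: "r \<in> {t..T}"
  shows "\<bar>lag xp r + lag xm r - 2 * lag x r\<bar> \<le> 4 * \<gamma>\<tau> * \<eta>\<^sup>2 + l\<tau> * norm (D r)"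
proof -
  have rt: "r \<in> {t0..T}" using r t by auto
  let ?m = "(1/2) *\<^sub>R (xp r + xm r)"
  have "\<bar>\<tau> (r, xp r) + \<tau> (r, xm r) - 2 * \<tau> (r, ?m)\<bar> \<le> \<gamma>\<tau> * (norm (xp r - xm r))\<^sup>2"
    by (rule \<gamma>\<tau>(2)[OF rt pp(2)[OF mem[OF r]] pm(2)[OF mem[OF r]]])
  also have "\<dots> \<le> \<gamma>\<tau> * (2 * \<eta>)\<^sup>2"
    using first_order(3)[OF mem[OF r]] \<gamma>\<tau>(1) by (intro mult_left_mono power_mono) auto
  finally have 1: "\<bar>\<tau> (r, xp r) + \<tau> (r, xm r) - 2 * \<tau> (r, ?m)\<bar> \<le> 4 * \<gamma>\<tau> * \<eta>\<^sup>2" by (simp add: power_mult_distrib)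
  have "?m - x r = (1/2) *\<^sub>R D r" by (simp add: D_def algebra_simps)
  then have 2: "\<bar>\<tau> (r, ?m) - \<tau> (r, x r)\<bar> \<le> l\<tau> * norm (D r) / 2"
    using l\<tau>(2)[OF rt, of ?m "x r"] by simp
  have "lag xp r + lag xm r - 2 * lag x r
    = - (\<tau> (r, xp r) + \<tau> (r, xm r) - 2 * \<tau> (r, ?m)) - 2 * (\<tau> (r, ?m) - \<tau> (r, x r))" by (simp add: lag_def)
  moreover have "\<bar>a\<bar> \<le> p + q" if "a = - X - 2 * Y" "\<bar>X\<bar> \<le> p" "\<bar>Y\<bar> \<le> q / 2" for a X Y p q :: real
    using that by linarith
  ultimately show ?thesis using 1 2 by blast
qed

section \<open>Increments of the perturbations\<close>

text \<open>The distribution function of the mass \<open>\<omega>\<close>, moved to the time axis.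
  Clamping makes it monotone on the whole line, as \<open>integral_increment_along_expanding\<close>
  requires.\<close>

definition "W v = integral {-\<tau>bar..min 0 (max (-\<tau>bar) (v - t))} \<omega>"

lemma W: "mono W" "0 \<le> W v" "W v \<le> I1"
proof -
  have I: "\<omega> integrable_on {a..b}" if "-\<tau>bar \<le> a" "b \<le> 0" for a b
    by (rule integrable_on_subinterval[OF \<omega>(1)]) (use that in auto)
  show "mono W" unfolding W_def
    by (intro monoI integral_subset_le I) (use \<omega>(2) delay_pos in auto)
  show "0 \<le> W v" unfolding W_def by (intro integral_nonneg I) (use \<omega>(2) delay_pos in auto)
  show "W v \<le> I1" unfolding W_def I1_def
    by (intro integral_subset_le I) (use \<omega>(2) delay_pos in auto)
qed

lemma w0_increment:
  assumes "t - \<tau>bar \<le> u" "u \<le> v" "v \<le> t"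
  shows "norm (w0 (v - t) - w0 (u - t)) \<le> W v - W u"
proof -
  have "norm (w0 (v - t) - w0 (u - t)) \<le> integral {u - t..v - t} \<omega>" using assms by (intro \<omega>(3)) auto
  also have "\<dots> = integral {-\<tau>bar..v - t} \<omega> - integral {-\<tau>bar..u - t} \<omega>"
    using integral_diff_Icc[OF \<omega>(1), of "u - t" "v - t"] assms by simp
  finally show ?thesis using assms by (simp add: W_def)
qed

lemma rhs_first_order:
  assumes r: "r \<in> {t<..<T}"
  shows "norm (rhs xp \<beta> r - rhs x \<beta> r) \<le> 2 * growth * \<eta>" "norm (rhs xm \<beta> r - rhs x \<beta> r) \<le> 2 * growth * \<eta>"
proof -
  have r': "r \<in> {t..T}" "\<beta> r \<in> A" using r \<beta> by (auto simp: controls_def)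
  have "norm (rhs y \<beta> r - rhs x \<beta> r) \<le> growth * (norm (y r - x r) + norm (y (lag y r) - x (lag y r)))" for y
    unfolding growth_def by (rule rhs_diff[where \<alpha>=\<beta>, OF px(3) r'(1) t(1) r'(2)])
  moreover have "growth * (norm (xp r - x r) + norm (xp (lag xp r) - x (lag xp r))) \<le> growth * (\<eta> + \<eta>)"
    "growth * (norm (xm r - x r) + norm (xm (lag xm r) - x (lag xm r))) \<le> growth * (\<eta> + \<eta>)"
    using first_order[OF mem[OF r'(1)]] first_order[OF lag_in[OF r'(1)]] growth_pos
    by (intro mult_left_mono add_mono; simp)+
  ultimately show "norm (rhs xp \<beta> r - rhs x \<beta> r) \<le> 2 * growth * \<eta>" "norm (rhs xm \<beta> r - rhs x \<beta> r) \<le> 2 * growth * \<eta>"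
    by (smt (verit) mult.commute mult_2 distrib_left)+
qed

text \<open>Before \<open>t\<close> the perturbation is plus or minus \<open>w0\<close>, and its
  increments are charged to \<open>W\<close>; after \<open>t\<close> it changes at a rate of order
  \<open>\<eta>\<close>. An interval across \<open>t\<close> is split there.\<close>

lemma increments:
  assumes uv: "u \<in> {t - \<tau>bar..T}" "v \<in> {t - \<tau>bar..T}" "u \<le> v" and y: "y = xp \<or> y = xm"
  shows "norm ((y v - x v) - (y u - x u)) \<le> W v - W u + 2 * growth * \<eta> * (v - u)"
proof -
  have py: "continuous_on {t - \<tau>bar..T} y" using y pp(4) pm(4) by blast
  have ysol: "\<And>s. s \<in> {t..T} \<Longrightarrow> y s = y t + integral {t..s} (rhs y \<beta>)"
    using y pp(1) pm(1) t by (auto simp: sol_def)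
  have xsol: "\<And>s. s \<in> {t..T} \<Longrightarrow> x s = x t + integral {t..s} (rhs x \<beta>)"
    using px(1) t by (auto simp: sol_def)
  have gn: "0 \<le> 2 * growth * \<eta>" using growth_pos eta_kappa by simp
  have hist: "norm ((y v - x v) - (y u - x u)) \<le> W v - W u" if "t - \<tau>bar \<le> u" "u \<le> v" "v \<le> t" for u v
    using y w0_increment[OF that] hist_values[of u] hist_values[of v] that by (auto simp: norm_minus_commute)
  have after: "norm ((y v - x v) - (y u - x u)) \<le> 2 * growth * \<eta> * (v - u)" if "t \<le> u" "u \<le> v" "v \<le> T" for u v
  proof -
    have I: "rhs y \<beta> integrable_on {a..b}" "rhs x \<beta> integrable_on {a..b}" if "t \<le> a" "b \<le> T" for a b
      using rhs_integrable(3)[OF py t(1) \<beta>] rhs_integrable(3)[OF px(4) t(1) \<beta>] that by auto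
    have "(y v - x v) - (y u - x u) = integral {u..v} (rhs y \<beta>) - integral {u..v} (rhs x \<beta>)"
      using ysol[of v] ysol[of u] xsol[of v] xsol[of u] that
        integral_diff_Icc[OF I(1), of t T u v] integral_diff_Icc[OF I(2), of t T u v] by (simp add: algebra_simps)
    also have "\<dots> = integral {u..v} (\<lambda>r. rhs y \<beta> r - rhs x \<beta> r)" using I[of u v] that by (simp add: integral_diff)
    also have "norm \<dots> \<le> 2 * growth * \<eta> * (v - u)"
      by (rule integral_lipschitz_bound) (use I[of u v] that y rhs_first_order in \<open>auto intro!: integrable_diff\<close>)
    finally show ?thesis .
  qed
  have Wm: "W a \<le> W b" if "a \<le> b" for a b using W(1) that by (rule monoD)
  consider "v \<le> t" | "t \<le> u" | "u \<le> t" "t \<le> v" by linarith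
  then show ?thesis
  proof cases
    case 1
    then show ?thesis using hist[of u v] uv mult_nonneg_nonneg[OF gn, of "v - u"]
      by (smt (verit) atLeastAtMost_iff)
  next
    case 2
    then show ?thesis using after[of u v] uv Wm[of u v] by auto
  next
    case 3
    have "norm ((y v - x v) - (y u - x u)) \<le> norm ((y v - x v) - (y t - x t)) + norm ((y t - x t) - (y u - x u))"
      using norm_diff_triangle3[of "y v - x v" "y u - x u" "y t - x t" "y t - x t"] by simp
    also have "\<dots> \<le> 2 * growth * \<eta> * (v - t) + (W t - W u)" using hist[of u t] after[of t v] uv 3 by (intro add_mono) auto
    also have "\<dots> \<le> 2 * growth * \<eta> * (v - u) + (W v - W u)"
      using Wm[of t v] 3 gn by (intro add_mono mult_left_mono) auto
    finally show ?thesis by simp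
  qed
qed

text \<open>Both lags lie in the window of radius \<open>\<kappa>\<close> about
  \<open>lag x r\<close>. Enlarging to the full window gives the bound the form whose time integral
  along the expanding lag is controlled.\<close>

lemma lag_increments:
  assumes r: "r \<in> {t..T}" and y: "y = xp \<or> y = xm"
  shows "norm ((y (lag y r) - x (lag y r)) - (y (lag x r) - x (lag x r)))
    \<le> W (lag x r + \<kappa>) - W (lag x r - \<kappa>) + 2 * growth * \<eta> * \<kappa>"
proof -
  have b: "\<bar>lag y r - lag x r\<bar> \<le> \<kappa>" using lag_first_order[OF r] y by blast
  have gn: "0 \<le> 2 * growth * \<eta>" using growth_pos eta_kappa by simp
  have Wm: "W a \<le> W b" if "a \<le> b" for a b using W(1) that by (rule monoD)
  show ?thesis
  proof (cases "lag x r \<le> lag y r")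
    case True
    have "norm ((y (lag y r) - x (lag y r)) - (y (lag x r) - x (lag x r)))
      \<le> W (lag y r) - W (lag x r) + 2 * growth * \<eta> * (lag y r - lag x r)"
      by (rule increments[OF lag_in[OF r] lag_in[OF r] True y])
    also have "\<dots> \<le> W (lag x r + \<kappa>) - W (lag x r - \<kappa>) + 2 * growth * \<eta> * \<kappa>"
      using b gn eta_kappa by (intro add_mono diff_mono Wm mult_left_mono) auto
    finally show ?thesis .
  next
    case False
    then have F: "lag y r \<le> lag x r" by simp
    have "norm ((y (lag y r) - x (lag y r)) - (y (lag x r) - x (lag x r)))
      \<le> W (lag x r) - W (lag y r) + 2 * growth * \<eta> * (lag x r - lag y r)"
      using increments[OF lag_in[OF r] lag_in[OF r] F y] by (simp add: norm_minus_commute)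
    also have "\<dots> \<le> W (lag x r + \<kappa>) - W (lag x r - \<kappa>) + 2 * growth * \<eta> * \<kappa>"
      using b gn eta_kappa by (intro add_mono diff_mono Wm mult_left_mono) auto
    finally show ?thesis .
  qed
qed

text \<open>\<open>Nc\<close> counts the breakpoints of \<open>x\<close> up to time \<open>t\<close>. Near a breakpoint second differences of \<open>x\<close>
  are only of first order, and this loss is charged to the increment of \<open>Nc\<close>.\<close>

definition "Bt = {t - \<tau>bar, t} \<union> (\<lambda>b. t + b) ` B"
definition "Nc v = real (card {b \<in> Bt. b \<le> v})"

lemma Bt: "finite Bt" "card Bt \<le> N + 2"
proof -
  show "finite Bt" using B by (simp add: Bt_def)
  have "card Bt \<le> card {t - \<tau>bar, t} + card ((\<lambda>b. t + b) ` B)" unfolding Bt_def by (rule card_Un_le)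
  also have "\<dots> \<le> 2 + N" using B card_image_le[of B "\<lambda>b. t + b"] card_insert_le_m1[of 2 "{t}" "t - \<tau>bar"] by (intro add_mono) auto
  finally show "card Bt \<le> N + 2" by simp
qed

lemma Nc: "mono Nc" "0 \<le> Nc v" "Nc v \<le> real N + 2"
proof -
  show "mono Nc" unfolding Nc_def using Bt(1) by (intro monoI) (auto intro!: card_mono)
  show "0 \<le> Nc v" by (simp add: Nc_def)
  have "card {b \<in> Bt. b \<le> v} \<le> card Bt" using Bt(1) by (intro card_mono) auto
  then show "Nc v \<le> real N + 2" using Bt(2) by (simp add: Nc_def)
qed

lemma Nc_jump:
  assumes "b \<in> Bt" "u < b" "b \<le> v"
  shows "Nc v - Nc u \<ge> 1"
proof -
  have "b \<in> {b \<in> Bt. b \<le> v} - {b \<in> Bt. b \<le> u}" using assms by auto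
  moreover have "{b \<in> Bt. b \<le> u} \<subseteq> {b \<in> Bt. b \<le> v}" using assms by auto
  ultimately have "{b \<in> Bt. b \<le> u} \<subset> {b \<in> Bt. b \<le> v}" by blast
  then have "card {b \<in> Bt. b \<le> u} < card {b \<in> Bt. b \<le> v}" using Bt(1) by (intro psubset_card_mono) auto
  then show ?thesis by (simp add: Nc_def)
qed

section \<open>Near-linearity of the unperturbed trajectory\<close>

text \<open>Time, state and control are changed one at a time. The additive
  \<open>\<epsilon>\<close> is the trace of the jumps of the control.\<close>

lemma rhs_quasi_lipschitz:
  assumes s: "s \<in> {t<..<T}" "s' \<in> {t<..<T}"
  shows "norm (rhs x \<beta> s - rhs x \<beta> s') \<le> rhs_lip * (\<bar>s - s'\<bar> + \<epsilon>)"
proof -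
  have st: "s \<in> {t..T}" "s' \<in> {t..T}" "s \<in> {t0..T}" "s' \<in> {t0..T}" using s t by auto
  have A: "\<beta> s \<in> A" "\<beta> s' \<in> A" using s \<beta> by (auto simp: controls_def)
  note bnd = px(2)[OF mem[OF st(1)]] px(2)[OF mem[OF st(2)]] px(2)[OF lag_in[OF st(1)]] px(2)[OF lag_in[OF st(2)]]
  have "norm (rhs x \<beta> s - rhs x \<beta> s') \<le> norm (f (s, x s, x (lag x s), \<beta> s) - f (s', x s, x (lag x s), \<beta> s))
      + norm (f (s', x s, x (lag x s), \<beta> s) - f (s', x s', x (lag x s'), \<beta> s))
      + norm (f (s', x s', x (lag x s'), \<beta> s) - f (s', x s', x (lag x s'), \<beta> s'))"
    unfolding rhs_def
    by (rule norm_diff_triangle3)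
  also have "\<dots> \<le> lft * \<bar>s - s'\<bar> + lf * (K * \<bar>s - s'\<bar> + K * lagK * \<bar>s - s'\<bar>) + lH * (gridc * (\<bar>s - s'\<bar> + \<epsilon>))"
  proof (intro add_mono)
    show "norm (f (s, x s, x (lag x s), \<beta> s) - f (s', x s, x (lag x s), \<beta> s)) \<le> lft * \<bar>s - s'\<bar>"
      by (rule lft(2)[OF st(3,4) bnd(1,3) A(1)])
    have "norm (x s - x s') \<le> K * \<bar>s - s'\<bar>"
      using lipschitz_onD[OF px(3) mem[OF st(1)] mem[OF st(2)]] by (simp add: dist_norm)
    moreover have "norm (x (lag x s) - x (lag x s')) \<le> K * lagK * \<bar>s - s'\<bar>"
      by (rule lag_lipschitz(2)[OF t(1) px(3) px(2) st(1,2)])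
    ultimately have "lf * (norm (x s - x s') + norm (x (lag x s) - x (lag x s'))) \<le> lf * (K * \<bar>s - s'\<bar> + K * lagK * \<bar>s - s'\<bar>)"
      using lf(1) by (intro mult_left_mono add_mono) auto
    then show "norm (f (s', x s, x (lag x s), \<beta> s) - f (s', x s', x (lag x s'), \<beta> s)) \<le> lf * (K * \<bar>s - s'\<bar> + K * lagK * \<bar>s - s'\<bar>)"
      using lf(2)[OF st(4) A(1)] order_trans by blast
    have "norm (f (s', x s', x (lag x s'), \<beta> s) - f (s', x s', x (lag x s'), \<beta> s')) \<le> lH * norm (\<beta> s - \<beta> s')"
      by (rule f_control_difference(2)[OF st(4) A])
    also have "\<dots> \<le> lH * (gridc * (\<bar>s - s'\<bar> + \<epsilon>))" using \<beta>_quasi[OF s] lH(1) by (intro mult_left_mono) auto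
    finally show "norm (f (s', x s', x (lag x s'), \<beta> s) - f (s', x s', x (lag x s'), \<beta> s')) \<le> lH * (gridc * (\<bar>s - s'\<bar> + \<epsilon>))" .
  qed
  also have "\<dots> = (lft + lf * (K + K * lagK)) * \<bar>s - s'\<bar> + lH * gridc * (\<bar>s - s'\<bar> + \<epsilon>)" by (simp add: algebra_simps)
  also have "\<dots> \<le> (lft + lf * (K + K * lagK)) * (\<bar>s - s'\<bar> + \<epsilon>) + lH * gridc * (\<bar>s - s'\<bar> + \<epsilon>)"
    using eps lft(1) lf(1) K_nonneg lagK_pos by (intro add_right_mono mult_left_mono add_nonneg_nonneg mult_nonneg_nonneg) auto
  also have "\<dots> = rhs_lip * (\<bar>s - s'\<bar> + \<epsilon>)" by (simp add: rhs_lip_def algebra_simps)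
  finally show ?thesis .
qed

text \<open>Away from breakpoints one slope serves the whole window: the derivative of
  \<open>w\<close> before \<open>t\<close>, the velocity at a nearby time after \<open>t\<close>.
  The breakpoint-free window has radius \<open>2 * \<kappa>\<close> while \<open>v\<close> ranges
  over radius \<open>\<kappa>\<close>, which leaves room for that nearby time.\<close>

lemma linearization_of_x:
  assumes u0: "u0 \<in> {t - \<tau>bar..T}" and nb: "\<And>b. b \<in> Bt \<Longrightarrow> \<not> (u0 - 2 * \<kappa> < b \<and> b \<le> u0 + 2 * \<kappa>)"
  shows "\<exists>p. norm p \<le> K \<and> (\<forall>v\<in>{t - \<tau>bar..T}. \<bar>v - u0\<bar> \<le> \<kappa> \<longrightarrow>
      norm (x v - x u0 - (v - u0) *\<^sub>R p) \<le> quasi * \<kappa> * (\<kappa> + \<epsilon>))"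
proof -
  have R0K: "R0 \<le> K" by (simp add: K_def sol_lip_def)
  have kap: "\<kappa> > 0" by (rule eta_kappa)
  \<comment> \<open>Since \<open>t - \<tau>bar\<close> belongs to \<open>Bt\<close>, the window
    cannot reach past the start of the history; in the same way the membership of \<open>t\<close>
    separates the two cases below.\<close>
  have b1: "t - \<tau>bar \<le> u0 - 2 * \<kappa>" using nb[of "t - \<tau>bar"] u0 kap by (auto simp: Bt_def)
  have "t \<le> u0 - 2 * \<kappa> \<or> t > u0 + 2 * \<kappa>" using nb[of t] by (auto simp: Bt_def)
  then show ?thesis
  proof
    assume after: "t \<le> u0 - 2 * \<kappa>"
    \<comment> \<open>\<open>u0\<close> may equal \<open>T\<close>, where the control is
      unrestricted; stepping back by \<open>\<kappa>\<close> reaches the open interval.\<close>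
    define s0 where "s0 = u0 - \<kappa>"
    have s0: "s0 \<in> {t<..<T}" using after u0 kap by (auto simp: s0_def)
    then have s0': "s0 \<in> {t..T}" "s0 \<in> {t0..T}" "\<beta> s0 \<in> A" using t \<beta> by (auto simp: controls_def)
    have "norm (rhs x \<beta> s0) \<le> Cf * (1 + norm (x s0) + norm (x (lag x s0)))"
      unfolding rhs_def by (rule Cf(2)[OF s0'(2,3)])
    also have "\<dots> \<le> Cf * (1 + sol_bound R0 + sol_bound R0)"
      using px(2)[OF mem[OF s0'(1)]] px(2)[OF lag_in[OF s0'(1)]] Cf(1) by (intro mult_left_mono add_mono) auto
    also have "\<dots> = Cf * (1 + 2 * sol_bound R0)" by simp
    also have "\<dots> \<le> K" unfolding K_def sol_lip_def by (rule max.cobounded2)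
    finally have pK: "norm (rhs x \<beta> s0) \<le> K" .
    have "norm (x v - x u0 - (v - u0) *\<^sub>R rhs x \<beta> s0) \<le> quasi * \<kappa> * (\<kappa> + \<epsilon>)"
      if v: "v \<in> {t - \<tau>bar..T}" "\<bar>v - u0\<bar> \<le> \<kappa>" for v
    proof -
      have *: "norm (x b - x a - (b - a) *\<^sub>R rhs x \<beta> s0) \<le> rhs_lip * (2 * \<kappa> + \<epsilon>) * \<kappa>"
        if ab: "u0 - \<kappa> \<le> a" "a \<le> b" "b \<le> u0 + \<kappa>" "b \<le> T" "b - a \<le> \<kappa>" for a b
      proof -
        have ta: "t \<le> a" using ab after kap by linarith
        have I: "rhs x \<beta> integrable_on {p..q}" if "t \<le> p" "q \<le> T" for p q
          using rhs_integrable(3)[OF px(4) t(1) \<beta>] that by auto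
        have "x b - x a = integral {a..b} (rhs x \<beta>)"
          using px(1) ab ta integral_diff_Icc[OF I, of t T a b] by (simp add: sol_def)
        then have "x b - x a - (b - a) *\<^sub>R rhs x \<beta> s0 = integral {a..b} (\<lambda>r. rhs x \<beta> r - rhs x \<beta> s0)"
          using I[of a b] ta ab integral_diff[OF I[of a b] integrable_const_ivl, of "rhs x \<beta> s0"] by simp
        also have "norm \<dots> \<le> rhs_lip * (2 * \<kappa> + \<epsilon>) * (b - a)"
        proof (rule integral_lipschitz_bound)
          show "(\<lambda>r. rhs x \<beta> r - rhs x \<beta> s0) integrable_on {a..b}" using I[of a b] ta ab by (intro integrable_diff integrable_const_ivl) auto
          fix r assume r: "r \<in> {a<..<b}"
          then have "norm (rhs x \<beta> r - rhs x \<beta> s0) \<le> rhs_lip * (\<bar>r - s0\<bar> + \<epsilon>)"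
            using ta ab by (intro rhs_quasi_lipschitz s0) auto
          also have "\<dots> \<le> rhs_lip * (2 * \<kappa> + \<epsilon>)"
            using r ab consts_nonneg(2) kap by (intro mult_left_mono add_right_mono) (auto simp: s0_def)
          finally show "norm (rhs x \<beta> r - rhs x \<beta> s0) \<le> rhs_lip * (2 * \<kappa> + \<epsilon>)" .
        qed (use ab in auto)
        also have "\<dots> \<le> rhs_lip * (2 * \<kappa> + \<epsilon>) * \<kappa>"
          using ab kap eps consts_nonneg(2) by (intro mult_left_mono mult_nonneg_nonneg) auto
        finally show ?thesis .
      qed
      have "norm (x v - x u0 - (v - u0) *\<^sub>R rhs x \<beta> s0) \<le> rhs_lip * (2 * \<kappa> + \<epsilon>) * \<kappa>"
      proof (cases "u0 \<le> v")
        case True then show ?thesis using *[of u0 v] v u0 kap by auto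
      next
        case False
        have "x v - x u0 - (v - u0) *\<^sub>R rhs x \<beta> s0 = - (x u0 - x v - (u0 - v) *\<^sub>R rhs x \<beta> s0)" by (simp add: algebra_simps)
        then have "norm (x v - x u0 - (v - u0) *\<^sub>R rhs x \<beta> s0) = norm (x u0 - x v - (u0 - v) *\<^sub>R rhs x \<beta> s0)"
          by (simp only: norm_minus_cancel)
        then show ?thesis using *[of v u0] v u0 kap False by (simp add: abs_le_iff)
      qed
      also have "\<dots> \<le> quasi * \<kappa> * (\<kappa> + \<epsilon>)"
      proof -
        have "rhs_lip * (2 * \<kappa> + \<epsilon>) * \<kappa> \<le> rhs_lip * (2 * (\<kappa> + \<epsilon>)) * \<kappa>"
          using consts_nonneg(2) kap eps by (intro mult_right_mono mult_left_mono) auto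
        also have "\<dots> \<le> quasi * \<kappa> * (\<kappa> + \<epsilon>)"
          using R0 kap eps by (simp add: quasi_def algebra_simps)
        finally show ?thesis .
      qed
      finally show ?thesis .
    qed
    then show ?thesis using pK by blast
  next
    assume before: "t > u0 + 2 * \<kappa>"
    define c where "c = u0 - t - 2 * \<kappa>"
    define e where "e = u0 - t + 2 * \<kappa>"
    have sub: "{c<..<e} \<subseteq> {-\<tau>bar<..<0} - B"
    proof
      fix \<theta> assume th: "\<theta> \<in> {c<..<e}"
      then have "\<theta> \<in> {-\<tau>bar<..<0}" using b1 before by (auto simp: c_def e_def)
      moreover have "\<theta> \<notin> B"
      proof
        assume "\<theta> \<in> B"
        then have "t + \<theta> \<in> Bt" by (simp add: Bt_def)
        from nb[OF this] th show False by (auto simp: c_def e_def)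
      qed
      ultimately show "\<theta> \<in> {-\<tau>bar<..<0} - B" by blast
    qed
    define \<theta>0 where "\<theta>0 = u0 - t"
    have th0: "\<theta>0 \<in> {c<..<e}" using kap by (simp add: \<theta>0_def c_def e_def)
    have "norm (dw \<theta>0) \<le> K" using w_smooth(3)[OF sub th0] R0K by linarith
    moreover have "norm (x v - x u0 - (v - u0) *\<^sub>R dw \<theta>0) \<le> quasi * \<kappa> * (\<kappa> + \<epsilon>)"
      if v: "v \<in> {t - \<tau>bar..T}" "\<bar>v - u0\<bar> \<le> \<kappa>" for v
    proof -
      have xv: "x v = w (v - t)" "x u0 = w \<theta>0" using hist_values[of v] hist_values[of u0] v u0 before kap by (auto simp: \<theta>0_def)
      have S: "{\<theta>0 - \<kappa>..\<theta>0 + \<kappa>} \<subseteq> {c<..<e}" using kap by (auto simp: c_def e_def \<theta>0_def)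
      have "norm (w (v - t) - w \<theta>0 - (v - t - \<theta>0) *\<^sub>R dw \<theta>0) \<le> (R0 * \<kappa>) * \<bar>v - t - \<theta>0\<bar>"
      proof (rule linearization_error[where S="{\<theta>0 - \<kappa>..\<theta>0 + \<kappa>}" and \<phi>'=dw])
        show "(w has_vector_derivative dw s) (at s within {\<theta>0 - \<kappa>..\<theta>0 + \<kappa>})" if "s \<in> {\<theta>0 - \<kappa>..\<theta>0 + \<kappa>}" for s
          by (rule has_vector_derivative_at_within[OF w_smooth(1)[OF sub]]) (use that S in blast)
        show "norm (dw s - dw \<theta>0) \<le> R0 * \<kappa>" if s: "s \<in> {\<theta>0 - \<kappa>..\<theta>0 + \<kappa>}" for s
        proof -
          have "s \<in> {c<..<e}" using s S by blast
          then have "norm (dw s - dw \<theta>0) \<le> R0 * \<bar>s - \<theta>0\<bar>"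
            using lipschitz_onD[OF w_smooth(2)[OF sub] _ th0, of s] by (simp add: dist_norm)
          also have "\<dots> \<le> R0 * \<kappa>" using s R0 by (intro mult_left_mono) auto
          finally show ?thesis .
        qed
      qed (use v kap in \<open>auto simp: \<theta>0_def\<close>)
      also have "\<dots> \<le> R0 * \<kappa> * \<kappa>" using v R0 kap by (intro mult_left_mono) (auto simp: \<theta>0_def)
      also have "\<dots> \<le> quasi * \<kappa> * (\<kappa> + \<epsilon>)"
        using consts_nonneg(2) kap eps R0 by (intro mult_mono) (auto simp: quasi_def)
      finally show ?thesis by (simp add: xv \<theta>0_def algebra_simps)
    qed
    ultimately show ?thesis by blast
  qed
qed

text \<open>If a breakpoint lies in the window, \<open>Nc\<close> grows by at least 1 across it and
  the plain Lipschitz bound is charged to that growth. Otherwise a common slope is subtracted, and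
  the linear parts combine to \<open>up + um - 2 * u0\<close> times the slope.\<close>

lemma x_second_difference:
  assumes "u0 \<in> {t - \<tau>bar..T}" "up \<in> {t - \<tau>bar..T}" "um \<in> {t - \<tau>bar..T}" "\<bar>up - u0\<bar> \<le> \<kappa>" "\<bar>um - u0\<bar> \<le> \<kappa>"
  shows "norm (x up + x um - 2 *\<^sub>R x u0)
    \<le> 2 * K * \<kappa> * (Nc (u0 + 2 * \<kappa>) - Nc (u0 - 2 * \<kappa>)) + 2 * quasi * \<kappa> * (\<kappa> + \<epsilon>) + K * \<bar>up + um - 2 * u0\<bar>"
proof -
  have kap: "\<kappa> > 0" by (rule eta_kappa)
  have nn: "0 \<le> 2 * quasi * \<kappa> * (\<kappa> + \<epsilon>)" using consts_nonneg(3) kap eps by simp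
  have Nn: "0 \<le> 2 * K * \<kappa> * (Nc (u0 + 2 * \<kappa>) - Nc (u0 - 2 * \<kappa>))"
    using K_nonneg kap monoD[OF Nc(1), of "u0 - 2 * \<kappa>" "u0 + 2 * \<kappa>"] by simp
  have Kn: "0 \<le> K * \<bar>up + um - 2 * u0\<bar>" using K_nonneg by simp
  show ?thesis
  proof (cases "\<exists>b\<in>Bt. u0 - 2 * \<kappa> < b \<and> b \<le> u0 + 2 * \<kappa>")
    case True
    have "x up + x um - 2 *\<^sub>R x u0 = (x up - x u0) + (x um - x u0)" by (simp add: scaleR_2)
    then have "norm (x up + x um - 2 *\<^sub>R x u0) \<le> norm (x up - x u0) + norm (x um - x u0)"
      by (simp only: norm_triangle_ineq)
    also have "\<dots> \<le> K * \<bar>up - u0\<bar> + K * \<bar>um - u0\<bar>"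
      using lipschitz_onD[OF px(3) assms(2,1)] lipschitz_onD[OF px(3) assms(3,1)] by (intro add_mono) (auto simp: dist_norm)
    also have "\<dots> \<le> K * \<kappa> + K * \<kappa>" using assms K_nonneg by (intro add_mono mult_left_mono) auto
    also have "\<dots> \<le> 2 * K * \<kappa> * (Nc (u0 + 2 * \<kappa>) - Nc (u0 - 2 * \<kappa>))"
      using True Nc_jump K_nonneg kap mult_left_mono[of 1 "Nc (u0 + 2 * \<kappa>) - Nc (u0 - 2 * \<kappa>)" "2 * K * \<kappa>"] by auto
    finally show ?thesis using nn Kn by linarith
  next
    case False
    then obtain p where p: "norm p \<le> K" "\<And>v. v \<in> {t - \<tau>bar..T} \<Longrightarrow> \<bar>v - u0\<bar> \<le> \<kappa> \<Longrightarrow>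
        norm (x v - x u0 - (v - u0) *\<^sub>R p) \<le> quasi * \<kappa> * (\<kappa> + \<epsilon>)"
      using linearization_of_x[OF assms(1)] by blast
    have "x up + x um - 2 *\<^sub>R x u0 = (x up - x u0 - (up - u0) *\<^sub>R p) + (x um - x u0 - (um - u0) *\<^sub>R p) + (up + um - 2 * u0) *\<^sub>R p"
    proof -
      have "(up + um - 2 * u0) *\<^sub>R p = (up - u0) *\<^sub>R p + (um - u0) *\<^sub>R p" by (simp flip: scaleR_left_distrib)
      then show ?thesis by (simp add: scaleR_2)
    qed
    then have "norm (x up + x um - 2 *\<^sub>R x u0) \<le> norm (x up - x u0 - (up - u0) *\<^sub>R p) + norm (x um - x u0 - (um - u0) *\<^sub>R p)
        + norm ((up + um - 2 * u0) *\<^sub>R p)"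
      by (simp only: norm_add3_le)
    also have "\<dots> \<le> quasi * \<kappa> * (\<kappa> + \<epsilon>) + quasi * \<kappa> * (\<kappa> + \<epsilon>) + K * \<bar>up + um - 2 * u0\<bar>"
      using p assms mult_left_mono[OF p(1), of "\<bar>up + um - 2 * u0\<bar>"] by (intro add_mono) (auto simp: mult.commute)
    finally show ?thesis using Nn by linarith
  qed
qed

section \<open>Second differences at lagged times and the Gronwall argument\<close>

definition "\<psi> r = norm (xp (lag xp r) + xm (lag xm r) - 2 *\<^sub>R x (lag x r))"

definition "\<Phi>c = 4 * growth * \<eta> * \<kappa> + 2 * quasi * \<kappa> * (\<kappa> + \<epsilon>) + 4 * K * \<gamma>\<tau> * \<eta>\<^sup>2"

text \<open>The part of \<open>\<psi>\<close> that does not come from \<open>D\<close>: mass of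
  \<open>\<omega>\<close> near the lag, breakpoints near the lag, and a constant of the order of
  \<open>\<Sigma>\<close>.\<close>

definition "\<Phi> r = 2 * (W (lag x r + \<kappa>) - W (lag x r - \<kappa>))
  + 2 * K * \<kappa> * (Nc (lag x r + 2 * \<kappa>) - Nc (lag x r - 2 * \<kappa>)) + \<Phi>c"

lemma \<Phi>c_nonneg: "0 \<le> \<Phi>c"
  unfolding \<Phi>c_def using growth_pos eta_kappa consts_nonneg K_nonneg \<gamma>\<tau>(1) eps by simp

lemma \<Phi>_nonneg: "0 \<le> \<Phi> r"
  unfolding \<Phi>_def
  using monoD[OF W(1), of "lag x r - \<kappa>" "lag x r + \<kappa>"] monoD[OF Nc(1), of "lag x r - 2 * \<kappa>" "lag x r + 2 * \<kappa>"]
    eta_kappa(2) K_nonneg \<Phi>c_nonneg by (intro add_nonneg_nonneg mult_nonneg_nonneg) auto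

text \<open>The second difference with three different lags splits into that of \<open>x\<close>
  alone at these lags, the increments of the two perturbations between their own lag and
  \<open>lag x r\<close>, and \<open>D\<close> at the common time \<open>lag x r\<close>.\<close>

lemma \<psi>_le:
  assumes r: "r \<in> {t..T}"
  shows "\<psi> r \<le> norm (D (lag x r)) + K * l\<tau> * norm (D r) + \<Phi> r"
proof -
  let ?u = "lag x r" and ?p = "lag xp r" and ?m = "lag xm r"
  have eq: "xp ?p + xm ?m - 2 *\<^sub>R x ?u = (x ?p + x ?m - 2 *\<^sub>R x ?u)
    + ((xp ?p - x ?p) - (xp ?u - x ?u)) + ((xm ?m - x ?m) - (xm ?u - x ?u)) + D ?u"
    by (simp add: D_def scaleR_2)
  have "\<psi> r \<le> norm ((x ?p + x ?m - 2 *\<^sub>R x ?u)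
    + ((xp ?p - x ?p) - (xp ?u - x ?u)) + ((xm ?m - x ?m) - (xm ?u - x ?u))) + norm (D ?u)"
    unfolding \<psi>_def eq by (rule norm_triangle_ineq)
  moreover have "norm ((x ?p + x ?m - 2 *\<^sub>R x ?u) + ((xp ?p - x ?p) - (xp ?u - x ?u)) + ((xm ?m - x ?m) - (xm ?u - x ?u)))
    \<le> norm (x ?p + x ?m - 2 *\<^sub>R x ?u) + norm ((xp ?p - x ?p) - (xp ?u - x ?u)) + norm ((xm ?m - x ?m) - (xm ?u - x ?u))"
    by (rule norm_add3_le)
  moreover have "norm (x ?p + x ?m - 2 *\<^sub>R x ?u)
    \<le> 2 * K * \<kappa> * (Nc (?u + 2 * \<kappa>) - Nc (?u - 2 * \<kappa>)) + 2 * quasi * \<kappa> * (\<kappa> + \<epsilon>) + K * \<bar>?p + ?m - 2 * ?u\<bar>"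
    by (rule x_second_difference[OF lag_in[OF r] lag_in[OF r] lag_in[OF r] lag_first_order[OF r]])
  moreover have "K * \<bar>?p + ?m - 2 * ?u\<bar> \<le> K * (4 * \<gamma>\<tau> * \<eta>\<^sup>2 + l\<tau> * norm (D r))"
    by (rule mult_left_mono[OF lag_second_order[OF r] K_nonneg])
  moreover have "K * (4 * \<gamma>\<tau> * \<eta>\<^sup>2 + l\<tau> * norm (D r)) = 4 * K * \<gamma>\<tau> * \<eta>\<^sup>2 + K * l\<tau> * norm (D r)" by (simp add: algebra_simps)
  moreover have "norm ((xp ?p - x ?p) - (xp ?u - x ?u)) \<le> W (?u + \<kappa>) - W (?u - \<kappa>) + 2 * growth * \<eta> * \<kappa>"
    "norm ((xm ?m - x ?m) - (xm ?u - x ?u)) \<le> W (?u + \<kappa>) - W (?u - \<kappa>) + 2 * growth * \<eta> * \<kappa>"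
    using lag_increments[OF r] by blast+
  ultimately show ?thesis by (simp add: \<Phi>_def \<Phi>c_def)
qed

text \<open>Pointwise, the window terms of \<open>\<Phi>\<close> are in general of first order only.
  Along the expanding lag they integrate to the window size over \<open>d\<close> times the total
  mass, so \<open>W\<close> contributes \<open>\<delta> * I1\<close>, and \<open>Nc\<close>, already
  carrying a factor \<open>\<kappa>\<close>, contributes \<open>\<delta>\<^sup>2\<close> times the
  bound on the number of breakpoints.\<close>

lemma \<Phi>_integral: "\<Phi> integrable_on {t..T}" "integral {t..T} \<Phi> \<le> lag_gap N * \<Sigma>"
proof -
  have lagx: "\<And>s s'. t \<le> s \<Longrightarrow> s \<le> s' \<Longrightarrow> s' \<le> T \<Longrightarrow> d * (s' - s) \<le> lag x s' - lag x s" by (rule px(5))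
  note IW = integral_increment_along_expanding[OF W lag_expanding(1) less_imp_le[OF eta_kappa(2)] less_imp_le[OF t(2)] lagx]
  have k2: "0 \<le> 2 * \<kappa>" using eta_kappa(2) by simp
  note IN = integral_increment_along_expanding[OF Nc lag_expanding(1) k2 less_imp_le[OF t(2)] lagx]
  have I: "(\<lambda>r. 2 * (W (lag x r + \<kappa>) - W (lag x r - \<kappa>))) integrable_on {t..T}"
    "(\<lambda>r. 2 * K * \<kappa> * (Nc (lag x r + 2 * \<kappa>) - Nc (lag x r - 2 * \<kappa>))) integrable_on {t..T}"
    by (intro integrable_on_mult_right IW IN; assumption)+
  show "\<Phi> integrable_on {t..T}" unfolding \<Phi>_def by (intro integrable_add I integrable_const_ivl)
  have "integral {t..T} \<Phi> = integral {t..T} (\<lambda>r. 2 * (W (lag x r + \<kappa>) - W (lag x r - \<kappa>)))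
    + integral {t..T} (\<lambda>r. 2 * K * \<kappa> * (Nc (lag x r + 2 * \<kappa>) - Nc (lag x r - 2 * \<kappa>))) + \<Phi>c * (T - t)"
    unfolding \<Phi>_def
    using integral_add[OF integrable_add[OF I] integrable_const_ivl, of \<Phi>c] integral_add[OF I] t by (simp add: mult.commute)
  also have "\<dots> \<le> 2 * (2 * \<kappa> / d * I1) + 2 * K * \<kappa> * (2 * (2 * \<kappa>) / d * (real N + 2)) + \<Phi>c * (T - t0)"
  proof (intro add_mono)
    show "integral {t..T} (\<lambda>r. 2 * (W (lag x r + \<kappa>) - W (lag x r - \<kappa>))) \<le> 2 * (2 * \<kappa> / d * I1)"
      using IW(2) integral_mult_right[of "{t..T}" 2 "\<lambda>r. W (lag x r + \<kappa>) - W (lag x r - \<kappa>)"] by linarith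
    show "integral {t..T} (\<lambda>r. 2 * K * \<kappa> * (Nc (lag x r + 2 * \<kappa>) - Nc (lag x r - 2 * \<kappa>))) \<le> 2 * K * \<kappa> * (2 * (2 * \<kappa>) / d * (real N + 2))"
      using mult_left_mono[OF IN(2), of "2 * K * \<kappa>"] K_nonneg eta_kappa(2) by simp
    show "\<Phi>c * (T - t) \<le> \<Phi>c * (T - t0)" using \<Phi>c_nonneg t by (intro mult_left_mono) auto
  qed
  also have "\<dots> \<le> lag_gap N * \<Sigma>"
  proof -
    have dI: "0 \<le> \<delta> * I1" "0 \<le> \<delta> * \<epsilon>" "0 \<le> \<delta>\<^sup>2" using eta_kappa \<delta> eps by auto
    have a: "2 * (2 * \<kappa> / d * I1) \<le> 4 * shift / d * \<Sigma>"
    proof -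
      have "2 * (2 * \<kappa> / d * I1) = 4 * shift / d * (\<delta> * I1)" by (simp add: \<kappa>_def)
      also have "\<dots> \<le> 4 * shift / d * \<Sigma>"
        using dI consts_nonneg(1) lag_expanding(1) by (intro mult_left_mono) (auto simp: \<Sigma>_def)
      finally show ?thesis .
    qed
    have b: "2 * K * \<kappa> * (2 * (2 * \<kappa>) / d * (real N + 2)) \<le> 8 * K * shift\<^sup>2 / d * (real N + 2) * \<Sigma>"
    proof -
      have "2 * K * \<kappa> * (2 * (2 * \<kappa>) / d * (real N + 2)) = 8 * K * shift\<^sup>2 / d * (real N + 2) * \<delta>\<^sup>2"
        by (simp add: \<kappa>_def power2_eq_square)
      also have "\<dots> \<le> 8 * K * shift\<^sup>2 / d * (real N + 2) * \<Sigma>"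
        using dI K_nonneg lag_expanding(1) by (intro mult_left_mono) (auto simp: \<Sigma>_def)
      finally show ?thesis .
    qed
    have c: "\<Phi>c \<le> (4 * growth * dep * shift + 2 * quasi * shift * (shift + 1) + 4 * K * \<gamma>\<tau> * dep\<^sup>2) * \<Sigma>"
    proof -
      have "\<Phi>c = 4 * growth * dep * shift * \<delta>\<^sup>2 + 2 * quasi * shift * (shift * \<delta>\<^sup>2 + \<delta> * \<epsilon>) + 4 * K * \<gamma>\<tau> * dep\<^sup>2 * \<delta>\<^sup>2"
        by (simp add: \<Phi>c_def \<eta>_def \<kappa>_def power2_eq_square algebra_simps)
      also have "\<dots> \<le> 4 * growth * dep * shift * \<Sigma> + 2 * quasi * shift * ((shift + 1) * \<Sigma>) + 4 * K * \<gamma>\<tau> * dep\<^sup>2 * \<Sigma>"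
      proof (intro add_mono mult_left_mono)
        have "shift * \<delta>\<^sup>2 \<le> shift * \<Sigma>" using dI consts_nonneg(1) by (intro mult_left_mono) (auto simp: \<Sigma>_def)
        moreover have "\<delta> * \<epsilon> \<le> \<Sigma>" using dI by (simp add: \<Sigma>_def)
        ultimately show "shift * \<delta>\<^sup>2 + \<delta> * \<epsilon> \<le> (shift + 1) * \<Sigma>" by (simp add: algebra_simps)
      qed (use dI growth_pos dep_pos consts_nonneg K_nonneg \<gamma>\<tau>(1) in \<open>auto simp: \<Sigma>_def\<close>)
      also have "\<dots> = (4 * growth * dep * shift + 2 * quasi * shift * (shift + 1) + 4 * K * \<gamma>\<tau> * dep\<^sup>2) * \<Sigma>"
        by (simp add: algebra_simps)
      finally show ?thesis .
    qed
    have "\<Phi>c * (T - t0) \<le> (4 * growth * dep * shift + 2 * quasi * shift * (shift + 1) + 4 * K * \<gamma>\<tau> * dep\<^sup>2) * \<Sigma> * (T - t0)"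
      using c time by (intro mult_right_mono) auto
    then have "2 * (2 * \<kappa> / d * I1) + 2 * K * \<kappa> * (2 * (2 * \<kappa>) / d * (real N + 2)) + \<Phi>c * (T - t0)
      \<le> 4 * shift / d * \<Sigma> + 8 * K * shift\<^sup>2 / d * (real N + 2) * \<Sigma>
        + (4 * growth * dep * shift + 2 * quasi * shift * (shift + 1) + 4 * K * \<gamma>\<tau> * dep\<^sup>2) * \<Sigma> * (T - t0)"
      by (intro add_mono a b)
    also have "\<dots> = lag_gap N * \<Sigma>" by (simp only: lag_gap_def distrib_right distrib_left mult_ac)
    finally show ?thesis .
  qed
  finally show "integral {t..T} \<Phi> \<le> lag_gap N * \<Sigma>" .
qed

lemma delayed_pair:
  assumes r: "r \<in> {t..T}"
  shows "(norm (xp r - xm r))\<^sup>2 + (norm (xp (lag xp r) - xm (lag xm r)))\<^sup>2 \<le> pair_gap * \<delta>\<^sup>2"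
proof -
  have c1: "1 \<le> 1 + K * l\<tau>" using K_nonneg l\<tau>(1) by simp
  have "norm (xp (lag xp r) - xm (lag xm r)) \<le> K * l\<tau> * norm (xp r - xm r) + norm (xp (lag xp r) - xm (lag xp r))"
    by (rule delayed_diff[OF pm(3) r t(1)])
  also have "\<dots> \<le> K * l\<tau> * (2 * \<eta>) + 2 * \<eta>"
    using first_order(3)[OF mem[OF r]] first_order(3)[OF lag_in[OF r]] K_nonneg l\<tau>(1)
    by (intro add_mono mult_left_mono) auto
  finally have "norm (xp (lag xp r) - xm (lag xm r)) \<le> 2 * (1 + K * l\<tau>) * \<eta>" by (simp add: algebra_simps)
  then have 1: "(norm (xp (lag xp r) - xm (lag xm r)))\<^sup>2 \<le> (2 * (1 + K * l\<tau>) * \<eta>)\<^sup>2" by (intro power_mono) auto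
  have "norm (xp r - xm r) \<le> 2 * \<eta>" by (rule first_order(3)[OF mem[OF r]])
  also have "\<dots> \<le> 2 * (1 + K * l\<tau>) * \<eta>" using c1 eta_kappa(1) by simp
  finally have "(norm (xp r - xm r))\<^sup>2 \<le> (2 * (1 + K * l\<tau>) * \<eta>)\<^sup>2" by (intro power_mono) auto
  with 1 have "(norm (xp r - xm r))\<^sup>2 + (norm (xp (lag xp r) - xm (lag xm r)))\<^sup>2 \<le> 2 * (2 * (1 + K * l\<tau>) * \<eta>)\<^sup>2" by simp
  also have "\<dots> = pair_gap * \<delta>\<^sup>2" by (simp add: pair_gap_def \<eta>_def power2_eq_square algebra_simps)
  finally show ?thesis .
qed

lemma midpoints:
  "norm ((1/2) *\<^sub>R (xp r + xm r) - x r) = norm (D r) / 2"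
  "norm ((1/2) *\<^sub>R (xp (lag xp r) + xm (lag xm r)) - x (lag x r)) = \<psi> r / 2"
proof -
  have h: "norm ((1/2) *\<^sub>R (a + b) - c) = norm (a + b - 2 *\<^sub>R c) / 2" for a b c :: "real^'b"
  proof -
    have "(1/2) *\<^sub>R (a + b) - c = (1/2) *\<^sub>R (a + b - 2 *\<^sub>R c)" by (simp add: scaleR_diff_right)
    then show ?thesis by simp
  qed
  show "norm ((1/2) *\<^sub>R (xp r + xm r) - x r) = norm (D r) / 2"
    "norm ((1/2) *\<^sub>R (xp (lag xp r) + xm (lag xm r)) - x (lag x r)) = \<psi> r / 2"
    unfolding D_def \<psi>_def by (rule h)+
qed

lemma mid_bound:
  assumes "s \<in> {t - \<tau>bar..T}" "s' \<in> {t - \<tau>bar..T}"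
  shows "norm ((1/2) *\<^sub>R (xp s + xm s')) \<le> sol_bound R0"
  using pp(2)[OF assms(1)] pm(2)[OF assms(2)] norm_triangle_ineq[of "xp s" "xm s'"] by simp

text \<open>The value of \<open>f\<close> at the midpoints of the perturbed arguments is inserted:
  the second-order condition on \<open>f\<close> reaches it, and Lipschitz continuity goes on to
  \<open>x\<close> over half of the second differences \<open>D\<close> and
  \<open>\<psi>\<close>.\<close>

lemma rhs_second_difference:
  assumes r: "r \<in> {t<..<T}"
  shows "norm (rhs xp \<beta> r + rhs xm \<beta> r - 2 *\<^sub>R rhs x \<beta> r)
    \<le> \<gamma>f * pair_gap * \<delta>\<^sup>2 + lf * (norm (D r) + \<psi> r)"
proof -
  have rt: "r \<in> {t..T}" "r \<in> {t0..T}" "\<beta> r \<in> A" using r t \<beta> by (auto simp: controls_def)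
  let ?fp = "rhs xp \<beta> r" and ?fm = "rhs xm \<beta> r" and ?f = "rhs x \<beta> r"
  let ?mid = "f (r, (1/2) *\<^sub>R (xp r + xm r), (1/2) *\<^sub>R (xp (lag xp r) + xm (lag xm r)), \<beta> r)"
  have "norm (?fp + ?fm - 2 *\<^sub>R ?mid) \<le> \<gamma>f * ((norm (xp r - xm r))\<^sup>2 + (norm (xp (lag xp r) - xm (lag xm r)))\<^sup>2)"
    unfolding rhs_def
    by (rule \<gamma>f(2)[OF rt(2,3) pp(2)[OF mem[OF rt(1)]] pm(2)[OF mem[OF rt(1)]] pp(2)[OF lag_in[OF rt(1)]] pm(2)[OF lag_in[OF rt(1)]]])
  also have "\<dots> \<le> \<gamma>f * (pair_gap * \<delta>\<^sup>2)" by (rule mult_left_mono[OF delayed_pair[OF rt(1)] \<gamma>f(1)])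
  finally have 1: "norm (?fp + ?fm - 2 *\<^sub>R ?mid) \<le> \<gamma>f * pair_gap * \<delta>\<^sup>2" by (simp add: mult.assoc)
  have "norm (?mid - ?f) \<le> lf * (norm (D r) / 2 + \<psi> r / 2)"
    using lf(2)[OF rt(2,3), of "(1/2) *\<^sub>R (xp r + xm r)" "(1/2) *\<^sub>R (xp (lag xp r) + xm (lag xm r))" "x r" "x (lag x r)"]
    unfolding rhs_def midpoints .
  moreover have "norm (2 *\<^sub>R (?mid - ?f)) = 2 * norm (?mid - ?f)" by (simp only: norm_scaleR abs_numeral)
  moreover have "2 * (lf * (norm (D r) / 2 + \<psi> r / 2)) = lf * (norm (D r) + \<psi> r)" by (simp add: field_simps)
  ultimately have 2: "norm (2 *\<^sub>R (?mid - ?f)) \<le> lf * (norm (D r) + \<psi> r)" by linarith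
  have "?fp + ?fm - 2 *\<^sub>R ?f = (?fp + ?fm - 2 *\<^sub>R ?mid) + 2 *\<^sub>R (?mid - ?f)" by (simp add: scaleR_diff_right)
  then have "norm (?fp + ?fm - 2 *\<^sub>R ?f) \<le> norm (?fp + ?fm - 2 *\<^sub>R ?mid) + norm (2 *\<^sub>R (?mid - ?f))"
    by (simp only: norm_triangle_ineq)
  with 1 2 show ?thesis by linarith
qed

lemma delta_sq_le: "\<delta>\<^sup>2 \<le> \<Sigma>"
  using eta_kappa \<delta> eps by (simp add: \<Sigma>_def)

text \<open>\<open>D\<close> vanishes on the whole history, because \<open>w + w0\<close> and
  \<open>w - w0\<close> average to \<open>w\<close>; hence the Gronwall recursion starts from 0 and
  is driven by \<open>\<phi>\<close> alone.\<close>

lemma D_bound: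
  assumes s: "s \<in> {t - \<tau>bar..T}"
  shows "norm (D s) \<le> traj_gap N * \<Sigma>"
proof (cases "s \<le> t")
  case True
  then show ?thesis using D_hist s consts_nonneg(6) eta_kappa(6) by simp
next
  case False
  then have s: "s \<in> {t..T}" using s by auto
  let ?h = "\<lambda>r. rhs xp \<beta> r + rhs xm \<beta> r - 2 *\<^sub>R rhs x \<beta> r"
  define \<rho> where "\<rho> r = (if r \<in> {t<..<T} then norm (?h r) else 0)" for r
  define \<phi> where "\<phi> r = lf * \<Phi> r + \<gamma>f * pair_gap * \<delta>\<^sup>2" for r
  define b where "b = lf * (lag_gap N * \<Sigma>) + \<gamma>f * pair_gap * \<Sigma> * (T - t0)"
  have gp: "0 \<le> \<gamma>f * pair_gap" using \<gamma>f(1) consts_nonneg(5) by simp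
  have "?h absolutely_integrable_on {t..T}"
    using rhs_integrable(1)[OF pp(4) t(1) \<beta>] rhs_integrable(1)[OF pm(4) t(1) \<beta>] rhs_integrable(1)[OF px(4) t(1) \<beta>]
    by (intro set_integral_diff set_integral_add absolutely_integrable_scaleR_left)
  then have hI: "?h integrable_on {t..T}" and nI: "(\<lambda>r. norm (?h r)) integrable_on {t..T}"
    by (auto simp: absolutely_integrable_on_def)
  have rI: "\<rho> integrable_on {t..T}" by (rule integrable_spike[OF nI, of "{t, T}"]) (auto simp: \<rho>_def)
  have "norm (D s) \<le> 2 * (0 + b) * exp (4 * growth * (s - t))"
  proof (rule gronwall_along_delay[where \<rho>=\<rho> and \<phi>=\<phi> and u="lag x" and E="\<lambda>s. norm (D s)" and T=T])
    show "continuous_on {t..T} (\<lambda>s. norm (D s))"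
      unfolding D_def using delayed_continuous(2)[OF px(4) t(1)] delayed_continuous(2)[OF pp(4) t(1)] delayed_continuous(2)[OF pm(4) t(1)]
      by (intro continuous_intros)
    show "lag x r \<le> r" if "r \<in> {t..T}" for r by (rule lag_bounds(1)[OF that t(1)])
    show "growth > 0" "(0::real) \<le> 0" by (auto simp: growth_pos)
    show "\<rho> integrable_on {t..T}" by (rule rI)
    show "\<phi> integrable_on {t..T}" unfolding \<phi>_def by (intro integrable_add integrable_on_mult_right \<Phi>_integral integrable_const_ivl)
    show "0 \<le> \<phi> r" for r using \<Phi>_nonneg lf(1) gp by (simp add: \<phi>_def)
    have "integral {t..T} \<phi> = lf * integral {t..T} \<Phi> + \<gamma>f * pair_gap * \<delta>\<^sup>2 * (T - t)"
      unfolding \<phi>_def using integral_add[OF integrable_on_mult_right[OF \<Phi>_integral(1)] integrable_const_ivl, of lf "\<gamma>f * pair_gap * \<delta>\<^sup>2"] t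
      by (simp add: mult.commute)
    also have "\<dots> \<le> lf * (lag_gap N * \<Sigma>) + \<gamma>f * pair_gap * \<Sigma> * (T - t0)"
      using \<Phi>_integral(2) lf(1) \<gamma>f(1) consts_nonneg(5) delta_sq_le eta_kappa(6) t by (intro add_mono mult_left_mono mult_mono mult_nonneg_nonneg) auto
    finally show "integral {t..T} \<phi> \<le> b" by (simp add: b_def)
    show "norm (D s) \<le> 0 + integral {t..s} \<rho>" if s: "s \<in> {t..T}" for s
    proof -
      have I: "rhs xp \<beta> integrable_on {t..s}" "rhs xm \<beta> integrable_on {t..s}" "rhs x \<beta> integrable_on {t..s}"
        using rhs_integrable(3)[OF pp(4) t(1) \<beta>, of t s] rhs_integrable(3)[OF pm(4) t(1) \<beta>, of t s]
          rhs_integrable(3)[OF px(4) t(1) \<beta>, of t s] s by auto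
      have "xp s = (w 0 + w0 0) + integral {t..s} (rhs xp \<beta>)" "xm s = (w 0 - w0 0) + integral {t..s} (rhs xm \<beta>)"
        "x s = w 0 + integral {t..s} (rhs x \<beta>)"
        using pp(1) pm(1) px(1) s by (auto simp: sol_def)
      then have "D s = integral {t..s} (rhs xp \<beta>) + integral {t..s} (rhs xm \<beta>) - 2 *\<^sub>R integral {t..s} (rhs x \<beta>)"
        by (simp add: D_def scaleR_2)
      also have "\<dots> = integral {t..s} ?h"
        using integral_diff[OF integrable_add[OF I(1,2)] integrable_cmul[OF I(3), of 2]] integral_add[OF I(1,2)] by simp
      finally have "norm (D s) = norm (integral {t..s} ?h)" by simp
      also have "\<dots> \<le> integral {t..s} (\<lambda>r. norm (?h r))"
        using s by (intro integral_norm_bound_integral integrable_on_subinterval[OF hI] integrable_on_subinterval[OF nI]) auto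
      also have "\<dots> = integral {t..s} \<rho>" by (rule integral_spike[of "{t, T}"]) (use s in \<open>auto simp: \<rho>_def\<close>)
      finally show ?thesis by simp
    qed
    show "\<rho> r \<le> \<phi> r + growth * (norm (D r) + (if t \<le> lag x r then norm (D (lag x r)) else 0))" if r: "r \<in> {t..T}" for r
    proof (cases "r \<in> {t<..<T}")
      case True
      have Dl: "norm (D (lag x r)) = (if t \<le> lag x r then norm (D (lag x r)) else 0)"
        using D_hist[of "lag x r"] lag_bounds(3)[OF r t(1), of x] by auto
      have "\<rho> r \<le> \<gamma>f * pair_gap * \<delta>\<^sup>2 + lf * (norm (D r) + \<psi> r)"
        using rhs_second_difference[OF True] True by (simp add: \<rho>_def)
      also have "\<dots> \<le> \<gamma>f * pair_gap * \<delta>\<^sup>2 + lf * (norm (D r) + (norm (D (lag x r)) + K * l\<tau> * norm (D r) + \<Phi> r))"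
        using \<psi>_le[OF r] lf(1) by (intro add_left_mono mult_left_mono) auto
      also have "\<dots> = \<phi> r + lf * ((1 + K * l\<tau>) * norm (D r) + norm (D (lag x r)))" by (simp add: \<phi>_def algebra_simps)
      also have "\<dots> \<le> \<phi> r + lf * ((1 + K * l\<tau>) * norm (D r) + (1 + K * l\<tau>) * norm (D (lag x r)))"
        using lf(1) K_nonneg l\<tau>(1) by (intro add_left_mono mult_left_mono) (auto simp: distrib_right)
      also have "\<dots> = \<phi> r + growth * (norm (D r) + norm (D (lag x r)))" by (simp add: growth_def algebra_simps)
      finally show ?thesis using Dl by simp
    next
      case False
      have "0 \<le> growth * (norm (D r) + (if t \<le> lag x r then norm (D (lag x r)) else 0))"
        using growth_pos by (intro mult_nonneg_nonneg add_nonneg_nonneg) auto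
      moreover have "0 \<le> \<phi> r" using \<Phi>_nonneg lf(1) gp by (simp add: \<phi>_def)
      ultimately show ?thesis using False by (simp only: \<rho>_def if_False)
    qed
  qed (use s in auto)
  also have "\<dots> \<le> 2 * (0 + b) * exp (4 * growth * (T - t0))"
  proof (rule mult_left_mono)
    show "exp (4 * growth * (s - t)) \<le> exp (4 * growth * (T - t0))" using growth_pos s t by auto
    show "0 \<le> 2 * (0 + b)" using lf(1) gp consts_nonneg(4)[of N] eta_kappa(6) time by (simp add: b_def)
  qed
  also have "\<dots> = traj_gap N * \<Sigma>" by (simp add: b_def traj_gap_def algebra_simps)
  finally show ?thesis .
qed

text \<open>Midpoints are compared as for the dynamics. Once \<open>D_bound\<close> is available,
  \<open>\<Phi>\<close> is the one term that becomes of second order only after integration.\<close>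

lemma running_second_difference:
  "integral {t..T} (\<lambda>r. L (r, xp r, xp (lag xp r), \<beta> r)) + integral {t..T} (\<lambda>r. L (r, xm r, xm (lag xm r), \<beta> r))
    - 2 * integral {t..T} (\<lambda>r. L (r, x r, x (lag x r), \<beta> r)) \<le> running_gap N * \<Sigma>"
proof -
  let ?Lp = "\<lambda>r. L (r, xp r, xp (lag xp r), \<beta> r)" and ?Lm = "\<lambda>r. L (r, xm r, xm (lag xm r), \<beta> r)"
    and ?L = "\<lambda>r. L (r, x r, x (lag x r), \<beta> r)"
  define G where "G = traj_gap N * \<Sigma>"
  have I: "?Lp integrable_on {t..T}" "?Lm integrable_on {t..T}" "?L integrable_on {t..T}"
    using path_integrable[OF L_cont pp(4) t(1) \<beta>] path_integrable[OF L_cont pm(4) t(1) \<beta>] path_integrable[OF L_cont px(4) t(1) \<beta>]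
    by (auto simp: absolutely_integrable_on_def)
  have hI: "(\<lambda>r. ?Lp r + ?Lm r - 2 * ?L r) integrable_on {t..T}"
    by (intro integrable_diff integrable_add integrable_on_mult_right I)
  define c where "c = \<gamma>L * pair_gap * \<delta>\<^sup>2 + lL * (2 + K * l\<tau>) * G"
  have "integral {t..T} ?Lp + integral {t..T} ?Lm - 2 * integral {t..T} ?L = integral {t..T} (\<lambda>r. ?Lp r + ?Lm r - 2 * ?L r)"
    using integral_diff[OF integrable_add[OF I(1,2)] integrable_on_mult_right[OF I(3), of 2]] integral_add[OF I(1,2)] by simp
  also have "\<dots> = integral {t..T} (\<lambda>r. if r \<in> {t, T} then 0 else ?Lp r + ?Lm r - 2 * ?L r)"
    by (rule integral_spike[of "{t, T}"]) auto
  also have "\<dots> \<le> integral {t..T} (\<lambda>r. c + lL * \<Phi> r)"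
  proof (rule integral_le)
    show "(\<lambda>r. if r \<in> {t, T} then 0 else ?Lp r + ?Lm r - 2 * ?L r) integrable_on {t..T}"
      by (rule integrable_spike[OF hI, of "{t, T}"]) auto
    show "(\<lambda>r. c + lL * \<Phi> r) integrable_on {t..T}"
      by (intro integrable_add integrable_on_mult_right \<Phi>_integral integrable_const_ivl)
    fix r assume r: "r \<in> {t..T}"
    show "(if r \<in> {t, T} then 0 else ?Lp r + ?Lm r - 2 * ?L r) \<le> c + lL * \<Phi> r"
    proof (cases "r \<in> {t, T}")
      case True
      have "0 \<le> G" using consts_nonneg(6) eta_kappa(6) by (simp add: G_def)
      then have "0 \<le> c" using \<gamma>L(1) consts_nonneg(5) lL(1) K_nonneg l\<tau>(1) unfolding c_def by (intro add_nonneg_nonneg mult_nonneg_nonneg) auto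
      then show ?thesis using True lL(1) \<Phi>_nonneg[of r] by simp
    next
      case False
      then have rt: "r \<in> {t0..T}" "\<beta> r \<in> A" using r t \<beta> by (auto simp: controls_def)
      note m = mem[OF r] and l = lag_in[OF r]
      let ?mid = "L (r, (1/2) *\<^sub>R (xp r + xm r), (1/2) *\<^sub>R (xp (lag xp r) + xm (lag xm r)), \<beta> r)"
      have "\<bar>?Lp r + ?Lm r - 2 * ?mid\<bar> \<le> \<gamma>L * ((norm (xp r - xm r))\<^sup>2 + (norm (xp (lag xp r) - xm (lag xm r)))\<^sup>2)"
        by (rule \<gamma>L(2)[OF rt pp(2)[OF m] pm(2)[OF m] pp(2)[OF l] pm(2)[OF l]])
      also have "\<dots> \<le> \<gamma>L * (pair_gap * \<delta>\<^sup>2)" by (rule mult_left_mono[OF delayed_pair[OF r] \<gamma>L(1)])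
      finally have 1: "\<bar>?Lp r + ?Lm r - 2 * ?mid\<bar> \<le> \<gamma>L * pair_gap * \<delta>\<^sup>2" by (simp add: mult.assoc)
      have "\<bar>?mid - ?L r\<bar> \<le> lL * (norm ((1/2) *\<^sub>R (xp r + xm r) - x r) + norm ((1/2) *\<^sub>R (xp (lag xp r) + xm (lag xm r)) - x (lag x r)))"
        by (rule lL(2)[OF rt mid_bound[OF m m] mid_bound[OF l l] px(2)[OF m] px(2)[OF l]])
      then have 2: "\<bar>?mid - ?L r\<bar> \<le> lL * (norm (D r) + \<psi> r) / 2" unfolding midpoints by (simp add: field_simps)
      have "\<psi> r \<le> G + K * l\<tau> * G + \<Phi> r"
        using \<psi>_le[OF r] D_bound[OF l, of x] mult_left_mono[OF D_bound[OF m], of "K * l\<tau>"] K_nonneg l\<tau>(1) by (simp add: G_def)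
      then have "lL * (norm (D r) + \<psi> r) \<le> lL * (G + (G + K * l\<tau> * G + \<Phi> r))"
        using D_bound[OF m] lL(1) by (intro mult_left_mono add_mono) (auto simp: G_def)
      also have "\<dots> = lL * (2 + K * l\<tau>) * G + lL * \<Phi> r" by (simp add: algebra_simps)
      finally have 3: "lL * (norm (D r) + \<psi> r) \<le> lL * (2 + K * l\<tau>) * G + lL * \<Phi> r" .
      have "?Lp r + ?Lm r - 2 * ?L r \<le> c + lL * \<Phi> r" using 1 2 3 unfolding c_def by linarith
      then show ?thesis using False by simp
    qed
  qed
  also have "\<dots> = c * (T - t) + lL * integral {t..T} \<Phi>"
    using integral_add[OF integrable_const_ivl integrable_on_mult_right[OF \<Phi>_integral(1)], of c lL] t by (simp add: mult.commute)
  also have "\<dots> \<le> (\<gamma>L * pair_gap * \<Sigma> + lL * (2 + K * l\<tau>) * G) * (T - t0) + lL * (lag_gap N * \<Sigma>)"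
  proof (intro add_mono mult_left_mono mult_mono)
    show "c \<le> \<gamma>L * pair_gap * \<Sigma> + lL * (2 + K * l\<tau>) * G"
      unfolding c_def using delta_sq_le \<gamma>L(1) consts_nonneg(5) by (intro add_right_mono mult_left_mono) auto
    have "0 \<le> G" using consts_nonneg(6) eta_kappa(6) by (simp add: G_def)
    then show "0 \<le> \<gamma>L * pair_gap * \<Sigma> + lL * (2 + K * l\<tau>) * G"
      using \<gamma>L(1) consts_nonneg(5) lL(1) K_nonneg l\<tau>(1) eta_kappa(6) by (intro add_nonneg_nonneg mult_nonneg_nonneg) auto
  qed (use t \<Phi>_integral lL in auto)
  also have "\<dots> = running_gap N * \<Sigma>" by (simp add: running_gap_def G_def algebra_simps)
  finally show ?thesis .
qed

end

subsection \<open>Piecewise smooth histories and the terminal cost\<close>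

lemma vector_derivative_norm_le:
  fixes w :: "real \<Rightarrow> 'a::real_normed_vector"
  assumes "k-lipschitz_on {c<..<e} w" "(w has_vector_derivative v) (at \<theta>)" "\<theta> \<in> {c<..<e}"
  shows "norm v \<le> k"
proof -
  have "(w has_derivative (\<lambda>h. h *\<^sub>R v)) (at \<theta>)" using assms(2) by (simp add: has_vector_derivative_def)
  then have "((\<lambda>h. norm (w (\<theta> + h) - w \<theta> - h *\<^sub>R v) / norm h) \<longlongrightarrow> 0) (at 0)"
    unfolding has_derivative_at by blast
  then have "((\<lambda>h. k + norm (w (\<theta> + h) - w \<theta> - h *\<^sub>R v) / norm h) \<longlongrightarrow> k + 0) (at 0)" by (intro tendsto_intros)
  moreover have "\<forall>\<^sub>F h in at 0. norm v \<le> k + norm (w (\<theta> + h) - w \<theta> - h *\<^sub>R v) / norm h"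
  proof -
    have "\<forall>\<^sub>F h in at 0. \<theta> + h \<in> {c<..<e} \<and> h \<noteq> 0"
    proof -
      have "open {c - \<theta><..<e - \<theta>}" "0 \<in> {c - \<theta><..<e - \<theta>}" using assms(3) by auto
      from eventually_at_in_open'[OF this] have "\<forall>\<^sub>F h in at 0. h \<in> {c - \<theta><..<e - \<theta>}" .
      moreover have "\<forall>\<^sub>F h in at 0. h \<noteq> (0::real)" by (simp add: eventually_at_filter)
      ultimately show ?thesis by eventually_elim auto
    qed
    then show ?thesis
    proof eventually_elim
      case (elim h)
      have "norm (h *\<^sub>R v) \<le> norm (w (\<theta> + h) - w \<theta>) + norm (w (\<theta> + h) - w \<theta> - h *\<^sub>R v)"
        using norm_triangle_ineq4[of "w (\<theta> + h) - w \<theta>" "w (\<theta> + h) - w \<theta> - h *\<^sub>R v"] by simp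
      moreover have "norm (w (\<theta> + h) - w \<theta>) \<le> k * \<bar>h\<bar>"
        using lipschitz_onD[OF assms(1), of "\<theta> + h" \<theta>] elim assms(3) by (simp add: dist_norm)
      ultimately have "\<bar>h\<bar> * norm v \<le> k * \<bar>h\<bar> + norm (w (\<theta> + h) - w \<theta> - h *\<^sub>R v)" by simp
      then show ?case using elim by (simp add: field_simps)
    qed
  qed
  ultimately have "norm v \<le> k + 0" by (rule tendsto_lowerbound) (rule at_neq_bot)
  then show ?thesis by simp
qed

text \<open>A violation at one point persists on a nondegenerate interval, which is not
  negligible.\<close>

lemma AE_le_imp_le_on_Icc:
  fixes h :: "real \<Rightarrow> real"
  assumes "continuous_on {a..b} h" "a < b" "AE s in lebesgue_on {a..b}. h s \<le> r" "s \<in> {a..b}"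
  shows "h s \<le> r"
proof (rule ccontr)
  assume "\<not> h s \<le> r"
  then have hs: "r < h s" by simp
  obtain N where N: "negligible N" "\<And>s. s \<in> {a..b} - N \<Longrightarrow> h s \<le> r"
    using assms(3) by (subst (asm) AE_lebesgue_on_iff) auto
  obtain e where e: "e > 0" "\<And>s'. s' \<in> {a..b} \<Longrightarrow> dist s' s < e \<Longrightarrow> dist (h s') (h s) < h s - r"
    using assms(1,4) hs unfolding continuous_on_iff by (metis diff_gt_0_iff_gt)
  define p where "p = max a (s - e / 2)"
  define q where "q = min b (s + e / 2)"
  have pq: "p < q" "{p..q} \<subseteq> {a..b}" using assms e by (auto simp: p_def q_def)
  have "{p..q} \<subseteq> N"
  proof
    fix s' assume s': "s' \<in> {p..q}"
    then have "dist s' s < e" "s' \<in> {a..b}" using e pq assms(4) by (auto simp: p_def q_def dist_real_def)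
    then have "h s' > r" using e(2)[of s'] by (auto simp: dist_real_def)
    then show "s' \<in> N" using N(2)[of s'] \<open>s' \<in> {a..b}\<close> by force
  qed
  then have "negligible {p..q}" using N(1) negligible_subset by blast
  then show False using pq by (simp add: negligible_interval(1)[of p q, unfolded cbox_interval])
qed

text \<open>Where no derivative exists \<open>dot y\<close> is an unspecified value, so
  measurability is reduced to continuity off a finite set.\<close>

lemma dot_measurable:
  fixes y :: "real \<Rightarrow> real^'n"
  assumes F: "finite F" and cont: "continuous_on ({a<..<b} - F) (dot y)"
  shows "dot y \<in> borel_measurable (lebesgue_on {a..b})"
proof -
  let ?U = "{a<..<b} - F"
  have "open ?U" using F by (intro open_Diff finite_imp_closed) auto
  then have "(\<lambda>s. indicator ?U s *\<^sub>R dot y s) \<in> borel_measurable borel"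
    using cont by (intro borel_measurable_continuous_on_indicator) auto
  then have "(\<lambda>s. indicator ?U s *\<^sub>R dot y s) \<in> borel_measurable (lebesgue_on {a..b})"
    by (intro measurable_restrict_space1) (simp add: measurable_completion)
  then show ?thesis
    by (rule measurable_discrete_difference[of _ _ _ "({a, b} \<union> F) \<inter> {a..b}"])
      (use F in \<open>auto simp: countable_finite sets_restrict_space_iff space_restrict_space\<close>)
qed

text \<open>Converts the essential bounds in the definition of \<open>hist_W\<close> into pointwise
  ones. The essential bound on \<open>dot w\<close> gives the Lipschitz constant \<open>r\<close> by
  integrating the derivative, and this constant in turn bounds \<open>dot w\<close> at every point
  off the nonsmooth ones.\<close>

lemma hist_W_facts:
  fixes w :: "real \<Rightarrow> real^'n"
  assumes w: "w \<in> hist_W \<tau>bar r" and \<tau>bar: "\<tau>bar > 0" and r: "r > 0"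
  defines "B \<equiv> nonsmooth_points \<tau>bar w"
  shows "r-lipschitz_on {-\<tau>bar..0} w" "\<And>\<theta>. \<theta> \<in> {-\<tau>bar..0} \<Longrightarrow> norm (w \<theta>) \<le> r" "finite B"
    "\<And>c e \<theta>. {c<..<e} \<subseteq> {-\<tau>bar<..<0} - B \<Longrightarrow> \<theta> \<in> {c<..<e} \<Longrightarrow> (w has_vector_derivative dot w \<theta>) (at \<theta>)"
    "\<And>c e. {c<..<e} \<subseteq> {-\<tau>bar<..<0} - B \<Longrightarrow> r-lipschitz_on {c<..<e} (dot w)"
    "\<And>\<theta>. \<theta> \<in> {-\<tau>bar<..<0} - B \<Longrightarrow> (w has_vector_derivative dot w \<theta>) (at \<theta>)"
    "\<And>\<theta>. \<theta> \<in> {-\<tau>bar<..<0} - B \<Longrightarrow> norm (dot w \<theta>) \<le> r"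
    "dot w \<in> borel_measurable (lebesgue_on {-\<tau>bar..0})"
proof -
  have V: "w \<in> hist_V \<tau>bar r" and pw: "piecewise_C11 \<tau>bar w"
    and W: "\<And>c d. {c<..<d} \<subseteq> {-\<tau>bar<..<0} \<Longrightarrow> C11_on {c<..<d} w \<Longrightarrow> r-lipschitz_on {c<..<d} (dot w)"
    using w unfolding hist_W_def by blast+
  have P: "w \<in> lip_hist \<tau>bar" "Linf_norm \<tau>bar w \<le> ereal r" and dotL: "Linf_norm \<tau>bar (dot w) \<le> ereal r"
    using V by (auto simp: hist_V_def hist_P_def)
  obtain k where k: "k-lipschitz_on {-\<tau>bar..0} w" using P(1) by (auto simp: lip_hist_def)
  note wc = lipschitz_on_continuous_on[OF k]
  show "norm (w \<theta>) \<le> r" if "\<theta> \<in> {-\<tau>bar..0}" for \<theta>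
  proof (rule AE_le_imp_le_on_Icc[OF _ _ _ that])
    show "continuous_on {-\<tau>bar..0} (\<lambda>s. norm (w s))" by (intro continuous_intros wc)
    have "AE s in lebesgue_on {-\<tau>bar..0}. ereal (norm (w s)) \<le> Linf_norm \<tau>bar w" unfolding Linf_norm_def by (rule esssup_AE)
    then show "AE s in lebesgue_on {-\<tau>bar..0}. norm (w s) \<le> r"
    proof (rule eventually_mono)
      show "norm (w s) \<le> r" if "ereal (norm (w s)) \<le> Linf_norm \<tau>bar w" for s
        using order_trans[OF that P(2)] by simp
    qed
  qed (use \<tau>bar in auto)
  obtain S where S: "finite S" "\<And>c d. {c<..<d} \<subseteq> {-\<tau>bar<..<0} - S \<Longrightarrow> C11_on {c<..<d} w"
    using pw by (auto simp: piecewise_C11_def)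
  have "B \<subseteq> S"
  proof
    fix \<theta> assume th: "\<theta> \<in> B"
    show "\<theta> \<in> S"
    proof (rule ccontr)
      assume "\<theta> \<notin> S"
      then have "\<theta> \<in> {-\<tau>bar<..<0} - S" using th by (auto simp: B_def nonsmooth_points_def)
      moreover have "open ({-\<tau>bar<..<0} - S)" using S(1) by (intro open_Diff finite_imp_closed) auto
      ultimately obtain e where e: "e > 0" "ball \<theta> e \<subseteq> {-\<tau>bar<..<0} - S" using openE by blast
      then have "C11_on {\<theta> - e<..<\<theta> + e} w" by (intro S(2)) (auto simp: ball_eq_greaterThanLessThan)
      then show False using th e(1) by (auto simp: B_def nonsmooth_points_def)
    qed
  qed
  then show finB: "finite B" using S(1) finite_subset by blast
  have nbhd: "\<exists>e>0. C11_on {\<theta> - e<..<\<theta> + e} w" if "\<theta> \<in> {-\<tau>bar<..<0} - B" for \<theta>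
    using that by (auto simp: B_def nonsmooth_points_def)
  show deriv: "(w has_vector_derivative dot w \<theta>) (at \<theta>)" if th: "\<theta> \<in> {-\<tau>bar<..<0} - B" for \<theta>
  proof -
    obtain e where "e > 0" "C11_on {\<theta> - e<..<\<theta> + e} w" using nbhd[OF th] by blast
    then have "w differentiable (at \<theta>)" by (auto simp: C11_on_def)
    then show ?thesis using vector_derivative_works by blast
  qed
  have dcont: "continuous (at \<theta>) (dot w)" if th: "\<theta> \<in> {-\<tau>bar<..<0} - B" for \<theta>
  proof -
    obtain e k' where e: "e > 0" "k'-lipschitz_on {\<theta> - e<..<\<theta> + e} (dot w)"
      using nbhd[OF th] by (auto simp: C11_on_def)
    then have "continuous_on {\<theta> - e<..<\<theta> + e} (dot w)" by (intro lipschitz_on_continuous_on)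
    then show ?thesis using e(1) by (simp add: continuous_on_eq_continuous_at)
  qed
  show "dot w \<in> borel_measurable (lebesgue_on {-\<tau>bar..0})"
    by (rule dot_measurable[OF finB]) (use dcont in \<open>auto intro: continuous_at_imp_continuous_on\<close>)
  show "(w has_vector_derivative dot w \<theta>) (at \<theta>)" if "{c<..<e} \<subseteq> {-\<tau>bar<..<0} - B" "\<theta> \<in> {c<..<e}" for c e \<theta>
    using deriv that by blast
  \<comment> \<open>\<open>S\<close> may contain points at which \<open>w\<close> is smooth. There
    \<open>dot w\<close> is continuous, so the pieces between points of \<open>S\<close> join
    without loss.\<close>
  show "r-lipschitz_on {c<..<e} (dot w)" if sub: "{c<..<e} \<subseteq> {-\<tau>bar<..<0} - B" for c e
  proof (rule piecewise_lipschitz_on[OF _ S(1)])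
    show "continuous_on {c<..<e} (dot w)"
      by (rule continuous_at_imp_continuous_on) (use dcont sub in blast)
    show "r-lipschitz_on {a<..<b} (dot w)" if "{a<..<b} \<subseteq> {c<..<e} - S" for a b
      by (rule W[OF _ S(2)]) (use that sub in blast)+
  qed (use r in auto)
  have "AE s in lebesgue_on {-\<tau>bar..0}. norm (dot w s) \<le> r"
  proof (rule eventually_mono)
    show "AE s in lebesgue_on {-\<tau>bar..0}. ereal (norm (dot w s)) \<le> Linf_norm \<tau>bar (dot w)" unfolding Linf_norm_def by (rule esssup_AE)
    show "norm (dot w s) \<le> r" if "ereal (norm (dot w s)) \<le> Linf_norm \<tau>bar (dot w)" for s
      using order_trans[OF that dotL] by simp
  qed
  then obtain M where M: "negligible M" "\<And>s. s \<in> {-\<tau>bar..0} - M \<Longrightarrow> norm (dot w s) \<le> r"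
    by (subst (asm) AE_lebesgue_on_iff) auto
  \<comment> \<open>Zero on the exceptional set, so that the bound \<open>r\<close> holds
    everywhere.\<close>
  define dr where "dr s = (if s \<in> {-\<tau>bar<..<0} - B - M then dot w s else 0)" for s
  have incr: "norm (w b - w a) \<le> r * (b - a)" if ab: "-\<tau>bar \<le> a" "a \<le> b" "b \<le> 0" for a b
  proof -
    have "(dr has_integral (w b - w a)) {a..b}"
    proof (rule lipschitz_on_has_integral_AE_derivative)
      show "k-lipschitz_on {a..b} w" by (rule lipschitz_on_subset[OF k]) (use ab in auto)
      show "AE s in lebesgue_on {a<..<b}. (w has_vector_derivative dr s) (at s)"
        by (subst AE_lebesgue_on_iff)
          (use ab M finB deriv in \<open>auto intro!: exI[of _ "B \<union> M"] negligible_Un simp: dr_def\<close>)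
    qed (use ab in auto)
    then have "dr integrable_on {a..b}" "integral {a..b} dr = w b - w a" by (auto simp: has_integral_iff)
    moreover have "norm (integral {a..b} dr) \<le> r * (b - a)"
      by (rule integral_lipschitz_bound) (use calculation M r ab in \<open>auto simp: dr_def\<close>)
    ultimately show ?thesis by simp
  qed
  show lip: "r-lipschitz_on {-\<tau>bar..0} w"
  proof (rule lipschitz_onI)
    fix a b assume "a \<in> {-\<tau>bar..0}" "b \<in> {-\<tau>bar..0}"
    then show "dist (w a) (w b) \<le> r * dist a b"
      using incr[of a b] incr[of b a] by (cases "a \<le> b") (auto simp: dist_norm norm_minus_commute)
  qed (use r in auto)
  show "norm (dot w \<theta>) \<le> r" if "\<theta> \<in> {-\<tau>bar<..<0} - B" for \<theta>
    by (rule vector_derivative_norm_le[OF lipschitz_on_subset[OF lip, of "{-\<tau>bar<..<0}"] deriv[OF that]]) (use that in auto)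
qed

text \<open>\<open>hist_W\<close> asks for the constant on every interval of smoothness, including
  one that crosses points of \<open>F\<close>. On such an interval \<open>dot y\<close> is
  continuous, so the bound \<open>M\<close> known between points of \<open>F\<close> extends across
  them by \<open>piecewise_lipschitz_on\<close>.\<close>

lemma hist_WI:
  fixes y :: "real \<Rightarrow> real^'n"
  assumes \<tau>bar: "\<tau>bar > 0" and lip: "k-lipschitz_on {-\<tau>bar..0} y" and bnd: "\<And>\<theta>. \<theta> \<in> {-\<tau>bar..0} \<Longrightarrow> norm (y \<theta>) \<le> r"
    and F: "finite F" and kr: "k \<le> r" and M: "0 \<le> M" "M \<le> r"
    and der: "\<And>c e \<theta>. {c<..<e} \<subseteq> {-\<tau>bar<..<0} - F \<Longrightarrow> \<theta> \<in> {c<..<e} \<Longrightarrow> (y has_vector_derivative dy \<theta>) (at \<theta>)"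
    and dlip: "\<And>c e. {c<..<e} \<subseteq> {-\<tau>bar<..<0} - F \<Longrightarrow> M-lipschitz_on {c<..<e} dy"
  shows "y \<in> hist_W \<tau>bar r" "\<And>\<theta>. \<theta> \<in> {-\<tau>bar<..<0} - F \<Longrightarrow> dot y \<theta> = dy \<theta>"
    "\<And>\<theta>. \<theta> \<in> {-\<tau>bar<..<0} - F \<Longrightarrow> norm (dot y \<theta>) \<le> k" "dot y \<in> borel_measurable (lebesgue_on {-\<tau>bar..0})"
proof -
  have opn: "open ({-\<tau>bar<..<0} - F)" using F by (intro open_Diff finite_imp_closed) auto
  have nbhd: "\<exists>e>0. {\<theta> - e<..<\<theta> + e} \<subseteq> {-\<tau>bar<..<0} - F" if "\<theta> \<in> {-\<tau>bar<..<0} - F" for \<theta>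
    using opn that unfolding open_contains_ball by (metis ball_eq_greaterThanLessThan)
  have der': "(y has_vector_derivative dy \<theta>) (at \<theta>)" if th: "\<theta> \<in> {-\<tau>bar<..<0} - F" for \<theta>
  proof -
    obtain e where e: "e > 0" "{\<theta> - e<..<\<theta> + e} \<subseteq> {-\<tau>bar<..<0} - F" using nbhd[OF th] by blast
    show ?thesis by (rule der[OF e(2)]) (use e in auto)
  qed
  show dot: "dot y \<theta> = dy \<theta>" if "\<theta> \<in> {-\<tau>bar<..<0} - F" for \<theta>
    using der'[OF that] by (rule vector_derivative_at)
  have dotlip: "M-lipschitz_on {c<..<e} (dot y)" if "{c<..<e} \<subseteq> {-\<tau>bar<..<0} - F" for c e
    by (rule lipschitz_on_transform[OF dlip[OF that]]) (use dot that in auto)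
  show kd: "norm (dot y \<theta>) \<le> k" if th: "\<theta> \<in> {-\<tau>bar<..<0} - F" for \<theta>
    unfolding dot[OF th]
    by (rule vector_derivative_norm_le[OF lipschitz_on_subset[OF lip, of "{-\<tau>bar<..<0}"] der'[OF th]]) (use th in auto)
  have dcont: "continuous (at \<theta>) (dot y)" if th: "\<theta> \<in> {-\<tau>bar<..<0} - F" for \<theta>
  proof -
    obtain e where e: "e > 0" "{\<theta> - e<..<\<theta> + e} \<subseteq> {-\<tau>bar<..<0} - F" using nbhd[OF th] by blast
    from lipschitz_on_continuous_on[OF dotlip[OF e(2)]] show ?thesis
      using e(1) by (simp add: continuous_on_eq_continuous_at)
  qed
  show meas: "dot y \<in> borel_measurable (lebesgue_on {-\<tau>bar..0})"
    by (rule dot_measurable[OF F]) (use dcont in \<open>auto intro: continuous_at_imp_continuous_on\<close>)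
  have C11: "C11_on {c<..<e} y" if "{c<..<e} \<subseteq> {-\<tau>bar<..<0} - F" for c e
    unfolding C11_on_def using dotlip[OF that] der[OF that] differentiableI_vector by blast
  have ym: "y \<in> borel_measurable (lebesgue_on {-\<tau>bar..0})"
    using lipschitz_on_continuous_on[OF lip] by (intro continuous_imp_measurable_on_sets_lebesgue) auto
  have "Linf_norm \<tau>bar y \<le> ereal r"
    unfolding Linf_norm_def
  proof (rule esssup_I)
    show "(\<lambda>\<theta>. ereal (norm (y \<theta>))) \<in> borel_measurable (lebesgue_on {-\<tau>bar..0})" using ym by measurable
    show "AE \<theta> in lebesgue_on {-\<tau>bar..0}. ereal (norm (y \<theta>)) \<le> ereal r" using bnd by (intro AE_I2) auto
  qed
  moreover have "Linf_norm \<tau>bar (dot y) \<le> ereal r"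
    unfolding Linf_norm_def
  proof (rule esssup_I)
    show "(\<lambda>\<theta>. ereal (norm (dot y \<theta>))) \<in> borel_measurable (lebesgue_on {-\<tau>bar..0})" using meas by measurable
    have "negligible ({-\<tau>bar, 0} \<union> F)" using F by (intro negligible_finite) auto
    then show "AE \<theta> in lebesgue_on {-\<tau>bar..0}. ereal (norm (dot y \<theta>)) \<le> ereal r"
    proof (subst AE_lebesgue_on_iff, simp, intro exI conjI ballI)
      show "ereal (norm (dot y \<theta>)) \<le> ereal r" if "\<theta> \<in> {-\<tau>bar..0} - ({-\<tau>bar, 0} \<union> F)" for \<theta>
        using kd[of \<theta>] kr that by auto
    qed
  qed
  moreover have "r-lipschitz_on {c<..<e} (dot y)" if sub: "{c<..<e} \<subseteq> {-\<tau>bar<..<0}" and C: "C11_on {c<..<e} y" for c e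
  proof -
    have "M-lipschitz_on {c<..<e} (dot y)"
    proof (rule piecewise_lipschitz_on[OF _ F M(1)])
      show "continuous_on {c<..<e} (dot y)" using C lipschitz_on_continuous_on by (auto simp: C11_on_def)
      show "M-lipschitz_on {a<..<b} (dot y)" if "{a<..<b} \<subseteq> {c<..<e} - F" for a b
        by (rule dotlip) (use that sub in blast)
    qed
    then show ?thesis using M(2) by (rule lipschitz_on_le)
  qed
  moreover have "piecewise_C11 \<tau>bar y" unfolding piecewise_C11_def using F C11 by blast
  moreover have "y \<in> lip_hist \<tau>bar" using lip by (auto simp: lip_hist_def)
  ultimately show "y \<in> hist_W \<tau>bar r" unfolding hist_W_def hist_V_def hist_P_def by blast
qed

section \<open>Terminal segments under step controls\<close>

context delay_semiconcave
begin

definition "cell_lip = lft + lf * (K + K * lagK)"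
text \<open>The class radius at which semiconcavity of \<open>g\<close> is invoked: it covers
  values, Lipschitz constants and derivative Lipschitz constants of the terminal segments, and
  involves neither the cell length nor the control.\<close>

definition "rW = sol_bound R0 + K + R0 + cell_lip"

lemma cell_lip_nonneg: "cell_lip \<ge> 0"
  unfolding cell_lip_def using lft(1) lf(1) K_nonneg lagK_pos by (intro add_nonneg_nonneg mult_nonneg_nonneg) auto

lemma sol_bound_nonneg: "sol_bound R0 \<ge> 0"
  using R0 by (simp add: sol_bound_def)

text \<open>Where the control is constant the velocity varies only through time and state, and so is
  Lipschitz with a constant free of the cell length. Being continuous, it is the derivative of the
  trajectory at every point of the cell and not just almost everywhere.\<close>

lemma tr_smooth_on_cell:
  assumes t: "t0 \<le> t" "t < T" and v: "hist_ok v" and \<beta>: "\<beta> \<in> controls A t T"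
    and sub: "{a<..<b} \<subseteq> {t<..<T}" and const: "\<And>s s'. s \<in> {a<..<b} \<Longrightarrow> s' \<in> {a<..<b} \<Longrightarrow> \<beta> s = \<beta> s'"
  shows "cell_lip-lipschitz_on {a<..<b} (rhs (tr t v \<beta>) \<beta>)"
    "\<And>s. s \<in> {a<..<b} \<Longrightarrow> (tr t v \<beta> has_vector_derivative rhs (tr t v \<beta>) \<beta> s) (at s)"
proof -
  note P = tr_props[OF t v \<beta>]
  let ?y = "tr t v \<beta>"
  show lip: "cell_lip-lipschitz_on {a<..<b} (rhs ?y \<beta>)"
  proof (rule lipschitz_onI[OF _ cell_lip_nonneg])
    fix s s' assume s: "s \<in> {a<..<b}" "s' \<in> {a<..<b}"
    then have "s \<in> {t<..<T}" "s' \<in> {t<..<T}" using sub by blast+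
    then have st: "s \<in> {t..T}" "s' \<in> {t..T}" "s \<in> {t0..T}" "s' \<in> {t0..T}"
      "s \<in> {t - \<tau>bar..T}" "s' \<in> {t - \<tau>bar..T}" "\<beta> s \<in> A"
      using t delay_pos \<beta> by (auto simp: controls_def)
    note l = lag_bounds(4)[OF st(1) t(1), of ?y] lag_bounds(4)[OF st(2) t(1), of ?y]
    have eq: "\<beta> s' = \<beta> s" using const s by blast
    have "norm (rhs ?y \<beta> s - rhs ?y \<beta> s') \<le> norm (f (s, ?y s, ?y (lag ?y s), \<beta> s) - f (s', ?y s, ?y (lag ?y s), \<beta> s))
      + norm (f (s', ?y s, ?y (lag ?y s), \<beta> s) - f (s', ?y s', ?y (lag ?y s'), \<beta> s)) + norm (0 :: real^'n)"
      using norm_diff_triangle3[of "f (s, ?y s, ?y (lag ?y s), \<beta> s)" "f (s', ?y s', ?y (lag ?y s'), \<beta> s)" "f (s', ?y s, ?y (lag ?y s), \<beta> s)" "f (s', ?y s', ?y (lag ?y s'), \<beta> s)"]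
      by (simp add: rhs_def eq)
    also have "\<dots> \<le> lft * \<bar>s - s'\<bar> + lf * (K * \<bar>s - s'\<bar> + K * lagK * \<bar>s - s'\<bar>) + 0"
    proof (intro add_mono)
      show "norm (f (s, ?y s, ?y (lag ?y s), \<beta> s) - f (s', ?y s, ?y (lag ?y s), \<beta> s)) \<le> lft * \<bar>s - s'\<bar>"
        by (rule lft(2)[OF st(3,4) P(2)[OF st(5)] P(2)[OF l(1)] st(7)])
      have "norm (?y s - ?y s') \<le> K * \<bar>s - s'\<bar>" using lipschitz_onD[OF P(3) st(5,6)] by (simp add: dist_norm)
      moreover have "norm (?y (lag ?y s) - ?y (lag ?y s')) \<le> K * lagK * \<bar>s - s'\<bar>"
        by (rule lag_lipschitz(2)[OF t(1) P(3) P(2) st(1,2)])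
      ultimately have "lf * (norm (?y s - ?y s') + norm (?y (lag ?y s) - ?y (lag ?y s'))) \<le> lf * (K * \<bar>s - s'\<bar> + K * lagK * \<bar>s - s'\<bar>)"
        using lf(1) by (intro mult_left_mono add_mono) auto
      then show "norm (f (s', ?y s, ?y (lag ?y s), \<beta> s) - f (s', ?y s', ?y (lag ?y s'), \<beta> s)) \<le> lf * (K * \<bar>s - s'\<bar> + K * lagK * \<bar>s - s'\<bar>)"
        using lf(2)[OF st(4,7)] order_trans by blast
    qed auto
    also have "\<dots> = cell_lip * \<bar>s - s'\<bar>" by (simp add: cell_lip_def algebra_simps)
    finally show "dist (rhs ?y \<beta> s) (rhs ?y \<beta> s') \<le> cell_lip * dist s s'" by (simp add: dist_norm)
  qed
  fix s assume s: "s \<in> {a<..<b}"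
  obtain p where p: "a < p" "p < s" using s dense by auto
  obtain q where q: "s < q" "q < b" using s dense by auto
  have "p \<in> {a<..<b}" "q \<in> {a<..<b}" using p q s by auto
  then have pq: "t < p" "q < T" using sub by auto
  have I: "rhs ?y \<beta> integrable_on {t..T}" by (rule rhs_integrable(2)[OF P(4) t(1) \<beta>])
  have "continuous_on {p..q} (rhs ?y \<beta>)"
    by (rule continuous_on_subset[OF lipschitz_on_continuous_on[OF lip]]) (use p q in auto)
  then have "((\<lambda>u. integral {p..u} (rhs ?y \<beta>)) has_vector_derivative rhs ?y \<beta> s) (at s within {p..q})"
    by (rule integral_has_vector_derivative) (use p q in auto)
  then have "((\<lambda>u. integral {p..u} (rhs ?y \<beta>)) has_vector_derivative rhs ?y \<beta> s) (at s)"
    using p q by (simp add: at_within_Icc_at)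
  then have "((\<lambda>u. ?y p + integral {p..u} (rhs ?y \<beta>)) has_vector_derivative 0 + rhs ?y \<beta> s) (at s)"
    by (intro has_vector_derivative_add has_vector_derivative_const)
  moreover have "?y p + integral {p..u} (rhs ?y \<beta>) = ?y u" if "u \<in> {p<..<q}" for u
    using integral_diff_Icc[OF I, of p u] P(1) that pq by (simp add: sol_def algebra_simps)
  ultimately show "(?y has_vector_derivative rhs ?y \<beta> s) (at s)"
    using has_vector_derivative_transform_within_open[of "\<lambda>u. ?y p + integral {p..u} (rhs ?y \<beta>)" "rhs ?y \<beta> s" s "{p<..<q}" ?y] p q
    by simp
qed

end

locale terminal_difference = second_difference +
  fixes S B0 :: "real set" and dw0 :: "real \<Rightarrow> real^'b" and Cg :: real
  assumes S: "finite S" "\<And>a b s s'. {a<..<b} \<subseteq> {t<..<T} - S \<Longrightarrow> s \<in> {a<..<b} \<Longrightarrow> s' \<in> {a<..<b} \<Longrightarrow> \<beta> s = \<beta> s'"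
    and B0: "finite B0"
    and w0_smooth: "\<And>c e \<theta>. {c<..<e} \<subseteq> {-\<tau>bar<..<0} - B0 \<Longrightarrow> \<theta> \<in> {c<..<e} \<Longrightarrow> (w0 has_vector_derivative dw0 \<theta>) (at \<theta>)"
      "\<And>c e. {c<..<e} \<subseteq> {-\<tau>bar<..<0} - B0 \<Longrightarrow> R0-lipschitz_on {c<..<e} dw0"
    and dw0_\<omega>: "\<And>\<theta>. \<theta> \<in> {-\<tau>bar<..<0} - B0 \<Longrightarrow> norm (dw0 \<theta>) \<le> \<omega> \<theta>"
    and \<omega>_sq: "(\<lambda>\<theta>. (\<omega> \<theta>)\<^sup>2) integrable_on {-\<tau>bar..0}"
    and Cg: "Cg \<ge> 0" "\<And>v v0. v \<in> hist_W \<tau>bar rW \<Longrightarrow> v0 \<in> hist_W \<tau>bar rW \<Longrightarrow>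
      g (v 0 + v0 0, \<lambda>\<theta>. v \<theta> + v0 \<theta>) + g (v 0 - v0 0, \<lambda>\<theta>. v \<theta> - v0 \<theta>) - 2 * g (v 0, v) \<le> Cg * (H1_norm \<tau>bar v0)\<^sup>2"
begin

text \<open>With \<open>v = Y True\<close> and \<open>v0 = Y False\<close> one has \<open>v + v0 = xp\<close> and \<open>v - v0 = xm\<close> exactly, so the
  semiconcavity of \<open>g\<close> applies at \<open>v\<close>, which is second-order close to \<open>x\<close>.\<close>

definition "Y b s = (1/2) *\<^sub>R (if b then xp s + xm s else xp s - xm s)"
definition "dY b s = (if s < t then (if b then dw (s - t) else dw0 (s - t))
  else (1/2) *\<^sub>R (if b then rhs xp \<beta> s + rhs xm \<beta> s else rhs xp \<beta> s - rhs xm \<beta> s))"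
text \<open>Breakpoints in the segment variable: the switch from history to dynamics, the shifted
  breakpoints of both histories and the jumps of the control. Some may fall outside the delay
  interval, which does no harm.\<close>

definition "F = {t - T} \<union> (\<lambda>b. b + t - T) ` (B \<union> B0) \<union> (\<lambda>s. s - T) ` S"

lemma F: "finite F" using B B0 S(1) by (simp add: F_def)

lemma Y_hist: "s \<in> {t - \<tau>bar..t} \<Longrightarrow> Y b s = (if b then w (s - t) else w0 (s - t))"
  by (simp add: Y_def hist_values scaleR_2[symmetric])

lemma Y_lipschitz: "K-lipschitz_on {t - \<tau>bar..T} (Y b)"
proof (rule lipschitz_onI[OF _ K_nonneg])
  fix s s' assume s: "s \<in> {t - \<tau>bar..T}" "s' \<in> {t - \<tau>bar..T}"
  have 1: "norm (xp s - xp s') \<le> K * \<bar>s - s'\<bar>" "norm (xm s - xm s') \<le> K * \<bar>s - s'\<bar>"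
    using lipschitz_onD[OF pp(3) s] lipschitz_onD[OF pm(3) s] by (auto simp: dist_norm)
  have "Y b s - Y b s' = (1/2) *\<^sub>R (if b then (xp s - xp s') + (xm s - xm s') else (xp s - xp s') - (xm s - xm s'))"
    by (simp add: Y_def algebra_simps)
  then have "norm (Y b s - Y b s') = (1/2) * norm (if b then (xp s - xp s') + (xm s - xm s') else (xp s - xp s') - (xm s - xm s'))"
    by (simp only: norm_scaleR)
  moreover have "norm (if b then (xp s - xp s') + (xm s - xm s') else (xp s - xp s') - (xm s - xm s'))
    \<le> norm (xp s - xp s') + norm (xm s - xm s')"
    using norm_triangle_ineq[of "xp s - xp s'" "xm s - xm s'"] norm_triangle_ineq4[of "xp s - xp s'" "xm s - xm s'"] by presburger
  ultimately have "norm (Y b s - Y b s') \<le> K * \<bar>s - s'\<bar>" using 1 by linarith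
  then show "dist (Y b s) (Y b s') \<le> K * dist s s'" by (simp add: dist_norm)
qed

lemma Y_bound: "s \<in> {t - \<tau>bar..T} \<Longrightarrow> norm (Y b s) \<le> sol_bound R0"
  using pp(2)[of s] pm(2)[of s] norm_triangle_ineq[of "xp s" "xm s"] norm_triangle_ineq4[of "xp s" "xm s"]
  by (simp add: Y_def)

text \<open>\<open>t - T\<close> belongs to \<open>F\<close>, so an interval free of
  \<open>F\<close> lies on one side of the switch. There \<open>Y\<close> is a shifted history, or
  half a sum or difference of two trajectories under a constant control.\<close>

lemma Y_smooth:
  assumes sub: "{c<..<e} \<subseteq> {-\<tau>bar<..<0} - F"
  shows "\<theta> \<in> {c<..<e} \<Longrightarrow> (segment_at (Y b) T has_vector_derivative dY b (T + \<theta>)) (at \<theta>)"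
    "(R0 + cell_lip)-lipschitz_on {c<..<e} (\<lambda>\<theta>. dY b (T + \<theta>))"
proof -
  have Rc: "0 \<le> R0 + cell_lip" using R0 cell_lip_nonneg by simp
  have chain: "((\<lambda>\<theta>. v (\<theta> + k)) has_vector_derivative v') (at \<theta>)" if "(v has_vector_derivative v') (at (\<theta> + k))" for v :: "real \<Rightarrow> real^'b" and v' k \<theta>
  proof -
    have "((\<lambda>\<theta>. \<theta> + k) has_vector_derivative 1) (at \<theta>)" by (auto intro!: derivative_eq_intros)
    from vector_diff_chain_at[OF this that] show ?thesis by (simp add: o_def)
  qed
  have "(\<forall>\<theta>\<in>{c<..<e}. (segment_at (Y b) T has_vector_derivative dY b (T + \<theta>)) (at \<theta>)) \<and>
    (R0 + cell_lip)-lipschitz_on {c<..<e} (\<lambda>\<theta>. dY b (T + \<theta>))"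
  proof (cases "c < e")
    case False
    then show ?thesis using Rc by (simp add: lipschitz_on_def)
  next
    case ce: True
    have cb: "-\<tau>bar \<le> c" "e \<le> 0"
    proof -
      have "{c<..<e} \<subseteq> {-\<tau>bar<..<0}" using sub by blast
      then show "-\<tau>bar \<le> c" "e \<le> 0" using ce by (simp_all add: greaterThanLessThan_subseteq_greaterThanLessThan)
    qed
    have "t - T \<notin> {c<..<e}" using sub by (auto simp: F_def)
    then consider "T + e \<le> t" | "t \<le> T + c" by fastforce
    then show ?thesis
    proof cases
      case 1
      define c' where "c' = c + (T - t)"
      define e' where "e' = e + (T - t)"
      have sub': "{c'<..<e'} \<subseteq> {-\<tau>bar<..<0} - (B \<union> B0)"
      proof
        fix z assume z: "z \<in> {c'<..<e'}"
        then have zz: "z - (T - t) \<in> {c<..<e}" by (auto simp: c'_def e'_def)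
        then have "z \<in> {-\<tau>bar<..<0}" using cb t 1 by auto
        moreover have "z \<notin> B \<union> B0"
        proof
          assume "z \<in> B \<union> B0"
          then have "z + t - T \<in> F" by (auto simp: F_def)
          moreover have "z + t - T = z - (T - t)" by simp
          ultimately show False using sub zz by (metis DiffD2 subsetD)
        qed
        ultimately show "z \<in> {-\<tau>bar<..<0} - (B \<union> B0)" by blast
      qed
      then have subs: "{c'<..<e'} \<subseteq> {-\<tau>bar<..<0} - B" "{c'<..<e'} \<subseteq> {-\<tau>bar<..<0} - B0" by blast+
      define v where "v = (if b then w else w0)"
      define dv where "dv = (if b then dw else dw0)"
      have vd: "(v has_vector_derivative dv \<theta>) (at \<theta>)" if "\<theta> \<in> {c'<..<e'}" for \<theta>
        using w_smooth(1)[OF subs(1) that] w0_smooth(1)[OF subs(2) that] by (simp add: v_def dv_def)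
      have vl: "R0-lipschitz_on {c'<..<e'} dv"
        using w_smooth(2)[OF subs(1)] w0_smooth(2)[OF subs(2)] by (simp add: dv_def)
      have dYe: "dY b (T + \<theta>) = dv (\<theta> + (T - t))" if "\<theta> \<in> {c<..<e}" for \<theta>
        using that 1 by (simp add: dY_def dv_def algebra_simps)
      show ?thesis
      proof (intro conjI ballI)
        fix \<theta> assume th: "\<theta> \<in> {c<..<e}"
        have "((\<lambda>\<theta>. v (\<theta> + (T - t))) has_vector_derivative dv (\<theta> + (T - t))) (at \<theta>)"
          by (rule chain[OF vd]) (use th in \<open>auto simp: c'_def e'_def\<close>)
        then show "(segment_at (Y b) T has_vector_derivative dY b (T + \<theta>)) (at \<theta>)"
          unfolding dYe[OF th]
        proof (rule has_vector_derivative_transform_within_open[where S="{c<..<e}"])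
          fix \<theta>' assume th': "\<theta>' \<in> {c<..<e}"
          have "Y b (T + \<theta>') = (if b then w (T + \<theta>' - t) else w0 (T + \<theta>' - t))"
            by (rule Y_hist) (use th' cb 1 t in auto)
          then show "v (\<theta>' + (T - t)) = segment_at (Y b) T \<theta>'"
            by (simp add: v_def segment_at_def algebra_simps)
        qed (use th in auto)
      next
        show "(R0 + cell_lip)-lipschitz_on {c<..<e} (\<lambda>\<theta>. dY b (T + \<theta>))"
        proof (rule lipschitz_onI[OF _ Rc])
          fix a a' assume a: "a \<in> {c<..<e}" "a' \<in> {c<..<e}"
          have "dist (dv (a + (T - t))) (dv (a' + (T - t))) \<le> R0 * dist (a + (T - t)) (a' + (T - t))"
            by (rule lipschitz_onD[OF vl]) (use a in \<open>auto simp: c'_def e'_def\<close>)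
          also have "\<dots> \<le> (R0 + cell_lip) * dist a a'" using cell_lip_nonneg by (simp add: distrib_right)
          finally show "dist (dY b (T + a)) (dY b (T + a')) \<le> (R0 + cell_lip) * dist a a'"
            using dYe a by simp
        qed
      qed
    next
      case 2
      have sub': "{T + c<..<T + e} \<subseteq> {t<..<T} - S"
      proof
        fix z assume z: "z \<in> {T + c<..<T + e}"
        then have "z - T \<in> {c<..<e}" by auto
        then have "z - T \<notin> F" using sub by blast
        then have "z \<notin> S" by (auto simp: F_def)
        then show "z \<in> {t<..<T} - S" using z 2 cb by auto
      qed
      then have subT: "{T + c<..<T + e} \<subseteq> {t<..<T}" by blast
      have const: "\<beta> s = \<beta> s'" if "s \<in> {T + c<..<T + e}" "s' \<in> {T + c<..<T + e}" for s s'
        by (rule S(2)[OF sub' that])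
      have cellp: "cell_lip-lipschitz_on {T + c<..<T + e} (rhs xp \<beta>)"
        "\<And>s. s \<in> {T + c<..<T + e} \<Longrightarrow> (xp has_vector_derivative rhs xp \<beta> s) (at s)"
        using tr_smooth_on_cell[OF t hp \<beta> subT] const by blast+
      have cellm: "cell_lip-lipschitz_on {T + c<..<T + e} (rhs xm \<beta>)"
        "\<And>s. s \<in> {T + c<..<T + e} \<Longrightarrow> (xm has_vector_derivative rhs xm \<beta> s) (at s)"
        using tr_smooth_on_cell[OF t hm \<beta> subT] const by blast+
      have dYe: "dY b s = (1/2) *\<^sub>R (if b then rhs xp \<beta> s + rhs xm \<beta> s else rhs xp \<beta> s - rhs xm \<beta> s)" if "s \<in> {T + c<..<T + e}" for s
        using that 2 by (simp add: dY_def)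
      show ?thesis
      proof (intro conjI ballI)
        fix \<theta> assume "\<theta> \<in> {c<..<e}"
        then have th: "\<theta> + T \<in> {T + c<..<T + e}" by auto
        have "(Y b has_vector_derivative dY b (\<theta> + T)) (at (\<theta> + T))"
          unfolding Y_def[abs_def] dYe[OF th] using cellp(2)[OF th] cellm(2)[OF th]
          by (cases b) (auto intro!: derivative_eq_intros)
        from chain[OF this] show "(segment_at (Y b) T has_vector_derivative dY b (T + \<theta>)) (at \<theta>)"
          by (simp add: segment_at_def[abs_def] add.commute)
      next
        show "(R0 + cell_lip)-lipschitz_on {c<..<e} (\<lambda>\<theta>. dY b (T + \<theta>))"
        proof (rule lipschitz_onI[OF _ Rc])
          fix a a' assume a: "a \<in> {c<..<e}" "a' \<in> {c<..<e}"
          then have aa: "T + a \<in> {T + c<..<T + e}" "T + a' \<in> {T + c<..<T + e}" by auto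
          let ?dp = "rhs xp \<beta> (T + a) - rhs xp \<beta> (T + a')" and ?dm = "rhs xm \<beta> (T + a) - rhs xm \<beta> (T + a')"
          have 1: "norm ?dp \<le> cell_lip * dist a a'" "norm ?dm \<le> cell_lip * dist a a'"
            using lipschitz_onD[OF cellp(1) aa] lipschitz_onD[OF cellm(1) aa] by (auto simp: dist_norm)
          have "dY b (T + a) - dY b (T + a') = (1/2) *\<^sub>R (if b then ?dp + ?dm else ?dp - ?dm)"
            unfolding dYe[OF aa(1)] dYe[OF aa(2)] by (simp add: algebra_simps)
          then have "norm (dY b (T + a) - dY b (T + a')) = (1/2) * norm (if b then ?dp + ?dm else ?dp - ?dm)"
            by (simp only: norm_scaleR)
          moreover have "norm (if b then ?dp + ?dm else ?dp - ?dm) \<le> norm ?dp + norm ?dm"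
            using norm_triangle_ineq[of ?dp ?dm] norm_triangle_ineq4[of ?dp ?dm] by presburger
          ultimately have "norm (dY b (T + a) - dY b (T + a')) \<le> cell_lip * dist a a'" using 1 by linarith
          also have "\<dots> \<le> (R0 + cell_lip) * dist a a'" using R0 by (intro mult_right_mono) auto
          finally show "dist (dY b (T + a)) (dY b (T + a')) \<le> (R0 + cell_lip) * dist a a'" by (simp add: dist_norm)
        qed
      qed
    qed
  qed
  then show "\<theta> \<in> {c<..<e} \<Longrightarrow> (segment_at (Y b) T has_vector_derivative dY b (T + \<theta>)) (at \<theta>)"
    "(R0 + cell_lip)-lipschitz_on {c<..<e} (\<lambda>\<theta>. dY b (T + \<theta>))" by blast+
qed

lemma segment_lipschitz: "K-lipschitz_on {t - \<tau>bar..T} y \<Longrightarrow> K-lipschitz_on {-\<tau>bar..0} (segment_at y T)"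
proof (rule lipschitz_onI[OF _ K_nonneg])
  fix a b assume y: "K-lipschitz_on {t - \<tau>bar..T} y" and "a \<in> {-\<tau>bar..0}" "b \<in> {-\<tau>bar..0}"
  then show "dist (segment_at y T a) (segment_at y T b) \<le> K * dist a b"
    using lipschitz_onD[OF y, of "T + a" "T + b"] t by (simp add: segment_at_def)
qed

lemma Y_segment:
  "segment_at (Y b) T \<in> hist_W \<tau>bar rW"
  "\<And>\<theta>. \<theta> \<in> {-\<tau>bar<..<0} - F \<Longrightarrow> dot (segment_at (Y b) T) \<theta> = dY b (T + \<theta>)"
  "dot (segment_at (Y b) T) \<in> borel_measurable (lebesgue_on {-\<tau>bar..0})"
proof -
  have r: "sol_bound R0 \<le> rW" "K \<le> rW" "0 \<le> R0 + cell_lip" "R0 + cell_lip \<le> rW"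
    using sol_bound_nonneg K_nonneg R0 cell_lip_nonneg by (auto simp: rW_def)
  have bnd: "norm (segment_at (Y b) T \<theta>) \<le> rW" if "\<theta> \<in> {-\<tau>bar..0}" for \<theta>
    using Y_bound[of "T + \<theta>" b] that t r(1) by (simp add: segment_at_def)
  show "segment_at (Y b) T \<in> hist_W \<tau>bar rW"
    by (rule hist_WI(1)[where dy="\<lambda>\<theta>. dY b (T + \<theta>)" and k=K and M="R0 + cell_lip" and F=F])
      (use delay_pos segment_lipschitz[OF Y_lipschitz] bnd F r Y_smooth in blast)+
  show "dot (segment_at (Y b) T) \<theta> = dY b (T + \<theta>)" if "\<theta> \<in> {-\<tau>bar<..<0} - F" for \<theta>
    by (rule hist_WI(2)[where k=K and M="R0 + cell_lip" and F=F and r=rW])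
      (use that delay_pos segment_lipschitz[OF Y_lipschitz] bnd F r Y_smooth in blast)+
  show "dot (segment_at (Y b) T) \<in> borel_measurable (lebesgue_on {-\<tau>bar..0})"
    by (rule hist_WI(4)[where dy="\<lambda>\<theta>. dY b (T + \<theta>)" and k=K and M="R0 + cell_lip" and F=F and r=rW])
      (use delay_pos segment_lipschitz[OF Y_lipschitz] bnd F r Y_smooth in blast)+
qed

text \<open>The part of the segment before \<open>t\<close> is a piece of \<open>w0\<close> itself,
  and its derivative contributes at most the integral of \<open>\<omega>\<^sup>2\<close>. After
  \<open>t\<close> both velocities differ from that of \<open>x\<close> by the order of
  \<open>\<eta>\<close>.\<close>

lemma H1_norm_difference:
  "(H1_norm \<tau>bar (segment_at (Y False) T))\<^sup>2 \<le> (\<tau>bar * dep\<^sup>2 + 4 * \<tau>bar * growth\<^sup>2 * dep\<^sup>2) * \<delta>\<^sup>2 + integral {-\<tau>bar..0} (\<lambda>\<theta>. (\<omega> \<theta>)\<^sup>2)"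
proof -
  let ?e = "segment_at (Y False) T" and ?M = "lebesgue_on {-\<tau>bar..0}"
  have a: "(LINT \<theta>|?M. (norm (?e \<theta>))\<^sup>2) \<le> \<tau>bar * \<eta>\<^sup>2"
  proof -
    have "continuous_on {-\<tau>bar..0} ?e" by (rule lipschitz_on_continuous_on[OF segment_lipschitz[OF Y_lipschitz]])
    then have I: "integrable ?M (\<lambda>\<theta>. (norm (?e \<theta>))\<^sup>2)" by (intro continuous_imp_integrable_real continuous_intros)
    have "(LINT \<theta>|?M. (norm (?e \<theta>))\<^sup>2) = integral {-\<tau>bar..0} (\<lambda>\<theta>. (norm (?e \<theta>))\<^sup>2)"
      by (rule lebesgue_integral_eq_integral[OF I]) simp
    also have "\<dots> \<le> integral {-\<tau>bar..0} (\<lambda>_. \<eta>\<^sup>2)"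
    proof (rule integral_le)
      show "(\<lambda>\<theta>. (norm (?e \<theta>))\<^sup>2) integrable_on {-\<tau>bar..0}" using I by (rule integrable_on_lebesgue_on) simp
      fix \<theta> assume "\<theta> \<in> {-\<tau>bar..0}"
      then have "norm (xp (T + \<theta>) - xm (T + \<theta>)) \<le> 2 * \<eta>" using t by (intro first_order(3)) auto
      then have "norm (?e \<theta>) \<le> \<eta>" by (simp add: segment_at_def Y_def)
      then show "(norm (?e \<theta>))\<^sup>2 \<le> \<eta>\<^sup>2" by (intro power_mono) auto
    qed auto
    finally show ?thesis using delay_pos by simp
  qed
  \<comment> \<open>Extension by 0 removes the times \<open>\<theta>\<close> whose shifted argument
    \<open>(T - t) + \<theta>\<close> has left the history interval.\<close>
  define k where "k u = (if u \<in> {-\<tau>bar..0} then (\<omega> u)\<^sup>2 else 0)" for u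
  have k0: "0 \<le> k u" for u by (simp add: k_def)
  define G where "G \<theta> = (2 * growth * \<eta>)\<^sup>2 + k ((T - t) + \<theta>)" for \<theta>
  have inter: "{-\<tau>bar..0} \<inter> {-\<tau>bar + (T - t)..0 + (T - t)} = {-\<tau>bar + (T - t)..0}" using t by auto
  have sqI: "(\<lambda>\<theta>. (\<omega> \<theta>)\<^sup>2) integrable_on {-\<tau>bar + (T - t)..0}" by (rule integrable_on_subinterval[OF \<omega>_sq]) (use t in auto)
  have kI: "k integrable_on {-\<tau>bar + (T - t)..0 + (T - t)}"
    unfolding k_def integrable_restrict_Int inter by (rule sqI)
  have kIs: "(\<lambda>\<theta>. k ((T - t) + \<theta>)) integrable_on {-\<tau>bar..0}"
    using kI integrable_on_shift_Icc_real[of k "T - t" "-\<tau>bar" 0] by (simp add: o_def)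
  have "G integrable_on {-\<tau>bar..0}" unfolding G_def by (intro integrable_add kIs integrable_const_ivl)
  then have "G absolutely_integrable_on {-\<tau>bar..0}"
    by (rule nonnegative_absolutely_integrable_1) (use k0 in \<open>auto simp: G_def\<close>)
  then have GL: "integrable ?M G" by (rule absolutely_integrable_imp_integrable) simp
  have AE: "AE \<theta> in ?M. (norm (dot ?e \<theta>))\<^sup>2 \<le> G \<theta>"
  proof (subst AE_lebesgue_on_iff, simp, intro exI conjI ballI)
    show "negligible ({-\<tau>bar, 0} \<union> F)" using F by (intro negligible_finite) auto
    fix \<theta> assume th: "\<theta> \<in> {-\<tau>bar..0} - ({-\<tau>bar, 0} \<union> F)"
    then have e: "dot ?e \<theta> = dY False (T + \<theta>)" by (intro Y_segment(2)) auto
    have ne: "T + \<theta> \<noteq> t" using th by (auto simp: F_def)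
    show "(norm (dot ?e \<theta>))\<^sup>2 \<le> G \<theta>"
    proof (cases "T + \<theta> < t")
      case True
      let ?u = "(T - t) + \<theta>"
      have u: "?u \<in> {-\<tau>bar<..<0} - B0"
      proof
        show "?u \<in> {-\<tau>bar<..<0}" using th t True by auto
        show "?u \<notin> B0"
        proof
          assume "?u \<in> B0"
          then have "?u + t - T \<in> (\<lambda>b. b + t - T) ` (B \<union> B0)" by (intro imageI UnI2)
          moreover have "?u + t - T = \<theta>" by simp
          ultimately have "\<theta> \<in> F" unfolding F_def by (metis UnCI)
          then show False using th by blast
        qed
      qed
      have "norm (dot ?e \<theta>) \<le> \<omega> ?u"
        using dw0_\<omega>[OF u] True unfolding e dY_def by (simp add: algebra_simps)
      then have "(norm (dot ?e \<theta>))\<^sup>2 \<le> (\<omega> ?u)\<^sup>2" by (intro power_mono) auto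
      then show ?thesis using u by (simp add: G_def k_def add_increasing)
    next
      case False
      then have s: "T + \<theta> \<in> {t<..<T}" using ne th by auto
      have "norm (rhs xp \<beta> (T + \<theta>) - rhs xm \<beta> (T + \<theta>)) \<le> 2 * growth * \<eta> + 2 * growth * \<eta>"
        using rhs_first_order[OF s] norm_triangle_ineq4[of "rhs xp \<beta> (T + \<theta>) - rhs x \<beta> (T + \<theta>)" "rhs xm \<beta> (T + \<theta>) - rhs x \<beta> (T + \<theta>)"] by simp
      then have "norm (dot ?e \<theta>) \<le> 2 * growth * \<eta>" using False unfolding e dY_def by simp
      then have "(norm (dot ?e \<theta>))\<^sup>2 \<le> (2 * growth * \<eta>)\<^sup>2" by (intro power_mono) auto
      then show ?thesis using k0[of "(T - t) + \<theta>"] by (simp add: G_def)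
    qed
  qed
  have b: "(LINT \<theta>|?M. (norm (dot ?e \<theta>))\<^sup>2) \<le> \<tau>bar * (2 * growth * \<eta>)\<^sup>2 + integral {-\<tau>bar..0} (\<lambda>\<theta>. (\<omega> \<theta>)\<^sup>2)"
  proof -
    have "(\<lambda>\<theta>. (norm (dot ?e \<theta>))\<^sup>2) \<in> borel_measurable ?M" using Y_segment(3)[of False] by measurable
    then have "integrable ?M (\<lambda>\<theta>. (norm (dot ?e \<theta>))\<^sup>2)"
      by (rule Bochner_Integration.integrable_bound[OF GL]) (use AE in \<open>auto elim!: eventually_mono\<close>)
    then have "(LINT \<theta>|?M. (norm (dot ?e \<theta>))\<^sup>2) \<le> (LINT \<theta>|?M. G \<theta>)" by (rule integral_mono_AE[OF _ GL AE])
    also have "\<dots> = integral {-\<tau>bar..0} G" by (rule lebesgue_integral_eq_integral[OF GL]) simp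
    also have "\<dots> = \<tau>bar * (2 * growth * \<eta>)\<^sup>2 + integral {-\<tau>bar..0} (\<lambda>\<theta>. k ((T - t) + \<theta>))"
      unfolding G_def using integral_add[OF integrable_const_ivl kIs, of "(2 * growth * \<eta>)\<^sup>2"] delay_pos by simp
    also have "integral {-\<tau>bar..0} (\<lambda>\<theta>. k ((T - t) + \<theta>)) = integral {-\<tau>bar + (T - t)..0 + (T - t)} k"
      using integral_shift_Icc_real[of "-\<tau>bar" 0 k "T - t"] by (simp add: o_def)
    also have "\<dots> = integral {-\<tau>bar + (T - t)..0} (\<lambda>\<theta>. (\<omega> \<theta>)\<^sup>2)"
      unfolding k_def integral_restrict_Int inter ..
    also have "\<dots> \<le> integral {-\<tau>bar..0} (\<lambda>\<theta>. (\<omega> \<theta>)\<^sup>2)"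
      by (rule integral_subset_le) (use t sqI \<omega>_sq in auto)
    finally show ?thesis by simp
  qed
  have "0 \<le> (LINT \<theta>|?M. (norm (?e \<theta>))\<^sup>2) + (LINT \<theta>|?M. (norm (dot ?e \<theta>))\<^sup>2)"
    by (intro add_nonneg_nonneg Bochner_Integration.integral_nonneg) auto
  then have "(H1_norm \<tau>bar ?e)\<^sup>2 = (LINT \<theta>|?M. (norm (?e \<theta>))\<^sup>2) + (LINT \<theta>|?M. (norm (dot ?e \<theta>))\<^sup>2)"
    unfolding H1_norm_def by (rule real_sqrt_pow2)
  also have "\<dots> \<le> \<tau>bar * \<eta>\<^sup>2 + (\<tau>bar * (2 * growth * \<eta>)\<^sup>2 + integral {-\<tau>bar..0} (\<lambda>\<theta>. (\<omega> \<theta>)\<^sup>2))"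
    by (rule add_mono[OF a b])
  also have "\<dots> = (\<tau>bar * dep\<^sup>2 + 4 * \<tau>bar * growth\<^sup>2 * dep\<^sup>2) * \<delta>\<^sup>2 + integral {-\<tau>bar..0} (\<lambda>\<theta>. (\<omega> \<theta>)\<^sup>2)"
    by (simp add: \<eta>_def power_mult_distrib algebra_simps)
  finally show ?thesis .
qed

text \<open>The base point of the semiconcavity inequality is the midpoint segment. Moving it to
  \<open>x\<close> costs twice the Lipschitz bound of \<open>g\<close> for half of \<open>D\<close>,
  so the factors 2 and 1/2 cancel.\<close>

lemma terminal_second_difference:
  "g (xp T, segment_at xp T) + g (xm T, segment_at xm T) - 2 * g (x T, segment_at x T)
    \<le> Cg * ((\<tau>bar * dep\<^sup>2 + 4 * \<tau>bar * growth\<^sup>2 * dep\<^sup>2) * \<delta>\<^sup>2 + integral {-\<tau>bar..0} (\<lambda>\<theta>. (\<omega> \<theta>)\<^sup>2))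
      + lg * (1 + \<tau>bar) * (traj_gap N * \<Sigma>)"
proof -
  let ?v = "segment_at (Y True) T" and ?e = "segment_at (Y False) T"
  have pm: "(1/2) *\<^sub>R (a + b) + (1/2) *\<^sub>R (a - b) = a" "(1/2) *\<^sub>R (a + b) - (1/2) *\<^sub>R (a - b) = b" for a b :: "real^'b"
  proof -
    have "(1/2) *\<^sub>R (a + b) + (1/2) *\<^sub>R (a - b) = (1/2) *\<^sub>R (2 *\<^sub>R a)" "(1/2) *\<^sub>R (a + b) - (1/2) *\<^sub>R (a - b) = (1/2) *\<^sub>R (2 *\<^sub>R b)"
      by (simp_all add: scaleR_2 scaleR_add_right[symmetric] scaleR_diff_right[symmetric] del: scaleR_half_double)
    then show "(1/2) *\<^sub>R (a + b) + (1/2) *\<^sub>R (a - b) = a" "(1/2) *\<^sub>R (a + b) - (1/2) *\<^sub>R (a - b) = b" by simp_all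
  qed
  have p: "(\<lambda>\<theta>. ?v \<theta> + ?e \<theta>) = segment_at xp T" "(\<lambda>\<theta>. ?v \<theta> - ?e \<theta>) = segment_at xm T"
    "?v 0 + ?e 0 = xp T" "?v 0 - ?e 0 = xm T"
    unfolding segment_at_def Y_def by (simp_all only: if_True if_False pm add_0_right)
  have "g (xp T, segment_at xp T) + g (xm T, segment_at xm T) - 2 * g (?v 0, ?v) \<le> Cg * (H1_norm \<tau>bar ?e)\<^sup>2"
    using Cg(2)[OF Y_segment(1) Y_segment(1), of True False] unfolding p .
  also have "\<dots> \<le> Cg * ((\<tau>bar * dep\<^sup>2 + 4 * \<tau>bar * growth\<^sup>2 * dep\<^sup>2) * \<delta>\<^sup>2 + integral {-\<tau>bar..0} (\<lambda>\<theta>. (\<omega> \<theta>)\<^sup>2))"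
    by (rule mult_left_mono[OF H1_norm_difference Cg(1)])
  finally have 1: "g (xp T, segment_at xp T) + g (xm T, segment_at xm T) - 2 * g (?v 0, ?v)
    \<le> Cg * ((\<tau>bar * dep\<^sup>2 + 4 * \<tau>bar * growth\<^sup>2 * dep\<^sup>2) * \<delta>\<^sup>2 + integral {-\<tau>bar..0} (\<lambda>\<theta>. (\<omega> \<theta>)\<^sup>2))" .
  have Yx: "norm (Y True s - x s) \<le> traj_gap N * \<Sigma> / 2" if "s \<in> {t - \<tau>bar..T}" for s
    using midpoints(1)[of s] D_bound[OF that] by (simp only: Y_def if_True)
  have "\<bar>g (?v 0, ?v) - g (segment_at x T 0, segment_at x T)\<bar>
    \<le> lg * (norm (?v 0 - segment_at x T 0) + integral {-\<tau>bar..0} (\<lambda>\<theta>. norm (?v \<theta> - segment_at x T \<theta>)))"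
    by (rule lg(2)[OF segment_lipschitz[OF Y_lipschitz] segment_lipschitz[OF px(3)]])
      (use Y_bound px(2) t in \<open>auto simp: segment_at_def\<close>)
  also have "\<dots> \<le> lg * (traj_gap N * \<Sigma> / 2 + traj_gap N * \<Sigma> / 2 * \<tau>bar)"
  proof (intro mult_left_mono add_mono)
    show "norm (?v 0 - segment_at x T 0) \<le> traj_gap N * \<Sigma> / 2"
      using Yx[of T] t delay_pos by (simp add: segment_at_def)
    have "continuous_on {-\<tau>bar..0} (\<lambda>\<theta>. norm (?v \<theta> - segment_at x T \<theta>))"
      by (intro continuous_intros lipschitz_on_continuous_on[OF segment_lipschitz[OF Y_lipschitz]] lipschitz_on_continuous_on[OF segment_lipschitz[OF px(3)]])
    then have "integral {-\<tau>bar..0} (\<lambda>\<theta>. norm (?v \<theta> - segment_at x T \<theta>)) \<le> integral {-\<tau>bar..0} (\<lambda>_. traj_gap N * \<Sigma> / 2)"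
      by (intro integral_le integrable_continuous_interval) (use Yx t in \<open>auto simp: segment_at_def\<close>)
    then show "integral {-\<tau>bar..0} (\<lambda>\<theta>. norm (?v \<theta> - segment_at x T \<theta>)) \<le> traj_gap N * \<Sigma> / 2 * \<tau>bar"
      using delay_pos by (simp add: mult_ac)
  qed (use lg in auto)
  also have "\<dots> = lg * (1 + \<tau>bar) * (traj_gap N * \<Sigma>) / 2" by (simp add: algebra_simps)
  finally have "\<bar>g (?v 0, ?v) - g (x T, segment_at x T)\<bar> \<le> lg * (1 + \<tau>bar) * (traj_gap N * \<Sigma>) / 2"
    by (simp add: segment_at_def)
  with 1 show ?thesis by linarith
qed

lemma J_second_difference:
  "J t (\<lambda>\<theta>. w \<theta> + w0 \<theta>) \<beta> + J t (\<lambda>\<theta>. w \<theta> - w0 \<theta>) \<beta> - 2 * J t w \<beta>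
    \<le> (running_gap N + lg * (1 + \<tau>bar) * traj_gap N + Cg * (\<tau>bar * dep\<^sup>2 + 4 * \<tau>bar * growth\<^sup>2 * dep\<^sup>2)) * \<Sigma>
      + Cg * integral {-\<tau>bar..0} (\<lambda>\<theta>. (\<omega> \<theta>)\<^sup>2)"
proof -
  have "J t (\<lambda>\<theta>. w \<theta> + w0 \<theta>) \<beta> + J t (\<lambda>\<theta>. w \<theta> - w0 \<theta>) \<beta> - 2 * J t w \<beta>
    \<le> running_gap N * \<Sigma> + (Cg * ((\<tau>bar * dep\<^sup>2 + 4 * \<tau>bar * growth\<^sup>2 * dep\<^sup>2) * \<delta>\<^sup>2 + integral {-\<tau>bar..0} (\<lambda>\<theta>. (\<omega> \<theta>)\<^sup>2))
      + lg * (1 + \<tau>bar) * (traj_gap N * \<Sigma>))"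
  proof -
    have eq: "(a1 + b1) + (a2 + b2) - 2 * (a3 + b3) = (a1 + a2 - 2 * a3) + (b1 + b2 - 2 * b3)" for a1 a2 a3 b1 b2 b3 :: real
      by simp
    show ?thesis unfolding J_def eq by (rule add_mono[OF running_second_difference terminal_second_difference])
  qed
  moreover have "Cg * (\<tau>bar * dep\<^sup>2 + 4 * \<tau>bar * growth\<^sup>2 * dep\<^sup>2) * \<delta>\<^sup>2 \<le> Cg * (\<tau>bar * dep\<^sup>2 + 4 * \<tau>bar * growth\<^sup>2 * dep\<^sup>2) * \<Sigma>"
    using delta_sq_le Cg(1) delay_pos by (intro mult_left_mono mult_nonneg_nonneg add_nonneg_nonneg) auto
  ultimately show ?thesis by (simp only: distrib_left distrib_right mult.assoc)
qed

end

subsection \<open>The value functional\<close>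

text \<open>One-dimensional Sobolev estimates. The derivative is set to 0 at nonsmooth points, where
  \<open>dot w\<close> carries no information. The sup bound follows by comparing
  \<open>w \<theta>\<close> with \<open>w \<theta>'\<close> through the L^1 norm of the derivative
  and averaging over \<open>\<theta>'\<close>.\<close>

lemma hist_W_H1:
  fixes w :: "real \<Rightarrow> real^'n"
  assumes w: "w \<in> hist_W \<tau>bar r" and \<tau>bar: "\<tau>bar > 0" and r: "r > 0"
  defines "U \<equiv> {-\<tau>bar<..<0} - nonsmooth_points \<tau>bar w"
  defines "\<omega> \<equiv> \<lambda>\<theta>. indicator U \<theta> * norm (dot w \<theta>)"
  shows "\<omega> integrable_on {-\<tau>bar..0}" "(\<lambda>\<theta>. (\<omega> \<theta>)\<^sup>2) integrable_on {-\<tau>bar..0}"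
    "\<And>a b. -\<tau>bar \<le> a \<Longrightarrow> a \<le> b \<Longrightarrow> b \<le> 0 \<Longrightarrow> norm (w b - w a) \<le> integral {a..b} \<omega>"
    "integral {-\<tau>bar..0} (\<lambda>\<theta>. (\<omega> \<theta>)\<^sup>2) \<le> (H1_norm \<tau>bar w)\<^sup>2"
    "(integral {-\<tau>bar..0} \<omega>)\<^sup>2 \<le> \<tau>bar * (H1_norm \<tau>bar w)\<^sup>2"
    "\<And>\<theta>. \<theta> \<in> {-\<tau>bar..0} \<Longrightarrow> (norm (w \<theta>))\<^sup>2 \<le> (2 / \<tau>bar + 2 * \<tau>bar) * (H1_norm \<tau>bar w)\<^sup>2"
proof -
  note facts = hist_W_facts[OF w \<tau>bar r]
  let ?M = "lebesgue_on {-\<tau>bar..0}"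
  let ?B = "nonsmooth_points \<tau>bar w"
  have "open U" unfolding U_def using facts(3) by (intro open_Diff finite_imp_closed) auto
  then have Um: "indicat_real U \<in> borel_measurable ?M"
    by (intro measurable_restrict_space1) (simp add: measurable_completion)
  have \<omega>m: "\<omega> \<in> borel_measurable ?M"
  proof -
    have "(\<lambda>\<theta>. norm (dot w \<theta>)) \<in> borel_measurable ?M" using facts(8) by measurable
    then show ?thesis unfolding \<omega>_def by (rule borel_measurable_times[OF Um])
  qed
  have \<omega>0: "0 \<le> \<omega> \<theta>" and \<omega>r: "\<omega> \<theta> \<le> r" for \<theta>
    using facts(7)[of \<theta>] r by (auto simp: \<omega>_def U_def indicator_def)
  have cI: "integrable ?M (\<lambda>_. c :: real)" for c by (rule continuous_imp_integrable_real) simp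
  have \<omega>I: "integrable ?M \<omega>"
    by (rule Bochner_Integration.integrable_bound[OF cI[of r] \<omega>m]) (use \<omega>0 \<omega>r r in \<open>auto intro!: AE_I2\<close>)
  have \<omega>2r: "(\<omega> \<theta>)\<^sup>2 \<le> r\<^sup>2" for \<theta> using \<omega>0 \<omega>r by (intro power_mono) auto
  have \<omega>2I: "integrable ?M (\<lambda>\<theta>. (\<omega> \<theta>)\<^sup>2)"
    by (rule Bochner_Integration.integrable_bound[OF cI[of "r\<^sup>2"]]) (use \<omega>m \<omega>2r in \<open>auto intro!: AE_I2 borel_measurable_power\<close>)
  show 1: "\<omega> integrable_on {-\<tau>bar..0}" using \<omega>I by (rule integrable_on_lebesgue_on) simp
  show 2: "(\<lambda>\<theta>. (\<omega> \<theta>)\<^sup>2) integrable_on {-\<tau>bar..0}" using \<omega>2I by (rule integrable_on_lebesgue_on) simp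
  show 3: "norm (w b - w a) \<le> integral {a..b} \<omega>" if ab: "-\<tau>bar \<le> a" "a \<le> b" "b \<le> 0" for a b
  proof -
    let ?g = "\<lambda>\<theta>. indicat_real U \<theta> *\<^sub>R dot w \<theta>"
    have "(?g has_integral (w b - w a)) {a..b}"
    proof (rule lipschitz_on_has_integral_AE_derivative)
      show "r-lipschitz_on {a..b} w" by (rule lipschitz_on_subset[OF facts(1)]) (use ab in auto)
      show "AE s in lebesgue_on {a<..<b}. (w has_vector_derivative ?g s) (at s)"
      proof (subst AE_lebesgue_on_iff, simp, intro exI conjI ballI)
        show "negligible ?B" using facts(3) by (rule negligible_finite)
        show "(w has_vector_derivative ?g s) (at s)" if "s \<in> {a<..<b} - ?B" for s
          using facts(6)[of s] that ab by (simp add: U_def)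
      qed
    qed (use ab in auto)
    then have g: "?g integrable_on {a..b}" "integral {a..b} ?g = w b - w a" by (auto simp: has_integral_iff)
    have "norm (integral {a..b} ?g) \<le> integral {a..b} \<omega>"
      by (rule integral_norm_bound_integral[OF g(1)])
        (use integrable_on_subinterval[OF 1] ab in \<open>auto simp: \<omega>_def indicator_def\<close>)
    then show ?thesis using g(2) by simp
  qed
  define P where "P = integral {-\<tau>bar..0} (\<lambda>\<theta>. (norm (w \<theta>))\<^sup>2)"
  define I2 where "I2 = integral {-\<tau>bar..0} (\<lambda>\<theta>. (\<omega> \<theta>)\<^sup>2)"
  define I1 where "I1 = integral {-\<tau>bar..0} \<omega>"
  have wI: "integrable ?M (\<lambda>\<theta>. (norm (w \<theta>))\<^sup>2)"
    by (intro continuous_imp_integrable_real continuous_intros lipschitz_on_continuous_on[OF facts(1)])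
  have wP: "(LINT \<theta>|?M. (norm (w \<theta>))\<^sup>2) = P" unfolding P_def by (rule lebesgue_integral_eq_integral[OF wI]) simp
  have wPI: "(\<lambda>\<theta>. (norm (w \<theta>))\<^sup>2) integrable_on {-\<tau>bar..0}" using wI by (rule integrable_on_lebesgue_on) simp
  have P0: "P \<ge> 0" unfolding P_def by (rule integral_nonneg[OF wPI]) auto
  have I20: "I2 \<ge> 0" unfolding I2_def by (rule integral_nonneg[OF 2]) auto
  have "(LINT \<theta>|?M. (norm (dot w \<theta>))\<^sup>2) = (LINT \<theta>|?M. (\<omega> \<theta>)\<^sup>2)"
  proof (rule integral_cong_AE)
    show "(\<lambda>\<theta>. (norm (dot w \<theta>))\<^sup>2) \<in> borel_measurable ?M" using facts(8) by measurable
    show "(\<lambda>\<theta>. (\<omega> \<theta>)\<^sup>2) \<in> borel_measurable ?M" using \<omega>m by measurable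
    show "AE \<theta> in ?M. (norm (dot w \<theta>))\<^sup>2 = (\<omega> \<theta>)\<^sup>2"
    proof (subst AE_lebesgue_on_iff, simp, intro exI conjI ballI)
      show "negligible ({-\<tau>bar, 0} \<union> ?B)" using facts(3) by (intro negligible_finite) auto
      show "(norm (dot w \<theta>))\<^sup>2 = (\<omega> \<theta>)\<^sup>2" if "\<theta> \<in> {-\<tau>bar..0} - ({-\<tau>bar, 0} \<union> ?B)" for \<theta>
        using that by (auto simp: \<omega>_def U_def)
    qed
  qed
  also have "\<dots> = I2" unfolding I2_def by (rule lebesgue_integral_eq_integral[OF \<omega>2I]) simp
  finally have H: "(H1_norm \<tau>bar w)\<^sup>2 = P + I2"
    unfolding H1_norm_def wP using P0 I20 by simp
  show "integral {-\<tau>bar..0} (\<lambda>\<theta>. (\<omega> \<theta>)\<^sup>2) \<le> (H1_norm \<tau>bar w)\<^sup>2" using P0 by (simp add: H I2_def)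
  \<comment> \<open>Cauchy-Schwarz, by expanding the square of \<open>\<omega>\<close> minus its
    mean.\<close>
  have CS: "I1\<^sup>2 \<le> \<tau>bar * I2"
  proof -
    define m where "m = I1 / \<tau>bar"
    have "0 \<le> integral {-\<tau>bar..0} (\<lambda>\<theta>. (\<omega> \<theta>)\<^sup>2 - (2 * m * \<omega> \<theta> - m\<^sup>2))"
    proof (rule integral_nonneg)
      show "(\<lambda>\<theta>. (\<omega> \<theta>)\<^sup>2 - (2 * m * \<omega> \<theta> - m\<^sup>2)) integrable_on {-\<tau>bar..0}"
        by (intro integrable_diff 2 integrable_on_mult_right 1 integrable_const_ivl)
      show "0 \<le> (\<omega> \<theta>)\<^sup>2 - (2 * m * \<omega> \<theta> - m\<^sup>2)" for \<theta>
        using zero_le_power2[of "\<omega> \<theta> - m"] by (simp add: power2_diff mult_ac)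
    qed
    also have "\<dots> = I2 - (2 * m * I1 - \<tau>bar * m\<^sup>2)"
      using integral_diff[OF 2 integrable_diff[OF integrable_on_mult_right[OF 1, of "2 * m"] integrable_const_ivl, of "m\<^sup>2"]]
        integral_diff[OF integrable_on_mult_right[OF 1, of "2 * m"] integrable_const_ivl, of "m\<^sup>2"] \<tau>bar
      by (simp add: I2_def I1_def)
    also have "2 * m * I1 - \<tau>bar * m\<^sup>2 = I1\<^sup>2 / \<tau>bar" using \<tau>bar by (simp add: m_def power2_eq_square field_simps)
    finally show ?thesis using \<tau>bar by (simp add: field_simps)
  qed
  also have "\<dots> \<le> \<tau>bar * (H1_norm \<tau>bar w)\<^sup>2" using P0 \<tau>bar by (simp add: H)
  finally show "(integral {-\<tau>bar..0} \<omega>)\<^sup>2 \<le> \<tau>bar * (H1_norm \<tau>bar w)\<^sup>2" by (simp add: I1_def)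
  show "(norm (w \<theta>))\<^sup>2 \<le> (2 / \<tau>bar + 2 * \<tau>bar) * (H1_norm \<tau>bar w)\<^sup>2" if th: "\<theta> \<in> {-\<tau>bar..0}" for \<theta>
  proof -
    have sub_le: "integral {a..b} \<omega> \<le> I1" if "-\<tau>bar \<le> a" "b \<le> 0" for a b
      unfolding I1_def by (rule integral_subset_le) (use that 1 \<omega>0 in \<open>auto intro: integrable_on_subinterval\<close>)
    have pt: "(norm (w \<theta>))\<^sup>2 \<le> 2 * (norm (w \<theta>'))\<^sup>2 + 2 * I1\<^sup>2" if th': "\<theta>' \<in> {-\<tau>bar..0}" for \<theta>'
    proof -
      have "norm (w \<theta> - w \<theta>') \<le> I1"
      proof (cases "\<theta>' \<le> \<theta>")
        case True
        then show ?thesis using 3[of \<theta>' \<theta>] sub_le[of \<theta>' \<theta>] th th' by auto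
      next
        case False
        then show ?thesis using 3[of \<theta> \<theta>'] sub_le[of \<theta> \<theta>'] th th' by (auto simp: norm_minus_commute)
      qed
      then have "norm (w \<theta>) \<le> norm (w \<theta>') + I1" using norm_triangle_ineq2[of "w \<theta>" "w \<theta>'"] by linarith
      then have "(norm (w \<theta>))\<^sup>2 \<le> (norm (w \<theta>') + I1)\<^sup>2" by (intro power_mono) auto
      also have "\<dots> \<le> 2 * (norm (w \<theta>'))\<^sup>2 + 2 * I1\<^sup>2"
        using zero_le_power2[of "norm (w \<theta>') - I1"] by (simp add: power2_sum power2_diff)
      finally show ?thesis .
    qed
    have "\<tau>bar * (norm (w \<theta>))\<^sup>2 = integral {-\<tau>bar..0} (\<lambda>_. (norm (w \<theta>))\<^sup>2)" using \<tau>bar by simp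
    also have "\<dots> \<le> integral {-\<tau>bar..0} (\<lambda>\<theta>'. 2 * (norm (w \<theta>'))\<^sup>2 + 2 * I1\<^sup>2)"
      by (rule integral_le[OF integrable_const_ivl]) (use pt in \<open>auto intro!: integrable_add integrable_on_mult_right wPI\<close>)
    also have "\<dots> = 2 * P + \<tau>bar * (2 * I1\<^sup>2)"
      using integral_add[OF integrable_on_mult_right[OF wPI, of 2] integrable_const_ivl, of "2 * I1\<^sup>2"] \<tau>bar by (simp add: P_def)
    also have "\<dots> \<le> 2 * P + \<tau>bar * (2 * (\<tau>bar * I2))" using CS \<tau>bar by (intro add_left_mono mult_left_mono) auto
    finally have "(norm (w \<theta>))\<^sup>2 \<le> 2 / \<tau>bar * P + 2 * \<tau>bar * I2" using \<tau>bar by (simp add: field_simps)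
    also have "\<dots> \<le> 2 / \<tau>bar * (P + I2) + 2 * \<tau>bar * (P + I2)"
      using P0 I20 \<tau>bar by (intro add_mono mult_left_mono) auto
    finally show ?thesis by (simp add: H distrib_right)
  qed
qed

context delay_semiconcave
begin

lemma running_gap_nonneg: "running_gap N \<ge> 0"
  unfolding running_gap_def using \<gamma>L(1) consts_nonneg lL(1) K_nonneg l\<tau>(1) time
  by (intro add_nonneg_nonneg mult_nonneg_nonneg) auto

lemma hist_ok_combinations:
  assumes r: "r > 0" "R0 = 2 * r" and w: "w \<in> hist_W \<tau>bar r" "w0 \<in> hist_W \<tau>bar r"
  shows "hist_ok w" "hist_ok (\<lambda>\<theta>. w \<theta> + w0 \<theta>)" "hist_ok (\<lambda>\<theta>. w \<theta> - w0 \<theta>)"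
proof -
  note fw = hist_W_facts[OF w(1) delay_pos r(1)] and fw0 = hist_W_facts[OF w(2) delay_pos r(1)]
  have rR: "r \<le> R0" using r by simp
  show "hist_ok w" unfolding hist_ok_def using lipschitz_on_le[OF fw(1) rR] order_trans[OF fw(2) rR] by blast
  have R: "R0 = r + r" using r by simp
  have b: "norm (w \<theta> + w0 \<theta>) \<le> R0" "norm (w \<theta> - w0 \<theta>) \<le> R0" if "\<theta> \<in> {-\<tau>bar..0}" for \<theta>
    using fw(2)[OF that] fw0(2)[OF that] norm_triangle_ineq[of "w \<theta>" "w0 \<theta>"] norm_triangle_ineq4[of "w \<theta>" "w0 \<theta>"] R by linarith+
  show "hist_ok (\<lambda>\<theta>. w \<theta> + w0 \<theta>)" unfolding hist_ok_def
    using lipschitz_on_add[OF fw(1) fw0(1)] b R by simp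
  show "hist_ok (\<lambda>\<theta>. w \<theta> - w0 \<theta>)" unfolding hist_ok_def
    using lipschitz_on_diff[OF fw(1) fw0(1)] b R by simp
qed

text \<open>One near-optimal control for \<open>w\<close> serves all three histories: its costs
  bound the two outer infima from above and the middle one from below up to
  \<open>gridc * \<epsilon>\<^sup>2\<close>. Since the constants do not depend on
  \<open>\<epsilon>\<close>, letting it tend to 0 removes both this error and the one in
  \<open>\<Sigma>\<close>.\<close>

lemma value_second_difference:
  assumes t: "t0 \<le> t" "t < T" and r: "r > 0" "R0 = 2 * r"
    and w: "w \<in> hist_WN \<tau>bar r N" and w0: "w0 \<in> hist_WN \<tau>bar r N"
    and Cg: "Cg \<ge> 0" "\<And>v v0. v \<in> hist_W \<tau>bar rW \<Longrightarrow> v0 \<in> hist_W \<tau>bar rW \<Longrightarrow>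
      g (v 0 + v0 0, \<lambda>\<theta>. v \<theta> + v0 \<theta>) + g (v 0 - v0 0, \<lambda>\<theta>. v \<theta> - v0 \<theta>) - 2 * g (v 0, v) \<le> Cg * (H1_norm \<tau>bar v0)\<^sup>2"
  shows "Inf (J t (\<lambda>\<theta>. w \<theta> + w0 \<theta>) ` controls A t T) + Inf (J t (\<lambda>\<theta>. w \<theta> - w0 \<theta>) ` controls A t T)
      - 2 * Inf (J t w ` controls A t T)
    \<le> ((running_gap N + lg * (1 + \<tau>bar) * traj_gap N + Cg * (\<tau>bar * dep\<^sup>2 + 4 * \<tau>bar * growth\<^sup>2 * dep\<^sup>2))
        * (4 * (2 / \<tau>bar + 2 * \<tau>bar) + \<tau>bar) + Cg) * (H1_norm \<tau>bar w0)\<^sup>2"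
    (is "?lhs \<le> (?A * ?c + Cg) * ?H\<^sup>2")
proof -
  let ?Bw = "nonsmooth_points \<tau>bar w" and ?Bz = "nonsmooth_points \<tau>bar w0"
  have wW: "w \<in> hist_W \<tau>bar r" "card ?Bw \<le> N" and w0W: "w0 \<in> hist_W \<tau>bar r"
    using w w0 by (auto simp: hist_WN_def)
  note fw = hist_W_facts[OF wW(1) delay_pos r(1)] and fw0 = hist_W_facts[OF w0W delay_pos r(1)]
    and Hw0 = hist_W_H1[OF w0W delay_pos r(1)]
  have rR: "r \<le> R0" using r by simp
  note ok = hist_ok_combinations[OF r wW(1) w0W]
  define \<omega> where "\<omega> = (\<lambda>\<theta>. indicat_real ({-\<tau>bar<..<0} - ?Bz) \<theta> * norm (dot w0 \<theta>))"
  have Hw: "\<omega> integrable_on {-\<tau>bar..0}" "(\<lambda>\<theta>. (\<omega> \<theta>)\<^sup>2) integrable_on {-\<tau>bar..0}"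
    "\<And>a b. -\<tau>bar \<le> a \<Longrightarrow> a \<le> b \<Longrightarrow> b \<le> 0 \<Longrightarrow> norm (w0 b - w0 a) \<le> integral {a..b} \<omega>"
    "integral {-\<tau>bar..0} (\<lambda>\<theta>. (\<omega> \<theta>)\<^sup>2) \<le> ?H\<^sup>2" "(integral {-\<tau>bar..0} \<omega>)\<^sup>2 \<le> \<tau>bar * ?H\<^sup>2"
    "\<And>\<theta>. \<theta> \<in> {-\<tau>bar..0} \<Longrightarrow> (norm (w0 \<theta>))\<^sup>2 \<le> (2 / \<tau>bar + 2 * \<tau>bar) * ?H\<^sup>2"
    unfolding \<omega>_def by (fact Hw0)+
  define c0 where "c0 = 2 / \<tau>bar + 2 * \<tau>bar"
  have c0: "c0 \<ge> 0" using delay_pos by (simp add: c0_def)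
  have H0: "?H \<ge> 0" unfolding H1_norm_def by (intro real_sqrt_ge_zero add_nonneg_nonneg Bochner_Integration.integral_nonneg) auto
  have A0: "?A \<ge> 0"
    using running_gap_nonneg consts_nonneg(6) lg(1) delay_pos Cg(1) by (intro add_nonneg_nonneg mult_nonneg_nonneg) auto
  have main: "?lhs \<le> (?A * ?c + Cg) * ?H\<^sup>2 + (5 * ?A + 2 * gridc) * \<epsilon>\<^sup>2" if eps: "0 < \<epsilon>" "\<epsilon> \<le> 1" for \<epsilon>
  proof -
    obtain \<beta> S where \<beta>: "\<beta> \<in> controls A t T" "J t w \<beta> \<le> Inf (J t w ` controls A t T) + gridc * \<epsilon>\<^sup>2"
      "\<And>s s'. s \<in> {t<..<T} \<Longrightarrow> s' \<in> {t<..<T} \<Longrightarrow> norm (\<beta> s - \<beta> s') \<le> gridc * (\<bar>s - s'\<bar> + \<epsilon>)"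
      "finite S" "\<And>a b s s'. {a<..<b} \<subseteq> {t<..<T} - S \<Longrightarrow> s \<in> {a<..<b} \<Longrightarrow> s' \<in> {a<..<b} \<Longrightarrow> \<beta> s = \<beta> s'"
      using near_optimal_step_control[OF t ok(1) eps] by blast
    \<comment> \<open>The summand \<open>\<epsilon>\<close> keeps \<open>\<delta>\<close> positive
      when \<open>w0\<close> vanishes.\<close>
    define \<delta> where "\<delta> = sqrt c0 * ?H + \<epsilon>"
    have \<delta>: "\<delta> > 0" using c0 H0 eps by (simp add: \<delta>_def add_nonneg_pos)
    have w0\<delta>: "norm (w0 \<theta>) \<le> \<delta>" if "\<theta> \<in> {-\<tau>bar..0}" for \<theta>
    proof -
      have "(norm (w0 \<theta>))\<^sup>2 \<le> (sqrt c0 * ?H)\<^sup>2" using Hw(6)[OF that] c0 by (simp add: c0_def power_mult_distrib)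
      then have "norm (w0 \<theta>) \<le> sqrt c0 * ?H" by (rule power2_le_imp_le) (use c0 H0 in auto)
      then show ?thesis using eps by (simp add: \<delta>_def)
    qed
    interpret td: terminal_difference t0 T \<tau>bar A f \<tau> lf Cf l\<tau> L g Ha R0 d lt lft lL lg \<mu> lH \<gamma>f \<gamma>L \<gamma>\<tau>
      t w w0 \<beta> ?Bw N "dot w" \<omega> \<delta> \<epsilon> S ?Bz "dot w0" Cg
    proof unfold_locales
      show "R0-lipschitz_on {c<..<e} (dot w)" if "{c<..<e} \<subseteq> {-\<tau>bar<..<0} - ?Bw" for c e
        by (rule lipschitz_on_le[OF fw(5)[OF that] rR])
      show "R0-lipschitz_on {c<..<e} (dot w0)" if "{c<..<e} \<subseteq> {-\<tau>bar<..<0} - ?Bz" for c e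
        by (rule lipschitz_on_le[OF fw0(5)[OF that] rR])
      show "norm (dot w \<theta>) \<le> R0" if "{c<..<e} \<subseteq> {-\<tau>bar<..<0} - ?Bw" "\<theta> \<in> {c<..<e}" for c e \<theta>
        using fw(7)[of \<theta>] that rR by fastforce
      show "0 \<le> \<omega> \<theta>" for \<theta> by (simp add: \<omega>_def)
      show "norm (dot w0 \<theta>) \<le> \<omega> \<theta>" if "\<theta> \<in> {-\<tau>bar<..<0} - ?Bz" for \<theta> using that by (simp add: \<omega>_def)
    qed (fact t ok \<beta> eps \<delta> w0\<delta> fw(3) fw0(3) wW(2) fw(4) fw0(4) Hw(1,2,3) Cg)+
    have I1: "td.I1\<^sup>2 \<le> \<tau>bar * ?H\<^sup>2" using Hw(5) by (simp add: td.I1_def)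
    have \<delta>2: "\<delta>\<^sup>2 \<le> 2 * c0 * ?H\<^sup>2 + 2 * \<epsilon>\<^sup>2"
    proof -
      have "\<delta>\<^sup>2 \<le> 2 * (sqrt c0 * ?H)\<^sup>2 + 2 * \<epsilon>\<^sup>2"
        using zero_le_power2[of "sqrt c0 * ?H - \<epsilon>"] by (simp add: \<delta>_def power2_sum power2_diff)
      then show ?thesis using c0 by (simp add: power_mult_distrib)
    qed
    \<comment> \<open>The mixed products in \<open>\<Sigma>\<close> are split into squares; the
      resulting coefficient 9/2 of \<open>\<epsilon>\<^sup>2\<close> is rounded up to 5.\<close>
    have "2 * (\<delta> * td.I1) \<le> \<delta>\<^sup>2 + td.I1\<^sup>2" "2 * (\<delta> * \<epsilon>) \<le> \<delta>\<^sup>2 + \<epsilon>\<^sup>2"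
      using zero_le_power2[of "\<delta> - td.I1"] zero_le_power2[of "\<delta> - \<epsilon>"] by (auto simp: power2_diff)
    then have "td.\<Sigma> \<le> 4 * c0 * ?H\<^sup>2 + \<tau>bar * ?H\<^sup>2 + 5 * \<epsilon>\<^sup>2"
      using \<delta>2 I1 zero_le_power2[of \<epsilon>] mult_nonneg_nonneg[OF less_imp_le[OF delay_pos] zero_le_power2[of ?H]]
      unfolding td.\<Sigma>_def by linarith
    then have "?A * td.\<Sigma> \<le> ?A * (4 * c0 * ?H\<^sup>2 + \<tau>bar * ?H\<^sup>2 + 5 * \<epsilon>\<^sup>2)" using A0 by (rule mult_left_mono)
    moreover have "Cg * integral {-\<tau>bar..0} (\<lambda>\<theta>. (\<omega> \<theta>)\<^sup>2) \<le> Cg * ?H\<^sup>2" by (rule mult_left_mono[OF Hw(4) Cg(1)])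
    moreover note td.J_second_difference
    moreover have "Inf (J t (\<lambda>\<theta>. w \<theta> + w0 \<theta>) ` controls A t T) \<le> J t (\<lambda>\<theta>. w \<theta> + w0 \<theta>) \<beta>"
      using J_bdd_below[OF t ok(2)] \<beta>(1) by (intro cINF_lower)
    moreover have "Inf (J t (\<lambda>\<theta>. w \<theta> - w0 \<theta>) ` controls A t T) \<le> J t (\<lambda>\<theta>. w \<theta> - w0 \<theta>) \<beta>"
      using J_bdd_below[OF t ok(3)] \<beta>(1) by (intro cINF_lower)
    ultimately have "?lhs \<le> ?A * (4 * c0 * ?H\<^sup>2 + \<tau>bar * ?H\<^sup>2 + 5 * \<epsilon>\<^sup>2) + Cg * ?H\<^sup>2 + 2 * (gridc * \<epsilon>\<^sup>2)"
      using \<beta>(2) by linarith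
    also have "\<dots> = (?A * ?c + Cg) * ?H\<^sup>2 + (5 * ?A + 2 * gridc) * \<epsilon>\<^sup>2"
      unfolding c0_def[symmetric] by (simp only: distrib_left distrib_right mult_ac add_ac)
    finally show ?thesis .
  qed
  define C where "C = 5 * ?A + 2 * gridc"
  have C: "C > 0" using A0 gridc_nonneg by (simp add: C_def)
  show ?thesis
  proof (rule field_le_epsilon)
    fix e :: real assume e: "e > 0"
    \<comment> \<open>With \<open>\<epsilon> \<le> 1\<close> one has
      \<open>\<epsilon>\<^sup>2 \<le> \<epsilon>\<close>, so a choice linear in \<open>e\<close>
      suffices.\<close>
    define \<epsilon> where "\<epsilon> = min 1 (e / C)"
    have eps: "0 < \<epsilon>" "\<epsilon> \<le> 1" "C * \<epsilon> \<le> e" using e C by (auto simp: \<epsilon>_def min_def field_simps)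
    have "\<epsilon>\<^sup>2 \<le> \<epsilon>" using eps by (simp add: power2_eq_square mult_left_le)
    then have "C * \<epsilon>\<^sup>2 \<le> e" using C eps(3) mult_left_mono[of "\<epsilon>\<^sup>2" \<epsilon> C] by linarith
    then show "?lhs \<le> (?A * ?c + Cg) * ?H\<^sup>2 + e" using main[OF eps(1,2)] unfolding C_def by linarith
  qed
qed

lemma value_functional_eq:
  assumes "t0 \<le> t" "t < T" "hist_ok v"
  shows "value_functional A f L g \<tau> \<tau>bar T t v = Inf (J t v ` controls A t T)"
  unfolding value_functional_def using assms cost_eq_J[OF assms] by (simp cong: image_cong_simp)

end

section \<open>From the hypotheses to the constants of the locales\<close>

lemma hist_PI:
  fixes w :: "real \<Rightarrow> real^'n"
  assumes "k-lipschitz_on {-\<tau>bar..0} w" "\<And>\<theta>. \<theta> \<in> {-\<tau>bar..0} \<Longrightarrow> norm (w \<theta>) \<le> R"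
  shows "w \<in> hist_P \<tau>bar R"
proof -
  have "w \<in> borel_measurable (lebesgue_on {-\<tau>bar..0})"
    using lipschitz_on_continuous_on[OF assms(1)] by (intro continuous_imp_measurable_on_sets_lebesgue) auto
  then have m: "(\<lambda>\<theta>. ereal (norm (w \<theta>))) \<in> borel_measurable (lebesgue_on {-\<tau>bar..0})" by measurable
  have "Linf_norm \<tau>bar w \<le> ereal R"
    unfolding Linf_norm_def by (rule esssup_I[OF m]) (use assms(2) in \<open>auto intro!: AE_I2\<close>)
  then show ?thesis using assms(1) by (auto simp: hist_P_def lip_hist_def)
qed

text \<open>Along a trajectory, the expression in the monotone-delay condition is the derivative of the
  lagged time \<open>s - \<tau>(s, x(s))\<close>.\<close>

lemma (in delay_ode) lag_expandingI:
  assumes C1: "C1_on ({t0..T} \<times> UNIV) \<tau>" and t: "t0 \<le> t" "t < T" and \<alpha>: "\<alpha> \<in> controls A t T"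
    and sol: "sol t w \<alpha> x"
    and mono: "AE s in lebesgue_on {t..T}.
      1 - vector_derivative (\<lambda>u. \<tau> (u, x s)) (at s within {t0..T})
        - frechet_derivative (\<lambda>z. \<tau> (s, z)) (at (x s)) (vector_derivative x (at s)) \<ge> d"
    and ss: "t \<le> s1" "s1 \<le> s2" "s2 \<le> T"
  shows "d * (s2 - s1) \<le> lag x s2 - lag x s1"
proof -
  obtain k where k: "k-lipschitz_on {t - \<tau>bar..T} x" using sol by (auto simp: sol_def)
  have k0: "k \<ge> 0" using k lipschitz_on_nonneg by blast
  have klip: "k-lipschitz_on {t..T} x" by (rule lipschitz_on_subset[OF k]) (use delay_pos in auto)
  have "compact (x ` {t..T})" by (intro compact_continuous_image lipschitz_on_continuous_on[OF klip]) auto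
  then obtain R where R: "\<And>s. s \<in> {t..T} \<Longrightarrow> norm (x s) \<le> R"
    by (meson bounded_iff compact_imp_bounded imageI)
  obtain B where B: "B \<ge> 0" "\<And>p q. p \<in> {t0..T} \<times> cball 0 R \<Longrightarrow> q \<in> {t0..T} \<times> cball 0 R \<Longrightarrow> norm (\<tau> p - \<tau> q) \<le> B * norm (p - q)"
  proof -
    have "\<exists>B\<ge>0. \<forall>p\<in>{t0..T} \<times> cball 0 R. \<forall>q\<in>{t0..T} \<times> cball 0 R. norm (\<tau> p - \<tau> q) \<le> B * norm (p - q)"
      by (rule C1_on_imp_lipschitz_on[OF C1]) (auto intro!: compact_Times convex_Times)
    then show thesis using that by blast
  qed
  have lag_lip: "(1 + B * (1 + k))-lipschitz_on {s1..s2} (lag x)"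
  proof (rule lipschitz_onI)
    show "0 \<le> 1 + B * (1 + k)" using B(1) k0 by simp
    fix a b assume ab: "a \<in> {s1..s2}" "b \<in> {s1..s2}"
    then have abt: "a \<in> {t..T}" "b \<in> {t..T}" using ss by auto
    have "norm (\<tau> (a, x a) - \<tau> (b, x b)) \<le> B * norm ((a, x a) - (b, x b))"
      using abt t R by (intro B(2)) auto
    also have "norm ((a, x a) - (b, x b)) \<le> \<bar>a - b\<bar> + norm (x a - x b)"
      using norm_Pair_le[of "a - b" "x a - x b"] by simp
    also have "norm (x a - x b) \<le> k * \<bar>a - b\<bar>" using lipschitz_onD[OF klip abt] by (simp add: dist_norm)
    finally have "\<bar>\<tau> (a, x a) - \<tau> (b, x b)\<bar> \<le> B * (\<bar>a - b\<bar> + k * \<bar>a - b\<bar>)" using B(1) by (simp add: mult_left_mono)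
    then show "dist (lag x a) (lag x b) \<le> (1 + B * (1 + k)) * dist a b"
      by (simp add: lag_def dist_real_def algebra_simps)
  qed
  obtain \<tau>' where \<tau>': "\<And>q. q \<in> {t0..T} \<times> UNIV \<Longrightarrow> (\<tau> has_derivative blinfun_apply (\<tau>' q)) (at q within {t0..T} \<times> UNIV)"
    using C1 unfolding C1_on_def by blast
  have tr: "is_trajectory f \<tau> \<tau>bar T t w \<alpha> x" using is_trajectory_iff_sol[OF t \<alpha>] sol by blast
  obtain N1 where N1: "negligible N1" "\<And>s. s \<in> {t<..<T} - N1 \<Longrightarrow> \<exists>v. (x has_vector_derivative v) (at s)"
  proof -
    have "AE s in lebesgue_on {t<..<T}. (x has_vector_derivative f (s, x s, x (s - \<tau> (s, x s)), \<alpha> s)) (at s)"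
      using tr by (auto simp: is_trajectory_def)
    then obtain N where "negligible N"
      "\<forall>s\<in>{t<..<T} - N. (x has_vector_derivative f (s, x s, x (s - \<tau> (s, x s)), \<alpha> s)) (at s)"
      by (subst (asm) AE_lebesgue_on_iff) auto
    then show thesis using that[of N] by blast
  qed
  obtain N2 where N2: "negligible N2" "\<And>s. s \<in> {t..T} - N2 \<Longrightarrow>
      1 - vector_derivative (\<lambda>u. \<tau> (u, x s)) (at s within {t0..T})
        - frechet_derivative (\<lambda>z. \<tau> (s, z)) (at (x s)) (vector_derivative x (at s)) \<ge> d"
    using mono by (subst (asm) AE_lebesgue_on_iff) auto
  show ?thesis
  proof (rule lipschitz_on_AE_derivative_lower_bound[OF lag_lip ss(2)])
    show "AE s in lebesgue_on {s1<..<s2}. \<exists>D\<ge>d. (lag x has_real_derivative D) (at s)"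
    proof (subst AE_lebesgue_on_iff, simp, intro exI[of _ "N1 \<union> N2"] conjI ballI)
      show "negligible (N1 \<union> N2)" using N1(1) N2(1) by (rule negligible_Un)
      fix s assume s: "s \<in> {s1<..<s2} - (N1 \<union> N2)"
      then have st: "s \<in> {t<..<T}" "s \<in> {t0<..<T}" using ss t by auto
      obtain v where v: "(x has_vector_derivative v) (at s)" using N1(2)[of s] s st by auto
      define D where "D = blinfun_apply (\<tau>' (s, x s))"
      \<comment> \<open>The derivative of \<open>\<tau>\<close> is given within the strip; at an
        interior time it is a full derivative, to which the chain rule applies in each variable and
        along the trajectory.\<close>
      have "at (s, x s) within {t0..T} \<times> UNIV = at (s, x s)"
      proof (rule at_within_interior)
        have "(s, x s) \<in> {t0<..<T} \<times> UNIV" using st by auto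
        moreover have "{t0<..<T} \<times> (UNIV :: (real^'n) set) \<subseteq> interior ({t0..T} \<times> UNIV)"
          by (rule interior_maximal) (auto intro: open_Times)
        ultimately show "(s, x s) \<in> interior ({t0..T} \<times> UNIV)" by blast
      qed
      then have D: "(\<tau> has_derivative D) (at (s, x s))"
        using \<tau>'[of "(s, x s)"] st by (simp add: D_def)
      have lin: "bounded_linear D" using D by (rule has_derivative_bounded_linear)
      have d1: "((\<lambda>u. \<tau> (u, x s)) has_derivative (\<lambda>h. D (h, 0))) (at s)"
        by (rule has_derivative_compose[of "\<lambda>u. (u, x s)", OF _ D]) (auto intro!: derivative_eq_intros)
      have d2: "((\<lambda>z. \<tau> (s, z)) has_derivative (\<lambda>z. D (0, z))) (at (x s))"
        by (rule has_derivative_compose[of "\<lambda>z. (s, z)", OF _ D]) (auto intro!: derivative_eq_intros)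
      have d3: "((\<lambda>u. \<tau> (u, x u)) has_derivative (\<lambda>h. D (h, h *\<^sub>R v))) (at s)"
        using has_derivative_compose[OF has_derivative_Pair[OF has_derivative_ident v[unfolded has_vector_derivative_def]] D] .
      have sc: "D (h *\<^sub>R p) = h * D p" for h p using linear_scale[OF bounded_linear.linear[OF lin]] by simp
      have "((\<lambda>u. \<tau> (u, x s)) has_vector_derivative D (1, 0)) (at s)"
      proof -
        have "D (h, 0) = h *\<^sub>R D (1, 0)" for h using sc[of h "(1, 0)"] by simp
        then have "(\<lambda>h. D (h, 0)) = (\<lambda>h. h *\<^sub>R D (1, 0))" by (rule ext)
        then show ?thesis using d1 by (simp only: has_vector_derivative_def)
      qed
      moreover have "at s within {t0..T} = at s" using st by (simp add: at_within_Icc_at)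
      ultimately have 1: "vector_derivative (\<lambda>u. \<tau> (u, x s)) (at s within {t0..T}) = D (1, 0)"
        by (simp add: vector_derivative_at)
      have 2: "frechet_derivative (\<lambda>z. \<tau> (s, z)) (at (x s)) = (\<lambda>z. D (0, z))"
        using frechet_derivative_at[OF d2] by simp
      have 3: "vector_derivative x (at s) = v" using v by (rule vector_derivative_at)
      have "D (1, v) = D (1, 0) + D (0, v)"
        using bounded_linear.linear[OF lin, THEN linear_add, of "(1, 0)" "(0, v)"] by simp
      then have "d \<le> 1 - D (1, v)" using N2(2)[of s] s st unfolding 1 2 3 by auto
      moreover have "(lag x has_real_derivative 1 - D (1, v)) (at s)"
      proof -
        have "(lag x has_derivative (\<lambda>h. h - D (h, h *\<^sub>R v))) (at s)"
          unfolding lag_def[abs_def] by (intro has_derivative_diff has_derivative_ident d3)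
        moreover have "h - D (h, h *\<^sub>R v) = (1 - D (1, v)) * h" for h
          using sc[of h "(1, v)"] by (simp add: algebra_simps)
        ultimately show ?thesis by (simp add: has_field_derivative_def)
      qed
      ultimately show "\<exists>D\<ge>d. (lag x has_real_derivative D) (at s)" by blast
    qed
  qed
qed

theorem theorem6p5:
  fixes t0 T \<tau>bar :: real
    and A :: "(real^'m) set"
    and f :: "real \<times> (real^'n) \<times> (real^'n) \<times> (real^'m) \<Rightarrow> real^'n"
    and L :: "real \<times> (real^'n) \<times> (real^'n) \<times> (real^'m) \<Rightarrow> real"
    and g :: "(real^'n) \<times> (real \<Rightarrow> real^'n) \<Rightarrow> real"
    and \<tau> :: "real \<times> (real^'n) \<Rightarrow> real"
    and Ha :: "real \<times> (real^'n) \<times> (real^'n) \<times> (real^'n) \<times> (real^'m) \<Rightarrow> real^'m"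
  assumes time: "t0 < T"
    and A: "A \<noteq> {}" "convex A" "compact A"
    and a1: "continuous_on ({t0..T} \<times> UNIV \<times> UNIV \<times> A) f"
            "continuous_on ({t0..T} \<times> UNIV \<times> UNIV \<times> A) L"
    and a2: "\<exists>lf>0. \<forall>t\<in>{t0..T}. \<forall>z y z' y'. \<forall>a\<in>A.
               norm (f (t, z, y, a) - f (t, z', y', a)) \<le> lf * (norm (z - z') + norm (y - y'))"
    and a3: "\<forall>t\<in>{t0..T}. \<forall>z y. convex {(f (t, z, y, a), l) | a l. a \<in> A \<and> l \<ge> L (t, z, y, a)}"
    and a4: "\<forall>R>0. \<exists>lL>0. \<forall>t\<in>{t0..T}. \<forall>a\<in>A.
               \<forall>z\<in>cball 0 R. \<forall>y\<in>cball 0 R. \<forall>z'\<in>cball 0 R. \<forall>y'\<in>cball 0 R.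
               \<bar>L (t, z, y, a) - L (t, z', y', a)\<bar> \<le> lL * (norm (z - z') + norm (y - y'))"
    and a5: "\<exists>CL>0. \<forall>t\<in>{t0..T}. \<forall>z y. \<forall>a\<in>A. \<bar>L (t, z, y, a)\<bar> \<le> CL * (1 + norm z + norm y)"
    and a6: "\<forall>R>0. \<exists>lg>0. \<forall>(z1, w1)\<in>hist_space \<tau>bar. \<forall>(z2, w2)\<in>hist_space \<tau>bar.
               w1 \<in> hist_P \<tau>bar R \<longrightarrow> w2 \<in> hist_P \<tau>bar R \<longrightarrow>
               \<bar>g (z1, w1) - g (z2, w2)\<bar> \<le> lg * norm_X \<tau>bar (z1 - z2, \<lambda>\<theta>. w1 \<theta> - w2 \<theta>)"
    and a7: "\<forall>t\<in>{t0..T}. \<forall>z. \<tau> (t, z) \<ge> 0"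
            "C1_on ({t0..T} \<times> UNIV) \<tau>"
            "bdd_above (\<tau> ` ({t0..T} \<times> UNIV))"
            "\<tau>bar = (SUP q\<in>{t0..T} \<times> UNIV. \<tau> q)"
            "\<exists>l\<tau>>0. \<forall>t\<in>{t0..T}. \<forall>z y. \<bar>\<tau> (t, z) - \<tau> (t, y)\<bar> \<le> l\<tau> * norm (z - y)"
    and delay_pos: "\<tau>bar > 0"
    and a8: "\<forall>r>0. \<exists>d>0. \<forall>t\<in>{t0..T}. \<forall>w\<in>hist_P \<tau>bar r. \<forall>\<alpha>\<in>controls A t T.
               (let x = trajectory f \<tau> \<tau>bar T t w \<alpha> in
                AE s in lebesgue_on {t..T}.
                  1 - vector_derivative (\<lambda>u. \<tau> (u, x s)) (at s within {t0..T})
                    - frechet_derivative (\<lambda>z. \<tau> (s, z)) (at (x s)) (vector_derivative x (at s)) \<ge> d)"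
    and S1: "C1_on ({t0..T} \<times> UNIV \<times> UNIV \<times> A) f"
            "C1_on ({t0..T} \<times> UNIV \<times> UNIV \<times> A) L"
    and Ha: "\<forall>t\<in>{t0..T}. \<forall>z y p. \<forall>a\<in>A.
               ((\<lambda>b. hamiltonian f L (t, z, y, p, b)) has_derivative (\<lambda>v. Ha (t, z, y, p, a) \<bullet> v))
                 (at a within A)"
    and S2: "\<exists>\<mu>>0. \<exists>lH>0.
               (\<forall>t\<in>{t0..T}. \<forall>z y p. \<forall>a1\<in>A. \<forall>a2\<in>A.
                  (Ha (t, z, y, p, a1) - Ha (t, z, y, p, a2)) \<bullet> (a1 - a2) \<ge> \<mu> * (norm (a1 - a2))\<^sup>2) \<and>
               (\<forall>t1\<in>{t0..T}. \<forall>t2\<in>{t0..T}. \<forall>z1 z2 y1 y2 p1 p2. \<forall>a\<in>A.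
                  norm (Ha (t1, z1, y1, p1, a) - Ha (t2, z2, y2, p2, a))
                    \<le> lH * (\<bar>t1 - t2\<bar> + norm (z1 - z2) + norm (y1 - y2) + norm (p1 - p2)))"
    and S3: "\<forall>r>0. \<exists>\<gamma>f>0. \<forall>t\<in>{t0..T}. \<forall>a\<in>A.
               \<forall>z1\<in>cball 0 r. \<forall>z2\<in>cball 0 r. \<forall>y1\<in>cball 0 r. \<forall>y2\<in>cball 0 r.
               norm (f (t, z1, y1, a) + f (t, z2, y2, a)
                       - 2 *\<^sub>R f (t, (1/2) *\<^sub>R (z1 + z2), (1/2) *\<^sub>R (y1 + y2), a))
                 \<le> \<gamma>f * ((norm (z1 - z2))\<^sup>2 + (norm (y1 - y2))\<^sup>2)"
            "\<forall>r>0. \<exists>\<gamma>L>0. \<forall>t\<in>{t0..T}. \<forall>a\<in>A.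
               \<forall>z1\<in>cball 0 r. \<forall>z2\<in>cball 0 r. \<forall>y1\<in>cball 0 r. \<forall>y2\<in>cball 0 r.
               \<bar>L (t, z1, y1, a) + L (t, z2, y2, a)
                  - 2 * L (t, (1/2) *\<^sub>R (z1 + z2), (1/2) *\<^sub>R (y1 + y2), a)\<bar>
                 \<le> \<gamma>L * ((norm (z1 - z2))\<^sup>2 + (norm (y1 - y2))\<^sup>2)"
    and S4: "\<forall>r>0. \<exists>\<gamma>\<tau>>0. \<forall>t\<in>{t0..T}. \<forall>z1\<in>cball 0 r. \<forall>z2\<in>cball 0 r.
               \<bar>\<tau> (t, z1) + \<tau> (t, z2) - 2 * \<tau> (t, (1/2) *\<^sub>R (z1 + z2))\<bar> \<le> \<gamma>\<tau> * (norm (z1 - z2))\<^sup>2"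
    and S5: "\<forall>t\<in>{t0..<T}. \<forall>w\<in>lip_hist \<tau>bar. \<forall>\<alpha>\<in>controls A t T.
               (let x = trajectory f \<tau> \<tau>bar T t w \<alpha> in
                \<exists>gz gw. has_hist_derivative \<tau>bar g gz gw (x T, segment_at x T))"
            "\<forall>r>0. \<exists>\<gamma>g>0. \<forall>t\<in>{t0..<T}. \<forall>w\<in>hist_V \<tau>bar r. \<forall>\<alpha>\<in>controls A t T.
               (let x = trajectory f \<tau> \<tau>bar T t w \<alpha> in
                \<forall>gz gw. has_hist_derivative \<tau>bar g gz gw (x T, segment_at x T) \<longrightarrow>
                  Linf_norm \<tau>bar gw \<le> ereal \<gamma>g)"
    and semiconcave: "\<forall>r>0. \<exists>C. \<forall>(z, w)\<in>hist_space \<tau>bar. \<forall>(z0, w0)\<in>hist_space \<tau>bar.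
               w \<in> hist_W \<tau>bar r \<longrightarrow> w0 \<in> hist_W \<tau>bar r \<longrightarrow>
               g (z + z0, \<lambda>\<theta>. w \<theta> + w0 \<theta>) + g (z - z0, \<lambda>\<theta>. w \<theta> - w0 \<theta>) - 2 * g (z, w)
                 \<le> C * (H1_norm \<tau>bar w0)\<^sup>2"
  shows "\<forall>r>0. \<forall>N. \<exists>C. \<forall>t\<in>{t0..T}. \<forall>w\<in>hist_WN \<tau>bar r N. \<forall>w0\<in>hist_WN \<tau>bar r N.
           value_functional A f L g \<tau> \<tau>bar T t (\<lambda>\<theta>. w \<theta> + w0 \<theta>)
             + value_functional A f L g \<tau> \<tau>bar T t (\<lambda>\<theta>. w \<theta> - w0 \<theta>)
             - 2 * value_functional A f L g \<tau> \<tau>bar T t w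
           \<le> C * (H1_norm \<tau>bar w0)\<^sup>2"
proof (intro allI impI)
  fix r :: real and N :: nat
  assume r: "r > 0"
  \<comment> \<open>Twice the radius makes room for \<open>w + w0\<close> and
    \<open>w - w0\<close>.\<close>
  define R0 where "R0 = 2 * r"
  have R0: "R0 > 0" using r by (simp add: R0_def)
  obtain lf where lf: "lf > 0" "\<And>t z y z' y' a. t \<in> {t0..T} \<Longrightarrow> a \<in> A \<Longrightarrow>
      norm (f (t, z, y, a) - f (t, z', y', a)) \<le> lf * (norm (z - z') + norm (y - y'))"
    using a2 by blast
  obtain l\<tau> where l\<tau>: "l\<tau> > 0" "\<And>t z y. t \<in> {t0..T} \<Longrightarrow> \<bar>\<tau> (t, z) - \<tau> (t, y)\<bar> \<le> l\<tau> * norm (z - y)"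
    using a7(5) by blast
  \<comment> \<open>Linear growth follows from the global Lipschitz condition and a bound of
    \<open>f (t, 0, 0, a)\<close> over the compact set of times and controls.\<close>
  obtain Cf where Cf: "Cf > 0" "\<And>t z y a. t \<in> {t0..T} \<Longrightarrow> a \<in> A \<Longrightarrow> norm (f (t, z, y, a)) \<le> Cf * (1 + norm z + norm y)"
  proof -
    let ?S = "{t0..T} \<times> {0::real^'n} \<times> {0::real^'n} \<times> A"
    have "compact ?S" using A(3) by (intro compact_Times) auto
    moreover have "continuous_on ?S f" by (rule continuous_on_subset[OF a1(1)]) auto
    ultimately have "compact (f ` ?S)" by (rule compact_continuous_image[rotated])
    then obtain M where M: "\<And>q. q \<in> ?S \<Longrightarrow> norm (f q) \<le> M" by (meson bounded_iff compact_imp_bounded imageI)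
    show thesis
    proof (rule that[of "\<bar>M\<bar> + lf"])
      show "\<bar>M\<bar> + lf > 0" using lf(1) by simp
      fix t z y a assume ta: "t \<in> {t0..T}" "a \<in> A"
      have "norm (f (t, z, y, a)) \<le> norm (f (t, 0, 0, a)) + norm (f (t, z, y, a) - f (t, 0, 0, a))"
        using norm_triangle_ineq[of "f (t, 0, 0, a)" "f (t, z, y, a) - f (t, 0, 0, a)"] by simp
      also have "\<dots> \<le> \<bar>M\<bar> + lf * (norm z + norm y)"
        using lf(2)[OF ta, of z y 0 0] M[of "(t, 0, 0, a)"] ta by (intro add_mono) auto
      also have "\<dots> \<le> \<bar>M\<bar> * (1 + norm z + norm y) + lf * (1 + norm z + norm y)"
        using lf(1) by (intro add_mono mult_left_mono) (auto simp: mult_le_cancel_left1 distrib_left)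
      finally show "norm (f (t, z, y, a)) \<le> (\<bar>M\<bar> + lf) * (1 + norm z + norm y)" by (simp add: distrib_right)
    qed
  qed
  have \<tau>_cont: "continuous_on ({t0..T} \<times> UNIV) \<tau>"
  proof -
    obtain \<tau>' where "\<And>q. q \<in> {t0..T} \<times> UNIV \<Longrightarrow> (\<tau> has_derivative blinfun_apply (\<tau>' q)) (at q within {t0..T} \<times> UNIV)"
      using a7(2) unfolding C1_on_def by blast
    then show ?thesis by (rule has_derivative_continuous_on)
  qed
  interpret delay_ode t0 T \<tau>bar A f \<tau> lf Cf l\<tau>
  proof unfold_locales
    show "\<tau> (t, z) \<le> \<tau>bar" if "t \<in> {t0..T}" for t z
      unfolding a7(4) using that a7(3) by (intro cSUP_upper) auto
  qed (use time A a1 lf Cf a7(1) \<tau>_cont l\<tau> delay_pos in auto)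
  \<comment> \<open>The radius reached by trajectories with histories of size \<open>R0\<close>; all
    local constants are taken there.\<close>
  define R1 where "R1 = sol_bound R0"
  have R1: "R1 > 0" using R0 by (simp add: R1_def sol_bound_def)
  obtain lL where lL: "lL > 0" "\<forall>t\<in>{t0..T}. \<forall>a\<in>A. \<forall>z\<in>cball 0 R1. \<forall>y\<in>cball 0 R1. \<forall>z'\<in>cball 0 R1. \<forall>y'\<in>cball 0 R1.
      \<bar>L (t, z, y, a) - L (t, z', y', a)\<bar> \<le> lL * (norm (z - z') + norm (y - y'))"
    using a4 R1 by blast
  obtain lg where lg: "lg > 0" "\<forall>(z1, w1)\<in>hist_space \<tau>bar. \<forall>(z2, w2)\<in>hist_space \<tau>bar.
      w1 \<in> hist_P \<tau>bar R1 \<longrightarrow> w2 \<in> hist_P \<tau>bar R1 \<longrightarrow>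
      \<bar>g (z1, w1) - g (z2, w2)\<bar> \<le> lg * norm_X \<tau>bar (z1 - z2, \<lambda>\<theta>. w1 \<theta> - w2 \<theta>)"
    using a6 R1 by blast
  obtain d where d: "d > 0" "\<forall>t\<in>{t0..T}. \<forall>w\<in>hist_P \<tau>bar R0. \<forall>\<alpha>\<in>controls A t T.
               (let x = trajectory f \<tau> \<tau>bar T t w \<alpha> in
                AE s in lebesgue_on {t..T}.
                  1 - vector_derivative (\<lambda>u. \<tau> (u, x s)) (at s within {t0..T})
                    - frechet_derivative (\<lambda>z. \<tau> (s, z)) (at (x s)) (vector_derivative x (at s)) \<ge> d)"
    using a8 R0 by blast
  obtain lt where lt: "lt \<ge> 0" "\<And>p q. p \<in> {t0..T} \<times> cball 0 R1 \<Longrightarrow> q \<in> {t0..T} \<times> cball 0 R1 \<Longrightarrow> norm (\<tau> p - \<tau> q) \<le> lt * norm (p - q)"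
  proof -
    have "\<exists>B\<ge>0. \<forall>p\<in>{t0..T} \<times> cball 0 R1. \<forall>q\<in>{t0..T} \<times> cball 0 R1. norm (\<tau> p - \<tau> q) \<le> B * norm (p - q)"
      by (rule C1_on_imp_lipschitz_on[OF a7(2)]) (auto intro!: compact_Times convex_Times)
    then show thesis using that by blast
  qed
  obtain lft where lft: "lft \<ge> 0" "\<And>p q. p \<in> {t0..T} \<times> cball 0 R1 \<times> cball 0 R1 \<times> A \<Longrightarrow> q \<in> {t0..T} \<times> cball 0 R1 \<times> cball 0 R1 \<times> A
      \<Longrightarrow> norm (f p - f q) \<le> lft * norm (p - q)"
  proof -
    let ?C = "{t0..T} \<times> cball (0::real^'n) R1 \<times> cball (0::real^'n) R1 \<times> A"
    have "\<exists>B\<ge>0. \<forall>p\<in>?C. \<forall>q\<in>?C. norm (f p - f q) \<le> B * norm (p - q)"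
      by (rule C1_on_imp_lipschitz_on[OF S1(1)]) (use A in \<open>auto intro!: compact_Times convex_Times\<close>)
    then show thesis using that by blast
  qed
  obtain \<mu> lH where \<mu>: "\<mu> > 0" and lH: "lH > 0"
    and Hmono: "\<forall>t\<in>{t0..T}. \<forall>z y p. \<forall>a1\<in>A. \<forall>a2\<in>A.
      (Ha (t, z, y, p, a1) - Ha (t, z, y, p, a2)) \<bullet> (a1 - a2) \<ge> \<mu> * (norm (a1 - a2))\<^sup>2"
    and Hlip: "\<forall>t1\<in>{t0..T}. \<forall>t2\<in>{t0..T}. \<forall>z1 z2 y1 y2 p1 p2. \<forall>a\<in>A.
      norm (Ha (t1, z1, y1, p1, a) - Ha (t2, z2, y2, p2, a))
        \<le> lH * (\<bar>t1 - t2\<bar> + norm (z1 - z2) + norm (y1 - y2) + norm (p1 - p2))"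
    using S2 by auto
  obtain \<gamma>f where \<gamma>f: "\<gamma>f > 0" "\<forall>t\<in>{t0..T}. \<forall>a\<in>A. \<forall>z1\<in>cball 0 R1. \<forall>z2\<in>cball 0 R1. \<forall>y1\<in>cball 0 R1. \<forall>y2\<in>cball 0 R1.
      norm (f (t, z1, y1, a) + f (t, z2, y2, a) - 2 *\<^sub>R f (t, (1/2) *\<^sub>R (z1 + z2), (1/2) *\<^sub>R (y1 + y2), a))
        \<le> \<gamma>f * ((norm (z1 - z2))\<^sup>2 + (norm (y1 - y2))\<^sup>2)"
    using S3(1) R1 by blast
  obtain \<gamma>L where \<gamma>L: "\<gamma>L > 0" "\<forall>t\<in>{t0..T}. \<forall>a\<in>A. \<forall>z1\<in>cball 0 R1. \<forall>z2\<in>cball 0 R1. \<forall>y1\<in>cball 0 R1. \<forall>y2\<in>cball 0 R1.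
      \<bar>L (t, z1, y1, a) + L (t, z2, y2, a) - 2 * L (t, (1/2) *\<^sub>R (z1 + z2), (1/2) *\<^sub>R (y1 + y2), a)\<bar>
        \<le> \<gamma>L * ((norm (z1 - z2))\<^sup>2 + (norm (y1 - y2))\<^sup>2)"
    using S3(2) R1 by blast
  obtain \<gamma>\<tau> where \<gamma>\<tau>: "\<gamma>\<tau> > 0" "\<forall>t\<in>{t0..T}. \<forall>z1\<in>cball 0 R1. \<forall>z2\<in>cball 0 R1.
      \<bar>\<tau> (t, z1) + \<tau> (t, z2) - 2 * \<tau> (t, (1/2) *\<^sub>R (z1 + z2))\<bar> \<le> \<gamma>\<tau> * (norm (z1 - z2))\<^sup>2"
    using S4 R1 by blast
  have g_lip: "\<bar>g (w1 0, w1) - g (w2 0, w2)\<bar> \<le> lg * (norm (w1 0 - w2 0) + integral {-\<tau>bar..0} (\<lambda>\<theta>. norm (w1 \<theta> - w2 \<theta>)))"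
    if "k1-lipschitz_on {-\<tau>bar..0} w1" "k2-lipschitz_on {-\<tau>bar..0} w2"
      "\<And>\<theta>. \<theta> \<in> {-\<tau>bar..0} \<Longrightarrow> norm (w1 \<theta>) \<le> sol_bound R0" "\<And>\<theta>. \<theta> \<in> {-\<tau>bar..0} \<Longrightarrow> norm (w2 \<theta>) \<le> sol_bound R0" for w1 w2 k1 k2
  proof -
    have P: "w1 \<in> hist_P \<tau>bar R1" "w2 \<in> hist_P \<tau>bar R1"
      unfolding R1_def by (rule hist_PI[OF that(1,3)] hist_PI[OF that(2,4)]; assumption)+
    have H: "(w1 0, w1) \<in> hist_space \<tau>bar" "(w2 0, w2) \<in> hist_space \<tau>bar"
      using that(1,2) by (auto simp: hist_space_def lip_hist_def)
    have "integrable (lebesgue_on {-\<tau>bar..0}) (\<lambda>\<theta>. norm (w1 \<theta> - w2 \<theta>))"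
      by (intro continuous_imp_integrable_real continuous_intros lipschitz_on_continuous_on[OF that(1)] lipschitz_on_continuous_on[OF that(2)])
    then have "L1_norm \<tau>bar (\<lambda>\<theta>. w1 \<theta> - w2 \<theta>) = integral {-\<tau>bar..0} (\<lambda>\<theta>. norm (w1 \<theta> - w2 \<theta>))"
      unfolding L1_norm_def by (rule lebesgue_integral_eq_integral) simp
    moreover have "\<bar>g (w1 0, w1) - g (w2 0, w2)\<bar> \<le> lg * norm_X \<tau>bar (w1 0 - w2 0, \<lambda>\<theta>. w1 \<theta> - w2 \<theta>)"
      using lg(2) H P by blast
    ultimately show ?thesis by (simp add: norm_X_def)
  qed
  have lag_exp: "d * (s' - s) \<le> lag (trajectory f \<tau> \<tau>bar T t w \<alpha>) s' - lag (trajectory f \<tau> \<tau>bar T t w \<alpha>) s"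
    if t: "t0 \<le> t" "t < T" and w: "R0-lipschitz_on {-\<tau>bar..0} w" "\<And>\<theta>. \<theta> \<in> {-\<tau>bar..0} \<Longrightarrow> norm (w \<theta>) \<le> R0"
      and \<alpha>: "\<alpha> \<in> controls A t T" and s: "t \<le> s" "s \<le> s'" "s' \<le> T" for t w \<alpha> s s'
  proof (rule lag_expandingI[OF a7(2) t \<alpha> trajectory_sol(1)[OF t w \<alpha>] _ s])
    have "t \<in> {t0..T}" "w \<in> hist_P \<tau>bar R0" using t hist_PI[OF w] by auto
    then show "AE s in lebesgue_on {t..T}. d \<le> 1 - vector_derivative (\<lambda>u. \<tau> (u, trajectory f \<tau> \<tau>bar T t w \<alpha> s)) (at s within {t0..T})
      - frechet_derivative (\<lambda>z. \<tau> (s, z)) (at (trajectory f \<tau> \<tau>bar T t w \<alpha> s)) (vector_derivative (trajectory f \<tau> \<tau>bar T t w \<alpha>) (at s))"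
      using d(2) \<alpha> by (auto simp: Let_def)
  qed
  interpret delay_semiconcave t0 T \<tau>bar A f \<tau> lf Cf l\<tau> L g Ha R0 d lt lft lL lg \<mu> lH \<gamma>f \<gamma>L \<gamma>\<tau>
  proof unfold_locales
    show "\<bar>\<tau> (s, z) - \<tau> (s', z)\<bar> \<le> lt * \<bar>s - s'\<bar>"
      if "s \<in> {t0..T}" "s' \<in> {t0..T}" "norm z \<le> sol_bound R0" for s s' z
      using lt(2)[of "(s, z)" "(s', z)"] that by (simp add: R1_def norm_Pair)
    show "norm (f (s, z, y, a) - f (s', z, y, a)) \<le> lft * \<bar>s - s'\<bar>"
      if "s \<in> {t0..T}" "s' \<in> {t0..T}" "norm z \<le> sol_bound R0" "norm y \<le> sol_bound R0" "a \<in> A" for s s' z y a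
      using lft(2)[of "(s, z, y, a)" "(s', z, y, a)"] that by (simp add: R1_def norm_Pair)
    show "\<bar>L (t, z, y, a) - L (t, z', y', a)\<bar> \<le> lL * (norm (z - z') + norm (y - y'))"
      if "t \<in> {t0..T}" "a \<in> A" "norm z \<le> sol_bound R0" "norm y \<le> sol_bound R0" "norm z' \<le> sol_bound R0" "norm y' \<le> sol_bound R0"
      for t z y z' y' a
      using lL(2) that by (simp add: R1_def)
    show "((\<lambda>b. f (t, z, y, b) \<bullet> p + L (t, z, y, b)) has_derivative (\<lambda>v. Ha (t, z, y, p, a) \<bullet> v)) (at a within A)"
      if "t \<in> {t0..T}" "a \<in> A" for t z y p a
      using Ha that by (simp add: hamiltonian_def)
    show "norm (f (t, z1, y1, a) + f (t, z2, y2, a) - 2 *\<^sub>R f (t, (1/2) *\<^sub>R (z1 + z2), (1/2) *\<^sub>R (y1 + y2), a))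
        \<le> \<gamma>f * ((norm (z1 - z2))\<^sup>2 + (norm (y1 - y2))\<^sup>2)"
      if "t \<in> {t0..T}" "a \<in> A" "norm z1 \<le> sol_bound R0" "norm z2 \<le> sol_bound R0" "norm y1 \<le> sol_bound R0" "norm y2 \<le> sol_bound R0"
      for t a z1 z2 y1 y2
    proof -
      have "z1 \<in> cball 0 R1" "z2 \<in> cball 0 R1" "y1 \<in> cball 0 R1" "y2 \<in> cball 0 R1" using that by (auto simp: R1_def)
      then show ?thesis using \<gamma>f(2) that(1,2) by blast
    qed
    show "\<bar>L (t, z1, y1, a) + L (t, z2, y2, a) - 2 * L (t, (1/2) *\<^sub>R (z1 + z2), (1/2) *\<^sub>R (y1 + y2), a)\<bar>
        \<le> \<gamma>L * ((norm (z1 - z2))\<^sup>2 + (norm (y1 - y2))\<^sup>2)"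
      if "t \<in> {t0..T}" "a \<in> A" "norm z1 \<le> sol_bound R0" "norm z2 \<le> sol_bound R0" "norm y1 \<le> sol_bound R0" "norm y2 \<le> sol_bound R0"
      for t a z1 z2 y1 y2
    proof -
      have "z1 \<in> cball 0 R1" "z2 \<in> cball 0 R1" "y1 \<in> cball 0 R1" "y2 \<in> cball 0 R1" using that by (auto simp: R1_def)
      then show ?thesis using \<gamma>L(2) that(1,2) by blast
    qed
    show "\<bar>\<tau> (t, z1) + \<tau> (t, z2) - 2 * \<tau> (t, (1/2) *\<^sub>R (z1 + z2))\<bar> \<le> \<gamma>\<tau> * (norm (z1 - z2))\<^sup>2"
      if "t \<in> {t0..T}" "norm z1 \<le> sol_bound R0" "norm z2 \<le> sol_bound R0" for t z1 z2
    proof -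
      have "z1 \<in> cball 0 R1" "z2 \<in> cball 0 R1" using that by (auto simp: R1_def)
      then show ?thesis using \<gamma>\<tau>(2) that(1) by blast
    qed
    show "(Ha (t, z, y, p, a1) - Ha (t, z, y, p, a2)) \<bullet> (a1 - a2) \<ge> \<mu> * (norm (a1 - a2))\<^sup>2"
      if "t \<in> {t0..T}" "a1 \<in> A" "a2 \<in> A" for t z y p a1 a2
      using Hmono that by blast
    show "norm (Ha (t1, z1, y1, p1, a) - Ha (t2, z2, y2, p2, a))
        \<le> lH * (\<bar>t1 - t2\<bar> + norm (z1 - z2) + norm (y1 - y2) + norm (p1 - p2))"
      if "t1 \<in> {t0..T}" "t2 \<in> {t0..T}" "a \<in> A" for t1 t2 z1 z2 y1 y2 p1 p2 a
      using Hlip that by blast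
    show "0 \<le> \<gamma>f" "0 \<le> \<gamma>L" "0 \<le> \<gamma>\<tau>" using \<gamma>f(1) \<gamma>L(1) \<gamma>\<tau>(1) by simp_all
  qed (fact a1(2) R0 lL(1) lg(1) g_lip d(1) lag_exp lt(1) lft(1) \<mu> lH)+
  \<comment> \<open>Passing from \<open>C\<close> to \<open>max C 0\<close> makes the constant
    usable as a nonnegative factor.\<close>
  have semi: "\<exists>C\<ge>0. \<forall>(v :: real \<Rightarrow> real^'n) v0 :: real \<Rightarrow> real^'n. v \<in> hist_W \<tau>bar q \<longrightarrow> v0 \<in> hist_W \<tau>bar q \<longrightarrow>
      g (v 0 + v0 0, \<lambda>\<theta>. v \<theta> + v0 \<theta>) + g (v 0 - v0 0, \<lambda>\<theta>. v \<theta> - v0 \<theta>) - 2 * g (v 0, v) \<le> C * (H1_norm \<tau>bar v0)\<^sup>2"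
    if q: "q > 0" for q
  proof -
    obtain C where C: "\<forall>(z, w)\<in>hist_space \<tau>bar. \<forall>(z0, w0)\<in>hist_space \<tau>bar. w \<in> hist_W \<tau>bar q \<longrightarrow> w0 \<in> hist_W \<tau>bar q \<longrightarrow>
        g (z + z0, \<lambda>\<theta>. w \<theta> + w0 \<theta>) + g (z - z0, \<lambda>\<theta>. w \<theta> - w0 \<theta>) - 2 * g (z, w) \<le> C * (H1_norm \<tau>bar w0)\<^sup>2"
      using semiconcave q by blast
    have "g (v 0 + v0 0, \<lambda>\<theta>. v \<theta> + v0 \<theta>) + g (v 0 - v0 0, \<lambda>\<theta>. v \<theta> - v0 \<theta>) - 2 * g (v 0, v) \<le> max C 0 * (H1_norm \<tau>bar v0)\<^sup>2"
      if v: "v \<in> hist_W \<tau>bar q" "v0 \<in> hist_W \<tau>bar q" for v v0 :: "real \<Rightarrow> real^'n"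
    proof -
      have "(v 0, v) \<in> hist_space \<tau>bar" "(v0 0, v0) \<in> hist_space \<tau>bar"
        using v by (auto simp: hist_space_def hist_W_def hist_V_def hist_P_def)
      then have "g (v 0 + v0 0, \<lambda>\<theta>. v \<theta> + v0 \<theta>) + g (v 0 - v0 0, \<lambda>\<theta>. v \<theta> - v0 \<theta>) - 2 * g (v 0, v) \<le> C * (H1_norm \<tau>bar v0)\<^sup>2"
        using C v by blast
      also have "\<dots> \<le> max C 0 * (H1_norm \<tau>bar v0)\<^sup>2" by (intro mult_right_mono) auto
      finally show ?thesis .
    qed
    then show ?thesis by (intro exI[of _ "max C 0"]) auto
  qed
  have "rW > 0" using sol_bound_nonneg K_nonneg R0 cell_lip_nonneg by (simp add: rW_def)
  then obtain Cg where Cg: "Cg \<ge> 0" "\<And>(v :: real \<Rightarrow> real^'n) v0 :: real \<Rightarrow> real^'n. v \<in> hist_W \<tau>bar rW \<Longrightarrow> v0 \<in> hist_W \<tau>bar rW \<Longrightarrow>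
      g (v 0 + v0 0, \<lambda>\<theta>. v \<theta> + v0 \<theta>) + g (v 0 - v0 0, \<lambda>\<theta>. v \<theta> - v0 \<theta>) - 2 * g (v 0, v) \<le> Cg * (H1_norm \<tau>bar v0)\<^sup>2"
    using semi by blast
  \<comment> \<open>For \<open>t = T\<close> the value is \<open>g\<close> itself, and semiconcavity
    is used directly at the radius \<open>r\<close>.\<close>
  obtain CT where CT: "CT \<ge> 0" "\<And>(v :: real \<Rightarrow> real^'n) v0 :: real \<Rightarrow> real^'n. v \<in> hist_W \<tau>bar r \<Longrightarrow> v0 \<in> hist_W \<tau>bar r \<Longrightarrow>
      g (v 0 + v0 0, \<lambda>\<theta>. v \<theta> + v0 \<theta>) + g (v 0 - v0 0, \<lambda>\<theta>. v \<theta> - v0 \<theta>) - 2 * g (v 0, v) \<le> CT * (H1_norm \<tau>bar v0)\<^sup>2"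
    using semi[OF r] by blast
  \<comment> \<open>The constant in \<open>value_second_difference\<close> depends neither on
    \<open>t\<close> nor on the two histories, so it can be fixed before them.\<close>
  obtain C where C: "\<And>t (w :: real \<Rightarrow> real^'n) w0 :: real \<Rightarrow> real^'n. t0 \<le> t \<Longrightarrow> t < T \<Longrightarrow> w \<in> hist_WN \<tau>bar r N \<Longrightarrow> w0 \<in> hist_WN \<tau>bar r N \<Longrightarrow>
      Inf (J t (\<lambda>\<theta>. w \<theta> + w0 \<theta>) ` controls A t T) + Inf (J t (\<lambda>\<theta>. w \<theta> - w0 \<theta>) ` controls A t T)
      - 2 * Inf (J t w ` controls A t T) \<le> C * (H1_norm \<tau>bar w0)\<^sup>2"
    using value_second_difference[OF _ _ r R0_def _ _ Cg] by blast
  show "\<exists>C. \<forall>t\<in>{t0..T}. \<forall>w\<in>hist_WN \<tau>bar r N. \<forall>w0\<in>hist_WN \<tau>bar r N.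
           value_functional A f L g \<tau> \<tau>bar T t (\<lambda>\<theta>. w \<theta> + w0 \<theta>)
             + value_functional A f L g \<tau> \<tau>bar T t (\<lambda>\<theta>. w \<theta> - w0 \<theta>)
             - 2 * value_functional A f L g \<tau> \<tau>bar T t w
           \<le> C * (H1_norm \<tau>bar w0)\<^sup>2"
  proof (intro exI[of _ "max C CT"] ballI)
    fix t and w w0 :: "real \<Rightarrow> real^'n"
    assume t: "t \<in> {t0..T}" and w: "w \<in> hist_WN \<tau>bar r N" and w0: "w0 \<in> hist_WN \<tau>bar r N"
    have W: "w \<in> hist_W \<tau>bar r" "w0 \<in> hist_W \<tau>bar r" using w w0 by (auto simp: hist_WN_def)
    have le: "C * (H1_norm \<tau>bar w0)\<^sup>2 \<le> max C CT * (H1_norm \<tau>bar w0)\<^sup>2" "CT * (H1_norm \<tau>bar w0)\<^sup>2 \<le> max C CT * (H1_norm \<tau>bar w0)\<^sup>2"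
      by (intro mult_right_mono; simp)+
    show "value_functional A f L g \<tau> \<tau>bar T t (\<lambda>\<theta>. w \<theta> + w0 \<theta>)
             + value_functional A f L g \<tau> \<tau>bar T t (\<lambda>\<theta>. w \<theta> - w0 \<theta>)
             - 2 * value_functional A f L g \<tau> \<tau>bar T t w
           \<le> max C CT * (H1_norm \<tau>bar w0)\<^sup>2"
    proof (cases "t = T")
      case True
      then show ?thesis using CT(2)[OF W] le(2) by (simp add: value_functional_def)
    next
      case False
      then have t: "t0 \<le> t" "t < T" using t by auto
      have "hist_ok w" "hist_ok (\<lambda>\<theta>. w \<theta> + w0 \<theta>)" "hist_ok (\<lambda>\<theta>. w \<theta> - w0 \<theta>)"
        using hist_ok_combinations[OF r R0_def W] by blast+
      then show ?thesis using C[OF t w w0] le(1) by (simp add: value_functional_eq[OF t])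
    qed
  qed
qed

end
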